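(* Let $n\in\mathbb N$, $p_1,p_2\in(1,\infty)$ and $q,s>0$ be such that $$\frac1q=\frac1{p_1}+\frac1{p_2}-\frac sn.$$ (a) If $s\in(0,2n)$, $0\le\delta\le1$ and $\sigma\in BS^{-s}_{1,\delta}(\mathbb R^n)\cup\dot{BS}{}^{-s}_{1,\delta}(\mathbb R^n)$, then $T_\sigma$ is bounded from $L^{p_1}_{w_1}\times L^{p_2}_{w_2}$ into $L^q_w$ for every pair of weights $(w_1,w_2)$ satisfying the $A_{(p_1,p_2),q}$ condition and $w:=w_1^{q/p_1}w_2^{q/p_2}$. (b) If $s\in(0,n)$, $\theta\in(0,\pi)\setminus\{\pi/2,3\pi/4\}$, $0\le\delta\le1$ and $\sigma\in BS^{-s}_{1,\delta;\theta}(\mathbb R^n)\cup\dot{BS}{}^{-s}_{1,\delta;\theta}(\mathbb R^n)$ is of the form $\sigma(x,\xi,\eta)=\sigma_0(x,\xi-\tan(\theta)\,\eta)$ with $\sigma_0\in S^{-s}_{1,\delta}(\mathbb R^n)$ or $\sigma_0\in\dot S^{-s}_{1,\delta}(\mathbb R^n)$ respectively, then $T_\sigma$ is bounded from $L^{p_1}\times L^{p_2}$ into $L^q$. If in addition $\frac1p:=\frac1{p_1}+\frac1{p_2}<1$, then $T_\sigma$ is bounded from $L^{p_1}_{w_1}\times L^{p_2}_{w_2}$ into $L^q_w$ for all weights $w_1,w_2$ in the class $A_{p,q}$ and $w:=w_1^{q/p_1}w_2^{q/p_2}$.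
   Context: For a symbol $\sigma(x,\xi,\eta)$, $x,\xi,\eta\in\mathbb R^n$, and $f,g\in\mathcal S(\mathbb R^n)$, $$T_\sigma(f,g)(x)=\int_{\mathbb R^{2n}}e^{ix\cdot(\xi+\eta)}\sigma(x,\xi,\eta)\hat f(\xi)\hat g(\eta)\,d\xi\,d\eta$$ ($\hat{\ }$ is the Fourier transform; normalization immaterial). For a weight $w$ and $p>0$, $\|h\|_{L^p_w}=(\int_{\mathbb R^n}|h|^pw\,dx)^{1/p}$. "Bounded from $L^{p_1}_{w_1}\times L^{p_2}_{w_2}$ into $L^q_w$" means that there is $C$ with $\|T_\sigma(f,g)\|_{L^q_w}\le C\|f\|_{L^{p_1}_{w_1}}\|g\|_{L^{p_2}_{w_2}}$ for all $f,g\in\mathcal S(\mathbb R^n)$ (similarly without weights, i.e. all weights $\equiv1$). $(w_1,w_2)$ satisfies the $A_{(p_1,p_2),q}$ condition if, with $w=w_1^{q/p_1}w_2^{q/p_2}$, $\sup_B\big(\frac1{|B|}\int_Bw\big)\prod_{j=1}^2\big(\frac1{|B|}\int_Bw_j^{1-p_j'}\big)^{q/p_j'}<\infty$, supremum over Euclidean balls. A weight $u$ is in $A_{p,q}$ if $\sup_B\big(\frac1{|B|}\int_Bu^{q/p}\big)\big(\frac1{|B|}\int_Bu^{1-p'}\big)^{q/p'}<\infty$. Primes denote conjugate exponents. Symbol classes ($\mu\in\mathbb R$, $0\le\delta\le1$, $\theta\in(0,\pi)$, $\theta\ne\pi/2$): - $BS^\mu_{1,\delta}(\mathbb R^n)$: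 $\sigma\in C^\infty(\mathbb R^{3n})$ such that for all multi-indices $\alpha,\beta,\gamma$ there is $C_{\alpha,\beta,\gamma}$ with $|\partial_x^\alpha\partial_\xi^\beta\partial_\eta^\gamma\sigma(x,\xi,\eta)|\le C_{\alpha,\beta,\gamma}(1+|\xi|+|\eta|)^{\mu-(|\beta|+|\gamma|)+\delta|\alpha|}$ for all $x,\xi,\eta$. - $BS^\mu_{1,\delta;\theta}(\mathbb R^n)$: same with $1+|\xi|+|\eta|$ replaced by $1+|\xi-\tan(\theta)\eta|$. - $S^\mu_{1,\delta}(\mathbb R^n)$: $\sigma_0\in C^\infty(\mathbb R^{2n})$ with $|\partial_x^\alpha\partial_\xi^\beta\sigma_0(x,\xi)|\le C_{\alpha,\beta}(1+|\xi|)^{\mu-|\beta|+\delta|\alpha|}$ for all $x,\xi$ and all multi-indices. - The homogeneous classes $\dot{BS}{}^\mu_{1,\delta}$, $\dot{BS}{}^\mu_{1,\delta;\theta}$, $\dot S^\mu_{1,\delta}$ are defined in the same way with $1+|\xi|+|\eta|$, $1+|\xi-\tan(\theta)\eta|$, $1+|\xi|$ replaced by $|\xi|+|\eta|$, $|\xi-\tan(\theta)\eta|$, $|\xi|$ respectively, smoothness and estimates being required at the points where the latter quantity is nonzero. *)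

theory Defs
  imports "HOL-Analysis.Analysis"
begin

definition dir_deriv :: "'a \<Rightarrow> ('a::real_normed_vector \<Rightarrow> 'b::real_normed_vector) \<Rightarrow> 'a \<Rightarrow> 'b" where
  "dir_deriv v f = (\<lambda>x. frechet_derivative f (at x) v)"

definition iter_deriv :: "'a list \<Rightarrow> ('a::real_normed_vector \<Rightarrow> 'b::real_normed_vector) \<Rightarrow> 'a \<Rightarrow> 'b" where
  "iter_deriv vs f = foldr dir_deriv vs f"

text \<open>
  \<open>C\<^sup>\<infinity>\<close> on \<open>S\<close>, which is meant to be open: every iterated partial derivative, of every
  order, exists and is again (totally) differentiable, hence continuous, on \<open>S\<close>.
\<close>

definition smooth_on :: "'a set \<Rightarrow> ('a::euclidean_space \<Rightarrow> 'b::real_normed_vector) \<Rightarrow> bool" where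
  "smooth_on S f \<longleftrightarrow>
     (\<forall>vs. set vs \<subseteq> Basis \<longrightarrow> (\<forall>x\<in>S. iter_deriv vs f differentiable at x))"

text \<open>
  A multi-index is represented by a list of coordinate indices: the list \<open>[i\<^sub>1, \<dots>, i\<^sub>k]\<close> stands
  for \<open>\<partial>\<^bsub>i\<^sub>1\<^esub> \<dots> \<partial>\<^bsub>i\<^sub>k\<^esub>\<close> and for the monomial \<open>x\<^bsub>i\<^sub>1\<^esub> \<dots> x\<^bsub>i\<^sub>k\<^esub>\<close>, and has order \<open>k\<close>.
  For smooth functions the order of the entries is immaterial, so quantifying over lists
  is quantifying over multi-indices.
\<close>

type_synonym 'n multi_index = "'n list"

definition schwartz :: "(real ^ 'n::finite \<Rightarrow> complex) \<Rightarrow> bool" where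
  "schwartz f \<longleftrightarrow> smooth_on UNIV f \<and>
     (\<forall>(\<alpha> :: 'n multi_index) (\<beta> :: 'n multi_index). \<exists>C. \<forall>x.
        norm ((\<Prod>i\<leftarrow>\<alpha>. x $ i) *\<^sub>R iter_deriv (map (\<lambda>i. axis i 1) \<beta>) f x) \<le> C)"

type_synonym 'n linear_symbol = "(real ^ 'n) \<times> (real ^ 'n) \<Rightarrow> complex"
type_synonym 'n bilinear_symbol = "(real ^ 'n) \<times> (real ^ 'n) \<times> (real ^ 'n) \<Rightarrow> complex"

definition deriv2 :: "'n::finite multi_index \<Rightarrow> 'n multi_index \<Rightarrow> 'n linear_symbol \<Rightarrow> 'n linear_symbol" where
  "deriv2 \<alpha> \<beta> = iter_deriv
     (map (\<lambda>i. (axis i 1, 0)) \<alpha> @ map (\<lambda>i. (0, axis i 1)) \<beta>)"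

definition deriv3 ::
  "'n::finite multi_index \<Rightarrow> 'n multi_index \<Rightarrow> 'n multi_index \<Rightarrow> 'n bilinear_symbol \<Rightarrow> 'n bilinear_symbol"
where
  "deriv3 \<alpha> \<beta> \<gamma> = iter_deriv
     (map (\<lambda>i. (axis i 1, 0, 0)) \<alpha> @ map (\<lambda>i. (0, axis i 1, 0)) \<beta> @ map (\<lambda>i. (0, 0, axis i 1)) \<gamma>)"

text \<open>
  All classes share one pattern, in which \<open>\<rho>\<close> is the size function in the frequency variables.
  Smoothness and estimates are required only where \<open>\<rho>\<close> is nonzero; this is no
  restriction for the inhomogeneous classes, for which \<open>\<rho> \<ge> 1\<close>.
\<close>

definition linear_class :: "(real ^ 'n::finite \<Rightarrow> real) \<Rightarrow> real \<Rightarrow> real \<Rightarrow> 'n linear_symbol set" where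
  "linear_class \<rho> \<mu> \<delta> = {\<sigma>.
     smooth_on {(x, \<xi>). \<rho> \<xi> \<noteq> 0} \<sigma> \<and>
     (\<forall>\<alpha> \<beta>. \<exists>C. \<forall>x \<xi>. \<rho> \<xi> \<noteq> 0 \<longrightarrow>
        norm (deriv2 \<alpha> \<beta> \<sigma> (x, \<xi>))
          \<le> C * \<rho> \<xi> powr (\<mu> - real (length \<beta>) + \<delta> * real (length \<alpha>)))}"

definition bilinear_class ::
  "(real ^ 'n::finite \<Rightarrow> real ^ 'n \<Rightarrow> real) \<Rightarrow> real \<Rightarrow> real \<Rightarrow> 'n bilinear_symbol set"
where
  "bilinear_class \<rho> \<mu> \<delta> = {\<sigma>.
     smooth_on {(x, \<xi>, \<eta>). \<rho> \<xi> \<eta> \<noteq> 0} \<sigma> \<and>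
     (\<forall>\<alpha> \<beta> \<gamma>. \<exists>C. \<forall>x \<xi> \<eta>. \<rho> \<xi> \<eta> \<noteq> 0 \<longrightarrow>
        norm (deriv3 \<alpha> \<beta> \<gamma> \<sigma> (x, \<xi>, \<eta>))
          \<le> C * \<rho> \<xi> \<eta> powr (\<mu> - real (length \<beta> + length \<gamma>) + \<delta> * real (length \<alpha>)))}"

definition S_class :: "real \<Rightarrow> real \<Rightarrow> 'n::finite linear_symbol set" where
  "S_class = linear_class (\<lambda>\<xi>. 1 + norm \<xi>)"

definition S_class_hom :: "real \<Rightarrow> real \<Rightarrow> 'n::finite linear_symbol set" where
  "S_class_hom = linear_class (\<lambda>\<xi>. norm \<xi>)"

definition BS_class :: "real \<Rightarrow> real \<Rightarrow> 'n::finite bilinear_symbol set" where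
  "BS_class = bilinear_class (\<lambda>\<xi> \<eta>. 1 + norm \<xi> + norm \<eta>)"

definition BS_class_hom :: "real \<Rightarrow> real \<Rightarrow> 'n::finite bilinear_symbol set" where
  "BS_class_hom = bilinear_class (\<lambda>\<xi> \<eta>. norm \<xi> + norm \<eta>)"

definition BS_theta_class :: "real \<Rightarrow> real \<Rightarrow> real \<Rightarrow> 'n::finite bilinear_symbol set" where
  "BS_theta_class \<theta> = bilinear_class (\<lambda>\<xi> \<eta>. 1 + norm (\<xi> - tan \<theta> *\<^sub>R \<eta>))"

definition BS_theta_class_hom :: "real \<Rightarrow> real \<Rightarrow> real \<Rightarrow> 'n::finite bilinear_symbol set" where
  "BS_theta_class_hom \<theta> = bilinear_class (\<lambda>\<xi> \<eta>. norm (\<xi> - tan \<theta> *\<^sub>R \<eta>))"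

text \<open>
  Integrals are taken over the completed measure: a symbol in a homogeneous
  class has arbitrary values on a null set, and these must not affect measurability.
\<close>

definition fourier :: "(real ^ 'n::finite \<Rightarrow> complex) \<Rightarrow> real ^ 'n \<Rightarrow> complex" where
  "fourier f \<xi> = (LINT x|lebesgue. exp (- \<i> * of_real (x \<bullet> \<xi>)) * f x)"

definition T_op ::
  "'n::finite bilinear_symbol \<Rightarrow> (real ^ 'n \<Rightarrow> complex) \<Rightarrow> (real ^ 'n \<Rightarrow> complex) \<Rightarrow> real ^ 'n \<Rightarrow> complex"
where
  "T_op \<sigma> f g x =
     (LINT z|lebesgue. (case z of (\<xi>, \<eta>) \<Rightarrow>
        exp (\<i> * of_real (x \<bullet> (\<xi> + \<eta>))) * \<sigma> (x, \<xi>, \<eta>) * fourier f \<xi> * fourier g \<eta>))"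

text \<open>Only meant for exponents \<open>a > 0\<close>.\<close>

definition ennpowr :: "ennreal \<Rightarrow> real \<Rightarrow> ennreal" where
  "ennpowr t a = (if t = \<infinity> then \<infinity> else ennreal (enn2real t powr a))"

definition weight :: "(real ^ 'n::finite \<Rightarrow> real) \<Rightarrow> bool" where
  "weight w \<longleftrightarrow>
     (AE x in lebesgue. 0 < w x) \<and> (\<forall>K. compact K \<longrightarrow> set_integrable lebesgue K w)"

definition Lp_norm :: "real \<Rightarrow> (real ^ 'n::finite \<Rightarrow> real) \<Rightarrow> (real ^ 'n \<Rightarrow> complex) \<Rightarrow> ennreal" where
  "Lp_norm p w h = ennpowr (\<integral>\<^sup>+x. ennreal (norm (h x) powr p * w x) \<partial>lebesgue) (1 / p)"

definition ball_avg :: "(real ^ 'n::finite \<Rightarrow> real) \<Rightarrow> real ^ 'n \<Rightarrow> real \<Rightarrow> ennreal" where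
  "ball_avg u c r = (\<integral>\<^sup>+x\<in>ball c r. ennreal (u x) \<partial>lebesgue) / emeasure lebesgue (ball c r)"

definition conj_exp :: "real \<Rightarrow> real" where
  "conj_exp p = p / (p - 1)"

definition prod_weight ::
  "real \<Rightarrow> real \<Rightarrow> real \<Rightarrow> (real ^ 'n::finite \<Rightarrow> real) \<Rightarrow> (real ^ 'n \<Rightarrow> real) \<Rightarrow> real ^ 'n \<Rightarrow> real"
where
  "prod_weight p1 p2 q w1 w2 x = w1 x powr (q / p1) * w2 x powr (q / p2)"

definition A_bilinear ::
  "real \<Rightarrow> real \<Rightarrow> real \<Rightarrow> (real ^ 'n::finite \<Rightarrow> real) \<Rightarrow> (real ^ 'n \<Rightarrow> real) \<Rightarrow> bool"
where
  "A_bilinear p1 p2 q w1 w2 \<longleftrightarrow>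
     (SUP c. SUP r\<in>{0<..}.
        ball_avg (prod_weight p1 p2 q w1 w2) c r
        * ennpowr (ball_avg (\<lambda>x. w1 x powr (1 - conj_exp p1)) c r) (q / conj_exp p1)
        * ennpowr (ball_avg (\<lambda>x. w2 x powr (1 - conj_exp p2)) c r) (q / conj_exp p2)) < \<infinity>"

definition A_linear :: "real \<Rightarrow> real \<Rightarrow> (real ^ 'n::finite \<Rightarrow> real) \<Rightarrow> bool" where
  "A_linear p q u \<longleftrightarrow>
     (SUP c. SUP r\<in>{0<..}.
        ball_avg (\<lambda>x. u x powr (q / p)) c r
        * ennpowr (ball_avg (\<lambda>x. u x powr (1 - conj_exp p)) c r) (q / conj_exp p)) < \<infinity>"

definition bounded_bilinear_Lp ::
  "((real ^ 'n::finite \<Rightarrow> complex) \<Rightarrow> (real ^ 'n \<Rightarrow> complex) \<Rightarrow> real ^ 'n \<Rightarrow> complex)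
   \<Rightarrow> real \<Rightarrow> (real ^ 'n \<Rightarrow> real) \<Rightarrow> real \<Rightarrow> (real ^ 'n \<Rightarrow> real) \<Rightarrow> real \<Rightarrow> (real ^ 'n \<Rightarrow> real) \<Rightarrow> bool"
where
  "bounded_bilinear_Lp T p1 w1 p2 w2 q w \<longleftrightarrow>
     (\<exists>C::real. \<forall>f g. schwartz f \<longrightarrow> schwartz g \<longrightarrow>
        Lp_norm q w (T f g) \<le> ennreal C * Lp_norm p1 w1 f * Lp_norm p2 w2 g)"

end

theory Submission
  imports Defs
begin


text \<open>
  Integrating by parts (as finite differences over half-periods) shows that the kernel of a
  multiplier of order \<open>- s\<close> in \<open>m\<close> frequency variables is bounded by a multiple of \<open>|u|\<^bsup>s - m\<^esup>\<close>,
  uniformly under a rational cutoff. Hence in (a) the operator is dominated by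
  \<open>\<integral>\<integral> |f y| |g z| (|x - y| + |x - z|)\<^bsup>s - 2n\<^esup> dy dz\<close>. In (b) the symbol is constant along the
  direction \<open>(tan \<theta>, 1)\<close>, and the operator is dominated by
  \<open>\<integral> |f y| |g ((1 + t) x - t y)| |x - y|\<^bsup>s - n\<^esup> dy\<close> with \<open>t = tan \<theta>\<close>.

  For the weighted bounds, such an integral is a sum over dyadic balls \<open>B\<close> around \<open>x\<close>. The product
  condition makes all weights involved \<open>A\<^sub>\<infinity>\<close>, so their measures grow geometrically along these balls
  and Hedberg's argument interpolates between the global norm and a maximal function with respect
  to the weights' own doubling measures. In (b), Hoelder's inequality with \<open>1 / p < 1\<close> splits the
  operator into two linear fractional integrals. Without weights and with \<open>1 / p \<ge> 1\<close>, the case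
  \<open>q \<le> 1\<close> is treated by taking means at each scale, and the remaining exponents follow by
  interpolation, because the kernel is positive; here \<open>t \<noteq> 0, - 1\<close> is used to change variables.
\<close>

section \<open>Maximal functions of doubling measures\<close>

text \<open>The exponent \<open>q\<close> may lie below 1, so nothing is dualised: each weighted
  estimate is a pointwise bound followed by a maximal theorem. The obstacle is that averages of
  \<open>f\<close> and \<open>g\<close> are natural for the dual weights \<sigma>1, \<sigma>2,
  whereas the result is measured in \<open>w\<close>. By A_infinity, \<sigma> / \<sigma>(B)
  dominates a multiple of w / w(B) on most of each ball \<open>B\<close>; hence a maximal function
  for \<sigma>, rescaled by \<open>(\<sigma> / w) powr (1 / P)\<close>, majorises the average on a
  large part of \<open>B\<close>, and a second maximal function, for \<open>w\<close>, carries the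
  bound back to the centre. A_infinity itself comes from the pointwise identity w^(1/q)
  \<sigma>1^(1/p1') \<sigma>2^(1/p2') = 1: Hoelder's inequality on a subset of \<open>B\<close>
  meets the Muckenhoupt bound on \<open>B\<close>, and the argument is symmetric in the three
  weights. The cutoff is rational because its finite differences along a line are explicit. Its
  Fourier transform is integrable, so in (b) the dilates form an approximate identity that pins the
  argument of \<open>g\<close> to (1 + t) x - t y.\<close>

lemma ennpowr_ennreal: "0 \<le> x \<Longrightarrow> ennpowr (ennreal x) a = ennreal (x powr a)"
  by (simp add: ennpowr_def)

lemma ennpowr_top [simp]: "ennpowr top a = top"
  by (simp add: ennpowr_def)

lemma ennpowr_0 [simp]: "ennpowr 0 a = 0"
  by (simp add: ennpowr_def)

lemma ennpowr_1 [simp]: "ennpowr 1 a = 1"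
  using ennpowr_ennreal[of 1 a] by simp

lemma ennpowr_one [simp]: "ennpowr t 1 = t"
  by (cases t) (auto simp: ennpowr_ennreal)

lemma ennpowr_mono: "0 \<le> a \<Longrightarrow> s \<le> t \<Longrightarrow> ennpowr s a \<le> ennpowr t a"
  by (cases s; cases t) (auto simp: ennpowr_ennreal powr_mono2 top_unique intro!: ennreal_leI)

lemma ennpowr_ennpowr: "ennpowr (ennpowr t a) b = ennpowr t (a * b)"
  by (cases t) (auto simp: ennpowr_ennreal powr_powr)

lemma ennpowr_eq_0_iff: "ennpowr t a = 0 \<longleftrightarrow> t = 0"
  by (cases t) (auto simp: ennpowr_ennreal)

lemma ennpowr_eq_top_iff: "ennpowr t a = top \<longleftrightarrow> t = top"
  by (cases t) (auto simp: ennpowr_ennreal)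

text \<open>The exceptional values agree for every sign of \<open>a\<close>: \<open>0\<close> goes
  to \<open>0\<close> (also for \<open>a \<le> 0\<close>, since \<open>0 powr a = 0\<close>),
  \<open>top\<close> goes to \<open>top\<close>, and \<open>0 * top = 0\<close> on both
  sides.\<close>

lemma ennpowr_mult: "ennpowr (s * t) a = ennpowr s a * ennpowr t a"
proof (cases "s = 0 \<or> t = 0 \<or> s = top \<or> t = top")
  case True
  then show ?thesis
    by (auto simp: ennreal_mult_eq_top_iff ennreal_top_mult ennreal_mult_top ennpowr_eq_0_iff)
next
  case False
  then obtain x y where "s = ennreal x" "t = ennreal y" "0 \<le> x" "0 \<le> y"
    by (metis ennreal_cases infinity_ennreal_def)
  then show ?thesis
    by (simp add: ennpowr_ennreal powr_mult flip: ennreal_mult)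
qed

lemma ennpowr_add: "ennpowr t a * ennpowr t b = ennpowr t (a + b)"
  by (cases t) (auto simp: ennpowr_ennreal powr_add ennreal_mult'' ennreal_top_mult)

lemma measurable_ennpowr [measurable (raw)]:
  assumes [measurable]: "f \<in> borel_measurable M"
  shows "(\<lambda>x. ennpowr (f x) a) \<in> borel_measurable M"
  unfolding ennpowr_def by measurable

text \<open>Young's inequality (weighted AM-GM) for \<open>f / F\<close> and \<open>g / G\<close>,
  where \<open>F\<close> and \<open>G\<close> are the two integrals. With the powers
  \<open>t\<close> and \<open>1 - t\<close> written on the factors, one form serves for splitting
  functions, kernels and weights.\<close>

lemma nn_integral_Holder:
  assumes [measurable]: "f \<in> borel_measurable M" "g \<in> borel_measurable M"
    and t: "0 < t" "t < 1"
  shows "(\<integral>\<^sup>+x. ennpowr (f x) t * ennpowr (g x) (1 - t) \<partial>M)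
    \<le> ennpowr (\<integral>\<^sup>+x. f x \<partial>M) t * ennpowr (\<integral>\<^sup>+x. g x \<partial>M) (1 - t)"
    (is "?L \<le> ennpowr ?F t * ennpowr ?G (1 - t)")
proof (cases "?F = 0 \<or> ?G = 0")
  case True
  then have "AE x in M. f x = 0 \<or> g x = 0"
    by (auto simp: nn_integral_0_iff_AE)
  then have "?L = (\<integral>\<^sup>+x. 0 \<partial>M)"
    by (intro nn_integral_cong_AE) auto
  then show ?thesis by simp
next
  case nz: False
  show ?thesis
  proof (cases "?F = top \<or> ?G = top")
    case True
    then show ?thesis
      using nz by (auto simp: ennreal_top_mult ennreal_mult_top ennpowr_eq_0_iff)
  next
    case False
    then obtain F G where F: "?F = ennreal F" "0 < F" and G: "?G = ennreal G" "0 < G"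
      using nz by (metis ennreal_cases infinity_ennreal_def ennreal_0 less_eq_real_def)
    let ?C = "F powr t * G powr (1 - t)"
    have pt: "ennpowr (f x) t * ennpowr (g x) (1 - t)
        \<le> ennreal ?C * (ennreal (t / F) * f x + ennreal ((1 - t) / G) * g x)" for x
    proof (cases "f x = top \<or> g x = top")
      case True
      then have "ennreal ?C * (ennreal (t / F) * f x + ennreal ((1 - t) / G) * g x) = top"
        using t F G by (auto simp: ennreal_mult_top ennreal_top_mult ennreal_mult_eq_top_iff)
      then show ?thesis by simp
    next
      case False
      then obtain a b where a: "f x = ennreal a" "0 \<le> a" and b: "g x = ennreal b" "0 \<le> b"
        by (metis ennreal_cases infinity_ennreal_def)
      have *: "(a / F) powr t * (b / G) powr (1 - t) \<le> t * (a / F) + (1 - t) * (b / G)"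
      proof (cases "a = 0 \<or> b = 0")
        case True
        then show ?thesis using t a b F G by auto
      next
        case False
        then have "0 < a / F" "0 < b / G"
          using a b F G by auto
        then show ?thesis
          using Youngs_inequality_0[of t "1 - t" "a / F" "b / G"] t by auto
      qed
      have "a powr t * b powr (1 - t) = ?C * ((a / F) powr t * (b / G) powr (1 - t))"
        using a b F G by (simp add: powr_divide)
      also have "\<dots> \<le> ?C * (t * (a / F) + (1 - t) * (b / G))"
        by (intro mult_left_mono *) auto
      finally have "a powr t * b powr (1 - t) \<le> ?C * (t / F * a + (1 - t) / G * b)"
        by (simp add: field_simps)
      then show ?thesis
        using a b F G t
        by (simp add: ennpowr_ennreal ennreal_leI flip: ennreal_mult ennreal_plus)
    qed
    have "?L \<le> (\<integral>\<^sup>+x. ennreal ?C * (ennreal (t / F) * f x + ennreal ((1 - t) / G) * g x) \<partial>M)"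
      by (intro nn_integral_mono pt)
    also have "\<dots> = ennreal ?C * (ennreal (t / F) * ?F + ennreal ((1 - t) / G) * ?G)"
      by (simp add: nn_integral_cmult nn_integral_add)
    also have "\<dots> = ennreal ?C"
      using t F G by (simp flip: ennreal_mult ennreal_plus)
    also have "\<dots> = ennpowr ?F t * ennpowr ?G (1 - t)"
      using F G by (simp add: ennpowr_ennreal ennreal_mult)
    finally show ?thesis .
  qed
qed

lemma ennreal_divide_mult_cancel: "0 < b \<Longrightarrow> b < top \<Longrightarrow> a / b * b = (a :: ennreal)"
  by (simp add: ennreal_divide_times)

text \<open>Countable subadditivity with the sum written as an integral over
  \<open>count_space I\<close>: a family delivered by a covering lemma can then be summed without an
  enumeration.\<close>

lemma emeasure_UN_countable_le:
  assumes I: "countable I" and [measurable]: "\<And>i. i \<in> I \<Longrightarrow> X i \<in> sets M"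
  shows "emeasure M (\<Union>i\<in>I. X i) \<le> (\<integral>\<^sup>+i. emeasure M (X i) \<partial>count_space I)"
proof -
  have U: "(\<Union>i\<in>I. X i) \<in> sets M"
    using assms by blast
  have "emeasure M (\<Union>i\<in>I. X i) = (\<integral>\<^sup>+x. indicator (\<Union>i\<in>I. X i) x \<partial>M)"
    using U by simp
  also have "\<dots> \<le> (\<integral>\<^sup>+x. \<integral>\<^sup>+i. indicator (X i) x \<partial>count_space I \<partial>M)"
  proof (intro nn_integral_mono)
    fix x
    show "indicator (\<Union>i\<in>I. X i) x \<le> (\<integral>\<^sup>+i. indicator (X i) x \<partial>count_space I)"
    proof (cases "x \<in> (\<Union>i\<in>I. X i)")
      case True
      then obtain i where "i \<in> I" "x \<in> X i" by auto
      moreover have "indicator (\<Union>i\<in>I. X i) x = (1 :: ennreal)"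
        using True by (simp only: indicator_simps)
      ultimately show ?thesis
        using nn_integral_ge_point[OF \<open>i \<in> I\<close>, of "\<lambda>i. indicator (X i) x :: ennreal"] by simp
    qed simp
  qed
  also have "\<dots> = (\<integral>\<^sup>+i. \<integral>\<^sup>+x. indicator (X i) x \<partial>M \<partial>count_space I)"
    using I by (subst nn_integral_count_space_nn_integral) auto
  also have "\<dots> = (\<integral>\<^sup>+i. emeasure M (X i) \<partial>count_space I)"
    by (intro nn_integral_cong) auto
  finally show ?thesis .
qed

text \<open>The dilation factor 5 is the one that the Vitali covering lemma produces.\<close>

definition doubling_measure :: "real \<Rightarrow> 'a::euclidean_space measure \<Rightarrow> bool" where
  "doubling_measure K \<mu> \<longleftrightarrow> sets \<mu> = sets borel \<and>
     (\<forall>c r. 0 < r \<longrightarrow> 0 < emeasure \<mu> (ball c r) \<and> emeasure \<mu> (ball c r) < top \<and>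
        emeasure \<mu> (ball c (5 * r)) \<le> ennreal K * emeasure \<mu> (ball c r))"

definition ball_mean :: "'a::euclidean_space measure \<Rightarrow> ('a \<Rightarrow> ennreal) \<Rightarrow> 'a \<Rightarrow> real \<Rightarrow> ennreal" where
  "ball_mean \<mu> h c r = (\<integral>\<^sup>+y\<in>ball c r. h y \<partial>\<mu>) / emeasure \<mu> (ball c r)"

text \<open>The uncentred maximal function: superlevel sets are unions of open balls, which settles
  measurability, and the mean over a ball bounds it from below at every point of that ball, not only
  at the centre.\<close>

definition maxfun :: "'a::euclidean_space measure \<Rightarrow> ('a \<Rightarrow> ennreal) \<Rightarrow> 'a \<Rightarrow> ennreal" where
  "maxfun \<mu> h x = (SUP (c, r)\<in>{(c, r). 0 < r \<and> x \<in> ball c r}. ball_mean \<mu> h c r)"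

lemma ball_mean_le_maxfun: "0 < r \<Longrightarrow> x \<in> ball c r \<Longrightarrow> ball_mean \<mu> h c r \<le> maxfun \<mu> h x"
  unfolding maxfun_def by (rule SUP_upper2[where i="(c, r)"]) auto

lemma maxfun_superlevel:
  "{x. t < maxfun \<mu> h x} = (\<Union>(c, r)\<in>{(c, r). 0 < r \<and> t < ball_mean \<mu> h c r}. ball c r)"
  unfolding maxfun_def by (fastforce simp: less_SUP_iff)

lemma measurable_maxfun [measurable]: "maxfun \<mu> h \<in> borel_measurable borel"
proof (rule borel_measurableI_greater)
  fix t :: ennreal
  have "open {x. t < maxfun \<mu> h x}"
    unfolding maxfun_superlevel by auto
  then show "{x \<in> space borel. t < maxfun \<mu> h x} \<in> sets borel"
    by simp
qed

text \<open>Vitali covering: among the balls with mean above \<open>t\<close>, disjoint ones are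
  selected whose fivefold dilates cover the superlevel set. Doubling pays for the dilation with
  \<open>K\<close>, and disjointness lets the integrals of \<open>h\<close> add up.\<close>

lemma maxfun_weak_type:
  fixes \<mu> :: "'a::euclidean_space measure"
  assumes mu: "doubling_measure K \<mu>"
    and [measurable]: "h \<in> borel_measurable borel"
  shows "t * emeasure \<mu> {x. t < maxfun \<mu> h x} \<le> ennreal K * (\<integral>\<^sup>+x. h x \<partial>\<mu>)"
proof -
  have sets[measurable_cong]: "sets \<mu> = sets borel"
    using mu by (simp add: doubling_measure_def)
  have space: "space \<mu> = UNIV"
    using sets_eq_imp_space_eq[OF sets] by simp
  have ball: "0 < emeasure \<mu> (ball c r)" "emeasure \<mu> (ball c r) < top"
    "emeasure \<mu> (ball c (5 * r)) \<le> ennreal K * emeasure \<mu> (ball c r)" if "0 < r" for c r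
    using mu that by (auto simp: doubling_measure_def)
  \<comment> \<open>The covering lemma asks for bounded radii. The cap \<open>n\<close> disappears
    in the limit, since the sets \<open>U n\<close> increase to the whole superlevel set.\<close>
  define I where "I n = {(c, r). 0 < r \<and> r \<le> real n \<and> t < ball_mean \<mu> h c r}" for n :: nat
  define U where "U n = (\<Union>(c, r)\<in>I n. ball c r)" for n
  have U_open: "open (U n)" for n
    unfolding U_def by auto
  have U_sets[measurable]: "U n \<in> sets borel" for n
    using U_open by simp
  have Un: "t * emeasure \<mu> (U n) \<le> ennreal K * (\<integral>\<^sup>+x. h x \<partial>\<mu>)" for n
  proof -
    have "U n \<subseteq> (\<Union>i\<in>I n. ball (fst i) (snd i))"
      by (auto simp: U_def)
    moreover have "\<And>i. i \<in> I n \<Longrightarrow> 0 < snd i \<and> snd i \<le> real n"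
      by (auto simp: I_def)
    ultimately obtain C where C: "countable C" "C \<subseteq> I n"
      and disj: "pairwise (\<lambda>i j. disjnt (ball (fst i) (snd i)) (ball (fst j) (snd j))) C"
      and cov: "U n \<subseteq> (\<Union>i\<in>C. ball (fst i) (5 * snd i))"
      by (rule Vitali_covering_lemma_balls)
    have dfam: "disjoint_family_on (\<lambda>i. ball (fst i) (snd i)) C"
      using disj by (auto simp: disjoint_family_on_def pairwise_def disjnt_def)
    have one: "t * emeasure \<mu> (ball (fst i) (5 * snd i))
        \<le> ennreal K * emeasure (density \<mu> h) (ball (fst i) (snd i))" if "i \<in> C" for i
    proof -
      obtain c r where i: "i = (c, r)" by (cases i)
      have r: "0 < r" "t < ball_mean \<mu> h c r"
        using that C i by (auto simp: I_def)
      have "t * emeasure \<mu> (ball c r) \<le> ball_mean \<mu> h c r * emeasure \<mu> (ball c r)"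
        using r by (intro mult_right_mono) auto
      also have "\<dots> = (\<integral>\<^sup>+y\<in>ball c r. h y \<partial>\<mu>)"
        using ball[OF r(1), of c] unfolding ball_mean_def
        by (intro ennreal_divide_mult_cancel) auto
      also have "\<dots> = emeasure (density \<mu> h) (ball c r)"
        by (subst emeasure_density) (auto simp: sets)
      finally have a: "t * emeasure \<mu> (ball c r) \<le> emeasure (density \<mu> h) (ball c r)" .
      have "t * emeasure \<mu> (ball c (5 * r)) \<le> t * (ennreal K * emeasure \<mu> (ball c r))"
        by (intro mult_left_mono ball(3) r) auto
      also have "\<dots> = ennreal K * (t * emeasure \<mu> (ball c r))"
        by (simp add: ac_simps)
      also have "\<dots> \<le> ennreal K * emeasure (density \<mu> h) (ball c r)"
        by (intro mult_left_mono a) auto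
      finally show ?thesis by (simp add: i)
    qed
    have "emeasure \<mu> (U n) \<le> emeasure \<mu> (\<Union>i\<in>C. ball (fst i) (5 * snd i))"
      using cov by (intro emeasure_mono) (auto simp: sets intro!: borel_open open_UN)
    also have "\<dots> \<le> (\<integral>\<^sup>+i. emeasure \<mu> (ball (fst i) (5 * snd i)) \<partial>count_space C)"
      by (intro emeasure_UN_countable_le C) (auto simp: sets)
    finally have "t * emeasure \<mu> (U n)
        \<le> t * (\<integral>\<^sup>+i. emeasure \<mu> (ball (fst i) (5 * snd i)) \<partial>count_space C)"
      by (intro mult_left_mono) auto
    also have "\<dots> = (\<integral>\<^sup>+i. t * emeasure \<mu> (ball (fst i) (5 * snd i)) \<partial>count_space C)"
      by (simp add: nn_integral_cmult)
    also have "\<dots> \<le> (\<integral>\<^sup>+i. ennreal K * emeasure (density \<mu> h) (ball (fst i) (snd i)) \<partial>count_space C)"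
      by (intro nn_integral_mono one) auto
    also have "\<dots> = ennreal K * (\<integral>\<^sup>+i. emeasure (density \<mu> h) (ball (fst i) (snd i)) \<partial>count_space C)"
      by (simp add: nn_integral_cmult)
    also have "\<dots> = ennreal K * emeasure (density \<mu> h) (\<Union>i\<in>C. ball (fst i) (snd i))"
      using C dfam by (subst emeasure_UN_countable) (auto simp: sets)
    also have "\<dots> \<le> ennreal K * emeasure (density \<mu> h) (space (density \<mu> h))"
      by (intro mult_left_mono emeasure_space) auto
    also have "\<dots> = ennreal K * (\<integral>\<^sup>+x. h x \<partial>\<mu>)"
      by (subst emeasure_density) (auto simp: sets space)
    finally show ?thesis .
  qed
  have "incseq U"
    unfolding incseq_def U_def I_def by (fastforce intro: order_trans)
  moreover have "{x. t < maxfun \<mu> h x} = (\<Union>n. U n)"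
  proof -
    have "x \<in> (\<Union>n. U n)" if "0 < r" "t < ball_mean \<mu> h c r" "x \<in> ball c r" for x c r
    proof -
      obtain n where "r \<le> real n" using real_arch_simple by blast
      then show ?thesis using that by (auto simp: U_def I_def)
    qed
    then show ?thesis
      unfolding maxfun_superlevel by (auto simp: U_def I_def)
  qed
  ultimately have "emeasure \<mu> {x. t < maxfun \<mu> h x} = (SUP n. emeasure \<mu> (U n))"
    by (subst SUP_emeasure_incseq) (auto simp: sets)
  then have "t * emeasure \<mu> {x. t < maxfun \<mu> h x} = (SUP n. t * emeasure \<mu> (U n))"
    by (simp add: SUP_mult_left_ennreal)
  also have "\<dots> \<le> ennreal K * (\<integral>\<^sup>+x. h x \<partial>\<mu>)"
    by (intro SUP_least Un)
  finally show ?thesis .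
qed


section \<open>Real interpolation for the maximal function\<close>

lemma nn_integral_powr_Ioo:
  assumes "0 < a" "0 \<le> t"
  shows "(\<integral>\<^sup>+u. ennreal (u powr (a - 1)) * indicator {0<..<t} u \<partial>lborel) = ennreal (t powr a / a)"
proof -
  have "((\<lambda>u. u powr (a - 1)) has_integral (t powr (a - 1 + 1) / (a - 1 + 1))) {0..t}"
    using assms by (intro has_integral_powr_from_0) auto
  then have "((\<lambda>u. if u \<in> {0..t} then u powr (a - 1) else 0) has_integral (t powr a / a)) UNIV"
    by (subst has_integral_restrict_UNIV) simp
  then have "(\<integral>\<^sup>+u. ennreal (if u \<in> {0..t} then u powr (a - 1) else 0) \<partial>lborel) = ennreal (t powr a / a)"
    by (intro nn_integral_has_integral_lborel) auto
  moreover have "(\<integral>\<^sup>+u. ennreal (u powr (a - 1)) * indicator {0<..<t} u \<partial>lborel)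
      = (\<integral>\<^sup>+u. ennreal (if u \<in> {0..t} then u powr (a - 1) else 0) \<partial>lborel)"
    using AE_lborel_singleton[of 0] AE_lborel_singleton[of t]
    by (intro nn_integral_cong_AE) (auto elim!: eventually_elim2 split: split_indicator)
  ultimately show ?thesis by simp
qed

lemma nn_integral_layer_cake:
  assumes a: "0 < a"
  shows "(\<integral>\<^sup>+u. ennreal (a * u powr (a - 1)) * indicator {u. 0 < u \<and> ennreal u < t} u \<partial>lborel) = ennpowr t a"
    (is "?I t = _")
proof (cases t)
  case (real x)
  have "?I t = (\<integral>\<^sup>+u. ennreal a * (ennreal (u powr (a - 1)) * indicator {0<..<x} u) \<partial>lborel)"
    using real a by (intro nn_integral_cong) (auto simp: ennreal_mult ennreal_less_iff split: split_indicator)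
  also have "\<dots> = ennreal (x powr a)"
    using a real by (simp add: nn_integral_cmult nn_integral_powr_Ioo flip: ennreal_mult)
  finally show ?thesis using real by (simp add: ennpowr_ennreal)
next
  case top
  have "ennreal (real n powr a) \<le> ?I t" for n
  proof -
    have "ennreal (real n powr a) = ennreal a * ennreal (real n powr a / a)"
      using a by (simp flip: ennreal_mult)
    also have "\<dots> = (\<integral>\<^sup>+u. ennreal a * (ennreal (u powr (a - 1)) * indicator {0<..<real n} u) \<partial>lborel)"
      using a by (simp add: nn_integral_cmult nn_integral_powr_Ioo)
    also have "\<dots> \<le> ?I t"
      using top a by (intro nn_integral_mono) (auto simp: ennreal_mult split: split_indicator)
    finally show ?thesis .
  qed
  then have le: "ennreal (real m) \<le> ?I t" for m
  proof -
    obtain n where n: "real m powr (1 / a) \<le> real n"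
      using real_arch_simple by blast
    have "real m = (real m powr (1 / a)) powr a"
      using a by (simp add: powr_powr)
    also have "\<dots> \<le> real n powr a"
      using n a by (intro powr_mono2) auto
    finally have "ennreal (real m) \<le> ennreal (real n powr a)"
      by (rule ennreal_leI)
    also have "\<dots> \<le> ?I t"
      by fact
    finally show ?thesis .
  qed
  have "?I t = top"
  proof (rule ccontr)
    assume "?I t \<noteq> top"
    then obtain y where y: "?I t = ennreal y" "0 \<le> y"
      by (cases "?I t") auto
    obtain m where "y < real m"
      using reals_Archimedean2 by blast
    then show False
      using le[of m] y by (simp add: ennreal_le_iff)
  qed
  then show ?thesis using top by simp
qed

text \<open>Marcinkiewicz interpolation between the weak type bound and the trivial bound for
  bounded functions. The constant is obtained before the measure is fixed, because it depends on
  \<open>K\<close> and \<open>r\<close> alone.\<close>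

theorem maxfun_strong_type:
  fixes \<mu> :: "'a::euclidean_space measure"
  assumes K: "0 \<le> K" and r: "1 < r"
  obtains C where "0 < C" and "\<And>(\<mu> :: 'a measure) h. doubling_measure K \<mu> \<Longrightarrow> sigma_finite_measure \<mu> \<Longrightarrow>
    h \<in> borel_measurable borel \<Longrightarrow>
    (\<integral>\<^sup>+x. ennpowr (maxfun \<mu> h x) r \<partial>\<mu>) \<le> ennreal C * (\<integral>\<^sup>+x. ennpowr (h x) r \<partial>\<mu>)"
proof -
  \<comment> \<open>The factor is what the layer cake computation yields; the summand 1 keeps
    \<open>C\<close> positive when \<open>K = 0\<close>.\<close>
  define C where "C = K * 2 * r * 2 powr (r - 1) / (r - 1) + 1"
  have C: "K * 2 * r * 2 powr (r - 1) / (r - 1) \<le> C" "0 < C"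
    using K r by (auto simp: C_def intro!: add_nonneg_pos divide_nonneg_pos)
  show ?thesis
  proof (rule that[OF C(2)])
    fix \<mu> :: "'a measure" and h :: "'a \<Rightarrow> ennreal"
    assume mu: "doubling_measure K \<mu>" "sigma_finite_measure \<mu>" and [measurable]: "h \<in> borel_measurable borel"
    interpret sigma_finite_measure \<mu> by fact
    interpret pair_sigma_finite \<mu> "lborel :: real measure" ..
    have sets[measurable_cong]: "sets \<mu> = sets borel"
      using mu by (simp add: doubling_measure_def)
    let ?M = "maxfun \<mu> h"
    \<comment> \<open>The part of \<open>h\<close> that matters at height \<open>u\<close>: what is
      cut off is at most \<open>u / 2\<close>, so a mean of \<open>h\<close> above \<open>u\<close>
      forces a mean of \<open>hu u\<close> above \<open>u / 2\<close>.\<close>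
    define hu where "hu u x = (if ennreal (u / 2) < h x then h x else 0)" for u x
    have [measurable]: "hu u \<in> borel_measurable borel" for u
      unfolding hu_def by measurable
    have weak: "ennreal (u / 2) * emeasure \<mu> {x. ennreal u < ?M x} \<le> ennreal K * (\<integral>\<^sup>+x. hu u x \<partial>\<mu>)"
      if u: "0 < u" for u
    proof -
      have "ball_mean \<mu> h c s \<le> ball_mean \<mu> (hu u) c s + ennreal (u / 2)" if "0 < s" for c s
      proof -
        have b: "0 < emeasure \<mu> (ball c s)" "emeasure \<mu> (ball c s) < top"
          using mu that by (auto simp: doubling_measure_def)
        have "(\<integral>\<^sup>+y\<in>ball c s. h y \<partial>\<mu>)
            \<le> (\<integral>\<^sup>+y. hu u y * indicator (ball c s) y + ennreal (u / 2) * indicator (ball c s) y \<partial>\<mu>)"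
          by (intro nn_integral_mono) (auto simp: hu_def split: split_indicator)
        also have "\<dots> = (\<integral>\<^sup>+y\<in>ball c s. hu u y \<partial>\<mu>) + ennreal (u / 2) * emeasure \<mu> (ball c s)"
        proof -
          have [measurable]: "ball c s \<in> sets \<mu>" by (simp add: sets)
          show ?thesis
            by (subst nn_integral_add, measurable) (simp add: nn_integral_cmult_indicator)
        qed
        finally have "ball_mean \<mu> h c s
            \<le> ((\<integral>\<^sup>+y\<in>ball c s. hu u y \<partial>\<mu>) + ennreal (u / 2) * emeasure \<mu> (ball c s)) / emeasure \<mu> (ball c s)"
          unfolding ball_mean_def by (intro divide_right_mono_ennreal)
        also have "\<dots> = ball_mean \<mu> (hu u) c s + ennreal (u / 2)"
          using b unfolding ball_mean_def
          by (subst add_divide_distrib_ennreal) (auto simp: mult_divide_eq_ennreal)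
        finally show ?thesis .
      qed
      then have le: "?M x \<le> maxfun \<mu> (hu u) x + ennreal (u / 2)" for x
        unfolding maxfun_def[of _ h]
        by (intro SUP_least) (auto intro!: order_trans[OF _ add_right_mono[OF ball_mean_le_maxfun]])
      have "{x. ennreal u < ?M x} \<subseteq> {x. ennreal (u / 2) < maxfun \<mu> (hu u) x}"
      proof safe
        fix x assume "ennreal u < ?M x"
        then have "ennreal (u / 2) + ennreal (u / 2) < maxfun \<mu> (hu u) x + ennreal (u / 2)"
          using le[of x] u by (simp flip: ennreal_plus)
        then show "ennreal (u / 2) < maxfun \<mu> (hu u) x"
          by (meson add_right_mono leD leI)
      qed
      then have "ennreal (u / 2) * emeasure \<mu> {x. ennreal u < ?M x}
          \<le> ennreal (u / 2) * emeasure \<mu> {x. ennreal (u / 2) < maxfun \<mu> (hu u) x}"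
        by (intro mult_left_mono emeasure_mono) (auto simp: sets)
      also have "\<dots> \<le> ennreal K * (\<integral>\<^sup>+x. hu u x \<partial>\<mu>)"
        by (intro maxfun_weak_type mu) auto
      finally show ?thesis .
    qed
    have eq0: "0 < u \<Longrightarrow> ennreal (r * u powr (r - 1)) = ennreal (2 * r * u powr (r - 2)) * ennreal (u / 2)" for u
      using r by (simp add: powr_diff power2_eq_square flip: ennreal_mult)
    have "(\<integral>\<^sup>+x. ennpowr (?M x) r \<partial>\<mu>)
        = (\<integral>\<^sup>+x. \<integral>\<^sup>+u. ennreal (r * u powr (r - 1)) * indicator {u. 0 < u \<and> ennreal u < ?M x} u \<partial>lborel \<partial>\<mu>)"
      using r by (simp add: nn_integral_layer_cake)
    also have "\<dots> = (\<integral>\<^sup>+u. \<integral>\<^sup>+x. ennreal (r * u powr (r - 1)) * indicator {u. 0 < u \<and> ennreal u < ?M x} u \<partial>\<mu> \<partial>lborel)"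
      by (rule Fubini'[symmetric]) measurable
    also have "\<dots> = (\<integral>\<^sup>+u. ennreal (r * u powr (r - 1)) * indicator {0<..} u * emeasure \<mu> {x. ennreal u < ?M x} \<partial>lborel)"
    proof (intro nn_integral_cong)
      fix u :: real
      have "(\<integral>\<^sup>+x. ennreal (r * u powr (r - 1)) * indicator {u. 0 < u \<and> ennreal u < ?M x} u \<partial>\<mu>)
          = (\<integral>\<^sup>+x. (ennreal (r * u powr (r - 1)) * indicator {0<..} u) * indicator {x. ennreal u < ?M x} x \<partial>\<mu>)"
        by (intro nn_integral_cong) (auto split: split_indicator)
      also have "\<dots> = ennreal (r * u powr (r - 1)) * indicator {0<..} u * emeasure \<mu> {x. ennreal u < ?M x}"
        by (subst nn_integral_cmult_indicator) (auto simp: sets)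
      finally show "(\<integral>\<^sup>+x. ennreal (r * u powr (r - 1)) * indicator {u. 0 < u \<and> ennreal u < ?M x} u \<partial>\<mu>)
          = ennreal (r * u powr (r - 1)) * indicator {0<..} u * emeasure \<mu> {x. ennreal u < ?M x}" .
    qed
    also have "\<dots> \<le> (\<integral>\<^sup>+u. ennreal (2 * r * u powr (r - 2)) * indicator {0<..} u * (ennreal K * (\<integral>\<^sup>+x. hu u x \<partial>\<mu>)) \<partial>lborel)"
    proof (intro nn_integral_mono)
      fix u :: real
      show "ennreal (r * u powr (r - 1)) * indicator {0<..} u * emeasure \<mu> {x. ennreal u < ?M x}
          \<le> ennreal (2 * r * u powr (r - 2)) * indicator {0<..} u * (ennreal K * (\<integral>\<^sup>+x. hu u x \<partial>\<mu>))"
      proof (cases "0 < u")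
        case True
        then have "ennreal (r * u powr (r - 1)) * indicator {0<..} u * emeasure \<mu> {x. ennreal u < ?M x}
            = ennreal (2 * r * u powr (r - 2)) * (ennreal (u / 2) * emeasure \<mu> {x. ennreal u < ?M x})"
          by (simp add: eq0 mult.assoc)
        also have "\<dots> \<le> ennreal (2 * r * u powr (r - 2)) * (ennreal K * (\<integral>\<^sup>+x. hu u x \<partial>\<mu>))"
          by (intro mult_left_mono weak True) auto
        finally show ?thesis using True by simp
      qed simp
    qed
    also have "\<dots> = (\<integral>\<^sup>+u. \<integral>\<^sup>+x. ennreal (2 * r * u powr (r - 2)) * indicator {0<..} u * (ennreal K * hu u x) \<partial>\<mu> \<partial>lborel)"
      by (intro nn_integral_cong) (simp add: nn_integral_cmult sets)
    also have "\<dots> = (\<integral>\<^sup>+x. \<integral>\<^sup>+u. ennreal (2 * r * u powr (r - 2)) * indicator {0<..} u * (ennreal K * hu u x) \<partial>lborel \<partial>\<mu>)"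
      unfolding hu_def by (rule Fubini') measurable
    also have "\<dots> = (\<integral>\<^sup>+x. ennreal (K * 2 * r / (r - 1)) * h x *
        (\<integral>\<^sup>+u. ennreal ((r - 1) * u powr (r - 1 - 1)) * indicator {u. 0 < u \<and> ennreal u < 2 * h x} u \<partial>lborel) \<partial>\<mu>)"
    proof (intro nn_integral_cong)
      fix x
      have ind: "ennreal (u / 2) < h x \<longleftrightarrow> ennreal u < 2 * h x" if "0 < u" for u
      proof (cases "h x")
        case (real y)
        then have "2 * h x = ennreal (2 * y)" by (simp add: ennreal_mult)
        then show ?thesis using real that by (auto simp: ennreal_less_iff)
      next
        case top
        then show ?thesis by (simp add: ennreal_mult_top)
      qed
      have *: "ennreal (2 * r * u powr (r - 2)) * ennreal K = ennreal (K * 2 * r / (r - 1)) * ennreal ((r - 1) * u powr (r - 1 - 1))" for u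
        using r K by (simp flip: ennreal_mult)
      have "(\<integral>\<^sup>+u. ennreal (2 * r * u powr (r - 2)) * indicator {0<..} u * (ennreal K * hu u x) \<partial>lborel)
          = (\<integral>\<^sup>+u. (ennreal (K * 2 * r / (r - 1)) * h x) * (ennreal ((r - 1) * u powr (r - 1 - 1)) * indicator {u. 0 < u \<and> ennreal u < 2 * h x} u) \<partial>lborel)"
      proof (intro nn_integral_cong)
        fix u :: real
        show "ennreal (2 * r * u powr (r - 2)) * indicator {0<..} u * (ennreal K * hu u x)
          = (ennreal (K * 2 * r / (r - 1)) * h x) * (ennreal ((r - 1) * u powr (r - 1 - 1)) * indicator {u. 0 < u \<and> ennreal u < 2 * h x} u)"
        proof (cases "0 < u \<and> ennreal u < 2 * h x")
          case True
          have "ennreal (2 * r * u powr (r - 2)) * indicator {0<..} u * (ennreal K * hu u x)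
              = (ennreal (2 * r * u powr (r - 2)) * ennreal K) * h x"
            using True ind[of u] by (simp add: hu_def ac_simps)
          then show ?thesis
            using True unfolding * by (simp add: ac_simps)
        next
          case False
          then show ?thesis
            using ind[of u] by (auto simp: hu_def split: split_indicator)
        qed
      qed
      also have "\<dots> = ennreal (K * 2 * r / (r - 1)) * h x *
        (\<integral>\<^sup>+u. ennreal ((r - 1) * u powr (r - 1 - 1)) * indicator {u. 0 < u \<and> ennreal u < 2 * h x} u \<partial>lborel)"
        by (simp add: nn_integral_cmult)
      finally show "(\<integral>\<^sup>+u. ennreal (2 * r * u powr (r - 2)) * indicator {0<..} u * (ennreal K * hu u x) \<partial>lborel) = \<dots>" .
    qed
    also have "\<dots> = (\<integral>\<^sup>+x. ennreal (K * 2 * r / (r - 1)) * h x * ennpowr (2 * h x) (r - 1) \<partial>\<mu>)"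
      using r by (subst nn_integral_layer_cake) auto
    also have "\<dots> = (\<integral>\<^sup>+x. ennreal (K * 2 * r * 2 powr (r - 1) / (r - 1)) * ennpowr (h x) r \<partial>\<mu>)"
    proof (intro nn_integral_cong)
      fix x
      have "ennreal (K * 2 * r / (r - 1)) * h x * ennpowr (2 * h x) (r - 1)
         = (ennreal (K * 2 * r / (r - 1)) * ennpowr 2 (r - 1)) * (ennpowr (h x) 1 * ennpowr (h x) (r - 1))"
        by (simp add: ennpowr_mult ac_simps)
      also have "\<dots> = (ennreal (K * 2 * r / (r - 1)) * ennreal (2 powr (r - 1))) * ennpowr (h x) r"
        using ennpowr_ennreal[of 2 "r - 1"] by (subst ennpowr_add) simp
      also have "ennreal (K * 2 * r / (r - 1)) * ennreal (2 powr (r - 1)) = ennreal (K * 2 * r * 2 powr (r - 1) / (r - 1))"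
        using K r by (simp add: field_simps flip: ennreal_mult)
      finally show "ennreal (K * 2 * r / (r - 1)) * h x * ennpowr (2 * h x) (r - 1)
        = ennreal (K * 2 * r * 2 powr (r - 1) / (r - 1)) * ennpowr (h x) r" .
    qed
    also have "\<dots> = ennreal (K * 2 * r * 2 powr (r - 1) / (r - 1)) * (\<integral>\<^sup>+x. ennpowr (h x) r \<partial>\<mu>)"
      by (intro nn_integral_cmult) measurable
    also have "\<dots> \<le> ennreal C * (\<integral>\<^sup>+x. ennpowr (h x) r \<partial>\<mu>)"
      by (intro mult_right_mono ennreal_leI C) auto
    finally show "(\<integral>\<^sup>+x. ennpowr (?M x) r \<partial>\<mu>) \<le> ennreal C * (\<integral>\<^sup>+x. ennpowr (h x) r \<partial>\<mu>)" .
  qed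
qed


section \<open>Muckenhoupt weights\<close>

lemma ball_in_borel [measurable]: "ball (c :: 'a::euclidean_space) r \<in> sets borel"
  by simp

definition wm :: "('a::euclidean_space \<Rightarrow> real) \<Rightarrow> 'a measure" where
  "wm v = density lborel (\<lambda>x. ennreal (v x))"

definition bvol :: "('a::euclidean_space \<Rightarrow> real) \<Rightarrow> 'a \<Rightarrow> real \<Rightarrow> real" where
  "bvol v c r = measure (wm v) (ball c r)"

text \<open>Borel and positive everywhere, so that powers and quotients of weights behave without
  exceptional sets. A given weight is replaced by such a version up to a null set.\<close>

definition adm_weight :: "('a::euclidean_space \<Rightarrow> real) \<Rightarrow> bool" where
  "adm_weight v \<longleftrightarrow> v \<in> borel_measurable borel \<and> (\<forall>x. 0 < v x) \<and>
     (\<forall>c r. emeasure (wm v) (ball c r) < top)"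

text \<open>Among the equivalent descriptions of A_infinity this one is convenient because doubling,
  reverse doubling and the comparison of two weights all follow from a suitable choice of
  \<open>E\<close>.\<close>

definition A_inf :: "('a::euclidean_space \<Rightarrow> real) \<Rightarrow> bool" where
  "A_inf v \<longleftrightarrow> adm_weight v \<and>
     (\<forall>\<epsilon>>0. \<exists>\<delta>>0. \<forall>c r E. 0 < r \<longrightarrow> E \<in> sets borel \<longrightarrow> E \<subseteq> ball c r \<longrightarrow>
        \<epsilon> * measure lborel (ball c r) \<le> measure lborel E \<longrightarrow> \<delta> * bvol v c r \<le> measure (wm v) E)"

lemma sets_wm [measurable_cong, simp]: "sets (wm v) = sets borel"
  by (simp add: wm_def)

lemma space_wm [simp]: "space (wm v) = UNIV"
  by (simp add: wm_def)

lemma adm_weightD: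
  assumes "adm_weight v"
  shows adm_weight_measurable: "v \<in> borel_measurable borel"
    and adm_weight_pos: "0 < v x" and adm_weight_nonneg: "0 \<le> v x"
    and adm_weight_finite: "emeasure (wm v) (ball c r) < top"
  using assms by (auto simp: adm_weight_def less_imp_le)

lemma A_inf_adm: "A_inf v \<Longrightarrow> adm_weight v"
  by (simp add: A_inf_def)

lemma emeasure_wm:
  "v \<in> borel_measurable borel \<Longrightarrow> E \<in> sets borel \<Longrightarrow>
    emeasure (wm v) E = (\<integral>\<^sup>+x\<in>E. ennreal (v x) \<partial>lborel)"
  by (simp add: wm_def emeasure_density)

lemma nn_integral_wm:
  "v \<in> borel_measurable borel \<Longrightarrow> h \<in> borel_measurable borel \<Longrightarrow>
    (\<integral>\<^sup>+x. h x \<partial>wm v) = (\<integral>\<^sup>+x. ennreal (v x) * h x \<partial>lborel)"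
  by (simp add: wm_def nn_integral_density)

lemma adm_weight_emeasure:
  assumes "adm_weight v" "E \<subseteq> ball c r"
  shows "emeasure (wm v) E = ennreal (measure (wm v) E)"
proof -
  have "emeasure (wm v) E \<le> emeasure (wm v) (ball c r)"
    using assms by (intro emeasure_mono) auto
  then have "emeasure (wm v) E \<noteq> top"
    using adm_weight_finite[OF assms(1), of c r] by (auto simp: top_unique)
  then show ?thesis by (simp add: emeasure_eq_ennreal_measure)
qed

lemma emeasure_ball_bvol: "adm_weight v \<Longrightarrow> emeasure (wm v) (ball c r) = ennreal (bvol v c r)"
  unfolding bvol_def by (rule adm_weight_emeasure) auto

lemma measure_wm_mono:
  assumes "adm_weight v" "E \<subseteq> F" "F \<subseteq> ball c r" "E \<in> sets borel" "F \<in> sets borel"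
  shows "measure (wm v) E \<le> measure (wm v) F"
  using emeasure_mono[of E F "wm v"] adm_weight_emeasure[OF assms(1), of E c r]
    adm_weight_emeasure[OF assms(1), of F c r] assms by auto

lemma emeasure_wm_ball_neq_0:
  assumes [measurable]: "v \<in> borel_measurable borel" and v: "\<And>x. 0 < v x" and r: "0 < r"
  shows "emeasure (wm v) (ball c r) \<noteq> 0"
proof
  assume "emeasure (wm v) (ball c r) = 0"
  then have "(\<integral>\<^sup>+x\<in>ball c r. ennreal (v x) \<partial>lborel) = 0"
    by (simp add: emeasure_wm)
  then have "AE x in lborel. ennreal (v x) * indicator (ball c r) x = 0"
    by (rule nn_integral_0_iff_AE[THEN iffD1, rotated]) measurable
  then have "AE x in lborel. x \<notin> ball c r"
    by (rule eventually_mono)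
      (use v in \<open>auto simp: ennreal_eq_0_iff simp flip: not_less split: split_indicator_asm\<close>)
  then have "emeasure lborel (ball c r) = 0"
    by (subst (asm) AE_iff_measurable[OF _ refl]) (auto simp: ball_def)
  then show False
    using r content_ball_gt_0_iff[of c r] by (simp add: measure_def)
qed

lemma bvol_pos:
  assumes v: "adm_weight v" and r: "0 < r"
  shows "0 < bvol v c r"
  using emeasure_ball_bvol[OF v, of c r] emeasure_wm_ball_neq_0[OF adm_weight_measurable[OF v] adm_weight_pos[OF v] r, of c]
  by (auto simp: ennreal_eq_0_iff not_le)

lemma bvol_mono:
  assumes "adm_weight v" "ball c r \<subseteq> ball d s"
  shows "bvol v c r \<le> bvol v d s"
  unfolding bvol_def using assms by (intro measure_wm_mono[of v _ _ d s]) auto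

lemma lball_pos: "0 < r \<Longrightarrow> 0 < measure lborel (ball (c::'a::euclidean_space) r)"
  by (simp add: content_ball)

lemma lball_scale:
  "0 \<le> r \<Longrightarrow> 0 \<le> k \<Longrightarrow>
    measure lborel (ball (c::'a::euclidean_space) (k * r)) = k ^ DIM('a) * measure lborel (ball c r)"
  by (simp add: content_ball power_mult_distrib)

lemma sigma_finite_wm: "adm_weight v \<Longrightarrow> sigma_finite_measure (wm v)"
  unfolding wm_def
  by (subst sigma_finite_measure.sigma_finite_iff_density_finite[OF sigma_finite_lborel]) (auto dest: adm_weight_measurable)

lemma A_inf_lower:
  assumes "A_inf v" "0 < \<epsilon>"
  obtains \<delta> where "0 < \<delta>" "\<And>c r E. 0 < r \<Longrightarrow> E \<in> sets borel \<Longrightarrow> E \<subseteq> ball c r \<Longrightarrow>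
        \<epsilon> * measure lborel (ball c r) \<le> measure lborel E \<Longrightarrow> \<delta> * bvol v c r \<le> measure (wm v) E"
  using assms unfolding A_inf_def by metis

text \<open>The set \<open>E\<close> is the ball of radius \<open>r\<close> inside the concentric
  ball of radius \<open>5 * r\<close>; in dimension \<open>n\<close> it has the fixed proportion
  5^(-n).\<close>

lemma A_inf_doubling:
  fixes v :: "'a::euclidean_space \<Rightarrow> real"
  assumes v: "A_inf v"
  obtains K where "0 < K" "doubling_measure K (wm v)" "\<And>c r. 0 < r \<Longrightarrow> bvol v c (5 * r) \<le> K * bvol v c r"
proof -
  obtain \<delta> where \<delta>: "0 < \<delta>" and low: "\<And>c r E. 0 < r \<Longrightarrow> E \<in> sets borel \<Longrightarrow> E \<subseteq> ball c r \<Longrightarrow>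
        (1 / 5) ^ DIM('a) * measure lborel (ball c r) \<le> measure lborel E \<Longrightarrow> \<delta> * bvol v c r \<le> measure (wm v) E"
    using A_inf_lower[OF v, of "(1 / 5) ^ DIM('a)"] by auto
  note adm = A_inf_adm[OF v]
  have dbl: "bvol v c (5 * r) \<le> (1 / \<delta>) * bvol v c r" if "0 < r" for c r
  proof -
    have "\<delta> * bvol v c (5 * r) \<le> measure (wm v) (ball c r)"
      using that by (intro low) (auto simp: lball_scale power_one_over)
    then show ?thesis using \<delta> by (simp add: bvol_def field_simps)
  qed
  have "doubling_measure (1 / \<delta>) (wm v)"
    unfolding doubling_measure_def
  proof (intro conjI allI impI)
    fix c :: 'a and r :: real assume r: "0 < r"
    show "0 < emeasure (wm v) (ball c r)"
      using bvol_pos[OF adm r, of c] by (simp add: emeasure_ball_bvol adm)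
    show "emeasure (wm v) (ball c r) < top"
      using adm by (rule adm_weight_finite)
    show "emeasure (wm v) (ball c (5 * r)) \<le> ennreal (1 / \<delta>) * emeasure (wm v) (ball c r)"
      using dbl[OF r, of c] \<delta> bvol_pos[OF adm r, of c]
      by (simp add: emeasure_ball_bvol adm flip: ennreal_mult)
  qed auto
  with dbl \<delta> that[of "1 / \<delta>"] show ?thesis by simp
qed

text \<open>The annulus between radii \<open>r\<close> and \<open>2 * r\<close> fills at least half
  of the larger ball, hence carries at least the fraction \<delta> of its weighted volume. This
  growth is what makes sums over dyadic balls geometric.\<close>

lemma A_inf_reverse_doubling:
  fixes v :: "'a::euclidean_space \<Rightarrow> real"
  assumes v: "A_inf v"
  obtains \<gamma> where "1 < \<gamma>" "\<And>c r. 0 < r \<Longrightarrow> \<gamma> * bvol v c r \<le> bvol v c (2 * r)"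
proof -
  obtain \<delta> where \<delta>: "0 < \<delta>" and low: "\<And>c r E. 0 < r \<Longrightarrow> E \<in> sets borel \<Longrightarrow> E \<subseteq> ball c r \<Longrightarrow>
        (1 / 2) * measure lborel (ball c r) \<le> measure lborel E \<Longrightarrow> \<delta> * bvol v c r \<le> measure (wm v) E"
    using A_inf_lower[OF v, of "1 / 2"] by auto
  note adm = A_inf_adm[OF v]
  have "(1 + \<delta>) * bvol v c r \<le> bvol v c (2 * r)" if r: "0 < r" for c r
  proof -
    let ?B = "ball c r" and ?D = "ball c (2 * r)"
    have sub: "?B \<subseteq> ?D" using r by auto
    have "measure lborel (?D - ?B) = measure lborel ?D - measure lborel ?B"
      using sub emeasure_lborel_ball_finite[of c "2 * r"] by (intro measure_Diff) auto
    moreover have "2 * measure lborel ?B \<le> measure lborel ?D"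
      using r self_le_power[of 2 "DIM('a)"] lball_pos[OF r, of c]
      by (subst lball_scale) auto
    ultimately have "\<delta> * bvol v c (2 * r) \<le> measure (wm v) (?D - ?B)"
      using r by (intro low) auto
    moreover have "measure (wm v) (?D - ?B) = bvol v c (2 * r) - bvol v c r"
      unfolding bvol_def using sub adm_weight_finite[OF adm, of c "2 * r"]
      by (intro measure_Diff) auto
    moreover have "\<delta> * bvol v c r \<le> \<delta> * bvol v c (2 * r)"
      using \<delta> bvol_mono[OF adm sub] by simp
    ultimately show ?thesis by (simp add: algebra_simps)
  qed
  then show ?thesis using \<delta> that[of "1 + \<delta>"] by simp
qed

text \<open>Integrating the defining inequality of the exceptional set gives it
  \<open>v\<close>-measure at most \<kappa> v(B). With \<kappa> = \<delta> / 2 this is less than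
  \<delta> v(B), which A_infinity forbids for a set of Lebesgue proportion \<epsilon>. So v / v(B)
  dominates \<kappa> w / w(B) on most of every ball.\<close>

lemma A_inf_compare:
  fixes v w :: "'a::euclidean_space \<Rightarrow> real"
  assumes v: "A_inf v" and w: "adm_weight w" and \<epsilon>: "0 < \<epsilon>"
  obtains \<kappa> where "0 < \<kappa>" "\<And>c r. 0 < r \<Longrightarrow>
    measure lborel {y \<in> ball c r. v y * bvol w c r < \<kappa> * bvol v c r * w y} < \<epsilon> * measure lborel (ball c r)"
proof -
  obtain \<delta> where \<delta>: "0 < \<delta>" and low: "\<And>c r E. 0 < r \<Longrightarrow> E \<in> sets borel \<Longrightarrow> E \<subseteq> ball c r \<Longrightarrow>
        \<epsilon> * measure lborel (ball c r) \<le> measure lborel E \<Longrightarrow> \<delta> * bvol v c r \<le> measure (wm v) E"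
    using A_inf_lower[OF v \<epsilon>] by auto
  note adm = A_inf_adm[OF v]
  note [measurable] = adm_weight_measurable[OF adm] adm_weight_measurable[OF w]
  show ?thesis
  proof (rule that[of "\<delta> / 2"])
    fix c :: 'a and r :: real assume r: "0 < r"
    let ?E = "{y \<in> ball c r. v y * bvol w c r < \<delta> / 2 * bvol v c r * w y}"
    have [measurable]: "?E \<in> sets borel" by measurable
    have p: "0 < bvol w c r" "0 < bvol v c r"
      using r adm w by (auto intro: bvol_pos)
    have "ennreal (bvol w c r) * emeasure (wm v) ?E
        = (\<integral>\<^sup>+y\<in>?E. ennreal (v y * bvol w c r) \<partial>lborel)"
      using adm_weight_nonneg[OF adm] p
      by (simp add: emeasure_wm ennreal_mult ac_simps flip: nn_integral_cmult)
    also have "\<dots> \<le> (\<integral>\<^sup>+y. ennreal (\<delta> / 2 * bvol v c r) * (ennreal (w y) * indicator (ball c r) y) \<partial>lborel)"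
      using \<delta> p adm_weight_nonneg[OF w]
      by (intro nn_integral_mono) (auto simp: simp flip: ennreal_mult split: split_indicator intro!: ennreal_leI)
    also have "\<dots> = ennreal (\<delta> / 2 * bvol v c r) * ennreal (bvol w c r)"
      by (simp add: nn_integral_cmult emeasure_wm w flip: emeasure_ball_bvol)
    finally have "ennreal (bvol w c r) * emeasure (wm v) ?E \<le> ennreal (\<delta> / 2 * bvol v c r) * ennreal (bvol w c r)" .
    then have "ennreal (bvol w c r * measure (wm v) ?E) \<le> ennreal (\<delta> / 2 * bvol v c r * bvol w c r)"
    proof -
      have "emeasure (wm v) ?E = ennreal (measure (wm v) ?E)"
        by (rule adm_weight_emeasure[OF adm, of _ c r]) auto
      then show ?thesis
        using \<open>_ \<le> ennreal (\<delta> / 2 * bvol v c r) * ennreal (bvol w c r)\<close> p \<delta>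
        by (simp only: ennreal_mult' mult_nonneg_nonneg less_imp_le divide_nonneg_pos zero_less_numeral)
    qed
    then have "measure (wm v) ?E \<le> \<delta> / 2 * bvol v c r"
      using p \<delta> by (simp add: ennreal_le_iff mult.commute)
    also have "\<dots> < \<delta> * bvol v c r"
      using p \<delta> by simp
    finally show "measure lborel ?E < \<epsilon> * measure lborel (ball c r)"
      using low[OF r, of ?E c] by force
  qed (use \<delta> in simp)
qed

lemma nn_integral_Holder3:
  assumes [measurable]: "f \<in> borel_measurable M" "g \<in> borel_measurable M" "h \<in> borel_measurable M"
    and t: "0 < a" "0 < b" "0 < c" "a + b + c = 1"
  shows "(\<integral>\<^sup>+x. ennpowr (f x) a * (ennpowr (g x) b * ennpowr (h x) c) \<partial>M)
    \<le> ennpowr (\<integral>\<^sup>+x. f x \<partial>M) a * (ennpowr (\<integral>\<^sup>+x. g x \<partial>M) b * ennpowr (\<integral>\<^sup>+x. h x \<partial>M) c)"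
proof -
  define k where "k x = ennpowr (g x) (b / (b + c)) * ennpowr (h x) (1 - b / (b + c))" for x
  have bc: "1 - b / (b + c) = c / (b + c)" "1 - a = b + c"
    using t by (auto simp: field_simps)
  have [measurable]: "k \<in> borel_measurable M"
    unfolding k_def by measurable
  have "(\<integral>\<^sup>+x. ennpowr (f x) a * (ennpowr (g x) b * ennpowr (h x) c) \<partial>M)
      = (\<integral>\<^sup>+x. ennpowr (f x) a * ennpowr (k x) (1 - a) \<partial>M)"
    using t by (intro nn_integral_cong) (simp add: k_def ennpowr_mult ennpowr_ennpowr bc)
  also have "\<dots> \<le> ennpowr (\<integral>\<^sup>+x. f x \<partial>M) a * ennpowr (\<integral>\<^sup>+x. k x \<partial>M) (1 - a)"
    using t by (intro nn_integral_Holder) auto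
  also have "\<dots> \<le> ennpowr (\<integral>\<^sup>+x. f x \<partial>M) a *
      ennpowr (ennpowr (\<integral>\<^sup>+x. g x \<partial>M) (b / (b + c)) * ennpowr (\<integral>\<^sup>+x. h x \<partial>M) (1 - b / (b + c))) (1 - a)"
    unfolding k_def using t by (intro mult_left_mono ennpowr_mono nn_integral_Holder) auto
  also have "\<dots> = ennpowr (\<integral>\<^sup>+x. f x \<partial>M) a * (ennpowr (\<integral>\<^sup>+x. g x \<partial>M) b * ennpowr (\<integral>\<^sup>+x. h x \<partial>M) c)"
    using t by (simp add: ennpowr_mult ennpowr_ennpowr bc)
  finally show ?thesis .
qed

text \<open>Hoelder's inequality applied to the pointwise identity on \<open>E\<close> gives |E|^e
  \<le> v1(E)^e1 v2(E)^e2 v3(E)^e3 with e = e1 + e2 + e3. Enlarging the last two sets to the ball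
  and inserting the ball condition leaves a lower bound for v1(E) / v1(B). Any of the three weights
  may be placed first.\<close>

lemma A_inf_of_product:
  fixes v1 v2 v3 :: "'a::euclidean_space \<Rightarrow> real"
  assumes adm: "adm_weight v1" "adm_weight v2" "adm_weight v3"
    and e: "0 < e1" "0 < e2" "0 < e3"
    and one: "\<And>x. v1 x powr e1 * (v2 x powr e2 * v3 x powr e3) = 1"
    and A: "0 < A"
    and bound: "\<And>c r. 0 < r \<Longrightarrow> bvol v1 c r powr e1 * (bvol v2 c r powr e2 * bvol v3 c r powr e3)
      \<le> A * measure lborel (ball c r) powr (e1 + e2 + e3)"
  shows "A_inf v1"
  unfolding A_inf_def
proof (intro conjI adm allI impI)
  fix \<epsilon> :: real assume \<epsilon>: "0 < \<epsilon>"
  define e where "e = e1 + e2 + e3"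
  have epos: "0 < e" using e by (simp add: e_def)
  note [measurable] = adm[THEN adm_weight_measurable]
  show "\<exists>\<delta>>0. \<forall>c r E. 0 < r \<longrightarrow> E \<in> sets borel \<longrightarrow> E \<subseteq> ball c r \<longrightarrow>
        \<epsilon> * measure lborel (ball c r) \<le> measure lborel E \<longrightarrow> \<delta> * bvol v1 c r \<le> measure (wm v1) E"
  proof (intro exI[of _ "(\<epsilon> powr e / A) powr (1 / e1)"] conjI allI impI)
    show "0 < (\<epsilon> powr e / A) powr (1 / e1)" using \<epsilon> A by simp
    fix c :: 'a and r :: real and E
    assume r: "0 < r" and [measurable]: "E \<in> sets borel" and sub: "E \<subseteq> ball c r"
      and le: "\<epsilon> * measure lborel (ball c r) \<le> measure lborel E"
    let ?V = "\<lambda>v. measure (wm v) E"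
    have em: "emeasure lborel E = ennreal (measure lborel E)"
    proof -
      have "emeasure lborel E \<le> emeasure lborel (ball c r)"
        using sub by (intro emeasure_mono) auto
      then have "emeasure lborel E \<noteq> top"
        using emeasure_lborel_ball_finite[of c r] by (auto simp: top_unique)
      then show ?thesis by (simp add: emeasure_eq_ennreal_measure)
    qed
    \<comment> \<open>The exponents are divided by their sum so that they add up to 1 for Hoelder's
      inequality; the power \<open>e\<close> is restored afterwards.\<close>
    have one': "v1 x powr (e1 / e) * (v2 x powr (e2 / e) * v3 x powr (e3 / e)) = 1" for x
    proof -
      have "v1 x powr (e1 / e) * (v2 x powr (e2 / e) * v3 x powr (e3 / e))
          = (v1 x powr e1 * (v2 x powr e2 * v3 x powr e3)) powr (1 / e)"
        using adm_weight_nonneg adm by (simp add: powr_mult powr_powr)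
      then show ?thesis by (simp add: one)
    qed
    have "emeasure lborel E = (\<integral>\<^sup>+x. ennpowr (ennreal (v1 x) * indicator E x) (e1 / e) *
       (ennpowr (ennreal (v2 x) * indicator E x) (e2 / e) * ennpowr (ennreal (v3 x) * indicator E x) (e3 / e)) \<partial>lborel)"
    proof (subst nn_integral_indicator[symmetric], simp, intro nn_integral_cong)
      fix x
      show "indicator E x = ennpowr (ennreal (v1 x) * indicator E x) (e1 / e) *
       (ennpowr (ennreal (v2 x) * indicator E x) (e2 / e) * ennpowr (ennreal (v3 x) * indicator E x) (e3 / e))"
        using one'[of x] adm_weight_nonneg[OF adm(1), of x] adm_weight_nonneg[OF adm(2), of x] adm_weight_nonneg[OF adm(3), of x]
        by (auto simp: ennpowr_ennreal split: split_indicator simp flip: ennreal_mult)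
    qed
    also have "\<dots> \<le> ennpowr (\<integral>\<^sup>+x\<in>E. ennreal (v1 x) \<partial>lborel) (e1 / e) *
       (ennpowr (\<integral>\<^sup>+x\<in>E. ennreal (v2 x) \<partial>lborel) (e2 / e) * ennpowr (\<integral>\<^sup>+x\<in>E. ennreal (v3 x) \<partial>lborel) (e3 / e))"
      using e epos by (intro nn_integral_Holder3) (auto simp: e_def simp flip: add_divide_distrib)
    also have "\<dots> = ennreal (?V v1 powr (e1 / e) * (?V v2 powr (e2 / e) * ?V v3 powr (e3 / e)))"
      using adm by (simp add: adm_weight_emeasure[OF _ sub] ennpowr_ennreal ennreal_mult flip: emeasure_wm)
    finally have "measure lborel E \<le> ?V v1 powr (e1 / e) * (?V v2 powr (e2 / e) * ?V v3 powr (e3 / e))"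
      by (simp add: em ennreal_le_iff)
    then have "measure lborel E powr e \<le> (?V v1 powr (e1 / e) * (?V v2 powr (e2 / e) * ?V v3 powr (e3 / e))) powr e"
      using epos by (intro powr_mono2) auto
    also have "\<dots> = ?V v1 powr e1 * (?V v2 powr e2 * ?V v3 powr e3)"
      using epos by (simp add: powr_mult powr_powr)
    \<comment> \<open>Only \<open>v1\<close> keeps the set \<open>E\<close>; the other two measures
      grow to the ball, where the hypothesis controls them.\<close>
    also have "\<dots> \<le> ?V v1 powr e1 * (bvol v2 c r powr e2 * bvol v3 c r powr e3)"
      using e adm sub unfolding bvol_def
      by (intro mult_left_mono mult_mono powr_mono2 measure_wm_mono[of _ _ _ c r]) auto
    finally have 1: "measure lborel E powr e \<le> ?V v1 powr e1 * (bvol v2 c r powr e2 * bvol v3 c r powr e3)" .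
    have pos: "0 < bvol v1 c r" "0 < bvol v2 c r" "0 < bvol v3 c r" "0 < measure lborel (ball c r)"
      using r adm by (auto intro: bvol_pos lball_pos)
    have "(\<epsilon> * measure lborel (ball c r)) powr e * bvol v1 c r powr e1 \<le> measure lborel E powr e * bvol v1 c r powr e1"
      using le \<epsilon> epos by (intro mult_right_mono powr_mono2) auto
    also have "\<dots> \<le> ?V v1 powr e1 * (bvol v2 c r powr e2 * bvol v3 c r powr e3) * bvol v1 c r powr e1"
      using 1 by (intro mult_right_mono) auto
    also have "\<dots> = ?V v1 powr e1 * (bvol v1 c r powr e1 * (bvol v2 c r powr e2 * bvol v3 c r powr e3))"
      by simp
    also have "\<dots> \<le> ?V v1 powr e1 * (A * measure lborel (ball c r) powr e)"
      unfolding e_def by (intro mult_left_mono bound r) auto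
    finally have "\<epsilon> powr e * bvol v1 c r powr e1 \<le> A * ?V v1 powr e1"
      using pos \<epsilon> by (simp add: powr_mult mult.commute)
    then have "\<epsilon> powr e / A * bvol v1 c r powr e1 \<le> ?V v1 powr e1"
      using A by (simp add: field_simps)
    then have "(\<epsilon> powr e / A * bvol v1 c r powr e1) powr (1 / e1) \<le> (?V v1 powr e1) powr (1 / e1)"
      using e A by (intro powr_mono2) auto
    then show "(\<epsilon> powr e / A) powr (1 / e1) * bvol v1 c r \<le> ?V v1"
      using e pos A by (simp only: powr_mult powr_powr) simp
  qed
qed


section \<open>Sums over dyadic scales\<close>

lemma nn_integral_geometric_int:
  assumes "0 \<le> \<theta>" "\<theta> < 1"
  obtains Z where "0 < Z" "\<And>k0. (\<integral>\<^sup>+k. ennreal (\<theta> ^ nat \<bar>k - k0\<bar>) \<partial>count_space UNIV) \<le> ennreal Z"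
proof -
  have geo: "(\<integral>\<^sup>+n. ennreal (\<theta> ^ n) \<partial>count_space UNIV) = ennreal (1 / (1 - \<theta>))"
    using assms by (simp add: nn_integral_count_space_nat suminf_ennreal2 suminf_geometric summable_geometric)
  show ?thesis
  proof (rule that[of "2 / (1 - \<theta>)"])
    fix k0 :: int
    let ?f = "\<lambda>k. ennreal (\<theta> ^ nat \<bar>k - k0\<bar>)"
    have "(\<integral>\<^sup>+k. ?f k \<partial>count_space UNIV)
        \<le> (\<integral>\<^sup>+k. ?f k * indicator {k0..} k + ?f k * indicator {..k0} k \<partial>count_space UNIV)"
      by (intro nn_integral_mono) (auto split: split_indicator)
    also have "\<dots> = (\<integral>\<^sup>+k. ?f k \<partial>count_space {k0..}) + (\<integral>\<^sup>+k. ?f k \<partial>count_space {..k0})"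
      by (simp add: nn_integral_add nn_integral_count_space_indicator)
    also have "(\<integral>\<^sup>+k. ?f k \<partial>count_space {k0..}) = (\<integral>\<^sup>+n. ?f (k0 + int n) \<partial>count_space UNIV)"
      by (rule nn_integral_bij_count_space[symmetric])
        (auto intro!: bij_betw_byWitness[where f'="\<lambda>k. nat (k - k0)"])
    also have "(\<integral>\<^sup>+k. ?f k \<partial>count_space {..k0}) = (\<integral>\<^sup>+n. ?f (k0 - int n) \<partial>count_space UNIV)"
      by (rule nn_integral_bij_count_space[symmetric])
        (auto intro!: bij_betw_byWitness[where f'="\<lambda>k. nat (k0 - k)"])
    finally show "(\<integral>\<^sup>+k. ?f k \<partial>count_space UNIV) \<le> ennreal (2 / (1 - \<theta>))"
      using assms by (simp add: geo flip: ennreal_plus)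
  qed (use assms in simp)
qed

lemma geometric_growth:
  fixes W :: "int \<Rightarrow> real"
  assumes "\<And>k. \<gamma> * W k \<le> W (k + 1)" "0 \<le> \<gamma>"
  shows "\<gamma> ^ n * W k \<le> W (k + int n)"
proof (induction n)
  case (Suc n)
  have "\<gamma> ^ Suc n * W k \<le> \<gamma> * W (k + int n)"
    using Suc assms(2) by (simp add: mult.assoc mult_left_mono)
  also have "\<dots> \<le> W (k + int (Suc n))"
    using assms(1)[of "k + int n"] by (simp add: ac_simps)
  finally show ?case .
qed simp

text \<open>Growth by a fixed factor sends \<open>W\<close> to infinity in one direction and to 0 in
  the other, so a level \<open>V\<close> is crossed; the crossing is the scale at which the two
  estimates in Hedberg's argument are exchanged.\<close>

lemma geometric_crossing:
  fixes W :: "int \<Rightarrow> real"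
  assumes W: "\<And>k. 0 < W k" "\<And>k. \<gamma> * W k \<le> W (k + 1)" and \<gamma>: "1 < \<gamma>" and V: "0 < V"
  obtains k0 where "W (k0 - 1) < V" "V \<le> W k0"
proof -
  obtain n where n: "V / W 0 < \<gamma> ^ n"
    using real_arch_pow[OF \<gamma>] by blast
  obtain m where m: "W 0 / V < \<gamma> ^ m"
    using real_arch_pow[OF \<gamma>] by blast
  have "V \<le> W (int n)"
    using n W(1)[of 0] geometric_growth[of \<gamma> W n 0] W(2) \<gamma> by (simp add: field_simps)
  have lo: "W (- int m) < V"
  proof -
    have "\<gamma> ^ m * W (- int m) \<le> W 0"
      using geometric_growth[of \<gamma> W m "- int m"] W(2) \<gamma> by simp
    also have "\<dots> < \<gamma> ^ m * V"
      using m V by (simp add: field_simps)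
    finally show ?thesis
      using \<gamma> by (subst (asm) mult_less_cancel_left_pos) auto
  qed
  \<comment> \<open>The search for the least index starts at \<open>- m\<close>, where
    \<open>W\<close> is known to be below \<open>V\<close>; hence \<open>j\<close> is positive and
    its predecessor still fails.\<close>
  define j where "j = (LEAST j. V \<le> W (- int m + int j))"
  have ex: "V \<le> W (- int m + int (n + m))"
    using \<open>V \<le> W (int n)\<close> by simp
  have j: "V \<le> W (- int m + int j)"
    unfolding j_def by (rule LeastI[of "\<lambda>j. V \<le> W (- int m + int j)", OF ex])
  have "j \<noteq> 0"
    using j lo by (intro notI) simp
  then have "\<not> V \<le> W (- int m + int (j - 1))"
    unfolding j_def by (intro not_less_Least) simp
  then show ?thesis
    using that[of "- int m + int j"] j \<open>j \<noteq> 0\<close> by (simp add: of_nat_diff not_le algebra_simps)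
qed

text \<open>Hedberg's trick: use the growth bound on \<open>\<Phi>\<close> for small \<open>k\<close>, and the uniform bound for large \<open>k\<close>.\<close>

lemma Hedberg_sum:
  assumes \<gamma>: "1 < \<gamma>" and ab: "0 < a" "a < b"
  obtains C where "0 < C" "\<And>(W :: int \<Rightarrow> real) \<Phi> \<Lambda> M.
    (\<And>k. 0 < W k) \<Longrightarrow> (\<And>k. \<gamma> * W k \<le> W (k + 1)) \<Longrightarrow> (\<And>k. 0 \<le> \<Phi> k) \<Longrightarrow> (\<And>k. \<Phi> k \<le> \<Lambda>) \<Longrightarrow>
    (\<And>k. \<Phi> k \<le> M * W k powr b) \<Longrightarrow>
    (\<integral>\<^sup>+k. ennreal (W k powr (- a) * \<Phi> k) \<partial>count_space UNIV) \<le> ennreal (C * \<Lambda> powr (1 - a / b) * M powr (a / b))"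
proof -
  \<comment> \<open>A decay rate valid on both sides: above the crossing the terms decay like
    \<open>W powr (- a)\<close>, below it they grow like \<open>W powr (b - a)\<close>.\<close>
  define \<eta> where "\<eta> = min a (b - a)"
  have \<eta>: "0 < \<eta>" "\<eta> \<le> a" "\<eta> \<le> b - a"
    using ab by (auto simp: \<eta>_def)
  define \<theta> where "\<theta> = \<gamma> powr (- \<eta>)"
  have \<theta>: "0 < \<theta>" "\<theta> < 1"
    using \<gamma> \<eta> by (auto simp: \<theta>_def powr_less_one)
  obtain Z where Z: "0 < Z" "\<And>k0. (\<integral>\<^sup>+k. ennreal (\<theta> ^ nat \<bar>k - k0\<bar>) \<partial>count_space UNIV) \<le> ennreal Z"
    using nn_integral_geometric_int[of \<theta>] \<theta> by (metis less_imp_le)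
  have \<theta>pow: "\<theta> ^ n = \<gamma> powr (- \<eta> * real n)" for n
    using \<gamma> \<theta> by (simp add: \<theta>_def powr_powr flip: powr_realpow)
  show ?thesis
  proof (rule that[of "Z / \<theta>"])
    fix W :: "int \<Rightarrow> real" and \<Phi> \<Lambda> M
    assume W: "\<And>k. 0 < W k" "\<And>k. \<gamma> * W k \<le> W (k + 1)" and \<Phi>: "\<And>k. 0 \<le> \<Phi> k" "\<And>k. \<Phi> k \<le> \<Lambda>"
      "\<And>k. \<Phi> k \<le> M * W k powr b"
    show "(\<integral>\<^sup>+k. ennreal (W k powr (- a) * \<Phi> k) \<partial>count_space UNIV)
        \<le> ennreal (Z / \<theta> * \<Lambda> powr (1 - a / b) * M powr (a / b))"
    proof (cases "\<Lambda> > 0 \<and> M > 0")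
      case False
      have "\<Phi> k = 0" for k
      proof -
        have "\<Phi> k \<le> 0"
        proof (cases "\<Lambda> > 0")
          case True
          then have "M * W k powr b \<le> 0"
            using False by (simp add: mult_nonpos_nonneg)
          then show ?thesis using \<Phi>(3)[of k] by simp
        next
          case False
          then show ?thesis using \<Phi>(2)[of k] by simp
        qed
        then show ?thesis using \<Phi>(1)[of k] by simp
      qed
      then show ?thesis by simp
    next
      case True
      \<comment> \<open>The level at which the bounds \<Lambda> and \<open>M * V powr b\<close> for
        \<Phi> coincide.\<close>
      define V where "V = (\<Lambda> / M) powr (1 / b)"
      have V: "0 < V" "V powr b = \<Lambda> / M"
        using True ab by (auto simp: V_def powr_powr)
      obtain k0 where k0: "W (k0 - 1) < V" "V \<le> W k0"
        using geometric_crossing[where W=W and \<gamma>=\<gamma> and V=V] W \<gamma> V(1) by blast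
      \<comment> \<open>The factor \<open>1 / \<theta>\<close> absorbs an off-by-one: below the
        crossing, \<open>W\<close> is compared with \<open>V\<close> at \<open>k0 - 1\<close>, one
        step short of the distance to \<open>k0\<close>.\<close>
      have one: "W k powr (- a) * \<Phi> k \<le> \<Lambda> * V powr (- a) / \<theta> * \<theta> ^ nat \<bar>k - k0\<bar>" for k
      proof (cases "k0 \<le> k")
        case True
        then obtain n where n: "k = k0 + int n"
          using zle_iff_zadd by blast
        have "\<gamma> ^ n * V \<le> W k"
        proof -
          have "\<gamma> ^ n * V \<le> \<gamma> ^ n * W k0"
            using \<gamma> k0 by (intro mult_left_mono) auto
          also have "\<dots> \<le> W k"
            using geometric_growth[of \<gamma> W n k0] W(2) \<gamma> n by simp
          finally show ?thesis .
        qed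
        then have "W k powr (- a) \<le> (\<gamma> ^ n * V) powr (- a)"
          using \<gamma> V ab by (intro powr_mono2') auto
        also have "\<dots> = \<gamma> powr (- a * real n) * V powr (- a)"
          using \<gamma> V by (simp add: powr_mult powr_powr mult.commute flip: powr_realpow)
        also have "\<dots> \<le> \<gamma> powr (- \<eta> * real n) * V powr (- a)"
          using \<gamma> \<eta> by (intro mult_right_mono powr_mono) (auto intro: mult_right_mono)
        finally have "W k powr (- a) \<le> \<theta> ^ n * V powr (- a)"
          by (simp add: \<theta>pow)
        then have "W k powr (- a) * \<Phi> k \<le> \<theta> ^ n * V powr (- a) * \<Lambda>"
          using \<Phi>[of k] \<theta> by (intro mult_mono) auto
        also have "\<dots> \<le> \<Lambda> * V powr (- a) / \<theta> * \<theta> ^ n"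
        proof -
          have "0 \<le> \<theta> ^ n * V powr (- a) * \<Lambda>"
            using \<theta> \<open>_ \<and> _\<close> by simp
          then have "\<theta> ^ n * V powr (- a) * \<Lambda> * \<theta> \<le> \<theta> ^ n * V powr (- a) * \<Lambda>"
            using \<theta> by (simp add: mult_left_le)
          then show ?thesis using \<theta> by (simp add: field_simps)
        qed
        finally show ?thesis using n by simp
      next
        case False
        then obtain n where n: "k0 - 1 = k + int n"
          using zle_iff_zadd[of k "k0 - 1"] by auto
        have "W k \<le> V / \<gamma> ^ n"
        proof -
          have "\<gamma> ^ n * W k \<le> W (k0 - 1)"
            using geometric_growth[of \<gamma> W n k] W(2) \<gamma> n by simp
          then show ?thesis using k0 \<gamma> by (simp add: field_simps)
        qed
        then have "W k powr (b - a) \<le> (V / \<gamma> ^ n) powr (b - a)"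
          using ab W(1)[of k] by (intro powr_mono2) auto
        also have "\<dots> = V powr (b - a) * \<gamma> powr (- (b - a) * real n)"
        proof -
          have "(V / \<gamma> ^ n) powr (b - a) = V powr (b - a) / (\<gamma> powr real n) powr (b - a)"
            using \<gamma> V by (simp add: powr_divide powr_realpow)
          also have "(\<gamma> powr real n) powr (b - a) = inverse (\<gamma> powr (- (b - a) * real n))"
          proof -
            have "- (b - a) * real n = - (real n * (b - a))" by (simp add: algebra_simps)
            then show ?thesis by (simp only: powr_powr powr_minus inverse_inverse_eq)
          qed
          finally show ?thesis by (simp add: divide_inverse)
        qed
        also have "\<dots> \<le> V powr (b - a) * \<gamma> powr (- \<eta> * real n)"
        proof -
          have "- (b - a) * real n \<le> - \<eta> * real n"
            using \<eta> by (intro mult_right_mono) auto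
          then show ?thesis using \<gamma> by (intro mult_left_mono powr_mono) auto
        qed
        finally have b1: "W k powr (b - a) \<le> V powr (b - a) * \<theta> ^ n"
          by (simp add: \<theta>pow)
        have "W k powr (- a) * \<Phi> k \<le> W k powr (- a) * (M * W k powr b)"
          using \<Phi>[of k] by (intro mult_left_mono) auto
        also have "\<dots> = M * W k powr (b - a)"
          by (simp add: powr_add[symmetric] algebra_simps)
        also have "\<dots> \<le> M * (V powr (b - a) * \<theta> ^ n)"
          using True by (intro mult_left_mono b1) auto
        also have "\<dots> = M * V powr b * V powr (- a) * \<theta> ^ n"
          using powr_add[of V b "- a"] by simp
        also have "\<dots> = \<Lambda> * V powr (- a) / \<theta> * \<theta> ^ (n + 1)"
          using True \<theta> V by simp
        also have "n + 1 = nat \<bar>k - k0\<bar>"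
          using n by simp
        finally show ?thesis .
      qed
      have "(\<integral>\<^sup>+k. ennreal (W k powr (- a) * \<Phi> k) \<partial>count_space UNIV)
          \<le> (\<integral>\<^sup>+k. ennreal (\<Lambda> * V powr (- a) / \<theta>) * ennreal (\<theta> ^ nat \<bar>k - k0\<bar>) \<partial>count_space UNIV)"
        using one True \<theta> by (intro nn_integral_mono) (auto simp: simp flip: ennreal_mult intro!: ennreal_leI)
      also have "\<dots> \<le> ennreal (\<Lambda> * V powr (- a) / \<theta>) * ennreal Z"
        by (simp add: nn_integral_cmult) (intro mult_left_mono Z, simp)
      also have "\<dots> = ennreal (Z / \<theta> * \<Lambda> powr (1 - a / b) * M powr (a / b))"
      proof -
        have "V powr (- a) = \<Lambda> powr (- a / b) * M powr (a / b)"
          using True by (simp add: V_def powr_powr powr_divide powr_minus_divide)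
        moreover have "\<Lambda> powr (1 - a / b) = \<Lambda> * \<Lambda> powr (- a / b)"
          using True powr_add[of \<Lambda> 1 "- a / b"] by simp
        ultimately have "\<Lambda> * V powr (- a) / \<theta> * Z = Z / \<theta> * \<Lambda> powr (1 - a / b) * M powr (a / b)"
          by simp
        then show ?thesis using Z \<theta> True by (simp flip: ennreal_mult)
      qed
      finally show ?thesis .
    qed
  qed (use Z \<theta> in simp)
qed

section \<open>Hedberg's inequality over dyadic balls\<close>

definition dyad :: "int \<Rightarrow> real" where
  "dyad k = 2 powr real_of_int k"

lemma dyad_pos [simp]: "0 < dyad k"
  by (simp add: dyad_def)

lemma dyad_nonneg [simp]: "0 \<le> dyad k"
  by (simp add: dyad_def)

lemma dyad_Suc: "dyad (k + 1) = 2 * dyad k"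
  by (simp add: dyad_def powr_add)

lemma bvol_nonneg [simp]: "0 \<le> bvol v c r"
  by (simp add: bvol_def)

text \<open>The growth bound on \<Phi> is not assumed at the centre \<open>x\<close>: it is only
  given on a set \<open>E\<close> that carries a fixed share of w(B), through the majorant
  \<open>H\<close>. The \<open>w\<close>-maximal function of \<open>H powr (p / 2)\<close>
  transports it to \<open>x\<close>, after which \<open>Hedberg_sum\<close> applies with
  \<open>W k\<close> the weighted volume of the dyadic ball. The power \<open>p / 2\<close> leads to
  the maximal theorem on L^2, so \<open>p \<le> 1\<close> is allowed. The parameter \<rho> covers
  both the plain sum (\<rho> = 1) and a sum of \<open>q\<close>-th powers.\<close>

proposition fractional_sum_bound:
  fixes w :: "'a::euclidean_space \<Rightarrow> real"
  assumes w: "A_inf w" and pq: "0 < p" "p < q" and \<rho>: "0 < \<rho>" and c: "0 < c"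
  obtains C where "0 < C" "\<And>\<Phi> \<Lambda> H. H \<in> borel_measurable borel \<Longrightarrow>
    (\<And>x r. 0 < r \<Longrightarrow> 0 \<le> \<Phi> x r) \<Longrightarrow> (\<And>x r. 0 < r \<Longrightarrow> \<Phi> x r \<le> \<Lambda>) \<Longrightarrow>
    (\<And>x r. 0 < r \<Longrightarrow> \<exists>E. E \<in> sets borel \<and> E \<subseteq> ball x r \<and> c * bvol w x r \<le> measure (wm w) E \<and>
       (\<forall>y\<in>E. ennreal (bvol w x r powr (- 1 / p) * \<Phi> x r) \<le> H y)) \<Longrightarrow>
    (\<integral>\<^sup>+x. ennpowr (\<integral>\<^sup>+k. ennreal ((bvol w x (dyad k) powr (- 1 / q) * \<Phi> x (dyad k)) powr \<rho>)
        \<partial>count_space UNIV) (q / \<rho>) \<partial>wm w)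
      \<le> ennreal (C * \<Lambda> powr (q - p)) * (\<integral>\<^sup>+x. ennpowr (H x) p \<partial>wm w)"
proof -
  note adm = A_inf_adm[OF w]
  note [measurable] = adm_weight_measurable[OF adm]
  obtain K where K: "0 < K" "doubling_measure K (wm w)"
    by (rule A_inf_doubling[OF w])
  obtain \<gamma> where \<gamma>: "1 < \<gamma>" "\<And>c r. 0 < r \<Longrightarrow> \<gamma> * bvol w c r \<le> bvol w c (2 * r)"
    using A_inf_reverse_doubling[OF w] by blast
  have "0 \<le> K" and two: "(1::real) < 2" using K by simp_all
  obtain C1 where C1: "0 < C1" "\<And>(\<mu> :: 'a measure) h. doubling_measure K \<mu> \<Longrightarrow> sigma_finite_measure \<mu> \<Longrightarrow>
    h \<in> borel_measurable borel \<Longrightarrow>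
    (\<integral>\<^sup>+x. ennpowr (maxfun \<mu> h x) 2 \<partial>\<mu>) \<le> ennreal C1 * (\<integral>\<^sup>+x. ennpowr (h x) 2 \<partial>\<mu>)"
    by (rule maxfun_strong_type[OF \<open>0 \<le> K\<close> two, where 'a='a]) (blast intro: that)
  \<comment> \<open>Chosen so that the exponent \<open>a / b = p / q\<close> in
    \<open>Hedberg_sum\<close>, after the outer power \<open>q / \<rho>\<close>, yields
    \<open>\<Lambda> powr (q - p)\<close> and the square of the maximal function.\<close>
  define a where "a = \<rho> / q"
  define b where "b = \<rho> / p"
  have ab: "0 < a" "a < b" "a / b = p / q"
    using pq \<rho> by (auto simp: a_def b_def field_simps)
  obtain C0 where C0: "0 < C0" "\<And>(W :: int \<Rightarrow> real) \<Phi> \<Lambda> M.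
    (\<And>k. 0 < W k) \<Longrightarrow> (\<And>k. \<gamma> * W k \<le> W (k + 1)) \<Longrightarrow> (\<And>k. 0 \<le> \<Phi> k) \<Longrightarrow> (\<And>k. \<Phi> k \<le> \<Lambda>) \<Longrightarrow>
    (\<And>k. \<Phi> k \<le> M * W k powr b) \<Longrightarrow>
    (\<integral>\<^sup>+k. ennreal (W k powr (- a) * \<Phi> k) \<partial>count_space UNIV) \<le> ennreal (C0 * \<Lambda> powr (1 - a / b) * M powr (a / b))"
    by (rule Hedberg_sum[OF \<gamma>(1) ab(1,2)]) (blast intro: that)
  define C2 where "C2 = C0 powr (q / \<rho>) * (1 / c) powr 2"
  have C2: "0 < C2" using C0 c by (simp add: C2_def)
  show ?thesis
  proof (rule that[of "C2 * C1"])
    fix \<Phi> \<Lambda> H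
    assume [measurable]: "H \<in> borel_measurable borel"
      and \<Phi>: "\<And>x r. 0 < r \<Longrightarrow> 0 \<le> \<Phi> x r" "\<And>x r. 0 < r \<Longrightarrow> \<Phi> x r \<le> \<Lambda>"
      and E: "\<And>x r. 0 < r \<Longrightarrow> \<exists>E. E \<in> sets borel \<and> E \<subseteq> ball x r \<and> c * bvol w x r \<le> measure (wm w) E \<and>
       (\<forall>y\<in>E. ennreal (bvol w x r powr (- 1 / p) * \<Phi> x r) \<le> H y)"
    let ?h = "\<lambda>x. ennpowr (H x) (p / 2)"
    let ?M = "maxfun (wm w) ?h"
    let ?S = "\<lambda>x. \<integral>\<^sup>+k. ennreal ((bvol w x (dyad k) powr (- 1 / q) * \<Phi> x (dyad k)) powr \<rho>) \<partial>count_space UNIV"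
    show "(\<integral>\<^sup>+x. ennpowr (?S x) (q / \<rho>) \<partial>wm w)
      \<le> ennreal (C2 * C1 * \<Lambda> powr (q - p)) * (\<integral>\<^sup>+x. ennpowr (H x) p \<partial>wm w)"
    proof (cases "0 < \<Lambda>")
      case False
      then have "\<Phi> x r = 0" if "0 < r" for x r
        using \<Phi>[OF that, of x] by simp
      then show ?thesis by simp
    next
      case True
      \<comment> \<open>The mean over the ball is at least the contribution of \<open>E\<close>,
        where the integrand is bounded below and whose share of the measure is
        \<open>c\<close>.\<close>
      have low: "ennreal (c * (bvol w x r powr (- 1 / p) * \<Phi> x r) powr (p / 2)) \<le> ?M x" if r: "0 < r" for x r
      proof -
        obtain E where E: "E \<in> sets borel" "E \<subseteq> ball x r" "c * bvol w x r \<le> measure (wm w) E"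
          "\<And>y. y \<in> E \<Longrightarrow> ennreal (bvol w x r powr (- 1 / p) * \<Phi> x r) \<le> H y"
          using E[OF r, of x] by blast
        note [measurable] = E(1)
        let ?t = "(bvol w x r powr (- 1 / p) * \<Phi> x r) powr (p / 2)"
        have W: "0 < bvol w x r" by (rule bvol_pos[OF adm r])
        have "ennreal (c * ?t) * ennreal (bvol w x r) = ennreal ?t * ennreal (c * bvol w x r)"
          using c by (simp add: ac_simps flip: ennreal_mult)
        also have "\<dots> \<le> ennreal ?t * emeasure (wm w) E"
          using E(3) by (intro mult_left_mono) (auto simp: adm_weight_emeasure[OF adm E(2)] intro: ennreal_leI)
        also have "\<dots> = (\<integral>\<^sup>+y. ennreal ?t * indicator E y \<partial>wm w)"
          by (simp add: nn_integral_cmult_indicator)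
        also have "\<dots> \<le> (\<integral>\<^sup>+y. ?h y * indicator (ball x r) y \<partial>wm w)"
        proof (intro nn_integral_mono)
          fix y
          show "ennreal ?t * indicator E y \<le> ?h y * indicator (ball x r) y"
          proof (cases "y \<in> E")
            case True
            have "ennreal ?t = ennpowr (ennreal (bvol w x r powr (- 1 / p) * \<Phi> x r)) (p / 2)"
              using \<Phi>[OF r, of x] by (simp add: ennpowr_ennreal)
            also have "\<dots> \<le> ?h y"
              using E(4)[OF True] pq by (intro ennpowr_mono) auto
            finally show ?thesis using True E(2) by (auto split: split_indicator)
          qed simp
        qed
        finally have "ennreal (c * ?t) * ennreal (bvol w x r) / ennreal (bvol w x r) \<le> ball_mean (wm w) ?h x r"
          unfolding ball_mean_def emeasure_ball_bvol[OF adm] by (rule divide_right_mono_ennreal)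
        then have "ennreal (c * ?t) \<le> ball_mean (wm w) ?h x r"
          using W by (simp add: mult_divide_eq_ennreal)
        also have "\<dots> \<le> ?M x"
          using r by (intro ball_mean_le_maxfun) auto
        finally show ?thesis .
      qed
      have pt: "ennpowr (?S x) (q / \<rho>) \<le> ennreal (C2 * \<Lambda> powr (q - p)) * ennpowr (?M x) 2" for x
      proof (cases "?M x")
        case top
        then show ?thesis
          using C2 True by (simp add: ennreal_mult_top)
      next
        case (real m)
        let ?W = "\<lambda>k. bvol w x (dyad k)"
        let ?F = "\<lambda>k. \<Phi> x (dyad k)"
        have W: "0 < ?W k" for k
          by (rule bvol_pos[OF adm]) simp
        \<comment> \<open>The maximal bound \<open>m\<close> at \<open>x\<close>, raised to the
          power \<open>2 * \<rho> / p\<close>, becomes the growth bound on \<Phi>^\<rho> with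
          exponent \<open>b\<close>.\<close>
        have key: "?F k powr \<rho> \<le> (m / c) powr (2 * \<rho> / p) * ?W k powr b" for k
        proof -
          let ?u = "?W k powr (- 1 / p) * ?F k"
          have F0: "0 \<le> ?F k" using \<Phi> by simp
          have "c * ?u powr (p / 2) \<le> m"
            using low[of "dyad k" x] real by (simp add: ennreal_le_iff)
          then have "?u powr (p / 2) \<le> m / c"
            using c by (simp add: field_simps)
          then have "(?u powr (p / 2)) powr (2 * \<rho> / p) \<le> (m / c) powr (2 * \<rho> / p)"
            using pq \<rho> by (intro powr_mono2) auto
          then have "?u powr \<rho> \<le> (m / c) powr (2 * \<rho> / p)"
            using pq by (simp add: powr_powr)
          then have "?u powr \<rho> * ?W k powr b \<le> (m / c) powr (2 * \<rho> / p) * ?W k powr b"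
            by (intro mult_right_mono) auto
          moreover have "?u powr \<rho> * ?W k powr b = ?F k powr \<rho>"
          proof -
            have "?W k powr (- 1 / p * \<rho>) * ?W k powr b = ?W k powr 0"
              using pq by (simp add: b_def flip: powr_add)
            then have "?W k powr (- 1 / p * \<rho>) * ?W k powr b = 1"
              using W[of k] by simp
            then have "?F k powr \<rho> * (?W k powr (- 1 / p * \<rho>) * ?W k powr b) = ?F k powr \<rho>"
              by simp
            then show ?thesis
              using F0 by (simp add: powr_mult powr_powr ac_simps)
          qed
          ultimately show ?thesis by simp
        qed
        have "?S x = (\<integral>\<^sup>+k. ennreal (?W k powr (- a) * ?F k powr \<rho>) \<partial>count_space UNIV)"
          using \<Phi> pq by (intro nn_integral_cong) (simp add: powr_mult powr_powr a_def)
        also have "\<dots> \<le> ennreal (C0 * (\<Lambda> powr \<rho>) powr (1 - a / b) * ((m / c) powr (2 * \<rho> / p)) powr (a / b))"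
        proof (rule C0(2))
          fix k
          show "0 < ?W k" by (rule W)
          show "\<gamma> * ?W k \<le> ?W (k + 1)"
            unfolding dyad_Suc by (rule \<gamma>) simp
          show "0 \<le> ?F k powr \<rho>" by simp
          show "?F k powr \<rho> \<le> \<Lambda> powr \<rho>"
            using \<Phi> \<rho> by (intro powr_mono2) auto
          show "?F k powr \<rho> \<le> (m / c) powr (2 * \<rho> / p) * ?W k powr b" by (rule key)
        qed
        finally have "ennpowr (?S x) (q / \<rho>)
            \<le> ennpowr (ennreal (C0 * (\<Lambda> powr \<rho>) powr (1 - a / b) * ((m / c) powr (2 * \<rho> / p)) powr (a / b))) (q / \<rho>)"
          using pq \<rho> by (intro ennpowr_mono) auto
        also have "\<dots> = ennreal (C2 * \<Lambda> powr (q - p) * m powr 2)"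
        proof -
          have "((\<Lambda> powr \<rho>) powr (1 - a / b)) powr (q / \<rho>) = \<Lambda> powr (q - p)"
          proof -
            have "\<rho> * (1 - p / q) * (q / \<rho>) = (1 - p / q) * q"
              using \<rho> by simp
            also have "\<dots> = q - p"
              using pq by (simp add: left_diff_distrib)
            finally show ?thesis by (simp only: powr_powr ab(3))
          qed
          moreover have "(((m / c) powr (2 * \<rho> / p)) powr (a / b)) powr (q / \<rho>) = (1 / c) powr 2 * m powr 2"
            using pq \<rho> real c by (simp add: powr_powr ab(3) powr_divide)
          ultimately show ?thesis
            using C0 by (simp add: ennpowr_ennreal powr_mult C2_def mult_ac)
        qed
        also have "\<dots> = ennreal (C2 * \<Lambda> powr (q - p)) * ennpowr (?M x) 2"
          using real C2 by (simp add: ennpowr_ennreal ennreal_mult)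
        finally show ?thesis .
      qed
      have "(\<integral>\<^sup>+x. ennpowr (?S x) (q / \<rho>) \<partial>wm w) \<le> (\<integral>\<^sup>+x. ennreal (C2 * \<Lambda> powr (q - p)) * ennpowr (?M x) 2 \<partial>wm w)"
        by (intro nn_integral_mono pt)
      also have "\<dots> = ennreal (C2 * \<Lambda> powr (q - p)) * (\<integral>\<^sup>+x. ennpowr (?M x) 2 \<partial>wm w)"
        by (intro nn_integral_cmult) measurable
      also have "\<dots> \<le> ennreal (C2 * \<Lambda> powr (q - p)) * (ennreal C1 * (\<integral>\<^sup>+x. ennpowr (?h x) 2 \<partial>wm w))"
        by (intro mult_left_mono C1 K sigma_finite_wm adm) auto
      also have "\<dots> = ennreal (C2 * C1 * \<Lambda> powr (q - p)) * (\<integral>\<^sup>+x. ennpowr (H x) p \<partial>wm w)"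
        using C1 C2 by (simp add: ennpowr_ennpowr ennreal_mult ac_simps)
      finally show ?thesis .
    qed
  qed (use C1 C2 in simp)
qed


section \<open>Averages with respect to a dual weight\<close>

definition loc_int :: "('a::euclidean_space \<Rightarrow> real) \<Rightarrow> bool" where
  "loc_int f \<longleftrightarrow> f \<in> borel_measurable borel \<and> (\<forall>x. 0 \<le> f x) \<and> (\<forall>c r. emeasure (wm f) (ball c r) < top)"

lemma loc_intD:
  assumes "loc_int f"
  shows loc_int_measurable: "f \<in> borel_measurable borel" and loc_int_nonneg: "0 \<le> f x"
    and loc_int_emeasure: "emeasure (wm f) (ball c r) = ennreal (bvol f c r)"
proof -
  show "f \<in> borel_measurable borel" "0 \<le> f x"
    using assms by (auto simp: loc_int_def)
  have "emeasure (wm f) (ball c r) < top"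
    using assms by (auto simp: loc_int_def)
  then show "emeasure (wm f) (ball c r) = ennreal (bvol f c r)"
    unfolding bvol_def by (intro emeasure_eq_ennreal_measure) auto
qed

text \<open>For \<open>f = h \<sigma>\<close> this is \<open>\<sigma>(B)\<^bsup>1/P\<^esup>\<close> times the \<open>\<sigma>\<close>-mean of \<open>h\<close> over the ball \<open>B\<close>.\<close>

definition normalized_mean :: "real \<Rightarrow> ('a::euclidean_space \<Rightarrow> real) \<Rightarrow> ('a \<Rightarrow> real) \<Rightarrow> 'a \<Rightarrow> real \<Rightarrow> real" where
  "normalized_mean P \<sigma> f x r = bvol \<sigma> x r powr (1 / P - 1) * bvol f x r"

text \<open>For the dual weight \<sigma> = w^(1 - P') one has \<sigma>^(1 - P) = w, so this is the
  \<open>P\<close>-th power of the norm of \<open>f\<close> in the space with weight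
  \<open>w\<close>. It also equals the integral of (f / \<sigma>)^P with respect to \<sigma>, the
  form to which the maximal theorem for \<sigma> applies.\<close>

definition wpow :: "real \<Rightarrow> ('a::euclidean_space \<Rightarrow> real) \<Rightarrow> ('a \<Rightarrow> real) \<Rightarrow> ennreal" where
  "wpow P \<sigma> f = (\<integral>\<^sup>+x. ennreal (f x powr P * \<sigma> x powr (1 - P)) \<partial>lborel)"

lemma wpow_eq_density:
  assumes \<sigma>: "adm_weight \<sigma>" and f: "loc_int f"
  shows "wpow P \<sigma> f = (\<integral>\<^sup>+x. ennpowr (ennreal (f x / \<sigma> x)) P \<partial>wm \<sigma>)"
proof -
  note [measurable] = adm_weight_measurable[OF \<sigma>] loc_int_measurable[OF f]
  have "ennreal (f x powr P * \<sigma> x powr (1 - P)) = ennreal (\<sigma> x) * ennpowr (ennreal (f x / \<sigma> x)) P" for x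
  proof -
    have p: "0 < \<sigma> x" "0 \<le> f x" using adm_weight_pos[OF \<sigma>] loc_int_nonneg[OF f] by auto
    have "\<sigma> x powr (1 - P) = \<sigma> x / \<sigma> x powr P"
      using p by (simp add: powr_diff)
    then have "f x powr P * \<sigma> x powr (1 - P) = \<sigma> x * (f x / \<sigma> x) powr P"
      using p by (simp add: powr_divide)
    then show ?thesis
      using p by (simp add: ennpowr_ennreal flip: ennreal_mult)
  qed
  then show ?thesis
    unfolding wpow_def by (subst nn_integral_wm) measurable
qed

lemma normalized_mean_nonneg [simp]: "0 \<le> normalized_mean P \<sigma> f x r"
  by (simp add: normalized_mean_def)

text \<open>Hoelder's inequality on the ball produces \<sigma>(B)^(1 - 1/P), which the normalisation
  cancels. This supplies the uniform bound \<Lambda> for the Hedberg argument.\<close>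

lemma normalized_mean_le:
  assumes \<sigma>: "adm_weight \<sigma>" and f: "loc_int f" and P: "1 < P" and r: "0 < r"
  shows "ennreal (normalized_mean P \<sigma> f x r) \<le> ennpowr (wpow P \<sigma> f) (1 / P)"
proof -
  note [measurable] = adm_weight_measurable[OF \<sigma>] loc_int_measurable[OF f]
  let ?B = "ball x r"
  have \<sigma>p: "0 < \<sigma> y" "0 \<le> f y" for y using adm_weight_pos[OF \<sigma>] loc_int_nonneg[OF f] by auto
  have b: "0 < bvol \<sigma> x r" by (rule bvol_pos[OF \<sigma> r])
  have "ennreal (bvol f x r) = (\<integral>\<^sup>+y\<in>?B. ennreal (f y) \<partial>lborel)"
    by (simp add: emeasure_wm flip: loc_int_emeasure[OF f])
  also have "\<dots> = (\<integral>\<^sup>+y. ennpowr (ennreal (f y powr P * \<sigma> y powr (1 - P))) (1 / P) *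
      ennpowr (ennreal (\<sigma> y) * indicator ?B y) (1 - 1 / P) \<partial>lborel)"
  proof (intro nn_integral_cong)
    fix y
    have "(f y powr P * \<sigma> y powr (1 - P)) powr (1 / P) * \<sigma> y powr (1 - 1 / P)
        = f y * (\<sigma> y powr ((1 - P) * (1 / P)) * \<sigma> y powr (1 - 1 / P))"
      using P \<sigma>p[of y] by (simp add: powr_mult powr_powr)
    also have "\<sigma> y powr ((1 - P) * (1 / P)) * \<sigma> y powr (1 - 1 / P) = 1"
    proof -
      have "(1 - P) * (1 / P) + (1 - 1 / P) = 0"
        using P by (simp add: field_simps)
      then show ?thesis using \<sigma>p[of y] by (simp only: powr_add[symmetric]) simp
    qed
    finally have "f y = (f y powr P * \<sigma> y powr (1 - P)) powr (1 / P) * \<sigma> y powr (1 - 1 / P)"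
      by simp
    then show "ennreal (f y) * indicator ?B y = ennpowr (ennreal (f y powr P * \<sigma> y powr (1 - P))) (1 / P) *
      ennpowr (ennreal (\<sigma> y) * indicator ?B y) (1 - 1 / P)"
      using \<sigma>p[of y] by (auto simp: ennpowr_ennreal less_imp_le simp flip: ennreal_mult split: split_indicator)
  qed
  also have "\<dots> \<le> ennpowr (wpow P \<sigma> f) (1 / P) * ennpowr (\<integral>\<^sup>+y\<in>?B. ennreal (\<sigma> y) \<partial>lborel) (1 - 1 / P)"
    unfolding wpow_def using P by (intro nn_integral_Holder) auto
  also have "(\<integral>\<^sup>+y\<in>?B. ennreal (\<sigma> y) \<partial>lborel) = ennreal (bvol \<sigma> x r)"
    by (simp add: emeasure_wm flip: emeasure_ball_bvol[OF \<sigma>])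
  finally have 1: "ennreal (bvol f x r) \<le> ennpowr (wpow P \<sigma> f) (1 / P) * ennreal (bvol \<sigma> x r powr (1 - 1 / P))"
    by (simp add: ennpowr_ennreal)
  have "ennreal (normalized_mean P \<sigma> f x r) = ennreal (bvol \<sigma> x r powr (1 / P - 1)) * ennreal (bvol f x r)"
    by (simp add: normalized_mean_def ennreal_mult)
  also have "\<dots> \<le> ennreal (bvol \<sigma> x r powr (1 / P - 1)) * (ennpowr (wpow P \<sigma> f) (1 / P) * ennreal (bvol \<sigma> x r powr (1 - 1 / P)))"
    by (intro mult_left_mono 1) auto
  also have "\<dots> = ennpowr (wpow P \<sigma> f) (1 / P) * ennreal (bvol \<sigma> x r powr (1 / P - 1) * bvol \<sigma> x r powr (1 - 1 / P))"
    by (simp add: ennreal_mult ac_simps)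
  also have "bvol \<sigma> x r powr (1 / P - 1) * bvol \<sigma> x r powr (1 - 1 / P) = 1"
    using b by (simp flip: powr_add)
  finally show ?thesis by simp
qed

text \<open>This moves a \<sigma>-average to the measure \<open>w\<close>. The maximal function of
  \<open>f / \<sigma>\<close> for \<sigma> bounds the average at all points of the ball, and at the
  points where \<sigma> / \<sigma>(B) \<ge> \<kappa> w / w(B) the ratio of the two volumes can be
  replaced by the ratio of the two densities. By \<open>A_inf_compare\<close> these points fill the
  ball up to the proportion \<epsilon>.\<close>

proposition normalized_mean_majorant:
  fixes \<sigma> w :: "'a::euclidean_space \<Rightarrow> real"
  assumes \<sigma>: "A_inf \<sigma>" and w: "adm_weight w" and P: "1 < P" and \<epsilon>: "0 < \<epsilon>"
  shows "\<exists>C>0. \<forall>f. loc_int f \<longrightarrow> (\<exists>h. h \<in> borel_measurable borel \<and>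
     (\<integral>\<^sup>+x. ennpowr (h x) P \<partial>wm w) \<le> ennreal C * wpow P \<sigma> f \<and>
     (\<forall>x r. 0 < r \<longrightarrow> (\<exists>E. E \<in> sets borel \<and> E \<subseteq> ball x r \<and>
        measure lborel (ball x r - E) \<le> \<epsilon> * measure lborel (ball x r) \<and>
        (\<forall>y\<in>E. ennreal (bvol w x r powr (- 1 / P) * normalized_mean P \<sigma> f x r) \<le> h y))))"
proof -
  note adm = A_inf_adm[OF \<sigma>]
  note [measurable] = adm_weight_measurable[OF adm] adm_weight_measurable[OF w]
  obtain K where K: "0 < K" "doubling_measure K (wm \<sigma>)"
    by (rule A_inf_doubling[OF \<sigma>])
  have K0: "0 \<le> K" using K by simp
  obtain C1 where C1: "0 < C1" "\<And>(\<mu> :: 'a measure) h. doubling_measure K \<mu> \<Longrightarrow> sigma_finite_measure \<mu> \<Longrightarrow>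
    h \<in> borel_measurable borel \<Longrightarrow>
    (\<integral>\<^sup>+x. ennpowr (maxfun \<mu> h x) P \<partial>\<mu>) \<le> ennreal C1 * (\<integral>\<^sup>+x. ennpowr (h x) P \<partial>\<mu>)"
    by (rule maxfun_strong_type[OF K0 P, where 'a='a]) (blast intro: that)
  obtain \<kappa> where \<kappa>: "0 < \<kappa>" "\<And>c r. 0 < r \<Longrightarrow>
    measure lborel {y \<in> ball c r. \<sigma> y * bvol w c r < \<kappa> * bvol \<sigma> c r * w y} < \<epsilon> * measure lborel (ball c r)"
    by (rule A_inf_compare[OF \<sigma> w \<epsilon>]) (blast intro: that)
  show ?thesis
  proof (intro exI[of _ "1 / \<kappa> * C1"] conjI allI impI)
    show "0 < 1 / \<kappa> * C1" using C1 \<kappa> by simp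
    fix f :: "'a \<Rightarrow> real" assume f: "loc_int f"
    note [measurable] = loc_int_measurable[OF f]
    let ?g = "\<lambda>y. ennreal (f y / \<sigma> y)"
    let ?M = "maxfun (wm \<sigma>) ?g"
    \<comment> \<open>The factor is made so that \<open>h powr P\<close> times \<open>w\<close>
      equals 1 / \<kappa> times the \<open>P\<close>-th power of the maximal function times
      \<sigma>: the norm of \<open>h\<close> for \<open>w\<close> is a norm for \<sigma>.\<close>
    define h where "h y = ennreal ((1 / \<kappa> * (\<sigma> y / w y)) powr (1 / P)) * ?M y" for y
    have [measurable]: "h \<in> borel_measurable borel"
      unfolding h_def by measurable
    have pos: "0 < \<sigma> y" "0 < w y" "0 \<le> f y" for y
      using adm_weight_pos[OF adm] adm_weight_pos[OF w] loc_int_nonneg[OF f] by auto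
    show "\<exists>h. h \<in> borel_measurable borel \<and>
     (\<integral>\<^sup>+x. ennpowr (h x) P \<partial>wm w) \<le> ennreal (1 / \<kappa> * C1) * wpow P \<sigma> f \<and>
     (\<forall>x r. 0 < r \<longrightarrow> (\<exists>E. E \<in> sets borel \<and> E \<subseteq> ball x r \<and>
        measure lborel (ball x r - E) \<le> \<epsilon> * measure lborel (ball x r) \<and>
        (\<forall>y\<in>E. ennreal (bvol w x r powr (- 1 / P) * normalized_mean P \<sigma> f x r) \<le> h y)))"
    proof (intro exI[of _ h] conjI allI impI)
      show "h \<in> borel_measurable borel" by fact
      have "(\<integral>\<^sup>+x. ennpowr (h x) P \<partial>wm w) = (\<integral>\<^sup>+x. ennreal (w x) * ennpowr (h x) P \<partial>lborel)"
        by (intro nn_integral_wm) measurable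
      also have "\<dots> = (\<integral>\<^sup>+x. ennreal (1 / \<kappa>) * (ennreal (\<sigma> x) * ennpowr (?M x) P) \<partial>lborel)"
      proof (intro nn_integral_cong)
        fix x
        have "ennpowr (ennreal ((1 / \<kappa> * (\<sigma> x / w x)) powr (1 / P))) P = ennreal (1 / \<kappa> * (\<sigma> x / w x))"
          using P \<kappa> pos[of x] by (simp add: ennpowr_ennreal powr_powr)
        then have "ennreal (w x) * ennpowr (h x) P = ennreal (w x) * ennreal (1 / \<kappa> * (\<sigma> x / w x)) * ennpowr (?M x) P"
          by (simp add: h_def ennpowr_mult mult.assoc)
        also have "ennreal (w x) * ennreal (1 / \<kappa> * (\<sigma> x / w x)) = ennreal (1 / \<kappa>) * ennreal (\<sigma> x)"
          using pos[of x] \<kappa> by (simp flip: ennreal_mult)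
        finally show "ennreal (w x) * ennpowr (h x) P = ennreal (1 / \<kappa>) * (ennreal (\<sigma> x) * ennpowr (?M x) P)"
          by (simp add: mult.assoc)
      qed
      also have "\<dots> = ennreal (1 / \<kappa>) * (\<integral>\<^sup>+x. ennreal (\<sigma> x) * ennpowr (?M x) P \<partial>lborel)"
        by (intro nn_integral_cmult) measurable
      also have "\<dots> = ennreal (1 / \<kappa>) * (\<integral>\<^sup>+x. ennpowr (?M x) P \<partial>wm \<sigma>)"
        by (subst nn_integral_wm) measurable
      also have "\<dots> \<le> ennreal (1 / \<kappa>) * (ennreal C1 * (\<integral>\<^sup>+x. ennpowr (?g x) P \<partial>wm \<sigma>))"
        by (intro mult_left_mono C1 K sigma_finite_wm adm) auto
      also have "\<dots> = ennreal (1 / \<kappa> * C1) * wpow P \<sigma> f"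
      proof -
        have "ennreal (1 / \<kappa> * C1) = ennreal (1 / \<kappa>) * ennreal C1"
          using C1 \<kappa> by (intro ennreal_mult) auto
        then show ?thesis
          by (simp only: wpow_eq_density[OF adm f] mult.assoc)
      qed
      finally show "(\<integral>\<^sup>+x. ennpowr (h x) P \<partial>wm w) \<le> ennreal (1 / \<kappa> * C1) * wpow P \<sigma> f" .
    next
      fix x :: 'a and r :: real assume r: "0 < r"
      \<comment> \<open>The exceptional part of the ball, where \<sigma> is too small compared with
        \<open>w\<close>.\<close>
      define D where "D = {y \<in> ball x r. \<sigma> y * bvol w x r < \<kappa> * bvol \<sigma> x r * w y}"
      have [measurable]: "D \<in> sets borel" unfolding D_def by measurable
      have b: "0 < bvol \<sigma> x r" "0 < bvol w x r"
        using r adm w by (auto intro: bvol_pos)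
      show "\<exists>E. E \<in> sets borel \<and> E \<subseteq> ball x r \<and>
        measure lborel (ball x r - E) \<le> \<epsilon> * measure lborel (ball x r) \<and>
        (\<forall>y\<in>E. ennreal (bvol w x r powr (- 1 / P) * normalized_mean P \<sigma> f x r) \<le> h y)"
      proof (intro exI[of _ "ball x r - D"] conjI ballI)
        show "ball x r - D \<in> sets borel" by measurable
        have "ball x r - (ball x r - D) = D" by (auto simp: D_def)
        then show "measure lborel (ball x r - (ball x r - D)) \<le> \<epsilon> * measure lborel (ball x r)"
          using \<kappa>(2)[OF r, of x] by (simp add: D_def)
        fix y assume y: "y \<in> ball x r - D"
        then have le: "\<kappa> * bvol \<sigma> x r * w y \<le> \<sigma> y * bvol w x r"
          by (auto simp: D_def)
        then have "bvol \<sigma> x r / bvol w x r \<le> 1 / \<kappa> * (\<sigma> y / w y)"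
          using b pos[of y] \<kappa> by (simp add: field_simps)
        then have 1: "(bvol \<sigma> x r / bvol w x r) powr (1 / P) \<le> (1 / \<kappa> * (\<sigma> y / w y)) powr (1 / P)"
          using P b by (intro powr_mono2) auto
        have "(\<integral>\<^sup>+y\<in>ball x r. ?g y \<partial>wm \<sigma>) = (\<integral>\<^sup>+y\<in>ball x r. ennreal (f y) \<partial>lborel)"
        proof -
          have "ennreal (\<sigma> y) * ?g y = ennreal (f y)" for y
            using pos[of y] by (simp add: less_imp_le flip: ennreal_mult)
          then show ?thesis by (subst nn_integral_wm) (auto simp flip: mult.assoc)
        qed
        also have "\<dots> = ennreal (bvol f x r)"
          by (simp add: emeasure_wm flip: loc_int_emeasure[OF f])
        finally have "ennreal (bvol f x r / bvol \<sigma> x r) = ball_mean (wm \<sigma>) ?g x r"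
          using b by (simp add: ball_mean_def emeasure_ball_bvol[OF adm] divide_ennreal)
        also have "\<dots> \<le> ?M y"
          using y r by (intro ball_mean_le_maxfun) auto
        finally have 2: "ennreal (bvol f x r / bvol \<sigma> x r) \<le> ?M y" .
        \<comment> \<open>The left side separates into (\<sigma>(B) / w(B))^(1/P) and the
          \<sigma>-mean of \<open>f / \<sigma>\<close>, which are bounded by the two factors of
          \<open>h\<close>.\<close>
        have "bvol w x r powr (- 1 / P) * normalized_mean P \<sigma> f x r
            = (bvol \<sigma> x r / bvol w x r) powr (1 / P) * (bvol f x r / bvol \<sigma> x r)"
          using b by (simp add: normalized_mean_def powr_divide powr_minus_divide powr_diff)
        then have "ennreal (bvol w x r powr (- 1 / P) * normalized_mean P \<sigma> f x r)
            = ennreal ((bvol \<sigma> x r / bvol w x r) powr (1 / P)) * ennreal (bvol f x r / bvol \<sigma> x r)"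
          by (simp only: ennreal_mult powr_ge_zero divide_nonneg_nonneg bvol_nonneg)
        also have "\<dots> \<le> h y"
          unfolding h_def by (intro mult_mono 2 ennreal_leI 1) auto
        finally show "ennreal (bvol w x r powr (- 1 / P) * normalized_mean P \<sigma> f x r) \<le> h y" .
      qed auto
    qed
  qed
qed

text \<open>The two normalised means have the majorants \<open>h1\<close> and \<open>h2\<close>;
  their product is a majorant on the intersection of the good sets, and Hoelder's inequality puts it
  in L^p of \<open>w\<close>, also when \<open>p \<le> 1\<close>. The numbers \<open>nf\<close> and
  \<open>ng\<close> are real upper bounds for the norms, so infinite norms do not enter
  here.\<close>

proposition bilinear_fractional_sum:
  fixes w \<sigma>1 \<sigma>2 :: "'a::euclidean_space \<Rightarrow> real"
  assumes A: "A_inf w" "A_inf \<sigma>1" "A_inf \<sigma>2" and P: "1 < P1" "1 < P2"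
    and p: "1 / p = 1 / P1 + 1 / P2" and pq: "p < q" and \<rho>: "0 < \<rho>"
  shows "\<exists>C>0. \<forall>f g nf ng. loc_int f \<longrightarrow> loc_int g \<longrightarrow> 0 \<le> nf \<longrightarrow> 0 \<le> ng \<longrightarrow>
    wpow P1 \<sigma>1 f \<le> ennreal (nf powr P1) \<longrightarrow> wpow P2 \<sigma>2 g \<le> ennreal (ng powr P2) \<longrightarrow>
    (\<integral>\<^sup>+x. ennpowr (\<integral>\<^sup>+k. ennreal ((bvol w x (dyad k) powr (- 1 / q) *
       (normalized_mean P1 \<sigma>1 f x (dyad k) * normalized_mean P2 \<sigma>2 g x (dyad k))) powr \<rho>)
        \<partial>count_space UNIV) (q / \<rho>) \<partial>wm w) \<le> ennreal (C * (nf * ng) powr q)"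
proof -
  note adm = A[THEN A_inf_adm]
  note [measurable] = adm[THEN adm_weight_measurable]
  have p0: "0 < p"
  proof -
    have "0 < 1 / p" unfolding p using P by (simp add: add_pos_pos)
    then show ?thesis by simp
  qed
  have frac: "p / P1 + p / P2 = 1" "0 < p / P1" "p / P1 < 1"
  proof -
    have "p * (1 / P1 + 1 / P2) = 1" unfolding p[symmetric] using p0 by simp
    then show "p / P1 + p / P2 = 1" by (simp add: distrib_left)
    moreover have "0 < p / P2" "0 < p / P1" using p0 P by auto
    ultimately show "0 < p / P1" "p / P1 < 1" by linarith+
  qed
  obtain c where c: "0 < c" "\<And>x r E. 0 < r \<Longrightarrow> E \<in> sets borel \<Longrightarrow> E \<subseteq> ball x r \<Longrightarrow>
        1 / 2 * measure lborel (ball x r) \<le> measure lborel E \<Longrightarrow> c * bvol w x r \<le> measure (wm w) E"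
    by (rule A_inf_lower[OF A(1), of "1 / 2"]) (simp, blast intro: that)
  obtain C where C: "0 < C" "\<And>\<Phi> \<Lambda> H. H \<in> borel_measurable borel \<Longrightarrow>
    (\<And>x r. 0 < r \<Longrightarrow> 0 \<le> \<Phi> x r) \<Longrightarrow> (\<And>x r. 0 < r \<Longrightarrow> \<Phi> x r \<le> \<Lambda>) \<Longrightarrow>
    (\<And>x r. 0 < r \<Longrightarrow> \<exists>E. E \<in> sets borel \<and> E \<subseteq> ball x r \<and> c * bvol w x r \<le> measure (wm w) E \<and>
       (\<forall>y\<in>E. ennreal (bvol w x r powr (- 1 / p) * \<Phi> x r) \<le> H y)) \<Longrightarrow>
    (\<integral>\<^sup>+x. ennpowr (\<integral>\<^sup>+k. ennreal ((bvol w x (dyad k) powr (- 1 / q) * \<Phi> x (dyad k)) powr \<rho>)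
        \<partial>count_space UNIV) (q / \<rho>) \<partial>wm w)
      \<le> ennreal (C * \<Lambda> powr (q - p)) * (\<integral>\<^sup>+x. ennpowr (H x) p \<partial>wm w)"
    by (rule fractional_sum_bound[OF A(1) p0 pq \<rho> c(1)]) (blast intro: that)
  \<comment> \<open>Tolerance 1/4 for each function, so that at least half of the ball survives when
    both exceptional sets are removed.\<close>
  obtain Cf where Cf: "0 < Cf" and hf: "\<And>f. loc_int f \<Longrightarrow> (\<exists>h. h \<in> borel_measurable borel \<and>
     (\<integral>\<^sup>+x. ennpowr (h x) P1 \<partial>wm w) \<le> ennreal Cf * wpow P1 \<sigma>1 f \<and>
     (\<forall>x r. 0 < r \<longrightarrow> (\<exists>E. E \<in> sets borel \<and> E \<subseteq> ball x r \<and>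
        measure lborel (ball x r - E) \<le> 1 / 4 * measure lborel (ball x r) \<and>
        (\<forall>y\<in>E. ennreal (bvol w x r powr (- 1 / P1) * normalized_mean P1 \<sigma>1 f x r) \<le> h y))))"
    using normalized_mean_majorant[OF A(2) adm(1) P(1), of "1 / 4"] by auto
  obtain Cg where Cg: "0 < Cg" and hg: "\<And>f. loc_int f \<Longrightarrow> (\<exists>h. h \<in> borel_measurable borel \<and>
     (\<integral>\<^sup>+x. ennpowr (h x) P2 \<partial>wm w) \<le> ennreal Cg * wpow P2 \<sigma>2 f \<and>
     (\<forall>x r. 0 < r \<longrightarrow> (\<exists>E. E \<in> sets borel \<and> E \<subseteq> ball x r \<and>
        measure lborel (ball x r - E) \<le> 1 / 4 * measure lborel (ball x r) \<and>
        (\<forall>y\<in>E. ennreal (bvol w x r powr (- 1 / P2) * normalized_mean P2 \<sigma>2 f x r) \<le> h y))))"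
    using normalized_mean_majorant[OF A(3) adm(1) P(2), of "1 / 4"] by auto
  define C' where "C' = C * (Cf powr (p / P1) * Cg powr (p / P2))"
  have "0 < C'" using C Cf Cg by (simp add: C'_def)
  show ?thesis
  proof (intro exI[of _ C'] conjI allI impI \<open>0 < C'\<close>)
    fix f g :: "'a \<Rightarrow> real" and nf ng :: real
    assume f: "loc_int f" and g: "loc_int g" and nn: "0 \<le> nf" "0 \<le> ng"
      and wf: "wpow P1 \<sigma>1 f \<le> ennreal (nf powr P1)" and wg: "wpow P2 \<sigma>2 g \<le> ennreal (ng powr P2)"
    obtain h1 where h1[measurable]: "h1 \<in> borel_measurable borel"
      and h1b: "(\<integral>\<^sup>+x. ennpowr (h1 x) P1 \<partial>wm w) \<le> ennreal Cf * wpow P1 \<sigma>1 f"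
      and h1E: "\<And>x r. 0 < r \<Longrightarrow> (\<exists>E. E \<in> sets borel \<and> E \<subseteq> ball x r \<and>
        measure lborel (ball x r - E) \<le> 1 / 4 * measure lborel (ball x r) \<and>
        (\<forall>y\<in>E. ennreal (bvol w x r powr (- 1 / P1) * normalized_mean P1 \<sigma>1 f x r) \<le> h1 y))"
      using hf[OF f] by blast
    obtain h2 where h2[measurable]: "h2 \<in> borel_measurable borel"
      and h2b: "(\<integral>\<^sup>+x. ennpowr (h2 x) P2 \<partial>wm w) \<le> ennreal Cg * wpow P2 \<sigma>2 g"
      and h2E: "\<And>x r. 0 < r \<Longrightarrow> (\<exists>E. E \<in> sets borel \<and> E \<subseteq> ball x r \<and>
        measure lborel (ball x r - E) \<le> 1 / 4 * measure lborel (ball x r) \<and>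
        (\<forall>y\<in>E. ennreal (bvol w x r powr (- 1 / P2) * normalized_mean P2 \<sigma>2 g x r) \<le> h2 y))"
      using hg[OF g] by blast
    define \<Phi> where "\<Phi> x r = normalized_mean P1 \<sigma>1 f x r * normalized_mean P2 \<sigma>2 g x r" for x r
    define H where "H x = h1 x * h2 x" for x
    have [measurable]: "H \<in> borel_measurable borel" unfolding H_def by measurable
    have m1: "normalized_mean P1 \<sigma>1 f x r \<le> nf" if "0 < r" for x r
    proof -
      have "ennreal (normalized_mean P1 \<sigma>1 f x r) \<le> ennpowr (ennreal (nf powr P1)) (1 / P1)"
        using P by (intro order_trans[OF normalized_mean_le[OF adm(2) f P(1) that]] ennpowr_mono wf) auto
      then show ?thesis using nn P by (simp add: ennpowr_ennreal powr_powr ennreal_le_iff)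
    qed
    have m2: "normalized_mean P2 \<sigma>2 g x r \<le> ng" if "0 < r" for x r
    proof -
      have "ennreal (normalized_mean P2 \<sigma>2 g x r) \<le> ennpowr (ennreal (ng powr P2)) (1 / P2)"
        using P by (intro order_trans[OF normalized_mean_le[OF adm(3) g P(2) that]] ennpowr_mono wg) auto
      then show ?thesis using nn P by (simp add: ennpowr_ennreal powr_powr ennreal_le_iff)
    qed
    have ex: "\<exists>E. E \<in> sets borel \<and> E \<subseteq> ball x r \<and> c * bvol w x r \<le> measure (wm w) E \<and>
       (\<forall>y\<in>E. ennreal (bvol w x r powr (- 1 / p) * \<Phi> x r) \<le> H y)" if r: "0 < r" for x r
    proof -
      obtain E1 where E1[measurable]: "E1 \<in> sets borel" and E1s: "E1 \<subseteq> ball x r"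
        "measure lborel (ball x r - E1) \<le> 1 / 4 * measure lborel (ball x r)"
        "\<And>y. y \<in> E1 \<Longrightarrow> ennreal (bvol w x r powr (- 1 / P1) * normalized_mean P1 \<sigma>1 f x r) \<le> h1 y"
        using h1E[OF r, of x] by blast
      obtain E2 where E2[measurable]: "E2 \<in> sets borel" and E2s: "E2 \<subseteq> ball x r"
        "measure lborel (ball x r - E2) \<le> 1 / 4 * measure lborel (ball x r)"
        "\<And>y. y \<in> E2 \<Longrightarrow> ennreal (bvol w x r powr (- 1 / P2) * normalized_mean P2 \<sigma>2 g x r) \<le> h2 y"
        using h2E[OF r, of x] by blast
      have "measure lborel (ball x r - E1 \<inter> E2) \<le> measure lborel (ball x r - E1) + measure lborel (ball x r - E2)"
        using measure_Un_le[of "ball x r - E1" lborel "ball x r - E2"] by (simp add: Diff_Int)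
      then have "measure lborel (ball x r - E1 \<inter> E2) \<le> 1 / 2 * measure lborel (ball x r)"
        using E1s E2s by simp
      moreover have "measure lborel (ball x r - E1 \<inter> E2) = measure lborel (ball x r) - measure lborel (E1 \<inter> E2)"
        using E1s emeasure_lborel_ball_finite[of x r] by (intro measure_Diff) auto
      ultimately have "c * bvol w x r \<le> measure (wm w) (E1 \<inter> E2)"
        using r E1s by (intro c) auto
      moreover have "ennreal (bvol w x r powr (- 1 / p) * \<Phi> x r) \<le> H y" if "y \<in> E1 \<inter> E2" for y
      proof -
        have "- 1 / p = - 1 / P1 + - 1 / P2" using p by (simp add: field_simps)
        then have "bvol w x r powr (- 1 / p) = bvol w x r powr (- 1 / P1) * bvol w x r powr (- 1 / P2)"
          by (simp only: powr_add)
        then have "ennreal (bvol w x r powr (- 1 / p) * \<Phi> x r)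
            = ennreal ((bvol w x r powr (- 1 / P1) * normalized_mean P1 \<sigma>1 f x r) *
              (bvol w x r powr (- 1 / P2) * normalized_mean P2 \<sigma>2 g x r))"
          unfolding \<Phi>_def by (simp only: mult_ac)
        also have "\<dots> = ennreal (bvol w x r powr (- 1 / P1) * normalized_mean P1 \<sigma>1 f x r) *
              ennreal (bvol w x r powr (- 1 / P2) * normalized_mean P2 \<sigma>2 g x r)"
          by (intro ennreal_mult) auto
        also have "\<dots> \<le> H y"
          unfolding H_def using that by (intro mult_mono E1s E2s) auto
        finally show ?thesis .
      qed
      ultimately show ?thesis
        using E1s by (intro exI[of _ "E1 \<inter> E2"]) auto
    qed
    have "(\<integral>\<^sup>+x. ennpowr (H x) p \<partial>wm w)
        = (\<integral>\<^sup>+x. ennpowr (ennpowr (h1 x) P1) (p / P1) * ennpowr (ennpowr (h2 x) P2) (1 - p / P1) \<partial>wm w)"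
    proof -
      have "1 - p / P1 = p / P2" using frac by simp
      then show ?thesis using P by (simp add: H_def ennpowr_mult ennpowr_ennpowr)
    qed
    also have "\<dots> \<le> ennpowr (\<integral>\<^sup>+x. ennpowr (h1 x) P1 \<partial>wm w) (p / P1) * ennpowr (\<integral>\<^sup>+x. ennpowr (h2 x) P2 \<partial>wm w) (1 - p / P1)"
      using frac by (intro nn_integral_Holder) measurable
    also have "\<dots> \<le> ennpowr (ennreal Cf * ennreal (nf powr P1)) (p / P1) * ennpowr (ennreal Cg * ennreal (ng powr P2)) (1 - p / P1)"
      using frac by (intro mult_mono ennpowr_mono order_trans[OF h1b] order_trans[OF h2b] wf wg) auto
    also have "\<dots> = ennreal (Cf powr (p / P1) * Cg powr (p / P2) * (nf * ng) powr p)"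
    proof -
      have "1 - p / P1 = p / P2" using frac by simp
      then show ?thesis
        using P Cf Cg nn by (simp add: ennpowr_ennreal powr_mult powr_powr mult_ac flip: ennreal_mult)
    qed
    finally have H: "(\<integral>\<^sup>+x. ennpowr (H x) p \<partial>wm w) \<le> ennreal (Cf powr (p / P1) * Cg powr (p / P2) * (nf * ng) powr p)" .
    have "(\<integral>\<^sup>+x. ennpowr (\<integral>\<^sup>+k. ennreal ((bvol w x (dyad k) powr (- 1 / q) * \<Phi> x (dyad k)) powr \<rho>)
        \<partial>count_space UNIV) (q / \<rho>) \<partial>wm w)
      \<le> ennreal (C * (nf * ng) powr (q - p)) * (\<integral>\<^sup>+x. ennpowr (H x) p \<partial>wm w)"
    proof (rule C(2))
      show "H \<in> borel_measurable borel" by fact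
      show "0 \<le> \<Phi> x r" for x r by (simp add: \<Phi>_def)
      show "\<Phi> x r \<le> nf * ng" if "0 < r" for x r
        unfolding \<Phi>_def using m1[OF that] m2[OF that] nn by (intro mult_mono) auto
    qed (rule ex)
    also have "\<dots> \<le> ennreal (C * (nf * ng) powr (q - p)) * ennreal (Cf powr (p / P1) * Cg powr (p / P2) * (nf * ng) powr p)"
      by (intro mult_left_mono H) auto
    also have "\<dots> = ennreal (C' * ((nf * ng) powr (q - p) * (nf * ng) powr p))"
      using C by (simp add: C'_def mult_ac flip: ennreal_mult)
    also have "(nf * ng) powr (q - p) * (nf * ng) powr p = (nf * ng) powr q"
      by (simp flip: powr_add)
    finally show "(\<integral>\<^sup>+x. ennpowr (\<integral>\<^sup>+k. ennreal ((bvol w x (dyad k) powr (- 1 / q) *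
       (normalized_mean P1 \<sigma>1 f x (dyad k) * normalized_mean P2 \<sigma>2 g x (dyad k))) powr \<rho>)
        \<partial>count_space UNIV) (q / \<rho>) \<partial>wm w) \<le> ennreal (C' * (nf * ng) powr q)"
      by (simp only: \<Phi>_def)
  qed
qed

text \<open>The one-function version: a single exceptional set, so tolerance 1/2 is enough, and the
  majorant of the mean is itself the function \<open>H\<close> of
  \<open>fractional_sum_bound\<close>.\<close>

proposition linear_fractional_sum:
  fixes w \<sigma> :: "'a::euclidean_space \<Rightarrow> real"
  assumes A: "A_inf w" "A_inf \<sigma>" and p: "1 < p" and pq: "p < q" and \<rho>: "0 < \<rho>"
  shows "\<exists>C>0. \<forall>f nf. loc_int f \<longrightarrow> 0 \<le> nf \<longrightarrow> wpow p \<sigma> f \<le> ennreal (nf powr p) \<longrightarrow>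
    (\<integral>\<^sup>+x. ennpowr (\<integral>\<^sup>+k. ennreal ((bvol w x (dyad k) powr (- 1 / q) *
       normalized_mean p \<sigma> f x (dyad k)) powr \<rho>) \<partial>count_space UNIV) (q / \<rho>) \<partial>wm w) \<le> ennreal (C * nf powr q)"
proof -
  note adm = A[THEN A_inf_adm]
  note [measurable] = adm[THEN adm_weight_measurable]
  have p0: "0 < p" using p by simp
  obtain c where c: "0 < c" "\<And>x r E. 0 < r \<Longrightarrow> E \<in> sets borel \<Longrightarrow> E \<subseteq> ball x r \<Longrightarrow>
        1 / 2 * measure lborel (ball x r) \<le> measure lborel E \<Longrightarrow> c * bvol w x r \<le> measure (wm w) E"
    by (rule A_inf_lower[OF A(1), of "1 / 2"]) (simp, blast intro: that)
  obtain C where C: "0 < C" "\<And>\<Phi> \<Lambda> H. H \<in> borel_measurable borel \<Longrightarrow>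
    (\<And>x r. 0 < r \<Longrightarrow> 0 \<le> \<Phi> x r) \<Longrightarrow> (\<And>x r. 0 < r \<Longrightarrow> \<Phi> x r \<le> \<Lambda>) \<Longrightarrow>
    (\<And>x r. 0 < r \<Longrightarrow> \<exists>E. E \<in> sets borel \<and> E \<subseteq> ball x r \<and> c * bvol w x r \<le> measure (wm w) E \<and>
       (\<forall>y\<in>E. ennreal (bvol w x r powr (- 1 / p) * \<Phi> x r) \<le> H y)) \<Longrightarrow>
    (\<integral>\<^sup>+x. ennpowr (\<integral>\<^sup>+k. ennreal ((bvol w x (dyad k) powr (- 1 / q) * \<Phi> x (dyad k)) powr \<rho>)
        \<partial>count_space UNIV) (q / \<rho>) \<partial>wm w)
      \<le> ennreal (C * \<Lambda> powr (q - p)) * (\<integral>\<^sup>+x. ennpowr (H x) p \<partial>wm w)"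
    by (rule fractional_sum_bound[OF A(1) p0 pq \<rho> c(1)]) (blast intro: that)
  obtain Cf where Cf: "0 < Cf" and hf: "\<And>f. loc_int f \<Longrightarrow> (\<exists>h. h \<in> borel_measurable borel \<and>
     (\<integral>\<^sup>+x. ennpowr (h x) p \<partial>wm w) \<le> ennreal Cf * wpow p \<sigma> f \<and>
     (\<forall>x r. 0 < r \<longrightarrow> (\<exists>E. E \<in> sets borel \<and> E \<subseteq> ball x r \<and>
        measure lborel (ball x r - E) \<le> 1 / 2 * measure lborel (ball x r) \<and>
        (\<forall>y\<in>E. ennreal (bvol w x r powr (- 1 / p) * normalized_mean p \<sigma> f x r) \<le> h y))))"
    using normalized_mean_majorant[OF A(2) adm(1) p, of "1 / 2"] by auto
  show ?thesis
  proof (intro exI[of _ "C * Cf"] conjI allI impI)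
    show "0 < C * Cf" using C Cf by simp
    fix f :: "'a \<Rightarrow> real" and nf :: real
    assume f: "loc_int f" and nn: "0 \<le> nf" and wf: "wpow p \<sigma> f \<le> ennreal (nf powr p)"
    obtain h1 where h1[measurable]: "h1 \<in> borel_measurable borel"
      and h1b: "(\<integral>\<^sup>+x. ennpowr (h1 x) p \<partial>wm w) \<le> ennreal Cf * wpow p \<sigma> f"
      and h1E: "\<And>x r. 0 < r \<Longrightarrow> (\<exists>E. E \<in> sets borel \<and> E \<subseteq> ball x r \<and>
        measure lborel (ball x r - E) \<le> 1 / 2 * measure lborel (ball x r) \<and>
        (\<forall>y\<in>E. ennreal (bvol w x r powr (- 1 / p) * normalized_mean p \<sigma> f x r) \<le> h1 y))"
      using hf[OF f] by blast
    have m1: "normalized_mean p \<sigma> f x r \<le> nf" if "0 < r" for x r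
    proof -
      have "ennreal (normalized_mean p \<sigma> f x r) \<le> ennpowr (ennreal (nf powr p)) (1 / p)"
        using p by (intro order_trans[OF normalized_mean_le[OF adm(2) f p that]] ennpowr_mono wf) auto
      then show ?thesis using nn p by (simp add: ennpowr_ennreal powr_powr ennreal_le_iff)
    qed
    have "(\<integral>\<^sup>+x. ennpowr (\<integral>\<^sup>+k. ennreal ((bvol w x (dyad k) powr (- 1 / q) * normalized_mean p \<sigma> f x (dyad k)) powr \<rho>)
        \<partial>count_space UNIV) (q / \<rho>) \<partial>wm w)
      \<le> ennreal (C * nf powr (q - p)) * (\<integral>\<^sup>+x. ennpowr (h1 x) p \<partial>wm w)"
    proof (rule C(2))
      fix x :: 'a and r :: real assume r: "0 < r"
      obtain E1 where E1[measurable]: "E1 \<in> sets borel" and E1s: "E1 \<subseteq> ball x r"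
        "measure lborel (ball x r - E1) \<le> 1 / 2 * measure lborel (ball x r)"
        "\<And>y. y \<in> E1 \<Longrightarrow> ennreal (bvol w x r powr (- 1 / p) * normalized_mean p \<sigma> f x r) \<le> h1 y"
        using h1E[OF r, of x] by blast
      have "measure lborel (ball x r - E1) = measure lborel (ball x r) - measure lborel E1"
        using E1s emeasure_lborel_ball_finite[of x r] by (intro measure_Diff) auto
      then have "c * bvol w x r \<le> measure (wm w) E1"
        using r E1s by (intro c) auto
      then show "\<exists>E. E \<in> sets borel \<and> E \<subseteq> ball x r \<and> c * bvol w x r \<le> measure (wm w) E \<and>
         (\<forall>y\<in>E. ennreal (bvol w x r powr (- 1 / p) * normalized_mean p \<sigma> f x r) \<le> h1 y)"
        using E1s E1 by blast
    qed (simp_all add: m1)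
    also have "\<dots> \<le> ennreal (C * nf powr (q - p)) * (ennreal Cf * ennreal (nf powr p))"
      by (intro mult_left_mono order_trans[OF h1b] wf) auto
    also have "\<dots> = ennreal (C * Cf * (nf powr (q - p) * nf powr p))"
      using C Cf by (simp add: mult_ac flip: ennreal_mult)
    also have "nf powr (q - p) * nf powr p = nf powr q"
      by (simp flip: powr_add)
    finally show "(\<integral>\<^sup>+x. ennpowr (\<integral>\<^sup>+k. ennreal ((bvol w x (dyad k) powr (- 1 / q) *
       normalized_mean p \<sigma> f x (dyad k)) powr \<rho>) \<partial>count_space UNIV) (q / \<rho>) \<partial>wm w) \<le> ennreal (C * Cf * nf powr q)" .
  qed
qed


section \<open>Fractional integrals\<close>

text \<open>A single term suffices: the dyadic number in the interval from \<open>d\<close>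
  (excluded) to \<open>2 * d\<close> (included).\<close>

lemma powr_le_dyadic_sum:
  assumes d: "0 < d" and e: "e < 0"
  shows "ennreal (d powr e) \<le> ennreal (2 powr (- e)) *
    (\<integral>\<^sup>+k. ennreal (dyad k powr e) * indicator {k. d < dyad k} k \<partial>count_space UNIV)"
proof -
  define k where "k = \<lfloor>log 2 d\<rfloor> + 1"
  have "log 2 d < real_of_int k" "real_of_int k \<le> log 2 d + 1"
    by (auto simp: k_def)
  then have "2 powr (log 2 d) < dyad k" "dyad k \<le> 2 powr (log 2 d + 1)"
    unfolding dyad_def by (intro powr_less_mono powr_mono; simp)+
  then have k: "d < dyad k" "dyad k \<le> 2 * d"
    using d by (auto simp: powr_add)
  have "(2 * d) powr e \<le> dyad k powr e"
    using k e by (intro powr_mono2') auto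
  then have "d powr e \<le> 2 powr (- e) * dyad k powr e"
    using d by (simp add: powr_mult powr_minus field_simps)
  then have "ennreal (d powr e) \<le> ennreal (2 powr (- e)) * (ennreal (dyad k powr e) * indicator {k. d < dyad k} k)"
    using k by (simp flip: ennreal_mult add: ennreal_leI)
  also have "\<dots> \<le> ennreal (2 powr (- e)) *
      (\<integral>\<^sup>+k. ennreal (dyad k powr e) * indicator {k. d < dyad k} k \<partial>count_space UNIV)"
    by (intro mult_left_mono nn_integral_ge_point) auto
  finally show ?thesis .
qed

text \<open>A positive real factor is invertible, so the simple functions below \<open>c * f\<close>
  are exactly \<open>c\<close> times those below \<open>f\<close>. The identity thus holds for
  arbitrary \<open>f\<close>; it is applied to dyadic sums of ball averages as functions of the
  centre.\<close>

lemma nn_integral_cmult_real: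
  assumes c: "0 < c"
  shows "(\<integral>\<^sup>+x. ennreal c * f x \<partial>M) = ennreal c * (\<integral>\<^sup>+x. f x \<partial>M)"
proof -
  have le: "(\<integral>\<^sup>+x. ennreal c * f x \<partial>M) \<le> ennreal c * (\<integral>\<^sup>+x. f x \<partial>M)" if c: "0 < c" for c f
    unfolding nn_integral_def[of M "\<lambda>x. ennreal c * f x"]
  proof (intro SUP_least)
    fix g assume g: "g \<in> {g. simple_function M g \<and> g \<le> (\<lambda>x. ennreal c * f x)}"
    have inv: "ennreal (1 / c) * ennreal c = 1"
      using c by (simp flip: ennreal_mult)
    have s: "simple_function M (\<lambda>x. ennreal (1 / c) * g x)"
      using g by (intro simple_function_mult) auto
    have g': "g x = ennreal c * (ennreal (1 / c) * g x)" for x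
      using inv by (simp add: mult.assoc[symmetric] mult.commute)
    have "integral\<^sup>S M g = (\<integral>\<^sup>+x. g x \<partial>M)"
      using g by (simp add: nn_integral_eq_simple_integral)
    also have "\<dots> = ennreal c * (\<integral>\<^sup>+x. ennreal (1 / c) * g x \<partial>M)"
      using s by (subst g', intro nn_integral_cmult) (rule borel_measurable_simple_function)
    also have "\<dots> \<le> ennreal c * (\<integral>\<^sup>+x. f x \<partial>M)"
    proof (intro mult_left_mono nn_integral_mono)
      fix x
      have "ennreal (1 / c) * g x \<le> ennreal (1 / c) * (ennreal c * f x)"
        using g by (intro mult_left_mono) (auto simp: le_fun_def)
      also have "\<dots> = f x"
        using inv by (simp add: mult.assoc[symmetric])
      finally show "ennreal (1 / c) * g x \<le> f x" .
    qed simp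
    finally show "integral\<^sup>S M g \<le> ennreal c * (\<integral>\<^sup>+x. f x \<partial>M)" .
  qed
  have inv: "ennreal (1 / c) * ennreal c = 1"
    using c by (simp flip: ennreal_mult)
  have "ennreal c * (\<integral>\<^sup>+x. f x \<partial>M) = ennreal c * (\<integral>\<^sup>+x. ennreal (1 / c) * (ennreal c * f x) \<partial>M)"
    using inv by (simp add: mult.assoc[symmetric])
  also have "\<dots> \<le> ennreal c * (ennreal (1 / c) * (\<integral>\<^sup>+x. ennreal c * f x \<partial>M))"
    using c by (intro mult_left_mono le) auto
  also have "\<dots> = (\<integral>\<^sup>+x. ennreal c * f x \<partial>M)"
    using inv by (simp add: mult.assoc[symmetric] mult.commute)
  finally show ?thesis
    using le[OF c, of f] by (intro antisym) auto
qed

lemma nn_integral_count_int: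
  fixes f :: "int \<Rightarrow> 'a \<Rightarrow> ennreal"
  assumes "\<And>i. f i \<in> borel_measurable M"
  shows "(\<integral>\<^sup>+x. \<integral>\<^sup>+i. f i x \<partial>count_space UNIV \<partial>M) = (\<integral>\<^sup>+i. \<integral>\<^sup>+x. f i x \<partial>M \<partial>count_space UNIV)"
  using assms by (intro nn_integral_count_space_nn_integral) auto

lemma nn_integral_ball_loc_int:
  assumes f: "loc_int f"
  shows "(\<integral>\<^sup>+y. ennreal (f y) * indicator (ball x r) y \<partial>lborel) = ennreal (bvol f x r)"
  using loc_int_measurable[OF f] by (simp add: emeasure_wm flip: loc_int_emeasure[OF f])

text \<open>The Riesz potential without its normalising constant. At \<open>y = x\<close> the kernel
  has the value 0, since \<open>0 powr e = 0\<close>.\<close>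

definition riesz1 :: "real \<Rightarrow> ('a::euclidean_space \<Rightarrow> real) \<Rightarrow> 'a \<Rightarrow> ennreal" where
  "riesz1 s f x = (\<integral>\<^sup>+y. ennreal (f y * norm (x - y) powr (s - real DIM('a))) \<partial>lborel)"

text \<open>The bilinear fractional integral of Kenig and Stein: on the product space it is a Riesz
  potential of order \<open>s\<close> of the tensor product of \<open>f\<close> and
  \<open>g\<close>, up to equivalent kernels, restricted to the diagonal point
  \<open>(x, x)\<close>.\<close>

definition riesz2 :: "real \<Rightarrow> ('a::euclidean_space \<Rightarrow> real) \<Rightarrow> ('a \<Rightarrow> real) \<Rightarrow> 'a \<Rightarrow> ennreal" where
  "riesz2 s f g x = (\<integral>\<^sup>+y. \<integral>\<^sup>+z.
     ennreal (f y * g z * (norm (x - y) + norm (x - z)) powr (s - 2 * real DIM('a))) \<partial>lborel \<partial>lborel)"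

lemma riesz1_le_sum:
  fixes f :: "'a::euclidean_space \<Rightarrow> real"
  assumes s: "s < real DIM('a)" and f: "loc_int f"
  shows "riesz1 s f x \<le> ennreal (2 powr (real DIM('a) - s)) *
    (\<integral>\<^sup>+k. ennreal (dyad k powr (s - real DIM('a)) * bvol f x (dyad k)) \<partial>count_space UNIV)"
proof -
  let ?e = "s - real DIM('a)"
  note [measurable] = loc_int_measurable[OF f]
  have pt: "ennreal (f y * norm (x - y) powr ?e) \<le>
      (\<integral>\<^sup>+k. ennreal (2 powr (- ?e)) * (ennreal (dyad k powr ?e) * (ennreal (f y) * indicator (ball x (dyad k)) y)) \<partial>count_space UNIV)" for y
  proof (cases "x = y")
    case False
    have "ennreal (f y * norm (x - y) powr ?e) = ennreal (f y) * ennreal (norm (x - y) powr ?e)"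
      using loc_int_nonneg[OF f, of y] by (simp add: ennreal_mult)
    also have "\<dots> \<le> ennreal (f y) * (ennreal (2 powr (- ?e)) *
      (\<integral>\<^sup>+k. ennreal (dyad k powr ?e) * indicator {k. norm (x - y) < dyad k} k \<partial>count_space UNIV))"
      using False s by (intro mult_left_mono powr_le_dyadic_sum) auto
    also have "\<dots> = (\<integral>\<^sup>+k. ennreal (f y) * (ennreal (2 powr (- ?e)) * (ennreal (dyad k powr ?e) * indicator {k. norm (x - y) < dyad k} k)) \<partial>count_space UNIV)"
      by (simp add: nn_integral_cmult)
    also have "\<dots> = (\<integral>\<^sup>+k. ennreal (2 powr (- ?e)) * (ennreal (dyad k powr ?e) * (ennreal (f y) * indicator (ball x (dyad k)) y)) \<partial>count_space UNIV)"
      by (intro nn_integral_cong) (auto simp: dist_norm ac_simps split: split_indicator)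
    finally show ?thesis .
  qed simp
  have "riesz1 s f x \<le> (\<integral>\<^sup>+y. \<integral>\<^sup>+k. ennreal (2 powr (- ?e)) * (ennreal (dyad k powr ?e) *
      (ennreal (f y) * indicator (ball x (dyad k)) y)) \<partial>count_space UNIV \<partial>lborel)"
    unfolding riesz1_def by (intro nn_integral_mono pt)
  also have "\<dots> = (\<integral>\<^sup>+k. \<integral>\<^sup>+y. ennreal (2 powr (- ?e)) * (ennreal (dyad k powr ?e) *
      (ennreal (f y) * indicator (ball x (dyad k)) y)) \<partial>lborel \<partial>count_space UNIV)"
    by (intro nn_integral_count_int) measurable
  also have "\<dots> = (\<integral>\<^sup>+k. ennreal (2 powr (- ?e)) * (ennreal (dyad k powr ?e) * ennreal (bvol f x (dyad k))) \<partial>count_space UNIV)"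
    by (simp add: nn_integral_cmult nn_integral_ball_loc_int[OF f])
  finally show ?thesis
    by (simp add: nn_integral_cmult ennreal_mult)
qed

text \<open>If the sum of the two distances is below a dyadic radius, both points lie in that ball,
  so at each scale the double integral factors into two ball integrals.\<close>

lemma riesz2_le_sum:
  fixes f g :: "'a::euclidean_space \<Rightarrow> real"
  assumes s: "s < 2 * real DIM('a)" and f: "loc_int f" and g: "loc_int g"
  shows "riesz2 s f g x \<le> ennreal (2 powr (2 * real DIM('a) - s)) *
    (\<integral>\<^sup>+k. ennreal (dyad k powr (s - 2 * real DIM('a)) * (bvol f x (dyad k) * bvol g x (dyad k))) \<partial>count_space UNIV)"
proof -
  let ?e = "s - 2 * real DIM('a)"
  let ?c = "\<lambda>k. ennreal (2 powr (- ?e)) * ennreal (dyad k powr ?e)"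
  let ?F = "\<lambda>k y. ennreal (f y) * indicator (ball x (dyad k)) y"
  let ?G = "\<lambda>k y. ennreal (g y) * indicator (ball x (dyad k)) y"
  note [measurable] = loc_int_measurable[OF f] loc_int_measurable[OF g]
  have pt: "ennreal (f y * g z * (norm (x - y) + norm (x - z)) powr ?e) \<le>
      (\<integral>\<^sup>+k. ?c k * (?F k y * ?G k z) \<partial>count_space UNIV)" for y z
  proof (cases "x = y \<and> x = z")
    case False
    then have d: "0 < norm (x - y) + norm (x - z)"
      by (metis add_nonneg_pos add_pos_nonneg norm_ge_zero right_minus_eq zero_less_norm_iff)
    have "ennreal (f y * g z * (norm (x - y) + norm (x - z)) powr ?e)
        = ennreal (f y * g z) * ennreal ((norm (x - y) + norm (x - z)) powr ?e)"
      using loc_int_nonneg[OF f, of y] loc_int_nonneg[OF g, of z] by (simp add: ennreal_mult)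
    also have "\<dots> \<le> ennreal (f y * g z) * (ennreal (2 powr (- ?e)) *
      (\<integral>\<^sup>+k. ennreal (dyad k powr ?e) * indicator {k. norm (x - y) + norm (x - z) < dyad k} k \<partial>count_space UNIV))"
      using d s by (intro mult_left_mono powr_le_dyadic_sum) auto
    also have "\<dots> = (\<integral>\<^sup>+k. ennreal (f y * g z) * (ennreal (2 powr (- ?e)) *
       (ennreal (dyad k powr ?e) * indicator {k. norm (x - y) + norm (x - z) < dyad k} k)) \<partial>count_space UNIV)"
      by (simp add: nn_integral_cmult)
    also have "\<dots> \<le> (\<integral>\<^sup>+k. ?c k * (?F k y * ?G k z) \<partial>count_space UNIV)"
    proof (intro nn_integral_mono)
      fix k
      show "ennreal (f y * g z) * (ennreal (2 powr (- ?e)) *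
         (ennreal (dyad k powr ?e) * indicator {k. norm (x - y) + norm (x - z) < dyad k} k))
         \<le> ?c k * (?F k y * ?G k z)"
      proof (cases "norm (x - y) + norm (x - z) < dyad k")
        case True
        then have "y \<in> ball x (dyad k)" "z \<in> ball x (dyad k)"
          using norm_ge_zero[of "x - y"] norm_ge_zero[of "x - z"]
          unfolding mem_ball dist_norm by linarith+
        then show ?thesis
          using True loc_int_nonneg[OF f, of y] loc_int_nonneg[OF g, of z]
          by (simp add: ennreal_mult ac_simps)
      qed simp
    qed
    finally show ?thesis .
  qed auto
  have "riesz2 s f g x \<le> (\<integral>\<^sup>+y. \<integral>\<^sup>+z. \<integral>\<^sup>+k. ?c k * (?F k y * ?G k z) \<partial>count_space UNIV \<partial>lborel \<partial>lborel)"
    unfolding riesz2_def by (intro nn_integral_mono pt)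
  also have "\<dots> = (\<integral>\<^sup>+y. \<integral>\<^sup>+k. \<integral>\<^sup>+z. ?c k * (?F k y * ?G k z) \<partial>lborel \<partial>count_space UNIV \<partial>lborel)"
    by (intro nn_integral_cong nn_integral_count_int) measurable
  also have "\<dots> = (\<integral>\<^sup>+y. \<integral>\<^sup>+k. ?c k * (?F k y * ennreal (bvol g x (dyad k))) \<partial>count_space UNIV \<partial>lborel)"
    by (simp add: nn_integral_cmult nn_integral_ball_loc_int[OF g])
  also have "\<dots> = (\<integral>\<^sup>+k. \<integral>\<^sup>+y. ?c k * (?F k y * ennreal (bvol g x (dyad k))) \<partial>lborel \<partial>count_space UNIV)"
    by (intro nn_integral_count_int) measurable
  also have "\<dots> = (\<integral>\<^sup>+k. ?c k * (ennreal (bvol f x (dyad k)) * ennreal (bvol g x (dyad k))) \<partial>count_space UNIV)"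
    by (simp add: nn_integral_cmult nn_integral_multc nn_integral_ball_loc_int[OF f])
  finally show ?thesis
    by (simp add: nn_integral_cmult ennreal_mult mult.assoc)
qed

lemma adm_weight_1: "adm_weight (\<lambda>x::'a::euclidean_space. 1)"
  unfolding adm_weight_def wm_def
  by (intro conjI allI) (simp_all add: density_1 emeasure_lborel_ball_finite[unfolded infinity_ennreal_def])

lemma bvol_1: "bvol (\<lambda>_. 1) x r = measure lborel (ball x r)"
  by (simp add: bvol_def wm_def density_1)

lemma unit_ball_vol_neq_0 [simp]: "unit_ball_vol (real n) \<noteq> 0"
  by (simp add: less_imp_neq[THEN not_sym])

lemma lball_dyad_powr:
  fixes x :: "'a::euclidean_space"
  shows "measure lborel (ball x (dyad k)) powr b = unit_ball_vol (real DIM('a)) powr b * dyad k powr (real DIM('a) * b)"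
  by (simp add: content_ball powr_mult powr_powr flip: powr_realpow)

lemma powr_mult_le_of_le:
  fixes X K d e :: real
  assumes "0 < d" "X \<le> K * d powr (- e)"
  shows "d powr e * X \<le> K"
proof -
  have "d powr e * X \<le> d powr e * (K * d powr (- e))"
    using assms by (intro mult_left_mono) auto
  also have "\<dots> = K"
    using assms by (simp add: powr_minus)
  finally show ?thesis .
qed

text \<open>The Muckenhoupt condition trades the power of the radius for w(B)^(-1/q)
  \<sigma>(B)^(1/p - 1), which turns each dyadic term into a normalised mean; the rest is the
  Hedberg estimate. The relation between the exponents gives 1/q + 1/p' = 1 - s/n.\<close>

theorem riesz1_weighted:
  fixes w \<sigma> :: "'a::euclidean_space \<Rightarrow> real"
  assumes adm: "adm_weight w" "adm_weight \<sigma>" and p: "1 < p" and q: "0 < q" and s: "0 < s"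
    and pq: "1 / q = 1 / p - s / real DIM('a)"
    and one: "\<And>x. w x powr (1 / q) * \<sigma> x powr (1 - 1 / p) = 1"
    and A: "0 < A" "\<And>x r. 0 < r \<Longrightarrow> bvol w x r powr (1 / q) * bvol \<sigma> x r powr (1 - 1 / p)
      \<le> A * measure lborel (ball x r) powr (1 - s / real DIM('a))"
  shows "\<exists>C>0. \<forall>f nf. loc_int f \<longrightarrow> 0 \<le> nf \<longrightarrow> wpow p \<sigma> f \<le> ennreal (nf powr p) \<longrightarrow>
    (\<integral>\<^sup>+x. ennpowr (riesz1 s f x) q \<partial>wm w) \<le> ennreal (C * nf powr q)"
proof -
  let ?m = "real DIM('a)"
  have e: "1 / q + (1 - 1 / p) = 1 - s / ?m" "0 < 1 - 1 / p" "0 < 1 / q"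
    using pq by linarith (use p q in simp_all)
  have sm: "s < ?m"
  proof -
    have "0 < 1 - s / ?m" using e(2,3) unfolding e(1)[symmetric] by linarith
    then show ?thesis by simp
  qed
  have "0 < s / ?m" using s by simp
  then have "1 / q < 1 / p" using pq by linarith
  then have plq: "p < q" using p q by (simp add: field_simps)
  \<comment> \<open>The constant weight with exponent 1 is inserted as a third factor, so that the
    three-weight criterion for A_infinity covers a pair of weights.\<close>
  have bound: "bvol w x r powr (1 / q) * (bvol \<sigma> x r powr (1 - 1 / p) * bvol (\<lambda>_. 1) x r powr 1)
      \<le> A * measure lborel (ball x r) powr (1 / q + (1 - 1 / p) + 1)" if "0 < r" for x :: 'a and r
  proof -
    have "bvol w x r powr (1 / q) * (bvol \<sigma> x r powr (1 - 1 / p) * bvol (\<lambda>_. 1) x r powr 1)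
        \<le> (A * measure lborel (ball x r) powr (1 - s / ?m)) * measure lborel (ball x r)"
      using mult_right_mono[OF A(2)[OF that, of x], of "measure lborel (ball x r)"]
      by (simp add: bvol_1 mult.assoc)
    then show ?thesis
      unfolding e(1) by (simp only: powr_add powr_one measure_nonneg mult.assoc)
  qed
  have Aw: "A_inf w"
    by (rule A_inf_of_product[OF adm adm_weight_1, of "1 / q" "1 - 1 / p" 1 A])
      (use e one A(1) bound in simp_all)
  have A\<sigma>: "A_inf \<sigma>"
    by (rule A_inf_of_product[OF adm(2,1) adm_weight_1, of "1 - 1 / p" "1 / q" 1 A])
      (use e one A(1) bound in \<open>simp_all add: mult_ac add_ac\<close>)
  obtain C where C: "0 < C" and Cb: "\<And>f nf. loc_int f \<Longrightarrow> 0 \<le> nf \<Longrightarrow> wpow p \<sigma> f \<le> ennreal (nf powr p) \<Longrightarrow>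
    (\<integral>\<^sup>+x. ennpowr (\<integral>\<^sup>+k. ennreal ((bvol w x (dyad k) powr (- 1 / q) *
       normalized_mean p \<sigma> f x (dyad k)) powr 1) \<partial>count_space UNIV) (q / 1) \<partial>wm w) \<le> ennreal (C * nf powr q)"
    using linear_fractional_sum[OF Aw A\<sigma> p plq, of 1] by auto
  define D where "D = 2 powr (?m - s) * (A * unit_ball_vol ?m powr (1 - s / ?m))"
  have D: "0 < D" using A by (simp add: D_def)
  show ?thesis
  proof (intro exI[of _ "D powr q * C"] conjI allI impI)
    show "0 < D powr q * C" using C D by simp
    fix f :: "'a \<Rightarrow> real" and nf :: real
    assume f: "loc_int f" and nf: "0 \<le> nf" "wpow p \<sigma> f \<le> ennreal (nf powr p)"
    let ?S = "\<lambda>x. \<integral>\<^sup>+k. ennreal ((bvol w x (dyad k) powr (- 1 / q) * normalized_mean p \<sigma> f x (dyad k)) powr 1) \<partial>count_space UNIV"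
    have pt: "riesz1 s f x \<le> ennreal D * ?S x" for x
    proof -
      \<comment> \<open>The Muckenhoupt condition on the dyadic ball, solved for the power of its
        radius.\<close>
      have "dyad k powr (s - ?m) * bvol f x (dyad k)
         \<le> (A * unit_ball_vol ?m powr (1 - s / ?m)) * (bvol w x (dyad k) powr (- 1 / q) * normalized_mean p \<sigma> f x (dyad k))" for k
      proof -
        have b: "0 < bvol w x (dyad k)" "0 < bvol \<sigma> x (dyad k)"
          using adm by (auto intro: bvol_pos)
        have "bvol w x (dyad k) powr (1 / q) * bvol \<sigma> x (dyad k) powr (1 - 1 / p)
           \<le> A * unit_ball_vol ?m powr (1 - s / ?m) * dyad k powr (?m * (1 - s / ?m))"
          using A(2)[of "dyad k" x] by (simp add: lball_dyad_powr mult_ac)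
        also have "?m * (1 - s / ?m) = - (s - ?m)" by (simp add: field_simps)
        finally have "dyad k powr (s - ?m) * (bvol w x (dyad k) powr (1 / q) * bvol \<sigma> x (dyad k) powr (1 - 1 / p))
           \<le> A * unit_ball_vol ?m powr (1 - s / ?m)"
          by (rule powr_mult_le_of_le[OF dyad_pos])
        then have "dyad k powr (s - ?m) \<le> (A * unit_ball_vol ?m powr (1 - s / ?m)) /
            (bvol w x (dyad k) powr (1 / q) * bvol \<sigma> x (dyad k) powr (1 - 1 / p))"
          using b by (subst pos_le_divide_eq) auto
        also have "\<dots> = (A * unit_ball_vol ?m powr (1 - s / ?m)) *
            (bvol w x (dyad k) powr (- (1 / q)) * bvol \<sigma> x (dyad k) powr (- (1 - 1 / p)))"
          by (simp only: powr_minus divide_inverse inverse_mult_distrib)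
        finally have "dyad k powr (s - ?m) \<le> (A * unit_ball_vol ?m powr (1 - s / ?m)) *
            (bvol w x (dyad k) powr (- 1 / q) * bvol \<sigma> x (dyad k) powr (1 / p - 1))"
          by simp
        then have "dyad k powr (s - ?m) * bvol f x (dyad k) \<le> (A * unit_ball_vol ?m powr (1 - s / ?m)) *
            (bvol w x (dyad k) powr (- 1 / q) * bvol \<sigma> x (dyad k) powr (1 / p - 1)) * bvol f x (dyad k)"
          by (intro mult_right_mono) auto
        then show ?thesis by (simp add: normalized_mean_def mult_ac)
      qed
      then have "(\<integral>\<^sup>+k. ennreal (dyad k powr (s - ?m) * bvol f x (dyad k)) \<partial>count_space UNIV)
         \<le> (\<integral>\<^sup>+k. ennreal (A * unit_ball_vol ?m powr (1 - s / ?m)) *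
             ennreal ((bvol w x (dyad k) powr (- 1 / q) * normalized_mean p \<sigma> f x (dyad k)) powr 1) \<partial>count_space UNIV)"
        using A(1) by (intro nn_integral_mono) (simp add: ennreal_leI flip: ennreal_mult)
      also have "\<dots> = ennreal (A * unit_ball_vol ?m powr (1 - s / ?m)) * ?S x"
        by (simp add: nn_integral_cmult)
      finally have "riesz1 s f x \<le> ennreal (2 powr (?m - s)) * (ennreal (A * unit_ball_vol ?m powr (1 - s / ?m)) * ?S x)"
        by (intro order_trans[OF riesz1_le_sum[OF sm f]] mult_left_mono) auto
      also have "\<dots> = ennreal D * ?S x"
        using A(1) by (simp only: D_def mult.assoc[symmetric] ennreal_mult[symmetric] powr_ge_zero mult_nonneg_nonneg less_imp_le)
      finally show ?thesis .
    qed
    have "(\<integral>\<^sup>+x. ennpowr (riesz1 s f x) q \<partial>wm w) \<le> (\<integral>\<^sup>+x. ennreal (D powr q) * ennpowr (?S x) q \<partial>wm w)"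
    proof (intro nn_integral_mono)
      fix x
      have "ennpowr (riesz1 s f x) q \<le> ennpowr (ennreal D * ?S x) q"
        using q by (intro ennpowr_mono pt) auto
      then show "ennpowr (riesz1 s f x) q \<le> ennreal (D powr q) * ennpowr (?S x) q"
        using D by (simp add: ennpowr_mult ennpowr_ennreal)
    qed
    also have "\<dots> = ennreal (D powr q) * (\<integral>\<^sup>+x. ennpowr (?S x) q \<partial>wm w)"
      using D by (intro nn_integral_cmult_real) simp
    also have "\<dots> \<le> ennreal (D powr q) * ennreal (C * nf powr q)"
      using Cb[OF f nf] by (intro mult_left_mono) auto
    also have "\<dots> = ennreal (D powr q * C * nf powr q)"
      using C by (simp add: mult.assoc flip: ennreal_mult)
    finally show "(\<integral>\<^sup>+x. ennpowr (riesz1 s f x) q \<partial>wm w) \<le> ennreal (D powr q * C * nf powr q)" .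
  qed
qed


text \<open>The exponents satisfy 1/q + 1/p1' + 1/p2' = 2 - s/n, so the Muckenhoupt condition
  replaces the power \<open>s - 2n\<close> of the radius by exactly the volumes that normalise the
  two means and the sum.\<close>

theorem riesz2_weighted:
  fixes w \<sigma>1 \<sigma>2 :: "'a::euclidean_space \<Rightarrow> real"
  assumes adm: "adm_weight w" "adm_weight \<sigma>1" "adm_weight \<sigma>2"
    and P: "1 < P1" "1 < P2" and q: "0 < q" and s: "0 < s"
    and pq: "1 / q = 1 / P1 + 1 / P2 - s / real DIM('a)"
    and one: "\<And>x. w x powr (1 / q) * (\<sigma>1 x powr (1 - 1 / P1) * \<sigma>2 x powr (1 - 1 / P2)) = 1"
    and A: "0 < A" "\<And>x r. 0 < r \<Longrightarrow>
      bvol w x r powr (1 / q) * (bvol \<sigma>1 x r powr (1 - 1 / P1) * bvol \<sigma>2 x r powr (1 - 1 / P2))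
      \<le> A * measure lborel (ball x r) powr (2 - s / real DIM('a))"
  shows "\<exists>C>0. \<forall>f g nf ng. loc_int f \<longrightarrow> loc_int g \<longrightarrow> 0 \<le> nf \<longrightarrow> 0 \<le> ng \<longrightarrow>
    wpow P1 \<sigma>1 f \<le> ennreal (nf powr P1) \<longrightarrow> wpow P2 \<sigma>2 g \<le> ennreal (ng powr P2) \<longrightarrow>
    (\<integral>\<^sup>+x. ennpowr (riesz2 s f g x) q \<partial>wm w) \<le> ennreal (C * (nf * ng) powr q)"
proof -
  let ?m = "real DIM('a)"
  have e: "1 / q + (1 - 1 / P1) + (1 - 1 / P2) = 2 - s / ?m" "0 < 1 - 1 / P1" "0 < 1 - 1 / P2" "0 < 1 / q"
    using pq by linarith (use P q in simp_all)
  have sm: "s < 2 * ?m"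
  proof -
    have "0 < 2 - s / ?m" using e(2,3,4) unfolding e(1)[symmetric] by linarith
    then show ?thesis by (simp add: field_simps)
  qed
  define p where "p = 1 / (1 / P1 + 1 / P2)"
  have p: "1 / p = 1 / P1 + 1 / P2" "0 < p"
    using P by (auto simp: p_def intro!: add_pos_pos)
  have "0 < s / ?m" using s by simp
  then have "1 / q < 1 / p" using pq p by linarith
  then have plq: "p < q" using p(2) q by (simp add: field_simps)
  have bnd: "bvol w x r powr (1 / q) * (bvol \<sigma>1 x r powr (1 - 1 / P1) * bvol \<sigma>2 x r powr (1 - 1 / P2))
      \<le> A * measure lborel (ball x r) powr (1 / q + (1 - 1 / P1) + (1 - 1 / P2))" if "0 < r" for x r
    unfolding e(1) by (rule A(2)[OF that])
  \<comment> \<open>The A_infinity criterion speaks about its first weight; it is used three times,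
    each of the three weights taking that place once.\<close>
  have perm: "1 - 1 / P1 + 1 / q + (1 - 1 / P2) = 1 / q + (1 - 1 / P1) + (1 - 1 / P2)"
    "1 - 1 / P2 + 1 / q + (1 - 1 / P1) = 1 / q + (1 - 1 / P1) + (1 - 1 / P2)" by simp_all
  have Aw: "A_inf w"
    by (rule A_inf_of_product[OF adm e(4,2,3) one A(1) bnd])
  have A1: "A_inf \<sigma>1"
    by (rule A_inf_of_product[OF adm(2,1,3) e(2,4,3) _ A(1)])
      (use one bnd in \<open>simp_all only: perm mult.left_commute\<close>)
  have A2: "A_inf \<sigma>2"
    by (rule A_inf_of_product[OF adm(3,1,2) e(3,4,2) _ A(1)])
      (use one bnd in \<open>simp_all only: perm mult_ac\<close>)
  obtain C where C: "0 < C" and Cb: "\<And>f g nf ng. loc_int f \<Longrightarrow> loc_int g \<Longrightarrow> 0 \<le> nf \<Longrightarrow> 0 \<le> ng \<Longrightarrow>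
    wpow P1 \<sigma>1 f \<le> ennreal (nf powr P1) \<Longrightarrow> wpow P2 \<sigma>2 g \<le> ennreal (ng powr P2) \<Longrightarrow>
    (\<integral>\<^sup>+x. ennpowr (\<integral>\<^sup>+k. ennreal ((bvol w x (dyad k) powr (- 1 / q) *
       (normalized_mean P1 \<sigma>1 f x (dyad k) * normalized_mean P2 \<sigma>2 g x (dyad k))) powr 1)
        \<partial>count_space UNIV) (q / 1) \<partial>wm w) \<le> ennreal (C * (nf * ng) powr q)"
    using bilinear_fractional_sum[OF Aw A1 A2 P p(1) plq, of 1] by auto
  define K where "K = A * unit_ball_vol ?m powr (2 - s / ?m)"
  have K: "0 < K" using A by (simp add: K_def)
  define D where "D = 2 powr (2 * ?m - s) * K"
  have D: "0 < D" using K by (simp add: D_def)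
  show ?thesis
  proof (intro exI[of _ "D powr q * C"] conjI allI impI)
    show "0 < D powr q * C" using C D by simp
    fix f g :: "'a \<Rightarrow> real" and nf ng :: real
    assume f: "loc_int f" and g: "loc_int g" and nn: "0 \<le> nf" "0 \<le> ng"
      and wp: "wpow P1 \<sigma>1 f \<le> ennreal (nf powr P1)" "wpow P2 \<sigma>2 g \<le> ennreal (ng powr P2)"
    let ?S = "\<lambda>x. \<integral>\<^sup>+k. ennreal ((bvol w x (dyad k) powr (- 1 / q) *
       (normalized_mean P1 \<sigma>1 f x (dyad k) * normalized_mean P2 \<sigma>2 g x (dyad k))) powr 1) \<partial>count_space UNIV"
    have pt: "riesz2 s f g x \<le> ennreal D * ?S x" for x
    proof -
      have "dyad k powr (s - 2 * ?m) * (bvol f x (dyad k) * bvol g x (dyad k))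
         \<le> K * (bvol w x (dyad k) powr (- 1 / q) *
            (normalized_mean P1 \<sigma>1 f x (dyad k) * normalized_mean P2 \<sigma>2 g x (dyad k)))" for k
      proof -
        let ?W = "bvol w x (dyad k)" and ?S1 = "bvol \<sigma>1 x (dyad k)" and ?S2 = "bvol \<sigma>2 x (dyad k)"
        have b: "0 < ?W" "0 < ?S1" "0 < ?S2"
          using adm by (auto intro: bvol_pos)
        have "?W powr (1 / q) * (?S1 powr (1 - 1 / P1) * ?S2 powr (1 - 1 / P2))
           \<le> K * dyad k powr (?m * (2 - s / ?m))"
          using A(2)[of "dyad k" x] by (simp add: lball_dyad_powr K_def mult_ac)
        also have "?m * (2 - s / ?m) = - (s - 2 * ?m)" by (simp add: field_simps)
        finally have "dyad k powr (s - 2 * ?m) * (?W powr (1 / q) * (?S1 powr (1 - 1 / P1) * ?S2 powr (1 - 1 / P2))) \<le> K"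
          by (rule powr_mult_le_of_le[OF dyad_pos])
        then have "dyad k powr (s - 2 * ?m) \<le> K / (?W powr (1 / q) * (?S1 powr (1 - 1 / P1) * ?S2 powr (1 - 1 / P2)))"
          using b by (subst pos_le_divide_eq) auto
        also have "\<dots> = K * (?W powr (- (1 / q)) * (?S1 powr (- (1 - 1 / P1)) * ?S2 powr (- (1 - 1 / P2))))"
          by (simp only: powr_minus divide_inverse inverse_mult_distrib mult.assoc)
        also have "\<dots> = K * (?W powr (- 1 / q) * (?S1 powr (1 / P1 - 1) * ?S2 powr (1 / P2 - 1)))"
          by simp
        finally have "dyad k powr (s - 2 * ?m) * (bvol f x (dyad k) * bvol g x (dyad k)) \<le>
          K * (?W powr (- 1 / q) * (?S1 powr (1 / P1 - 1) * ?S2 powr (1 / P2 - 1))) * (bvol f x (dyad k) * bvol g x (dyad k))"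
          by (intro mult_right_mono) auto
        then show ?thesis by (simp add: normalized_mean_def mult_ac)
      qed
      then have "(\<integral>\<^sup>+k. ennreal (dyad k powr (s - 2 * ?m) * (bvol f x (dyad k) * bvol g x (dyad k))) \<partial>count_space UNIV)
         \<le> (\<integral>\<^sup>+k. ennreal K * ennreal ((bvol w x (dyad k) powr (- 1 / q) *
       (normalized_mean P1 \<sigma>1 f x (dyad k) * normalized_mean P2 \<sigma>2 g x (dyad k))) powr 1) \<partial>count_space UNIV)"
        using K by (intro nn_integral_mono) (simp add: ennreal_leI flip: ennreal_mult)
      also have "\<dots> = ennreal K * ?S x"
        by (simp add: nn_integral_cmult)
      finally have "riesz2 s f g x \<le> ennreal (2 powr (2 * ?m - s)) * (ennreal K * ?S x)"
        by (intro order_trans[OF riesz2_le_sum[OF sm f g]] mult_left_mono) auto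
      also have "\<dots> = ennreal D * ?S x"
        using K by (simp only: D_def mult.assoc[symmetric] ennreal_mult[symmetric] powr_ge_zero mult_nonneg_nonneg less_imp_le)
      finally show ?thesis .
    qed
    have "(\<integral>\<^sup>+x. ennpowr (riesz2 s f g x) q \<partial>wm w) \<le> (\<integral>\<^sup>+x. ennreal (D powr q) * ennpowr (?S x) q \<partial>wm w)"
    proof (intro nn_integral_mono)
      fix x
      have "ennpowr (riesz2 s f g x) q \<le> ennpowr (ennreal D * ?S x) q"
        using q by (intro ennpowr_mono pt) auto
      then show "ennpowr (riesz2 s f g x) q \<le> ennreal (D powr q) * ennpowr (?S x) q"
        using D by (simp add: ennpowr_mult ennpowr_ennreal)
    qed
    also have "\<dots> = ennreal (D powr q) * (\<integral>\<^sup>+x. ennpowr (?S x) q \<partial>wm w)"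
      using D by (intro nn_integral_cmult_real) simp
    also have "\<dots> \<le> ennreal (D powr q) * ennreal (C * (nf * ng) powr q)"
      using Cb[OF f g nn wp] by (intro mult_left_mono) auto
    also have "\<dots> = ennreal (D powr q * C * (nf * ng) powr q)"
      using C by (simp add: mult.assoc flip: ennreal_mult)
    finally show "(\<integral>\<^sup>+x. ennpowr (riesz2 s f g x) q \<partial>wm w) \<le> ennreal (D powr q * C * (nf * ng) powr q)" .
  qed
qed


section \<open>The sheared bilinear fractional integral\<close>

text \<open>A class of test functions that is closed under the positive powers taken in the Hoelder
  splittings and that lies within the locally integrable functions.\<close>

definition bmf :: "('a::euclidean_space \<Rightarrow> real) \<Rightarrow> bool" where
  "bmf f \<longleftrightarrow> f \<in> borel_measurable borel \<and> (\<exists>B. \<forall>x. 0 \<le> f x \<and> f x \<le> B)"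

lemma bmfD: "bmf f \<Longrightarrow> f \<in> borel_measurable borel" "bmf f \<Longrightarrow> 0 \<le> f x"
  by (auto simp: bmf_def)

lemma bmf_loc_int:
  assumes f: "bmf f"
  shows "loc_int f"
proof -
  obtain B where B: "\<And>x. 0 \<le> f x" "\<And>x. f x \<le> B" and [measurable]: "f \<in> borel_measurable borel"
    using f by (auto simp: bmf_def)
  have "emeasure (wm f) (ball c r) < top" for c r
  proof -
    have "emeasure (wm f) (ball c r) = (\<integral>\<^sup>+x. ennreal (f x) * indicator (ball c r) x \<partial>lborel)"
      by (simp add: emeasure_wm)
    also have "\<dots> \<le> (\<integral>\<^sup>+x. ennreal B * indicator (ball c r) x \<partial>lborel)"
      by (intro nn_integral_mono mult_right_mono ennreal_leI B) auto
    also have "\<dots> = ennreal B * emeasure lborel (ball c r)"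
      by (simp add: nn_integral_cmult_indicator)
    also have "\<dots> < top"
      using emeasure_lborel_ball_finite[of c r] by (simp add: ennreal_mult_less_top)
    finally show ?thesis .
  qed
  then show ?thesis using B by (auto simp: loc_int_def)
qed

lemma bmf_powr:
  assumes f: "bmf f" and a: "0 \<le> a"
  shows "bmf (\<lambda>x. f x powr a)"
proof -
  obtain B where B: "\<And>x. 0 \<le> f x" "\<And>x. f x \<le> B" and [measurable]: "f \<in> borel_measurable borel"
    using f by (auto simp: bmf_def)
  have "f x powr a \<le> B powr a" for x
    using B a by (intro powr_mono2) auto
  then show ?thesis unfolding bmf_def by auto
qed

lemma bmf_1: "bmf (\<lambda>_. 1)"
  by (auto simp: bmf_def)

lemma nn_integral_affine:
  fixes f :: "'a::euclidean_space \<Rightarrow> ennreal"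
  assumes [measurable]: "f \<in> borel_measurable borel" and c: "c \<noteq> 0"
  shows "(\<integral>\<^sup>+x. f x \<partial>lborel) = ennreal (\<bar>c\<bar> ^ DIM('a)) * (\<integral>\<^sup>+x. f (t + c *\<^sub>R x) \<partial>lborel)"
  by (subst lborel_affine[OF c, of t])
    (simp add: nn_integral_density nn_integral_distr nn_integral_cmult)

text \<open>With \<open>y = x - u\<close> the argument of \<open>g\<close> becomes
  \<open>x + t u\<close>, so this is the integral of f(x - u) g(x + t u) |u|^(s - n) over
  \<open>u\<close>.\<close>

definition bil :: "real \<Rightarrow> real \<Rightarrow> ('a::euclidean_space \<Rightarrow> real) \<Rightarrow> ('a \<Rightarrow> real) \<Rightarrow> 'a \<Rightarrow> ennreal" where
  "bil s t f g x = (\<integral>\<^sup>+y. ennreal (f y * g ((1 + t) *\<^sub>R x - t *\<^sub>R y) * norm (x - y) powr (s - real DIM('a))) \<partial>lborel)"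

lemma measurable_bil [measurable]:
  assumes [measurable]: "f \<in> borel_measurable borel" "g \<in> borel_measurable borel"
  shows "bil s t f g \<in> borel_measurable borel"
  unfolding bil_def by measurable

lemma measurable_riesz1 [measurable]:
  assumes [measurable]: "f \<in> borel_measurable borel"
  shows "riesz1 s f \<in> borel_measurable borel"
  unfolding riesz1_def by measurable

text \<open>Hoelder's inequality in \<open>y\<close> with the positive kernel written as
  \<open>k powr l * k powr (1 - l)\<close>. It serves both to separate \<open>f\<close> from
  \<open>g\<close> and to interpolate.\<close>

lemma bil_Holder:
  fixes f g :: "'a::euclidean_space \<Rightarrow> real"
  assumes bm: "bmf f1" "bmf f2" "bmf g1" "bmf g2" and l: "0 < l" "l < 1"
    and f: "\<And>x. f x = f1 x powr l * f2 x powr (1 - l)" and g: "\<And>x. g x = g1 x powr l * g2 x powr (1 - l)"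
  shows "bil s t f g x \<le> ennpowr (bil s t f1 g1 x) l * ennpowr (bil s t f2 g2 x) (1 - l)"
proof -
  note [measurable] = bm[THEN bmfD(1)]
  let ?k = "\<lambda>y. norm (x - y) powr (s - real DIM('a))"
  let ?v = "\<lambda>y. (1 + t) *\<^sub>R x - t *\<^sub>R y"
  have "bil s t f g x = (\<integral>\<^sup>+y. ennpowr (ennreal (f1 y * g1 (?v y) * ?k y)) l *
      ennpowr (ennreal (f2 y * g2 (?v y) * ?k y)) (1 - l) \<partial>lborel)"
    unfolding bil_def
  proof (intro nn_integral_cong)
    fix y
    have "(?k y) powr l * (?k y) powr (1 - l) = ?k y"
      by (simp flip: powr_add)
    then have eq: "f y * g (?v y) * ?k y = (f1 y * g1 (?v y) * ?k y) powr l * (f2 y * g2 (?v y) * ?k y) powr (1 - l)"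
      using bm by (simp add: f g powr_mult bmfD mult_ac)
    have nn: "0 \<le> f1 y * g1 (?v y) * ?k y" "0 \<le> f2 y * g2 (?v y) * ?k y"
      using bm by (simp_all add: bmfD)
    show "ennreal (f y * g (?v y) * ?k y) = ennpowr (ennreal (f1 y * g1 (?v y) * ?k y)) l *
      ennpowr (ennreal (f2 y * g2 (?v y) * ?k y)) (1 - l)"
      by (simp only: eq ennpowr_ennreal[OF nn(1)] ennpowr_ennreal[OF nn(2)] ennreal_mult[OF powr_ge_zero powr_ge_zero])
  qed
  also have "\<dots> \<le> ennpowr (bil s t f1 g1 x) l * ennpowr (bil s t f2 g2 x) (1 - l)"
    unfolding bil_def using l by (intro nn_integral_Holder) measurable
  finally show ?thesis .
qed

lemma bil_1_right: "bil s t f (\<lambda>_. 1) x = riesz1 s f x"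
  by (simp add: bil_def riesz1_def)

text \<open>Substituting z = (1 + t) x - t y gives x - z = - t (x - y); the Jacobian and the
  homogeneity of the kernel combine to the factor |t|^(-s).\<close>

lemma bil_1_left:
  fixes g :: "'a::euclidean_space \<Rightarrow> real"
  assumes g: "bmf g" and t: "t \<noteq> 0"
  shows "bil s t (\<lambda>_. 1) g x = ennreal (\<bar>t\<bar> powr (- s)) * riesz1 s g x"
proof -
  let ?m = "real DIM('a)"
  note [measurable] = bmfD(1)[OF g]
  have "riesz1 s g x = ennreal (\<bar>t\<bar> ^ DIM('a)) *
      (\<integral>\<^sup>+y. ennreal (g ((1 + t) *\<^sub>R x + (- t) *\<^sub>R y) * norm (x - ((1 + t) *\<^sub>R x + (- t) *\<^sub>R y)) powr (s - ?m)) \<partial>lborel)"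
    unfolding riesz1_def using t by (subst nn_integral_affine[of _ "- t" "(1 + t) *\<^sub>R x"]) auto
  also have "(\<integral>\<^sup>+y. ennreal (g ((1 + t) *\<^sub>R x + (- t) *\<^sub>R y) * norm (x - ((1 + t) *\<^sub>R x + (- t) *\<^sub>R y)) powr (s - ?m)) \<partial>lborel)
      = (\<integral>\<^sup>+y. ennreal (\<bar>t\<bar> powr (s - ?m)) * ennreal (1 * g ((1 + t) *\<^sub>R x - t *\<^sub>R y) * norm (x - y) powr (s - ?m)) \<partial>lborel)"
  proof (intro nn_integral_cong)
    fix y
    have "x - ((1 + t) *\<^sub>R x + (- t) *\<^sub>R y) = (- t) *\<^sub>R (x - y)"
      by (simp add: algebra_simps)
    then have "norm (x - ((1 + t) *\<^sub>R x + (- t) *\<^sub>R y)) powr (s - ?m) = \<bar>t\<bar> powr (s - ?m) * norm (x - y) powr (s - ?m)"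
      by (simp add: powr_mult)
    then show "ennreal (g ((1 + t) *\<^sub>R x + (- t) *\<^sub>R y) * norm (x - ((1 + t) *\<^sub>R x + (- t) *\<^sub>R y)) powr (s - ?m))
      = ennreal (\<bar>t\<bar> powr (s - ?m)) * ennreal (1 * g ((1 + t) *\<^sub>R x - t *\<^sub>R y) * norm (x - y) powr (s - ?m))"
      using g by (simp add: bmfD mult_ac flip: ennreal_mult)
  qed
  also have "\<dots> = ennreal (\<bar>t\<bar> powr (s - ?m)) * bil s t (\<lambda>_. 1) g x"
    unfolding bil_def by (intro nn_integral_cmult) measurable
  finally have 1: "riesz1 s g x = ennreal (\<bar>t\<bar> ^ DIM('a)) * (ennreal (\<bar>t\<bar> powr (s - ?m)) * bil s t (\<lambda>_. 1) g x)" .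
  have "\<bar>t\<bar> powr (- s) * (\<bar>t\<bar> ^ DIM('a) * \<bar>t\<bar> powr (s - ?m)) = 1"
    using t by (simp add: powr_realpow[symmetric] powr_add[symmetric])
  then have "ennreal (\<bar>t\<bar> powr (- s)) * (ennreal (\<bar>t\<bar> ^ DIM('a)) * ennreal (\<bar>t\<bar> powr (s - ?m))) = 1"
    by (simp flip: ennreal_mult)
  then show ?thesis
    by (simp add: 1 mult.assoc[symmetric])
qed

text \<open>With l = p / P1 the pair (f, g) is split into (F, 1) and (1, G), where F = f^(1/l) and G
  = g^(1/(1-l)). The operator is then bounded by the powers \<open>l\<close> and
  \<open>1 - l\<close> of two Riesz potentials, each controlled from exponent \<open>p\<close> to
  \<open>q\<close>, and a second use of Hoelder's inequality, in \<open>x\<close>, recombines them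
  with the weights \<open>u1\<close> and \<open>u2\<close>.\<close>

theorem bil_weighted:
  fixes u1 u2 \<sigma>1 \<sigma>2 :: "'a::euclidean_space \<Rightarrow> real"
  assumes adm: "adm_weight u1" "adm_weight u2" and t: "t \<noteq> 0"
    and P: "1 < P1" "1 < P2" and q: "0 < q" and p: "1 / p = 1 / P1 + 1 / P2"
    and b1: "\<exists>C>0. \<forall>f nf. loc_int f \<longrightarrow> 0 \<le> nf \<longrightarrow> wpow p \<sigma>1 f \<le> ennreal (nf powr p) \<longrightarrow>
      (\<integral>\<^sup>+x. ennpowr (riesz1 s f x) q \<partial>wm u1) \<le> ennreal (C * nf powr q)"
    and b2: "\<exists>C>0. \<forall>f nf. loc_int f \<longrightarrow> 0 \<le> nf \<longrightarrow> wpow p \<sigma>2 f \<le> ennreal (nf powr p) \<longrightarrow>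
      (\<integral>\<^sup>+x. ennpowr (riesz1 s f x) q \<partial>wm u2) \<le> ennreal (C * nf powr q)"
  shows "\<exists>C>0. \<forall>f g nf ng. bmf f \<longrightarrow> bmf g \<longrightarrow> 0 \<le> nf \<longrightarrow> 0 \<le> ng \<longrightarrow>
    (\<integral>\<^sup>+x. ennreal (f x powr P1 * \<sigma>1 x powr (1 - p)) \<partial>lborel) \<le> ennreal (nf powr P1) \<longrightarrow>
    (\<integral>\<^sup>+x. ennreal (g x powr P2 * \<sigma>2 x powr (1 - p)) \<partial>lborel) \<le> ennreal (ng powr P2) \<longrightarrow>
    (\<integral>\<^sup>+x. ennpowr (bil s t f g x) q * ennreal (u1 x powr (p / P1) * u2 x powr (p / P2)) \<partial>lborel)
      \<le> ennreal (C * (nf * ng) powr q)"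
proof -
  note [measurable] = adm[THEN adm_weight_measurable]
  have p0: "0 < p"
  proof -
    have "0 < 1 / p" unfolding p using P by (simp add: add_pos_pos)
    then show ?thesis by simp
  qed
  define l where "l = p / P1"
  have l: "0 < l" "l < 1" "1 - l = p / P2" "0 < p / P2"
  proof -
    have "p * (1 / P1 + 1 / P2) = 1" unfolding p[symmetric] using p0 by simp
    then show "1 - l = p / P2" by (simp add: distrib_left l_def)
    moreover show "0 < p / P2" "0 < l" using p0 P by (auto simp: l_def)
    ultimately show "l < 1" by linarith
  qed
  obtain C1 where C1: "0 < C1" "\<And>f nf. loc_int f \<Longrightarrow> 0 \<le> nf \<Longrightarrow> wpow p \<sigma>1 f \<le> ennreal (nf powr p) \<Longrightarrow>
      (\<integral>\<^sup>+x. ennpowr (riesz1 s f x) q \<partial>wm u1) \<le> ennreal (C1 * nf powr q)"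
    using b1 by auto
  obtain C2 where C2: "0 < C2" "\<And>f nf. loc_int f \<Longrightarrow> 0 \<le> nf \<Longrightarrow> wpow p \<sigma>2 f \<le> ennreal (nf powr p) \<Longrightarrow>
      (\<integral>\<^sup>+x. ennpowr (riesz1 s f x) q \<partial>wm u2) \<le> ennreal (C2 * nf powr q)"
    using b2 by auto
  define T where "T = ((\<bar>t\<bar> powr (- s)) powr (1 - l)) powr q"
  have T: "0 < T" using t by (simp add: T_def)
  show ?thesis
  proof (intro exI[of _ "T * (C1 powr l * C2 powr (1 - l))"] conjI allI impI)
    show "0 < T * (C1 powr l * C2 powr (1 - l))" using C1 C2 T by simp
    fix f g :: "'a \<Rightarrow> real" and nf ng :: real
    assume f: "bmf f" and g: "bmf g" and nn: "0 \<le> nf" "0 \<le> ng"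
      and wf: "(\<integral>\<^sup>+x. ennreal (f x powr P1 * \<sigma>1 x powr (1 - p)) \<partial>lborel) \<le> ennreal (nf powr P1)"
      and wg: "(\<integral>\<^sup>+x. ennreal (g x powr P2 * \<sigma>2 x powr (1 - p)) \<partial>lborel) \<le> ennreal (ng powr P2)"
    \<comment> \<open>These powers turn integrability of order \<open>P1\<close> and
      \<open>P2\<close> into order \<open>p\<close>, because p / l = P1 and p / (1 - l) =
      P2.\<close>
    define F where "F x = f x powr (1 / l)" for x
    define G where "G x = g x powr (1 / (1 - l))" for x
    have "0 \<le> 1 / l" "0 \<le> 1 / (1 - l)" using l(1,2) by simp_all
    then have F: "bmf F" and G: "bmf G"
      unfolding F_def G_def by (blast intro: bmf_powr f g)+
    note [measurable] = bmfD(1)[OF F] bmfD(1)[OF G] bmfD(1)[OF f] bmfD(1)[OF g]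
    have pt: "bil s t f g x \<le> ennpowr (riesz1 s F x) l * ennpowr (ennreal (\<bar>t\<bar> powr (- s)) * riesz1 s G x) (1 - l)" for x
    proof -
      have "bil s t f g x \<le> ennpowr (bil s t F (\<lambda>_. 1) x) l * ennpowr (bil s t (\<lambda>_. 1) G x) (1 - l)"
        using l f g by (intro bil_Holder F G bmf_1) (auto simp: F_def G_def powr_powr bmfD)
      then show ?thesis by (simp only: bil_1_right bil_1_left[OF G t])
    qed
    have "wpow p \<sigma>1 F = (\<integral>\<^sup>+x. ennreal (f x powr P1 * \<sigma>1 x powr (1 - p)) \<partial>lborel)"
      using p0 P by (simp add: wpow_def F_def powr_powr l_def)
    then have nF: "(\<integral>\<^sup>+x. ennpowr (riesz1 s F x) q \<partial>wm u1) \<le> ennreal (C1 * (nf powr (1 / l)) powr q)"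
      using wf p0 P by (intro C1(2) bmf_loc_int F) (auto simp: powr_powr l_def)
    have "wpow p \<sigma>2 G = (\<integral>\<^sup>+x. ennreal (g x powr P2 * \<sigma>2 x powr (1 - p)) \<partial>lborel)"
      using p0 P by (simp add: wpow_def G_def powr_powr l)
    then have nG: "(\<integral>\<^sup>+x. ennpowr (riesz1 s G x) q \<partial>wm u2) \<le> ennreal (C2 * (ng powr (1 / (1 - l))) powr q)"
      using wg p0 P by (intro C2(2) bmf_loc_int G) (auto simp: powr_powr l)
    have "(\<integral>\<^sup>+x. ennpowr (bil s t f g x) q * ennreal (u1 x powr (p / P1) * u2 x powr (p / P2)) \<partial>lborel)
        \<le> (\<integral>\<^sup>+x. ennreal T * (ennpowr (ennreal (u1 x) * ennpowr (riesz1 s F x) q) l *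
            ennpowr (ennreal (u2 x) * ennpowr (riesz1 s G x) q) (1 - l)) \<partial>lborel)"
    proof (intro nn_integral_mono)
      fix x
      have "ennpowr (bil s t f g x) q
          \<le> ennpowr (ennpowr (riesz1 s F x) l * ennpowr (ennreal (\<bar>t\<bar> powr (- s)) * riesz1 s G x) (1 - l)) q"
        using q by (intro ennpowr_mono pt) auto
      also have "\<dots> = ennreal T * (ennpowr (riesz1 s F x) (q * l) * ennpowr (riesz1 s G x) (q * (1 - l)))"
        by (simp add: ennpowr_mult ennpowr_ennpowr T_def ennpowr_ennreal mult_ac)
      finally have le: "ennpowr (bil s t f g x) q \<le> ennreal T * (ennpowr (riesz1 s F x) (q * l) * ennpowr (riesz1 s G x) (q * (1 - l)))" .
      have u: "ennreal (u1 x powr (p / P1) * u2 x powr (p / P2)) = ennpowr (ennreal (u1 x)) l * ennpowr (ennreal (u2 x)) (1 - l)"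
        using adm_weight_nonneg[OF adm(1), of x] adm_weight_nonneg[OF adm(2), of x]
        by (simp add: ennpowr_ennreal ennreal_mult l(3) l_def[symmetric])
      have "ennpowr (bil s t f g x) q * ennreal (u1 x powr (p / P1) * u2 x powr (p / P2))
         \<le> ennreal T * (ennpowr (riesz1 s F x) (q * l) * ennpowr (riesz1 s G x) (q * (1 - l))) *
            (ennpowr (ennreal (u1 x)) l * ennpowr (ennreal (u2 x)) (1 - l))"
        unfolding u by (intro mult_right_mono le) auto
      also have "\<dots> = ennreal T * (ennpowr (ennreal (u1 x) * ennpowr (riesz1 s F x) q) l *
            ennpowr (ennreal (u2 x) * ennpowr (riesz1 s G x) q) (1 - l))"
        by (simp add: ennpowr_mult ennpowr_ennpowr mult_ac)
      finally show "ennpowr (bil s t f g x) q * ennreal (u1 x powr (p / P1) * u2 x powr (p / P2)) \<le>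
         ennreal T * (ennpowr (ennreal (u1 x) * ennpowr (riesz1 s F x) q) l *
            ennpowr (ennreal (u2 x) * ennpowr (riesz1 s G x) q) (1 - l))" .
    qed
    also have "\<dots> = ennreal T * (\<integral>\<^sup>+x. ennpowr (ennreal (u1 x) * ennpowr (riesz1 s F x) q) l *
            ennpowr (ennreal (u2 x) * ennpowr (riesz1 s G x) q) (1 - l) \<partial>lborel)"
      by (intro nn_integral_cmult) measurable
    also have "\<dots> \<le> ennreal T * (ennpowr (\<integral>\<^sup>+x. ennreal (u1 x) * ennpowr (riesz1 s F x) q \<partial>lborel) l *
        ennpowr (\<integral>\<^sup>+x. ennreal (u2 x) * ennpowr (riesz1 s G x) q \<partial>lborel) (1 - l))"
      using l by (intro mult_left_mono nn_integral_Holder) auto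
    also have "\<dots> = ennreal T * (ennpowr (\<integral>\<^sup>+x. ennpowr (riesz1 s F x) q \<partial>wm u1) l *
        ennpowr (\<integral>\<^sup>+x. ennpowr (riesz1 s G x) q \<partial>wm u2) (1 - l))"
      by (simp add: nn_integral_wm)
    also have "\<dots> \<le> ennreal T * (ennpowr (ennreal (C1 * (nf powr (1 / l)) powr q)) l *
        ennpowr (ennreal (C2 * (ng powr (1 / (1 - l))) powr q)) (1 - l))"
      using l by (intro mult_left_mono mult_mono ennpowr_mono nF nG) auto
    also have "\<dots> = ennreal (T * (C1 powr l * C2 powr (1 - l)) * (nf * ng) powr q)"
    proof -
      have "(C1 * (nf powr (1 / l)) powr q) powr l = C1 powr l * nf powr q"
        using C1 l by (simp add: powr_mult powr_powr)
      moreover have "(C2 * (ng powr (1 / (1 - l))) powr q) powr (1 - l) = C2 powr (1 - l) * ng powr q"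
        using C2 l(1,2) by (simp add: powr_mult powr_powr)
      ultimately show ?thesis
        using C1 C2 T nn by (simp add: ennpowr_ennreal powr_mult mult_ac flip: ennreal_mult)
    qed
    finally show "(\<integral>\<^sup>+x. ennpowr (bil s t f g x) q * ennreal (u1 x powr (p / P1) * u2 x powr (p / P2)) \<partial>lborel)
      \<le> ennreal (T * (C1 powr l * C2 powr (1 - l)) * (nf * ng) powr q)" .
  qed
qed

section \<open>Unweighted bounds for the sheared operator\<close>

definition bil_bounded :: "'a::euclidean_space itself \<Rightarrow> real \<Rightarrow> real \<Rightarrow> real \<Rightarrow> real \<Rightarrow> real \<Rightarrow> bool" where
  "bil_bounded (_ :: 'a itself) s t P1 P2 q \<longleftrightarrow> (\<exists>C>0. \<forall>f g nf ng.
    bmf (f :: 'a \<Rightarrow> real) \<longrightarrow> bmf g \<longrightarrow> 0 \<le> nf \<longrightarrow> 0 \<le> ng \<longrightarrow>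
    (\<integral>\<^sup>+x. ennreal (f x powr P1) \<partial>lborel) \<le> ennreal (nf powr P1) \<longrightarrow>
    (\<integral>\<^sup>+x. ennreal (g x powr P2) \<partial>lborel) \<le> ennreal (ng powr P2) \<longrightarrow>
    (\<integral>\<^sup>+x. ennpowr (bil s t f g x) q \<partial>lborel) \<le> ennreal (C * (nf * ng) powr q))"

lemma wm_1: "wm (\<lambda>_. 1) = lborel"
  by (simp add: wm_def density_1)

text \<open>For constant weights the Muckenhoupt condition is an equality with constant 1, so the
  weighted Hoelder splitting applies directly.\<close>

lemma bil_bounded_large_p:
  assumes t: "t \<noteq> 0" and P: "1 < P1" "1 < P2" and q: "0 < q" and s: "0 < s"
    and p: "1 / P1 + 1 / P2 < 1" and pq: "1 / q = 1 / P1 + 1 / P2 - s / real DIM('a)"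
  shows "bil_bounded TYPE('a::euclidean_space) s t P1 P2 q"
proof -
  define p' where "p' = 1 / (1 / P1 + 1 / P2)"
  have p': "1 / p' = 1 / P1 + 1 / P2" by (simp add: p'_def)
  have pos: "0 < 1 / P1 + 1 / P2" using P by (simp add: add_pos_pos)
  then have p1: "1 < p'" using p by (simp add: p'_def)
  have e: "1 / q + (1 - 1 / p') = 1 - s / real DIM('a)" using pq p' by simp
  have "\<exists>C>0. \<forall>f nf. loc_int (f :: 'a \<Rightarrow> real) \<longrightarrow> 0 \<le> nf \<longrightarrow> wpow p' (\<lambda>_. 1) f \<le> ennreal (nf powr p') \<longrightarrow>
    (\<integral>\<^sup>+x. ennpowr (riesz1 s f x) q \<partial>wm (\<lambda>_. 1)) \<le> ennreal (C * nf powr q)"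
  proof (rule riesz1_weighted[where A=1])
    fix x :: 'a and r :: real assume r: "0 < r"
    have "bvol (\<lambda>_. 1) x r powr (1 / q) * bvol (\<lambda>_. 1) x r powr (1 - 1 / p')
      = measure lborel (ball x r) powr (1 - s / real DIM('a))"
      by (simp only: bvol_1 powr_add[symmetric] e)
    then show "bvol (\<lambda>_. 1) x r powr (1 / q) * bvol (\<lambda>_. 1) x r powr (1 - 1 / p')
      \<le> 1 * measure lborel (ball x r) powr (1 - s / real DIM('a))" by simp
  qed (use adm_weight_1 p1 q s pq p' in auto)
  from bil_weighted[OF adm_weight_1 adm_weight_1 t P q p' this this] show ?thesis
    unfolding bil_bounded_def by simp
qed


text \<open>Each term is a^q times (a^q)^(1/q - 1), and the second factor is at most the same power
  of the whole sum of \<open>q\<close>-th powers.\<close>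

lemma ennpowr_count_int_le:
  fixes a :: "'i \<Rightarrow> ennreal"
  assumes q: "0 < q" "q \<le> 1"
  shows "ennpowr (\<integral>\<^sup>+k. a k \<partial>count_space UNIV) q \<le> (\<integral>\<^sup>+k. ennpowr (a k) q \<partial>count_space UNIV)"
proof -
  let ?S = "\<integral>\<^sup>+k. ennpowr (a k) q \<partial>count_space UNIV"
  have pt: "a k \<le> ennpowr (a k) q * ennpowr ?S (1 / q - 1)" for k
  proof -
    have "ennpowr (a k) q \<le> ?S"
      by (rule nn_integral_ge_point) simp
    then have "ennpowr (ennpowr (a k) q) (1 / q - 1) \<le> ennpowr ?S (1 / q - 1)"
      using q by (intro ennpowr_mono) auto
    then have "ennpowr (a k) q * ennpowr (ennpowr (a k) q) (1 / q - 1) \<le> ennpowr (a k) q * ennpowr ?S (1 / q - 1)"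
      by (intro mult_left_mono) auto
    moreover have "ennpowr (a k) q * ennpowr (ennpowr (a k) q) (1 / q - 1) = a k"
    proof -
      have "q + q * (1 / q - 1) = 1" using q by (simp add: field_simps)
      then show ?thesis by (simp only: ennpowr_ennpowr ennpowr_add ennpowr_one)
    qed
    ultimately show ?thesis by simp
  qed
  have "(\<integral>\<^sup>+k. a k \<partial>count_space UNIV) \<le> (\<integral>\<^sup>+k. ennpowr (a k) q * ennpowr ?S (1 / q - 1) \<partial>count_space UNIV)"
    by (intro nn_integral_mono pt)
  also have "\<dots> = ?S * ennpowr ?S (1 / q - 1)"
    by (intro nn_integral_multc) simp
  also have "\<dots> = ennpowr ?S (1 / q)"
    using ennpowr_add[of ?S 1 "1 / q - 1"] by simp
  finally have "ennpowr (\<integral>\<^sup>+k. a k \<partial>count_space UNIV) q \<le> ennpowr (ennpowr ?S (1 / q)) q"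
    using q by (intro ennpowr_mono) auto
  then show ?thesis using q by (simp add: ennpowr_ennpowr)
qed

lemma emeasure_lborel_ball_eq: "emeasure lborel (ball c r) = ennreal (measure lborel (ball (c :: 'a::euclidean_space) r))"
  using emeasure_lborel_ball_finite[of c r] by (intro emeasure_eq_ennreal_measure) auto

lemma lball_center: "measure lborel (ball (c :: 'a::euclidean_space) r) = measure lborel (ball (0 :: 'a) r)"
  by (cases "0 \<le> r") (auto simp: content_ball ball_empty)

text \<open>Jensen's inequality for the concave power \<open>q \<le> 1\<close>, averaged over the centres of the balls.\<close>

lemma nn_integral_ennpowr_le_local_means:
  fixes \<phi> :: "'a::euclidean_space \<Rightarrow> ennreal"
  assumes [measurable]: "\<phi> \<in> borel_measurable borel" and q: "0 < q" "q \<le> 1" and r: "0 < r"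
  shows "(\<integral>\<^sup>+x. ennpowr (\<phi> x) q \<partial>lborel) \<le>
    (\<integral>\<^sup>+z. ennpowr (ennreal (1 / measure lborel (ball (0::'a) r)) * (\<integral>\<^sup>+x. \<phi> x * indicator (ball z r) x \<partial>lborel)) q \<partial>lborel)"
proof -
  let ?V = "measure lborel (ball (0::'a) r)"
  have V: "0 < ?V" by (rule lball_pos[OF r])
  have ball_sym: "indicator (ball z r) x = (indicator (ball x r) z :: ennreal)" for z x :: 'a
    by (auto simp: dist_commute split: split_indicator)
  have [measurable]: "(\<lambda>p. indicator (ball (snd p) r) (fst p) :: ennreal) \<in> borel_measurable (borel \<Otimes>\<^sub>M (borel :: 'a measure))"
    unfolding indicator_def mem_ball by measurable
  have [measurable]: "(\<lambda>p. indicator (ball (fst p) r) (snd p) :: ennreal) \<in> borel_measurable (borel \<Otimes>\<^sub>M (borel :: 'a measure))"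
    unfolding indicator_def mem_ball by measurable
  have one: "(\<integral>\<^sup>+x. ennpowr (\<phi> x) q * indicator (ball z r) x \<partial>lborel)
     \<le> ennreal ?V * ennpowr (ennreal (1 / ?V) * (\<integral>\<^sup>+x. \<phi> x * indicator (ball z r) x \<partial>lborel)) q" for z
  proof (cases "q = 1")
    case True
    have "ennreal ?V * ennreal (1 / ?V) = 1" using V by (simp flip: ennreal_mult)
    then show ?thesis using True by (simp flip: mult.assoc)
  next
    case False
    then have q': "q < 1" using q by simp
    have "(\<integral>\<^sup>+x. ennpowr (\<phi> x) q * indicator (ball z r) x \<partial>lborel)
        = (\<integral>\<^sup>+x. ennpowr (\<phi> x * indicator (ball z r) x) q * ennpowr (indicator (ball z r) x) (1 - q) \<partial>lborel)"
      by (intro nn_integral_cong) (auto split: split_indicator)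
    also have "\<dots> \<le> ennpowr (\<integral>\<^sup>+x. \<phi> x * indicator (ball z r) x \<partial>lborel) q * ennpowr (\<integral>\<^sup>+x. indicator (ball z r) x \<partial>lborel) (1 - q)"
      using q q' by (intro nn_integral_Holder) auto
    also have "(\<integral>\<^sup>+x. indicator (ball z r) x \<partial>lborel) = ennreal ?V"
      by (simp add: emeasure_lborel_ball_eq lball_center[of z])
    also have "ennpowr (ennreal ?V) (1 - q) = ennreal (?V powr (1 - q))"
      by (simp add: ennpowr_ennreal)
    also have "?V powr (1 - q) = ?V * (1 / ?V) powr q"
      using V by (simp add: powr_diff powr_divide)
    also have "ennreal (?V * (1 / ?V) powr q) = ennreal ?V * ennpowr (ennreal (1 / ?V)) q"
      using V by (simp add: ennpowr_ennreal ennreal_mult)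
    finally show ?thesis
      by (simp add: ennpowr_mult mult_ac)
  qed
  \<comment> \<open>The volume of the ball is written as the integral over all centres
    \<open>z\<close> within distance \<open>r\<close> of \<open>x\<close>; Tonelli's theorem then
    makes \<open>z\<close> the outer variable.\<close>
  have "ennreal ?V * (\<integral>\<^sup>+x. ennpowr (\<phi> x) q \<partial>lborel) = (\<integral>\<^sup>+x. ennpowr (\<phi> x) q * ennreal ?V \<partial>lborel)"
    by (simp add: nn_integral_multc mult.commute)
  also have "\<dots> = (\<integral>\<^sup>+x. \<integral>\<^sup>+z. ennpowr (\<phi> x) q * indicator (ball x r) z \<partial>lborel \<partial>lborel)"
  proof (intro nn_integral_cong)
    fix x
    show "ennpowr (\<phi> x) q * ennreal ?V = (\<integral>\<^sup>+z. ennpowr (\<phi> x) q * indicator (ball x r) z \<partial>lborel)"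
      by (simp add: nn_integral_cmult_indicator emeasure_lborel_ball_eq lball_center[of x])
  qed
  also have "\<dots> = (\<integral>\<^sup>+z. \<integral>\<^sup>+x. ennpowr (\<phi> x) q * indicator (ball x r) z \<partial>lborel \<partial>lborel)"
    by (intro lborel_pair.Fubini') (simp add: split_beta')
  also have "\<dots> = (\<integral>\<^sup>+z. \<integral>\<^sup>+x. ennpowr (\<phi> x) q * indicator (ball z r) x \<partial>lborel \<partial>lborel)"
    by (simp add: ball_sym)
  also have "\<dots> \<le> (\<integral>\<^sup>+z. ennreal ?V * ennpowr (ennreal (1 / ?V) * (\<integral>\<^sup>+x. \<phi> x * indicator (ball z r) x \<partial>lborel)) q \<partial>lborel)"
    by (intro nn_integral_mono one)
  also have "\<dots> = ennreal ?V * (\<integral>\<^sup>+z. ennpowr (ennreal (1 / ?V) * (\<integral>\<^sup>+x. \<phi> x * indicator (ball z r) x \<partial>lborel)) q \<partial>lborel)"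
    using V by (rule nn_integral_cmult_real)
  finally have le: "ennreal ?V * (\<integral>\<^sup>+x. ennpowr (\<phi> x) q \<partial>lborel) \<le>
     ennreal ?V * (\<integral>\<^sup>+z. ennpowr (ennreal (1 / ?V) * (\<integral>\<^sup>+x. \<phi> x * indicator (ball z r) x \<partial>lborel)) q \<partial>lborel)" .
  have inv: "ennreal (1 / ?V) * (ennreal ?V * A) = A" for A
  proof -
    have "ennreal (1 / ?V) * ennreal ?V = 1" using V by (simp flip: ennreal_mult)
    then show ?thesis by (metis mult.assoc mult_1)
  qed
  show ?thesis
    using mult_left_mono[OF le, of "ennreal (1 / ?V)"] unfolding inv by simp
qed

definition bil_loc :: "real \<Rightarrow> ('a::euclidean_space \<Rightarrow> real) \<Rightarrow> ('a \<Rightarrow> real) \<Rightarrow> real \<Rightarrow> 'a \<Rightarrow> ennreal" where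
  "bil_loc t f g r x = (\<integral>\<^sup>+y. ennreal (f y * g ((1 + t) *\<^sub>R x - t *\<^sub>R y)) * indicator {0<..<r} (norm (x - y)) \<partial>lborel)"

lemma measurable_bil_loc [measurable]:
  assumes [measurable]: "f \<in> borel_measurable borel" "g \<in> borel_measurable borel"
  shows "bil_loc t f g r \<in> borel_measurable borel"
  unfolding bil_loc_def by measurable

lemma bil_le_sum:
  fixes f g :: "'a::euclidean_space \<Rightarrow> real"
  assumes s: "s < real DIM('a)" and f: "bmf f" and g: "bmf g"
  shows "bil s t f g x \<le> ennreal (2 powr (real DIM('a) - s)) *
    (\<integral>\<^sup>+k. ennreal (dyad k powr (s - real DIM('a))) * bil_loc t f g (dyad k) x \<partial>count_space UNIV)"
proof -
  let ?e = "s - real DIM('a)"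
  let ?h = "\<lambda>y. f y * g ((1 + t) *\<^sub>R x - t *\<^sub>R y)"
  note [measurable] = bmfD(1)[OF f] bmfD(1)[OF g]
  have h: "0 \<le> ?h y" for y using f g by (simp add: bmfD)
  have pt: "ennreal (?h y * norm (x - y) powr ?e) \<le>
      (\<integral>\<^sup>+k. ennreal (2 powr (- ?e)) * (ennreal (dyad k powr ?e) * (ennreal (?h y) * indicator {0<..<dyad k} (norm (x - y)))) \<partial>count_space UNIV)" for y
  proof (cases "x = y")
    case False
    have "ennreal (?h y * norm (x - y) powr ?e) = ennreal (?h y) * ennreal (norm (x - y) powr ?e)"
      using h by (simp only: ennreal_mult powr_ge_zero)
    also have "\<dots> \<le> ennreal (?h y) * (ennreal (2 powr (- ?e)) *
      (\<integral>\<^sup>+k. ennreal (dyad k powr ?e) * indicator {k. norm (x - y) < dyad k} k \<partial>count_space UNIV))"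
      using False s by (intro mult_left_mono powr_le_dyadic_sum) auto
    also have "\<dots> = (\<integral>\<^sup>+k. ennreal (?h y) * (ennreal (2 powr (- ?e)) * (ennreal (dyad k powr ?e) * indicator {k. norm (x - y) < dyad k} k)) \<partial>count_space UNIV)"
      by (simp add: nn_integral_cmult)
    also have "\<dots> = (\<integral>\<^sup>+k. ennreal (2 powr (- ?e)) * (ennreal (dyad k powr ?e) * (ennreal (?h y) * indicator {0<..<dyad k} (norm (x - y)))) \<partial>count_space UNIV)"
      using False by (intro nn_integral_cong) (auto simp: mult_ac split: split_indicator)
    finally show ?thesis .
  qed simp
  have "bil s t f g x \<le> (\<integral>\<^sup>+y. \<integral>\<^sup>+k. ennreal (2 powr (- ?e)) * (ennreal (dyad k powr ?e) *
      (ennreal (?h y) * indicator {0<..<dyad k} (norm (x - y)))) \<partial>count_space UNIV \<partial>lborel)"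
    unfolding bil_def by (intro nn_integral_mono pt)
  also have "\<dots> = (\<integral>\<^sup>+k. \<integral>\<^sup>+y. ennreal (2 powr (- ?e)) * (ennreal (dyad k powr ?e) *
      (ennreal (?h y) * indicator {0<..<dyad k} (norm (x - y)))) \<partial>lborel \<partial>count_space UNIV)"
    by (intro nn_integral_count_int) measurable
  also have "\<dots> = (\<integral>\<^sup>+k. ennreal (2 powr (- ?e)) * (ennreal (dyad k powr ?e) * bil_loc t f g (dyad k) x) \<partial>count_space UNIV)"
    by (simp add: nn_integral_cmult bil_loc_def)
  finally show ?thesis
    by (simp add: nn_integral_cmult)
qed

text \<open>Averaging over \<open>x\<close> decouples the two functions: for fixed \<open>y\<close>
  the map from \<open>x\<close> to (1 + t) x - t y is an affine change of variables with Jacobian |1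
  + t|^n, nonzero because t \<noteq> - 1. The enlargement \<open>L\<close> keeps both arguments in
  one ball: y is within 2 r of \<open>z\<close>, and the argument of \<open>g\<close> within (2 +
  |t|) r.\<close>

lemma bil_loc_mean:
  fixes f g :: "'a::euclidean_space \<Rightarrow> real"
  assumes t: "t \<noteq> - 1" and f: "bmf f" and g: "bmf g" and r: "0 < r" and L: "2 + \<bar>t\<bar> \<le> L"
  shows "(\<integral>\<^sup>+x. bil_loc t f g r x * indicator (ball z r) x \<partial>lborel)
    \<le> ennreal (1 / \<bar>1 + t\<bar> ^ DIM('a)) * ennreal (bvol f z (L * r) * bvol g z (L * r))"
proof -
  note [measurable] = bmfD(1)[OF f] bmfD(1)[OF g]
  let ?v = "\<lambda>x y. - (t *\<^sub>R y) + (1 + t) *\<^sub>R x"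
  let ?B = "ball z (L * r)"
  let ?G = "\<lambda>v. ennreal (g v) * indicator ?B v"
  have pt: "ennreal (f y * g ((1 + t) *\<^sub>R x - t *\<^sub>R y)) * indicator {0<..<r} (norm (x - y)) * indicator (ball z r) x
     \<le> ennreal (f y) * indicator ?B y * ?G (?v x y)" for x y
  proof (cases "norm (x - y) < r \<and> x \<in> ball z r")
    case True
    then have xy: "norm (x - y) < r" "norm (x - z) < r"
      by (auto simp: dist_norm norm_minus_commute)
    have L2: "2 * r \<le> L * r" "(2 + \<bar>t\<bar>) * r \<le> L * r" using r L by (auto intro!: mult_right_mono)
    have "norm (y - z) \<le> norm (x - z) + norm (x - y)"
      using norm_triangle_ineq4[of "x - z" "x - y"] by simp
    then have "y \<in> ?B" using xy L2 by (simp add: dist_norm norm_minus_commute)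
    have "?v x y - z = (x - z) + t *\<^sub>R (x - y)" by (simp add: algebra_simps)
    then have "norm (?v x y - z) \<le> norm (x - z) + \<bar>t\<bar> * norm (x - y)"
      by (metis norm_scaleR norm_triangle_ineq)
    also have "\<dots> < r + (1 + \<bar>t\<bar>) * r"
    proof -
      have "\<bar>t\<bar> * norm (x - y) \<le> \<bar>t\<bar> * r" using xy by (intro mult_left_mono) auto
      then show ?thesis using xy r by (simp add: algebra_simps)
    qed
    also have "\<dots> \<le> L * r" using L2 by (simp add: algebra_simps)
    finally have "?v x y \<in> ?B" by (simp add: dist_norm norm_minus_commute)
    then show ?thesis
      using True \<open>y \<in> ?B\<close> f g by (auto simp: bmfD ennreal_mult add.commute split: split_indicator)
  next
    case False
    then have "indicator {0<..<r} (norm (x - y)) * (indicator (ball z r) x :: ennreal) = 0"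
      by (auto split: split_indicator)
    then show ?thesis by (simp only: mult.assoc mult_zero_right zero_le)
  qed
  have "(\<integral>\<^sup>+x. bil_loc t f g r x * indicator (ball z r) x \<partial>lborel)
      = (\<integral>\<^sup>+x. \<integral>\<^sup>+y. ennreal (f y * g ((1 + t) *\<^sub>R x - t *\<^sub>R y)) * indicator {0<..<r} (norm (x - y)) * indicator (ball z r) x \<partial>lborel \<partial>lborel)"
    unfolding bil_loc_def by (simp add: nn_integral_multc)
  also have "\<dots> \<le> (\<integral>\<^sup>+x. \<integral>\<^sup>+y. ennreal (f y) * indicator ?B y * ?G (?v x y) \<partial>lborel \<partial>lborel)"
    by (intro nn_integral_mono pt)
  also have "\<dots> = (\<integral>\<^sup>+y. \<integral>\<^sup>+x. ennreal (f y) * indicator ?B y * ?G (?v x y) \<partial>lborel \<partial>lborel)"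
    by (intro lborel_pair.Fubini') measurable
  also have "\<dots> = (\<integral>\<^sup>+y. ennreal (f y) * indicator ?B y * (ennreal (1 / \<bar>1 + t\<bar> ^ DIM('a)) * ennreal (bvol g z (L * r))) \<partial>lborel)"
  proof (intro nn_integral_cong)
    fix y
    have c: "1 + t \<noteq> 0" using t by auto
    have "ennreal (bvol g z (L * r)) = (\<integral>\<^sup>+v. ?G v \<partial>lborel)"
      by (rule nn_integral_ball_loc_int[OF bmf_loc_int[OF g], symmetric])
    also have "\<dots> = ennreal (\<bar>1 + t\<bar> ^ DIM('a)) * (\<integral>\<^sup>+x. ?G (?v x y) \<partial>lborel)"
      using c by (intro nn_integral_affine) auto
    finally have "ennreal (1 / \<bar>1 + t\<bar> ^ DIM('a)) * ennreal (bvol g z (L * r)) = ennreal (1 / \<bar>1 + t\<bar> ^ DIM('a)) * ennreal (\<bar>1 + t\<bar> ^ DIM('a)) * (\<integral>\<^sup>+x. ?G (?v x y) \<partial>lborel)"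
      by (simp add: mult.assoc)
    also have "ennreal (1 / \<bar>1 + t\<bar> ^ DIM('a)) * ennreal (\<bar>1 + t\<bar> ^ DIM('a)) = 1"
      using c by (simp flip: ennreal_mult)
    finally show "(\<integral>\<^sup>+x. ennreal (f y) * indicator ?B y * ?G (?v x y) \<partial>lborel)
       = ennreal (f y) * indicator ?B y * (ennreal (1 / \<bar>1 + t\<bar> ^ DIM('a)) * ennreal (bvol g z (L * r)))"
      by (simp add: nn_integral_cmult)
  qed
  also have "\<dots> = ennreal (bvol f z (L * r)) * (ennreal (1 / \<bar>1 + t\<bar> ^ DIM('a)) * ennreal (bvol g z (L * r)))"
    by (simp add: nn_integral_multc nn_integral_ball_loc_int[OF bmf_loc_int[OF f]])
  finally show ?thesis by (simp add: ennreal_mult mult_ac)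
qed


lemma A_inf_1: "A_inf (\<lambda>x::'a::euclidean_space. 1)"
  by (rule A_inf_of_product[OF adm_weight_1 adm_weight_1 adm_weight_1, of 1 1 1 1])
    (auto simp: bvol_1 powr_add mult.assoc power3_eq_cube)

lemma dyad_add: "dyad (k + l) = dyad k * dyad l"
  by (simp add: dyad_def powr_add)

lemma nn_integral_int_shift:
  "(\<integral>\<^sup>+k. h (k + l) \<partial>count_space UNIV) = (\<integral>\<^sup>+k. h k \<partial>count_space (UNIV :: int set))"
  by (rule nn_integral_bij_count_space) (auto intro!: bij_betw_byWitness[where f'="\<lambda>k. k - l"])

text \<open>For q \<le> 1 the power can be taken inside the dyadic sum, and at each scale Jensen's
  inequality replaces the operator by its local means, which are products of averages of
  \<open>f\<close> and \<open>g\<close>. What remains is the Hedberg sum with \<rho> = q, so that no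
  outer power is left, and scales and space can be exchanged freely.\<close>

proposition bil_bounded_small_q:
  assumes t: "t \<noteq> - 1" and P: "1 < P1" "1 < P2" and q: "0 < q" "q \<le> 1" and s: "0 < s" "s < real DIM('a)"
    and pq: "1 / q = 1 / P1 + 1 / P2 - s / real DIM('a)"
  shows "bil_bounded TYPE('a::euclidean_space) s t P1 P2 q"
proof -
  let ?m = "real DIM('a)"
  let ?U = "unit_ball_vol ?m"
  define p where "p = 1 / (1 / P1 + 1 / P2)"
  have p: "1 / p = 1 / P1 + 1 / P2" "0 < p"
    using P by (auto simp: p_def intro!: add_pos_pos)
  have "0 < s / ?m" using s by simp
  then have "1 / q < 1 / p" using pq p by linarith
  then have plq: "p < q" using p(2) q by (simp add: field_simps)
  obtain C where C: "0 < C" and Cb: "\<And>f g nf ng. loc_int f \<Longrightarrow> loc_int g \<Longrightarrow> 0 \<le> nf \<Longrightarrow> 0 \<le> ng \<Longrightarrow>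
    wpow P1 (\<lambda>_. 1) f \<le> ennreal (nf powr P1) \<Longrightarrow> wpow P2 (\<lambda>_. 1) g \<le> ennreal (ng powr P2) \<Longrightarrow>
    (\<integral>\<^sup>+x. ennpowr (\<integral>\<^sup>+k. ennreal ((bvol (\<lambda>_. 1) x (dyad k) powr (- 1 / q) *
       (normalized_mean P1 (\<lambda>_. 1) f x (dyad k) * normalized_mean P2 (\<lambda>_. 1) g x (dyad k))) powr q)
        \<partial>count_space UNIV) (q / q) \<partial>wm (\<lambda>_::'a. 1)) \<le> ennreal (C * (nf * ng) powr q)"
    using bilinear_fractional_sum[OF A_inf_1 A_inf_1 A_inf_1 P p(1) plq q(1), where 'a='a] by auto
  \<comment> \<open>The enlargement of the balls is rounded up to a power of 2, so that it becomes a
    shift of the dyadic index by \<open>l\<close>.\<close>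
  obtain l :: nat where l: "2 + \<bar>t\<bar> < 2 ^ l"
    using real_arch_pow[of 2 "2 + \<bar>t\<bar>"] by auto
  then have L: "2 + \<bar>t\<bar> \<le> dyad (int l)"
    by (simp add: dyad_def powr_realpow)
  let ?L = "dyad (int l)"
  define c1 where "c1 = 2 powr (?m - s)"
  define c2 where "c2 = 1 / ?U * (1 / \<bar>1 + t\<bar> ^ DIM('a))"
  \<comment> \<open>\<open>c1\<close> comes from the dyadic decomposition, \<open>c2\<close> from
    the mean over the unit ball and the Jacobian; the last two factors convert the power of the
    original radius into volumes of the enlarged ball.\<close>
  define K where "K = c1 * c2 * ?L powr (2 * ?m - s) * ?U powr (2 - s / ?m)"
  have cpos: "0 < c1" "0 < c2" "0 < K"
  proof -
    have "0 < ?U" "0 < \<bar>1 + t\<bar> ^ DIM('a)" using t by auto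
    then show "0 < c1" "0 < c2" by (auto simp: c1_def c2_def)
    then show "0 < K" by (simp add: K_def less_imp_neq[OF dyad_pos, THEN not_sym])
  qed
  show ?thesis
    unfolding bil_bounded_def
  proof (intro exI[of _ "K powr q * C"] conjI allI impI)
    show "0 < K powr q * C" using C cpos by simp
    fix f g :: "'a \<Rightarrow> real" and nf ng :: real
    assume f: "bmf f" and g: "bmf g" and nn: "0 \<le> nf" "0 \<le> ng"
      and wf: "(\<integral>\<^sup>+x. ennreal (f x powr P1) \<partial>lborel) \<le> ennreal (nf powr P1)"
      and wg: "(\<integral>\<^sup>+x. ennreal (g x powr P2) \<partial>lborel) \<le> ennreal (ng powr P2)"
    note [measurable] = bmfD(1)[OF f] bmfD(1)[OF g]
    let ?X = "\<lambda>k x. bvol (\<lambda>_. 1) x (dyad k) powr (- 1 / q) *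
       (normalized_mean P1 (\<lambda>_. 1) f x (dyad k) * normalized_mean P2 (\<lambda>_. 1) g x (dyad k))"
    have loc: "(\<integral>\<^sup>+x. ennpowr (ennreal c1 * (ennreal (dyad k powr (s - ?m)) * bil_loc t f g (dyad k) x)) q \<partial>lborel)
       \<le> (\<integral>\<^sup>+z. ennreal (K powr q) * ennreal (?X (k + int l) z powr q) \<partial>lborel)" for k
    proof -
      let ?d = "dyad k"
      have V: "measure lborel (ball (0::'a) ?d) = ?U * ?d powr ?m"
        using lball_dyad_powr[of "0::'a" k 1] by simp
      have "(\<integral>\<^sup>+x. ennpowr (ennreal c1 * (ennreal (?d powr (s - ?m)) * bil_loc t f g ?d x)) q \<partial>lborel)
        \<le> (\<integral>\<^sup>+z. ennpowr (ennreal (1 / measure lborel (ball (0::'a) ?d)) *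
            (\<integral>\<^sup>+x. ennreal c1 * (ennreal (?d powr (s - ?m)) * bil_loc t f g ?d x) * indicator (ball z ?d) x \<partial>lborel)) q \<partial>lborel)"
        using q by (intro nn_integral_ennpowr_le_local_means) auto
      also have "\<dots> \<le> (\<integral>\<^sup>+z. ennreal (K powr q) * ennreal (?X (k + int l) z powr q) \<partial>lborel)"
      proof (intro nn_integral_mono)
        fix z
        let ?F = "bvol f z (?L * ?d)" and ?G = "bvol g z (?L * ?d)"
        let ?b = "bvol (\<lambda>_. 1) z (dyad (k + int l))"
        have b: "0 < ?b" by (intro bvol_pos adm_weight_1) simp
        have "ennreal (1 / measure lborel (ball (0::'a) ?d)) *
            (\<integral>\<^sup>+x. ennreal c1 * (ennreal (?d powr (s - ?m)) * bil_loc t f g ?d x) * indicator (ball z ?d) x \<partial>lborel)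
           = ennreal (1 / measure lborel (ball (0::'a) ?d)) * (ennreal c1 * (ennreal (?d powr (s - ?m)) *
              (\<integral>\<^sup>+x. bil_loc t f g ?d x * indicator (ball z ?d) x \<partial>lborel)))"
          by (simp add: nn_integral_cmult mult.assoc)
        also have "\<dots> \<le> ennreal (1 / measure lborel (ball (0::'a) ?d)) * (ennreal c1 * (ennreal (?d powr (s - ?m)) *
              (ennreal (1 / \<bar>1 + t\<bar> ^ DIM('a)) * ennreal (?F * ?G))))"
          using L by (intro mult_left_mono bil_loc_mean t f g) auto
        also have "\<dots> = ennreal ((1 / measure lborel (ball (0::'a) ?d)) * (c1 * (?d powr (s - ?m) *
              ((1 / \<bar>1 + t\<bar> ^ DIM('a)) * (?F * ?G)))))"
          using cpos by (simp only: ennreal_mult[symmetric] less_imp_le powr_ge_zero mult_nonneg_nonneg bvol_nonneg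
              divide_nonneg_nonneg zero_le_power abs_ge_zero zero_le_one measure_nonneg)
        also have "(1 / measure lborel (ball (0::'a) ?d)) * (c1 * (?d powr (s - ?m) *
              ((1 / \<bar>1 + t\<bar> ^ DIM('a)) * (?F * ?G)))) = c1 * c2 * (?d powr (s - ?m) / ?d powr ?m) * (?F * ?G)"
          by (simp add: V c2_def mult_ac)
        also have "?d powr (s - ?m) / ?d powr ?m = ?d powr (s - 2 * ?m)"
          by (simp flip: powr_diff)
        also have "c1 * c2 * ?d powr (s - 2 * ?m) * (?F * ?G) = K * ?X (k + int l) z"
        proof -
          have b1: "?b = ?U * (?L * ?d) powr ?m"
            using lball_dyad_powr[of z "k + int l" 1] by (simp add: bvol_1 dyad_add mult.commute)
          have "- 1 / q + ((1 / P1 - 1) + (1 / P2 - 1)) = s / ?m - 2"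
            using pq by simp
          then have "?b powr (- 1 / q) * (?b powr (1 / P1 - 1) * ?b powr (1 / P2 - 1)) = ?b powr (s / ?m - 2)"
            by (simp only: powr_add[symmetric])
          also have "\<dots> = ?U powr (s / ?m - 2) * (?L * ?d) powr (?m * (s / ?m - 2))"
            by (simp add: b1 powr_mult powr_powr)
          also have "?m * (s / ?m - 2) = s - 2 * ?m" by (simp add: field_simps)
          finally have X: "?X (k + int l) z = ?U powr (s / ?m - 2) * (?L powr (s - 2 * ?m) * ?d powr (s - 2 * ?m)) * (?F * ?G)"
            by (simp add: normalized_mean_def dyad_add powr_mult mult_ac)
          have "?U powr (2 - s / ?m) * ?U powr (s / ?m - 2) = 1"
            by (simp flip: powr_add)
          moreover have "?L powr (2 * ?m - s) * ?L powr (s - 2 * ?m) = 1"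
            by (simp flip: powr_add add: less_imp_neq[OF dyad_pos, THEN not_sym])
          ultimately have "K * ?X (k + int l) z = c1 * c2 * (?L powr (2 * ?m - s) * ?L powr (s - 2 * ?m)) *
              (?U powr (2 - s / ?m) * ?U powr (s / ?m - 2)) * ?d powr (s - 2 * ?m) * (?F * ?G)"
            unfolding X K_def by (simp only: mult_ac)
          then show ?thesis
            using \<open>?U powr (2 - s / ?m) * ?U powr (s / ?m - 2) = 1\<close> \<open>?L powr (2 * ?m - s) * ?L powr (s - 2 * ?m) = 1\<close>
            by simp
        qed
        finally have "ennpowr (ennreal (1 / measure lborel (ball (0::'a) ?d)) *
            (\<integral>\<^sup>+x. ennreal c1 * (ennreal (?d powr (s - ?m)) * bil_loc t f g ?d x) * indicator (ball z ?d) x \<partial>lborel)) q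
            \<le> ennpowr (ennreal (K * ?X (k + int l) z)) q"
          using q by (intro ennpowr_mono) auto
        also have "\<dots> = ennreal (K powr q) * ennreal (?X (k + int l) z powr q)"
          using cpos by (subst ennpowr_ennreal) (auto simp: powr_mult ennreal_mult)
        finally show "ennpowr (ennreal (1 / measure lborel (ball (0::'a) ?d)) *
            (\<integral>\<^sup>+x. ennreal c1 * (ennreal (?d powr (s - ?m)) * bil_loc t f g ?d x) * indicator (ball z ?d) x \<partial>lborel)) q
            \<le> ennreal (K powr q) * ennreal (?X (k + int l) z powr q)" .
      qed
      finally show ?thesis .
    qed
    have "(\<integral>\<^sup>+x. ennpowr (bil s t f g x) q \<partial>lborel)
       \<le> (\<integral>\<^sup>+x. \<integral>\<^sup>+k. ennpowr (ennreal c1 * (ennreal (dyad k powr (s - ?m)) * bil_loc t f g (dyad k) x)) q \<partial>count_space UNIV \<partial>lborel)"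
    proof (intro nn_integral_mono)
      fix x
      have "bil s t f g x \<le> (\<integral>\<^sup>+k. ennreal c1 * (ennreal (dyad k powr (s - ?m)) * bil_loc t f g (dyad k) x) \<partial>count_space UNIV)"
        using bil_le_sum[OF s(2) f g, of t x] by (simp add: nn_integral_cmult c1_def)
      then have "ennpowr (bil s t f g x) q \<le> ennpowr (\<integral>\<^sup>+k. ennreal c1 * (ennreal (dyad k powr (s - ?m)) * bil_loc t f g (dyad k) x) \<partial>count_space UNIV) q"
        using q by (intro ennpowr_mono) auto
      also have "\<dots> \<le> (\<integral>\<^sup>+k. ennpowr (ennreal c1 * (ennreal (dyad k powr (s - ?m)) * bil_loc t f g (dyad k) x)) q \<partial>count_space UNIV)"
        using q by (intro ennpowr_count_int_le)
      finally show "ennpowr (bil s t f g x) q \<le> \<dots>" .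
    qed
    also have "\<dots> = (\<integral>\<^sup>+k. \<integral>\<^sup>+x. ennpowr (ennreal c1 * (ennreal (dyad k powr (s - ?m)) * bil_loc t f g (dyad k) x)) q \<partial>lborel \<partial>count_space UNIV)"
      by (intro nn_integral_count_int) measurable
    also have "\<dots> \<le> (\<integral>\<^sup>+k. \<integral>\<^sup>+z. ennreal (K powr q) * ennreal (?X (k + int l) z powr q) \<partial>lborel \<partial>count_space UNIV)"
      by (intro nn_integral_mono loc)
    also have "\<dots> = (\<integral>\<^sup>+k. \<integral>\<^sup>+z. ennreal (K powr q) * ennreal (?X k z powr q) \<partial>lborel \<partial>count_space UNIV)"
      by (rule nn_integral_int_shift)
    also have "\<dots> = (\<integral>\<^sup>+z. \<integral>\<^sup>+k. ennreal (K powr q) * ennreal (?X k z powr q) \<partial>count_space UNIV \<partial>lborel)"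
    proof (rule nn_integral_count_int[symmetric])
      \<comment> \<open>Returning the integral outside the sum requires ball volumes to be
        measurable in the centre, which Tonelli's theorem provides.\<close>
      have [measurable]: "(\<lambda>z. bvol h z r) \<in> borel_measurable borel" if "bmf h" for h :: "'a \<Rightarrow> real" and r
      proof -
        note [measurable] = bmfD(1)[OF that]
        have "(\<lambda>p. indicator (ball (fst p) r) (snd p) :: ennreal) \<in> borel_measurable (borel \<Otimes>\<^sub>M (borel :: 'a measure))"
          unfolding indicator_def mem_ball by measurable
        then have "(\<lambda>z. \<integral>\<^sup>+y. ennreal (h y) * indicator (ball z r) y \<partial>lborel) \<in> borel_measurable borel"
          by (intro sigma_finite_measure.borel_measurable_nn_integral[OF sigma_finite_lborel]) (simp add: split_beta')
        then have "(\<lambda>z. enn2real (ennreal (bvol h z r))) \<in> borel_measurable borel"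
          unfolding nn_integral_ball_loc_int[OF bmf_loc_int[OF that]] by measurable
        then show ?thesis by simp
      qed
      note [measurable] = this[OF f] this[OF g] this[OF bmf_1]
      show "(\<lambda>x. ennreal (K powr q) * ennreal (?X i x powr q)) \<in> borel_measurable lborel" for i
        unfolding normalized_mean_def by measurable
    qed
    also have "\<dots> = ennreal (K powr q) * (\<integral>\<^sup>+z. ennpowr (\<integral>\<^sup>+k. ennreal (?X k z powr q) \<partial>count_space UNIV) (q / q) \<partial>lborel)"
      using cpos q by (simp add: nn_integral_cmult nn_integral_cmult_real)
    also have "\<dots> \<le> ennreal (K powr q) * ennreal (C * (nf * ng) powr q)"
      using Cb[OF bmf_loc_int[OF f] bmf_loc_int[OF g] nn] wf wg
      by (intro mult_left_mono) (auto simp: wpow_def wm_1)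
    also have "\<dots> = ennreal (K powr q * C * (nf * ng) powr q)"
      using C by (simp add: mult.assoc flip: ennreal_mult)
    finally show "(\<integral>\<^sup>+x. ennpowr (bil s t f g x) q \<partial>lborel) \<le> ennreal (K powr q * C * (nf * ng) powr q)" .
  qed
qed


text \<open>The kernel is positive, so Hoelder's inequality interpolates between two estimates of the same operator.\<close>

lemma bil_bounded_interpolate:
  fixes P1 P2 Q1 Q2 R1 R2 :: real
  assumes 0: "bil_bounded TYPE('a::euclidean_space) s t Q1 Q2 q0"
    and 1: "bil_bounded TYPE('a) s t R1 R2 q1"
    and pos: "0 < P1" "0 < P2" "0 < q" "0 < Q1" "0 < Q2" "0 < q0" "0 < R1" "0 < R2" "0 < q1"
    and l: "0 < l" "l < 1"
    and P1: "1 / P1 = l / Q1 + (1 - l) / R1" and P2: "1 / P2 = l / Q2 + (1 - l) / R2"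
    and q: "1 / q = l / q0 + (1 - l) / q1"
  shows "bil_bounded TYPE('a) s t P1 P2 q"
proof -
  obtain C0 where C0: "0 < C0" "\<And>(f :: 'a \<Rightarrow> real) g nf ng. bmf f \<Longrightarrow> bmf g \<Longrightarrow> 0 \<le> nf \<Longrightarrow> 0 \<le> ng \<Longrightarrow>
    (\<integral>\<^sup>+x. ennreal (f x powr Q1) \<partial>lborel) \<le> ennreal (nf powr Q1) \<Longrightarrow>
    (\<integral>\<^sup>+x. ennreal (g x powr Q2) \<partial>lborel) \<le> ennreal (ng powr Q2) \<Longrightarrow>
    (\<integral>\<^sup>+x. ennpowr (bil s t f g x) q0 \<partial>lborel) \<le> ennreal (C0 * (nf * ng) powr q0)"
    using 0 unfolding bil_bounded_def by auto
  obtain C1 where C1: "0 < C1" "\<And>(f :: 'a \<Rightarrow> real) g nf ng. bmf f \<Longrightarrow> bmf g \<Longrightarrow> 0 \<le> nf \<Longrightarrow> 0 \<le> ng \<Longrightarrow>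
    (\<integral>\<^sup>+x. ennreal (f x powr R1) \<partial>lborel) \<le> ennreal (nf powr R1) \<Longrightarrow>
    (\<integral>\<^sup>+x. ennreal (g x powr R2) \<partial>lborel) \<le> ennreal (ng powr R2) \<Longrightarrow>
    (\<integral>\<^sup>+x. ennpowr (bil s t f g x) q1 \<partial>lborel) \<le> ennreal (C1 * (nf * ng) powr q1)"
    using 1 unfolding bil_bounded_def by auto
  \<comment> \<open>The Hoelder exponent in \<open>x\<close>: multiplying the relation for
    \<open>1 / q\<close> by \<open>q\<close> gives weights \<theta> and 1 - \<theta> for the powers
    \<open>q0\<close> and \<open>q1\<close>.\<close>
  define \<theta> where "\<theta> = l * q / q0"
  have \<theta>: "0 < \<theta>" "\<theta> < 1" "1 - \<theta> = (1 - l) * q / q1"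
  proof -
    have "q * (l / q0 + (1 - l) / q1) = 1" unfolding q[symmetric] using pos by simp
    then show "1 - \<theta> = (1 - l) * q / q1" by (simp add: distrib_left \<theta>_def mult.commute)
    moreover show "0 < \<theta>" using l pos by (simp add: \<theta>_def)
    moreover have "0 < (1 - l) * q / q1" using l pos by simp
    ultimately show "\<theta> < 1" by linarith
  qed
  have e1: "P1 / Q1 * l + P1 / R1 * (1 - l) = 1"
  proof -
    have "P1 * (l / Q1 + (1 - l) / R1) = 1" unfolding P1[symmetric] using pos by simp
    then show ?thesis by (simp add: distrib_left mult.commute)
  qed
  have e2: "P2 / Q2 * l + P2 / R2 * (1 - l) = 1"
  proof -
    have "P2 * (l / Q2 + (1 - l) / R2) = 1" unfolding P2[symmetric] using pos by simp
    then show ?thesis by (simp add: distrib_left mult.commute)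
  qed
  show ?thesis
    unfolding bil_bounded_def
  proof (intro exI[of _ "C0 powr \<theta> * C1 powr (1 - \<theta>)"] conjI allI impI)
    show "0 < C0 powr \<theta> * C1 powr (1 - \<theta>)" using C0 C1 by simp
    fix f g :: "'a \<Rightarrow> real" and nf ng :: real
    assume f: "bmf f" and g: "bmf g" and nn: "0 \<le> nf" "0 \<le> ng"
      and wf: "(\<integral>\<^sup>+x. ennreal (f x powr P1) \<partial>lborel) \<le> ennreal (nf powr P1)"
      and wg: "(\<integral>\<^sup>+x. ennreal (g x powr P2) \<partial>lborel) \<le> ennreal (ng powr P2)"
    \<comment> \<open>Powers of one nonnegative function replace the analytic family of complex
      interpolation: f = f0^l f1^(1-l), and f0 and f1 have the integrability required at the two
      endpoints.\<close>
    define f0 where "f0 x = f x powr (P1 / Q1)" for x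
    define f1 where "f1 x = f x powr (P1 / R1)" for x
    define g0 where "g0 x = g x powr (P2 / Q2)" for x
    define g1 where "g1 x = g x powr (P2 / R2)" for x
    have bm: "bmf f0" "bmf f1" "bmf g0" "bmf g1"
      using pos unfolding f0_def f1_def g0_def g1_def by (auto intro!: bmf_powr f g)
    note [measurable] = bm[THEN bmfD(1)]
    have fx: "f x = f0 x powr l * f1 x powr (1 - l)" for x
      using e1 f by (simp add: f0_def f1_def powr_powr bmfD flip: powr_add)
    have gx: "g x = g0 x powr l * g1 x powr (1 - l)" for x
      using e2 g by (simp add: g0_def g1_def powr_powr bmfD flip: powr_add)
    have b0: "(\<integral>\<^sup>+x. ennpowr (bil s t f0 g0 x) q0 \<partial>lborel) \<le> ennreal (C0 * (nf powr (P1 / Q1) * ng powr (P2 / Q2)) powr q0)"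
      using pos wf wg by (intro C0(2) bm) (auto simp: f0_def g0_def powr_powr)
    have b1: "(\<integral>\<^sup>+x. ennpowr (bil s t f1 g1 x) q1 \<partial>lborel) \<le> ennreal (C1 * (nf powr (P1 / R1) * ng powr (P2 / R2)) powr q1)"
      using pos wf wg by (intro C1(2) bm) (auto simp: f1_def g1_def powr_powr)
    have "(\<integral>\<^sup>+x. ennpowr (bil s t f g x) q \<partial>lborel) \<le>
        (\<integral>\<^sup>+x. ennpowr (ennpowr (bil s t f0 g0 x) q0) \<theta> * ennpowr (ennpowr (bil s t f1 g1 x) q1) (1 - \<theta>) \<partial>lborel)"
    proof (intro nn_integral_mono)
      fix x
      have "ennpowr (bil s t f g x) q \<le> ennpowr (ennpowr (bil s t f0 g0 x) l * ennpowr (bil s t f1 g1 x) (1 - l)) q"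
        using pos by (intro ennpowr_mono bil_Holder bm l fx gx) auto
      also have "\<dots> = ennpowr (ennpowr (bil s t f0 g0 x) q0) \<theta> * ennpowr (ennpowr (bil s t f1 g1 x) q1) (1 - \<theta>)"
        using pos by (simp add: ennpowr_mult ennpowr_ennpowr \<theta>(3)) (simp add: \<theta>_def)
      finally show "ennpowr (bil s t f g x) q \<le> \<dots>" .
    qed
    also have "\<dots> \<le> ennpowr (\<integral>\<^sup>+x. ennpowr (bil s t f0 g0 x) q0 \<partial>lborel) \<theta> * ennpowr (\<integral>\<^sup>+x. ennpowr (bil s t f1 g1 x) q1 \<partial>lborel) (1 - \<theta>)"
      using \<theta> by (intro nn_integral_Holder) auto
    also have "\<dots> \<le> ennpowr (ennreal (C0 * (nf powr (P1 / Q1) * ng powr (P2 / Q2)) powr q0)) \<theta> *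
        ennpowr (ennreal (C1 * (nf powr (P1 / R1) * ng powr (P2 / R2)) powr q1)) (1 - \<theta>)"
      using \<theta> by (intro mult_mono ennpowr_mono b0 b1) auto
    also have "\<dots> = ennreal (C0 powr \<theta> * C1 powr (1 - \<theta>) * (nf * ng) powr q)"
    proof -
      have a: "P1 / Q1 * (q0 * \<theta>) + P1 / R1 * (q1 * (1 - \<theta>)) = q"
      proof -
        have "q0 * \<theta> = l * q" "q1 * (1 - \<theta>) = (1 - l) * q"
          using pos unfolding \<theta>(3) by (simp_all add: \<theta>_def)
        then have "P1 / Q1 * (q0 * \<theta>) + P1 / R1 * (q1 * (1 - \<theta>)) = (P1 / Q1 * l + P1 / R1 * (1 - l)) * q"
          by (simp only: distrib_right mult.assoc)
        then show ?thesis using e1 by simp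
      qed
      have b: "P2 / Q2 * (q0 * \<theta>) + P2 / R2 * (q1 * (1 - \<theta>)) = q"
      proof -
        have "q0 * \<theta> = l * q" "q1 * (1 - \<theta>) = (1 - l) * q"
          using pos unfolding \<theta>(3) by (simp_all add: \<theta>_def)
        then have "P2 / Q2 * (q0 * \<theta>) + P2 / R2 * (q1 * (1 - \<theta>)) = (P2 / Q2 * l + P2 / R2 * (1 - l)) * q"
          by (simp only: distrib_right mult.assoc)
        then show ?thesis using e2 by simp
      qed
      have c: "nf powr q = nf powr (P1 / Q1 * (q0 * \<theta>)) * nf powr (P1 / R1 * (q1 * (1 - \<theta>)))"
        "ng powr q = ng powr (P2 / Q2 * (q0 * \<theta>)) * ng powr (P2 / R2 * (q1 * (1 - \<theta>)))"
        by (simp_all only: powr_add[symmetric] a b)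
      have "(C0 * (nf powr (P1 / Q1) * ng powr (P2 / Q2)) powr q0) powr \<theta> *
        (C1 * (nf powr (P1 / R1) * ng powr (P2 / R2)) powr q1) powr (1 - \<theta>) = C0 powr \<theta> * C1 powr (1 - \<theta>) * (nf * ng) powr q"
        using C0 C1 nn by (simp add: powr_mult powr_powr c mult_ac)
      then show ?thesis
        using C0 C1 by (simp add: ennpowr_ennreal flip: ennreal_mult)
    qed
    finally show "(\<integral>\<^sup>+x. ennpowr (bil s t f g x) q \<partial>lborel) \<le> ennreal (C0 powr \<theta> * C1 powr (1 - \<theta>) * (nf * ng) powr q)" .
  qed
qed

text \<open>Both new exponent pairs lie on the line through \<open>(x, y)\<close> and \<open>(1, 1)\<close>.\<close>

lemma interpolation_parameters:
  fixes x y \<sigma> :: real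
  assumes xy: "0 < x" "x < 1" "0 < y" "y < 1" and \<sigma>: "0 < \<sigma>" "\<sigma> < 1"
    and S: "1 \<le> x + y" "x + y < 1 + \<sigma>"
  obtains l x0 y0 x1 y1 where "0 < l" "l < 1"
    "0 < x0" "x0 < 1" "0 < y0" "y0 < 1" "x0 + y0 < 1" "\<sigma> < x0 + y0"
    "0 < x1" "x1 < 1" "0 < y1" "y1 < 1" "1 + \<sigma> = x1 + y1"
    "x = l * x0 + (1 - l) * x1" "y = l * y0 + (1 - l) * y1"
proof -
  define D where "D = 2 - x - y"
  have D: "0 < D" using xy by (simp add: D_def)
  \<comment> \<open>The step towards (1, 1) that reaches the line where the coordinates add up to 1
    + \<sigma>.\<close>
  define \<kappa> where "\<kappa> = (1 + \<sigma> - x - y) / D"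
  have \<kappa>: "0 < \<kappa>" "\<kappa> < 1" "\<kappa> * D = 1 + \<sigma> - x - y"
    using D S \<sigma> by (auto simp: \<kappa>_def D_def field_simps)
  \<comment> \<open>Bounds for the step \<mu> away from (1, 1): above \<open>L\<close> the sum of
    the coordinates drops below 1; below \<open>U\<close> the sum stays above \<sigma> and both
    coordinates stay positive.\<close>
  define L where "L = (x + y - 1) / D"
  define U where "U = Min {(x + y - \<sigma>) / D, x / (1 - x), y / (1 - y)}"
  have "L < x / (1 - x)"
  proof -
    have "(x + y - 1) * (1 - x) < x * D"
    proof -
      have "x * D - (x + y - 1) * (1 - x) = 1 - y" by (simp add: D_def algebra_simps)
      then show ?thesis using xy by linarith
    qed
    then show ?thesis using D xy by (simp add: L_def field_simps)
  qed
  moreover have "L < y / (1 - y)"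
  proof -
    have "(x + y - 1) * (1 - y) < y * D"
    proof -
      have "y * D - (x + y - 1) * (1 - y) = 1 - x" by (simp add: D_def algebra_simps)
      then show ?thesis using xy by linarith
    qed
    then show ?thesis using D xy by (simp add: L_def field_simps)
  qed
  moreover have "L < (x + y - \<sigma>) / D"
    using D \<sigma> by (simp add: L_def divide_strict_right_mono)
  ultimately have "L < U" by (simp add: U_def)
  then obtain \<mu> where \<mu>: "L < \<mu>" "\<mu> < U" using dense by blast
  have "0 \<le> L" using S D by (simp add: L_def)
  then have \<mu>0: "0 < \<mu>" using \<mu> by simp
  have u: "\<mu> < (x + y - \<sigma>) / D" "\<mu> < x / (1 - x)" "\<mu> < y / (1 - y)"
    using \<mu> by (auto simp: U_def)
  \<comment> \<open>The weight that puts (x, y) back between the two displaced points.\<close>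
  define l where "l = \<kappa> / (\<kappa> + \<mu>)"
  have l: "0 < l" "l < 1" "(1 - l) * \<kappa> = l * \<mu>"
    using \<kappa> \<mu>0 by (auto simp: l_def field_simps)
  have m1: "x + y - 1 < \<mu> * D" using \<mu>(1) D by (simp add: L_def field_simps)
  have m2: "\<mu> * D < x + y - \<sigma>" using u(1) D by (simp add: field_simps)
  have m3: "\<mu> * (1 - x) < x" using u(2) xy by (simp add: field_simps)
  have m4: "\<mu> * (1 - y) < y" using u(3) xy by (simp add: field_simps)
  have mp: "0 < \<mu> * (1 - x)" "0 < \<mu> * (1 - y)" "0 < \<kappa> * (1 - x)" "0 < \<kappa> * (1 - y)"
    using \<mu>0 \<kappa> xy by auto
  have mk: "\<kappa> * (1 - x) < 1 - x" "\<kappa> * (1 - y) < 1 - y"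
    using \<kappa> xy by auto
  have sumD: "\<mu> * (1 - x) + \<mu> * (1 - y) = \<mu> * D" "\<kappa> * (1 - x) + \<kappa> * (1 - y) = \<kappa> * D"
    by (simp_all add: D_def algebra_simps)
  have comb: "z = l * (z - \<mu> * (1 - z)) + (1 - l) * (z + \<kappa> * (1 - z))" for z
  proof -
    have "l * (z - \<mu> * (1 - z)) + (1 - l) * (z + \<kappa> * (1 - z)) = z + ((1 - l) * \<kappa> - l * \<mu>) * (1 - z)"
      by (simp add: algebra_simps)
    then show ?thesis using l by simp
  qed
  show ?thesis
    by (rule that[of l "x - \<mu> * (1 - x)" "y - \<mu> * (1 - y)" "x + \<kappa> * (1 - x)" "y + \<kappa> * (1 - y)"])
      (use l m1 m2 m3 m4 mp mk sumD \<kappa> xy comb[of x] comb[of y] in linarith)+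
qed

text \<open>In the remaining range, 1/P1 + 1/P2 \<ge> 1 with q > 1, the pair of exponents lies
  between a pair with reciprocal sum below 1 (Hoelder splitting) and a pair whose target exponent is
  exactly 1 (local means). Both new pairs must remain strictly between 1 and infinity, which is what
  the choice of the line achieves.\<close>

theorem bil_bounded:
  assumes t: "t \<noteq> 0" "t \<noteq> - 1" and P: "1 < P1" "1 < P2" and q: "0 < q" and s: "0 < s" "s < real DIM('a)"
    and pq: "1 / q = 1 / P1 + 1 / P2 - s / real DIM('a)"
  shows "bil_bounded TYPE('a::euclidean_space) s t P1 P2 q"
proof -
  let ?\<sigma> = "s / real DIM('a)"
  consider "1 / P1 + 1 / P2 < 1" | "q \<le> 1" | "1 \<le> 1 / P1 + 1 / P2" "1 < q" by linarith
  then show ?thesis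
  proof cases
    case 1
    then show ?thesis using bil_bounded_large_p t P q s pq by blast
  next
    case 2
    then show ?thesis using bil_bounded_small_q t P q s pq by blast
  next
    case 3
    have "1 / q < 1" using 3 by simp
    then have S: "1 / P1 + 1 / P2 < 1 + ?\<sigma>" using pq by linarith
    have \<sigma>: "0 < ?\<sigma>" "?\<sigma> < 1" using s by (auto simp: field_simps)
    have xy: "0 < 1 / P1" "1 / P1 < 1" "0 < 1 / P2" "1 / P2 < 1" using P by auto
    obtain l x0 y0 x1 y1 where l: "0 < l" "l < 1"
      and z0: "0 < x0" "x0 < 1" "0 < y0" "y0 < 1" "x0 + y0 < 1" "?\<sigma> < x0 + y0"
      and z1: "0 < x1" "x1 < 1" "0 < y1" "y1 < 1" "1 + ?\<sigma> = x1 + y1"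
      and c: "1 / P1 = l * x0 + (1 - l) * x1" "1 / P2 = l * y0 + (1 - l) * y1"
      by (rule interpolation_parameters[OF xy \<sigma> 3(1) S])
    define q0 where "q0 = 1 / (x0 + y0 - ?\<sigma>)"
    have q0: "0 < q0" "1 / q0 = x0 + y0 - ?\<sigma>" using z0 by (auto simp: q0_def)
    have b0: "bil_bounded TYPE('a) s t (1 / x0) (1 / y0) q0"
      using z0 q0 by (intro bil_bounded_large_p t s) auto
    \<comment> \<open>On the line x1 + y1 = 1 + s/n the scaling relation gives target exponent 1,
      the largest that the local means reach.\<close>
    have b1: "bil_bounded TYPE('a) s t (1 / x1) (1 / y1) 1"
      using z1 by (intro bil_bounded_small_q t s) auto
    have "1 / q = l * (x0 + y0 - ?\<sigma>) + (1 - l) * (x1 + y1 - ?\<sigma>)"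
    proof -
      have "(l * x0 + (1 - l) * x1) + (l * y0 + (1 - l) * y1) - z = l * (x0 + y0 - z) + (1 - l) * (x1 + y1 - z)" for z
        by (simp add: algebra_simps)
      then show ?thesis unfolding pq c .
    qed
    also have "x1 + y1 - ?\<sigma> = 1" using z1 by simp
    finally have "1 / q = l / q0 + (1 - l) / 1"
      unfolding q0(2)[symmetric] by simp
    then show ?thesis
      using l z0 z1 q0 P q c by (intro bil_bounded_interpolate[OF b0 b1, where l=l]) auto
  qed
qed


section \<open>Kernels of multipliers\<close>

definition sdiff :: "(nat \<Rightarrow> complex) \<Rightarrow> nat \<Rightarrow> complex" where
  "sdiff g j = g (Suc j) - g j"

text \<open>Discrete symbol estimates: \<open>B\<close> is the size and \<epsilon> the gain per
  difference. The condition \<open>i + j \<le> n\<close> restricts to differences that involve only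
  the values of \<open>g\<close> at 0, ..., n.\<close>

definition diff_bound :: "nat \<Rightarrow> real \<Rightarrow> real \<Rightarrow> (nat \<Rightarrow> complex) \<Rightarrow> bool" where
  "diff_bound n B \<epsilon> g \<longleftrightarrow> (\<forall>i j. i + j \<le> n \<longrightarrow> norm ((sdiff ^^ i) g j) \<le> B * \<epsilon> ^ i)"

lemma diff_boundD: "diff_bound n B \<epsilon> g \<Longrightarrow> i + j \<le> n \<Longrightarrow> norm ((sdiff ^^ i) g j) \<le> B * \<epsilon> ^ i"
  by (simp add: diff_bound_def)

lemma sdiff_pow_add: "(sdiff ^^ i) (\<lambda>j. f j + g j) = (\<lambda>j. (sdiff ^^ i) f j + (sdiff ^^ i) g j)"
  by (induction i) (auto simp: sdiff_def)

lemma sdiff_pow_Suc: "(sdiff ^^ Suc i) g = (sdiff ^^ i) (sdiff g)"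
  by (simp only: funpow_Suc_right o_apply)

lemma sdiff_pow_shift: "(sdiff ^^ i) (\<lambda>j. f (j + k)) j = (sdiff ^^ i) f (j + k)"
  by (induction i arbitrary: j) (auto simp: sdiff_def)

text \<open>The discrete Leibniz rule: the difference of a product is \<Delta>f g plus the shifted
  \<open>f\<close> times \<Delta>g. Each of the \<open>i\<close> steps doubles the number of terms,
  and the hypotheses pass to \<Delta>f, \<Delta>g and the shift with order one less.\<close>

lemma diff_bound_mult_aux:
  assumes "diff_bound i Bf \<epsilon> f" "diff_bound i Bg \<epsilon> g"
  shows "norm ((sdiff ^^ i) (\<lambda>j. f j * g j) 0) \<le> 2 ^ i * Bf * Bg * \<epsilon> ^ i"
  using assms
proof (induction i arbitrary: f g Bf Bg)
  case 0
  have "norm (f 0) \<le> Bf" "norm (g 0) \<le> Bg"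
    using diff_boundD[OF 0(1), of 0 0] diff_boundD[OF 0(2), of 0 0] by auto
  then show ?case
    by (simp add: norm_mult mult_mono')
next
  case (Suc i)
  have 1: "diff_bound i (Bf * \<epsilon>) \<epsilon> (sdiff f)"
    unfolding diff_bound_def
  proof (intro allI impI)
    fix i' j assume "i' + j \<le> i"
    then have "norm ((sdiff ^^ Suc i') f j) \<le> Bf * \<epsilon> ^ Suc i'"
      by (intro diff_boundD[OF Suc.prems(1)]) auto
    then show "norm ((sdiff ^^ i') (sdiff f) j) \<le> Bf * \<epsilon> * \<epsilon> ^ i'"
      by (simp only: sdiff_pow_Suc power_Suc mult.assoc)
  qed
  have 2: "diff_bound i Bg \<epsilon> g"
    using Suc.prems(2) by (auto simp: diff_bound_def)
  have 3: "diff_bound i Bf \<epsilon> (\<lambda>j. f (j + 1))"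
    unfolding diff_bound_def
  proof (intro allI impI)
    fix i' j assume "i' + j \<le> i"
    then show "norm ((sdiff ^^ i') (\<lambda>j. f (j + 1)) j) \<le> Bf * \<epsilon> ^ i'"
      unfolding sdiff_pow_shift by (intro diff_boundD[OF Suc.prems(1)]) auto
  qed
  have 4: "diff_bound i (Bg * \<epsilon>) \<epsilon> (sdiff g)"
    unfolding diff_bound_def
  proof (intro allI impI)
    fix i' j assume "i' + j \<le> i"
    then have "norm ((sdiff ^^ Suc i') g j) \<le> Bg * \<epsilon> ^ Suc i'"
      by (intro diff_boundD[OF Suc.prems(2)]) auto
    then show "norm ((sdiff ^^ i') (sdiff g) j) \<le> Bg * \<epsilon> * \<epsilon> ^ i'"
      by (simp only: sdiff_pow_Suc power_Suc mult.assoc)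
  qed
  have eq: "sdiff (\<lambda>j. f j * g j) = (\<lambda>j. sdiff f j * g j + f (j + 1) * sdiff g j)"
    by (auto simp: sdiff_def algebra_simps)
  have "(sdiff ^^ Suc i) (\<lambda>j. f j * g j) 0
      = (sdiff ^^ i) (\<lambda>j. sdiff f j * g j) 0 + (sdiff ^^ i) (\<lambda>j. f (j + 1) * sdiff g j) 0"
    by (simp only: sdiff_pow_Suc eq sdiff_pow_add)
  then have "norm ((sdiff ^^ Suc i) (\<lambda>j. f j * g j) 0)
      \<le> 2 ^ i * (Bf * \<epsilon>) * Bg * \<epsilon> ^ i + 2 ^ i * Bf * (Bg * \<epsilon>) * \<epsilon> ^ i"
    using Suc.IH[OF 1 2] Suc.IH[OF 3 4] by (metis (no_types, lifting) add_mono norm_triangle_le)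
  then show ?case by (simp add: algebra_simps)
qed

lemma diff_bound_mult:
  assumes f: "diff_bound n Bf \<epsilon> f" and g: "diff_bound n Bg \<epsilon> g" and nn: "0 \<le> Bf" "0 \<le> Bg" "0 \<le> \<epsilon>"
  shows "diff_bound n (2 ^ n * Bf * Bg) \<epsilon> (\<lambda>j. f j * g j)"
  unfolding diff_bound_def
proof (intro allI impI)
  fix i j assume ij: "i + j \<le> n"
  have "diff_bound i B \<epsilon> (\<lambda>k. h (k + j))" if h: "diff_bound n B \<epsilon> h" for B h
    unfolding diff_bound_def
  proof (intro allI impI)
    fix i' j' assume "i' + j' \<le> i"
    then show "norm ((sdiff ^^ i') (\<lambda>k. h (k + j)) j') \<le> B * \<epsilon> ^ i'"
      unfolding sdiff_pow_shift using ij by (intro diff_boundD[OF h]) auto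
  qed
  from diff_bound_mult_aux[OF this[OF f] this[OF g]]
  have "norm ((sdiff ^^ i) (\<lambda>k. f (k + j) * g (k + j)) 0) \<le> 2 ^ i * Bf * Bg * \<epsilon> ^ i" .
  also have "\<dots> \<le> 2 ^ n * Bf * Bg * \<epsilon> ^ i"
    using ij nn by (intro mult_right_mono power_increasing) auto
  finally show "norm ((sdiff ^^ i) (\<lambda>j. f j * g j) j) \<le> 2 ^ n * Bf * Bg * \<epsilon> ^ i"
    using sdiff_pow_shift[of i "\<lambda>k. f k * g k" j 0] by simp
qed

lemma diff_bound_power:
  assumes f: "diff_bound n B \<epsilon> f" and nn: "0 \<le> B" "0 \<le> \<epsilon>"
  shows "diff_bound n ((2 ^ n * B) ^ k) \<epsilon> (\<lambda>j. f j ^ k)"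
proof (induction k)
  case 0
  have "(sdiff ^^ i) (\<lambda>_. 1) = (\<lambda>_. if i = 0 then 1 else 0)" for i
    by (induction i) (auto simp: sdiff_def)
  then show ?case using nn by (auto simp: diff_bound_def)
next
  case (Suc k)
  have "diff_bound n (2 ^ n * B * (2 ^ n * B) ^ k) \<epsilon> (\<lambda>j. f j * f j ^ k)"
    using nn by (intro diff_bound_mult f Suc) auto
  then show ?case by simp
qed

lemma diff_bound_mono:
  assumes f: "diff_bound n B \<epsilon> f" and le: "B \<le> B'" "0 \<le> \<epsilon>" "\<epsilon> \<le> \<epsilon>'" "0 \<le> B"
  shows "diff_bound n B' \<epsilon>' f"
  unfolding diff_bound_def
proof (intro allI impI)
  fix i j assume "i + j \<le> n"
  then have "norm ((sdiff ^^ i) f j) \<le> B * \<epsilon> ^ i" by (rule diff_boundD[OF f])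
  also have "\<dots> \<le> B' * \<epsilon>' ^ i"
    using le by (intro mult_mono power_mono) auto
  finally show "norm ((sdiff ^^ i) f j) \<le> B' * \<epsilon>' ^ i" .
qed

text \<open>Successive products of reciprocals share all but their end factors, so a difference
  telescopes to a constant over the next longer product, exactly as for derivatives of 1/t.\<close>

lemma sdiff_pow_inverse_linear:
  fixes z :: complex and \<eta> :: real
  assumes nz: "\<And>j. j \<le> n \<Longrightarrow> z + of_real (\<eta> * real j) \<noteq> 0"
  shows "i + j \<le> n \<Longrightarrow> (sdiff ^^ i) (\<lambda>j. 1 / (z + of_real (\<eta> * real j))) j
    = of_real ((- \<eta>) ^ i * fact i) / (\<Prod>k\<le>i. z + of_real (\<eta> * real (j + k)))"
proof (induction i arbitrary: j)
  case (Suc i)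
  let ?a = "\<lambda>k. z + of_real (\<eta> * real (j + k))"
  let ?c = "of_real ((- \<eta>) ^ i * fact i) :: complex"
  have nza: "?a k \<noteq> 0" if "k \<le> Suc i" for k
    using Suc.prems that by (intro nz) auto
  have p0: "(\<Prod>k\<le>i. ?a k) \<noteq> 0" "(\<Prod>k\<le>i. ?a (Suc k)) \<noteq> 0" "(\<Prod>k\<le>Suc i. ?a k) \<noteq> 0"
  proof -
    have "?a (Suc k) \<noteq> 0" if "k \<le> i" for k using that by (intro nza) simp
    then show "(\<Prod>k\<le>i. ?a k) \<noteq> 0" "(\<Prod>k\<le>i. ?a (Suc k)) \<noteq> 0" "(\<Prod>k\<le>Suc i. ?a k) \<noteq> 0"
      unfolding prod_zero_iff[OF finite_atMost] using nza by (blast intro: le_SucI)+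
  qed
  have P1: "(\<Prod>k\<le>Suc i. ?a k) = (\<Prod>k\<le>i. ?a k) * ?a (Suc i)" by simp
  have P2: "(\<Prod>k\<le>Suc i. ?a k) = ?a 0 * (\<Prod>k\<le>i. ?a (Suc k))"
    by (rule prod.atMost_Suc_shift)
  have "(sdiff ^^ Suc i) (\<lambda>j. 1 / (z + of_real (\<eta> * real j))) j
      = ?c / (\<Prod>k\<le>i. z + of_real (\<eta> * real (Suc j + k))) - ?c / (\<Prod>k\<le>i. ?a k)"
  proof -
    have "i + Suc j \<le> n" "i + j \<le> n" using Suc.prems by simp_all
    then show ?thesis by (simp only: funpow.simps o_apply sdiff_def[of "(sdiff ^^ i) f" for f] Suc.IH)
  qed
  also have "(\<Prod>k\<le>i. z + of_real (\<eta> * real (Suc j + k))) = (\<Prod>k\<le>i. ?a (Suc k))"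
    by simp
  also have "?c / (\<Prod>k\<le>i. ?a (Suc k)) = ?c * ?a 0 / (\<Prod>k\<le>Suc i. ?a k)"
    unfolding P2 using nza[of 0] by simp
  also have "?c / (\<Prod>k\<le>i. ?a k) = ?c * ?a (Suc i) / (\<Prod>k\<le>Suc i. ?a k)"
    unfolding P1 using nza[of "Suc i"] by simp
  also have "?c * ?a 0 / (\<Prod>k\<le>Suc i. ?a k) - ?c * ?a (Suc i) / (\<Prod>k\<le>Suc i. ?a k)
      = ?c * (?a 0 - ?a (Suc i)) / (\<Prod>k\<le>Suc i. ?a k)"
    by (simp only: diff_divide_distrib right_diff_distrib)
  also have "?a 0 - ?a (Suc i) = of_real (- \<eta> * real (Suc i))"
    by (simp add: algebra_simps)
  also have "?c * of_real (- \<eta> * real (Suc i)) = of_real ((- \<eta>) ^ Suc i * fact (Suc i))"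
    by (simp add: algebra_simps)
  finally show ?case .
qed simp

lemma diff_bound_inverse_linear:
  fixes z :: complex and \<eta> :: real
  assumes R: "0 < R" "\<And>j. j \<le> n \<Longrightarrow> R \<le> norm (z + of_real (\<eta> * real j))"
  shows "diff_bound n (fact n / R) (\<bar>\<eta>\<bar> / R) (\<lambda>j. 1 / (z + of_real (\<eta> * real j)))"
  unfolding diff_bound_def
proof (intro allI impI)
  fix i j assume ij: "i + j \<le> n"
  have nz: "z + of_real (\<eta> * real j) \<noteq> 0" if "j \<le> n" for j
    using R(1) R(2)[OF that] by auto
  have "R ^ Suc i \<le> (\<Prod>k\<le>i. norm (z + of_real (\<eta> * real (j + k))))"
  proof -
    have "(\<Prod>k\<le>i. R) \<le> (\<Prod>k\<le>i. norm (z + of_real (\<eta> * real (j + k))))"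
      using R ij by (intro prod_mono) (auto simp del: of_nat_add)
    then show ?thesis by simp
  qed
  then have "norm ((sdiff ^^ i) (\<lambda>j. 1 / (z + of_real (\<eta> * real j))) j) \<le> (\<bar>\<eta>\<bar> ^ i * fact i) / R ^ Suc i"
  proof -
    have "norm ((sdiff ^^ i) (\<lambda>j. 1 / (z + of_real (\<eta> * real j))) j)
       = (\<bar>\<eta>\<bar> ^ i * fact i) / (\<Prod>k\<le>i. norm (z + of_real (\<eta> * real (j + k))))"
      by (simp only: sdiff_pow_inverse_linear[OF nz ij] norm_divide norm_of_real prod_norm abs_mult power_abs
          abs_minus_cancel abs_of_nonneg[OF fact_ge_zero])
    also have "\<dots> \<le> (\<bar>\<eta>\<bar> ^ i * fact i) / R ^ Suc i"
      using R(1) \<open>R ^ Suc i \<le> _\<close> by (intro frac_le) (auto simp del: power_Suc)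
    finally show ?thesis .
  qed
  also have "\<dots> \<le> (\<bar>\<eta>\<bar> ^ i * fact n) / R ^ Suc i"
    using R ij by (intro divide_right_mono mult_left_mono fact_mono) auto
  finally show "norm ((sdiff ^^ i) (\<lambda>j. 1 / (z + of_real (\<eta> * real j))) j) \<le> fact n / R * (\<bar>\<eta>\<bar> / R) ^ i"
    by (simp add: power_divide mult.commute)
qed

text \<open>By the mean value inequality a unit step costs one derivative. The induction applies
  this to the whole jet: its differences form a jet on a shorter interval with one order less and
  bound \<open>B * \<epsilon>\<close>.\<close>

lemma diff_bound_jet:
  fixes D :: "nat \<Rightarrow> real \<Rightarrow> complex"
  assumes der: "\<And>k t. k < n \<Longrightarrow> 0 \<le> t \<Longrightarrow> t \<le> real n \<Longrightarrow> (D k has_vector_derivative D (Suc k) t) (at t)"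
    and bd: "\<And>k t. k \<le> n \<Longrightarrow> 0 \<le> t \<Longrightarrow> t \<le> real n \<Longrightarrow> norm (D k t) \<le> B * \<epsilon> ^ k"
  shows "diff_bound n B \<epsilon> (\<lambda>j. D 0 (real j))"
proof -
  have key: "norm ((sdiff ^^ i) (\<lambda>j. D 0 (real j)) j) \<le> B * \<epsilon> ^ i"
    if "i + j \<le> N" "\<And>k t. k < i \<Longrightarrow> 0 \<le> t \<Longrightarrow> t \<le> real N \<Longrightarrow> (D k has_vector_derivative D (Suc k) t) (at t)"
      "\<And>k t. k \<le> i \<Longrightarrow> 0 \<le> t \<Longrightarrow> t \<le> real N \<Longrightarrow> norm (D k t) \<le> B * \<epsilon> ^ k" for i j N D B
    using that
  proof (induction i arbitrary: N D B)
    case 0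
    then show ?case by simp
  next
    case (Suc i)
    define D' where "D' k t = D k (t + 1) - D k t" for k t
    obtain N' where N: "N = Suc N'" using Suc.prems(1) by (cases N) auto
    have "norm ((sdiff ^^ i) (\<lambda>j. D' 0 (real j)) j) \<le> B * \<epsilon> * \<epsilon> ^ i"
    proof (rule Suc.IH[of N'])
      show "i + j \<le> N'" using Suc.prems(1) N by simp
    next
      fix k t assume k: "k < i" and t: "0 \<le> t" "t \<le> real N'"
      have d: "(D k has_vector_derivative D (Suc k) t') (at t')" if "0 \<le> t'" "t' \<le> real N" for t'
        using k that by (intro Suc.prems(2)) auto
      have "((\<lambda>t. D k (t + 1)) has_vector_derivative D (Suc k) (t + 1)) (at t)"
      proof -
        have "((\<lambda>t. t + 1) has_vector_derivative 1) (at t)"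
          by (auto intro!: derivative_eq_intros)
        from vector_diff_chain_at[OF this, of "D k" "D (Suc k) (t + 1)"] show ?thesis
          using d[of "t + 1"] t N by (simp add: o_def)
      qed
      moreover have "(D k has_vector_derivative D (Suc k) t) (at t)"
        using t N by (intro d) auto
      ultimately show "(D' k has_vector_derivative D' (Suc k) t) (at t)"
        unfolding D'_def by (rule has_vector_derivative_diff)
    next
      fix k t assume k: "k \<le> i" and t: "0 \<le> t" "t \<le> real N'"
      have "norm (D k (t + 1) - D k t) \<le> B * \<epsilon> ^ Suc k * norm (t + 1 - t)"
      proof (rule differentiable_bound[of "{t..t + 1}" "D k" "\<lambda>x h. h *\<^sub>R D (Suc k) x"])
        fix x assume x: "x \<in> {t..t + 1}"
        then have "(D k has_vector_derivative D (Suc k) x) (at x)"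
          using k t N by (intro Suc.prems(2)) auto
        then show "(D k has_derivative (\<lambda>h. h *\<^sub>R D (Suc k) x)) (at x within {t..t + 1})"
          by (simp add: has_vector_derivative_def has_derivative_at_withinI)
        have "norm (D (Suc k) x) \<le> B * \<epsilon> ^ Suc k"
          using k t N x by (intro Suc.prems(3)) auto
        then show "onorm (\<lambda>h. h *\<^sub>R D (Suc k) x) \<le> B * \<epsilon> ^ Suc k"
          by (intro onorm_le) (metis norm_scaleR mult.commute mult_left_mono norm_ge_zero real_norm_def)
      qed auto
      then show "norm (D' k t) \<le> B * \<epsilon> * \<epsilon> ^ k"
        by (simp add: D'_def mult.assoc)
    qed
    moreover have "sdiff (\<lambda>j. D 0 (real j)) = (\<lambda>j. D' 0 (real j))"
      by (auto simp: sdiff_def D'_def add.commute)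
    ultimately show ?case
      by (simp only: sdiff_pow_Suc power_Suc mult.assoc)
  qed
  show ?thesis
    unfolding diff_bound_def
  proof (intro allI impI)
    fix i j assume "i + j \<le> n"
    then show "norm ((sdiff ^^ i) (\<lambda>j. D 0 (real j)) j) \<le> B * \<epsilon> ^ i"
      by (intro key[of i j n]) (auto intro: der bd)
  qed
qed

section \<open>The rational cutoff\<close>

text \<open>In dimension m the power makes it decay like |z|^(-2m), which is integrable at infinity;
  as \<open>L\<close> grows it tends to 1 from below.\<close>

definition cutoff :: "real \<Rightarrow> 'a::euclidean_space \<Rightarrow> complex" where
  "cutoff L z = of_real ((L\<^sup>2 / (L\<^sup>2 + (norm z)\<^sup>2)) ^ DIM('a))"

lemma measurable_cutoff [measurable]: "cutoff L \<in> borel_measurable borel"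
  unfolding cutoff_def by measurable

lemma norm_cutoff: "norm (cutoff L (z::'a::euclidean_space)) = (L\<^sup>2 / (L\<^sup>2 + (norm z)\<^sup>2)) ^ DIM('a)"
  by (simp add: cutoff_def norm_power norm_divide flip: of_real_power of_real_divide)

lemma norm_cutoff_le_1: "norm (cutoff L z) \<le> 1"
proof -
  have "L\<^sup>2 / (L\<^sup>2 + (norm z)\<^sup>2) \<le> 1"
  proof (cases "0 < L\<^sup>2 + (norm z)\<^sup>2")
    case False
    then have "L = 0 \<and> z = 0" using sum_power2_le_zero_iff[of L "norm z"] by simp
    then show ?thesis by simp
  qed simp
  then show ?thesis unfolding norm_cutoff by (intro power_le_one) auto
qed

text \<open>Along a coordinate line the cutoff is a power of a product of two conjugate factors \<open>L / (c + t)\<close>.\<close>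

lemma diff_bound_cutoff:
  obtains C where "0 \<le> C" "\<And>(P :: 'a::euclidean_space) e \<eta> L R. e \<in> Basis \<Longrightarrow> 0 < L \<Longrightarrow> 0 < R \<Longrightarrow>
    (\<And>j. j \<le> n \<Longrightarrow> R\<^sup>2 \<le> L\<^sup>2 + (norm (P + (\<eta> * real j) *\<^sub>R e))\<^sup>2) \<Longrightarrow>
    diff_bound n (C * (L / R) ^ (2 * DIM('a))) (\<bar>\<eta>\<bar> / R) (\<lambda>j. cutoff L (P + (\<eta> * real j) *\<^sub>R e))"
proof (rule that[of "(2 ^ n * (2 ^ n * fact n * fact n)) ^ DIM('a)"])
  fix P e :: 'a and \<eta> L R :: real
  assume e: "e \<in> Basis" and L: "0 < L" and R: "0 < R"
    and le: "\<And>j. j \<le> n \<Longrightarrow> R\<^sup>2 \<le> L\<^sup>2 + (norm (P + (\<eta> * real j) *\<^sub>R e))\<^sup>2"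
  have ee: "e \<bullet> e = 1" using e by (simp add: inner_Basis)
  have "(P \<bullet> e)\<^sup>2 \<le> (norm P)\<^sup>2"
    using Basis_le_norm[OF e, of P] by (metis abs_ge_zero power2_abs power_mono)
  then have q0: "0 \<le> L\<^sup>2 + (norm P)\<^sup>2 - (P \<bullet> e)\<^sup>2" using zero_le_power2[of L] by linarith
  \<comment> \<open>The squared distance along the line, L^2 + |P + t e|^2, is a real quadratic in
    \<open>t\<close> without real zeros; - c and its conjugate are its roots, so it equals |c +
    t|^2.\<close>
  define c where "c = Complex (P \<bullet> e) (sqrt (L\<^sup>2 + (norm P)\<^sup>2 - (P \<bullet> e)\<^sup>2))"
  have sq: "(norm (c + of_real (\<eta> * real j)))\<^sup>2 = L\<^sup>2 + (norm (P + (\<eta> * real j) *\<^sub>R e))\<^sup>2" for j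
  proof -
    have "(norm (c + of_real (\<eta> * real j)))\<^sup>2 = (P \<bullet> e + \<eta> * real j)\<^sup>2 + (L\<^sup>2 + (norm P)\<^sup>2 - (P \<bullet> e)\<^sup>2)"
      using q0 by (simp add: cmod_power2 c_def)
    also have "\<dots> = L\<^sup>2 + (norm (P + (\<eta> * real j) *\<^sub>R e))\<^sup>2"
    proof -
      have "(norm (P + (\<eta> * real j) *\<^sub>R e))\<^sup>2 = (norm P)\<^sup>2 + 2 * (\<eta> * real j) * (P \<bullet> e) + (\<eta> * real j)\<^sup>2"
        by (simp only: power2_norm_eq_inner inner_add_left inner_add_right inner_scaleR_left inner_scaleR_right ee
            inner_commute[of e P]) (simp only: power2_eq_square, simp add: algebra_simps)
      then show ?thesis by (simp only:) (simp add: power2_sum)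
    qed
    finally show ?thesis .
  qed
  have ge: "R \<le> norm (c + of_real (\<eta> * real j))" if "j \<le> n" for j
    using le[OF that] R unfolding sq[symmetric] by (meson norm_ge_zero power2_le_imp_le)
  have ge': "R \<le> norm (cnj c + of_real (\<eta> * real j))" if "j \<le> n" for j
    using ge[OF that] by (metis complex_cnj_add complex_cnj_complex_of_real complex_mod_cnj)
  have "diff_bound n (2 ^ n * (fact n / R) * (fact n / R)) (\<bar>\<eta>\<bar> / R)
      (\<lambda>j. 1 / (c + of_real (\<eta> * real j)) * (1 / (cnj c + of_real (\<eta> * real j))))"
    using R by (intro diff_bound_mult diff_bound_inverse_linear ge ge') auto
  then have "diff_bound n ((2 ^ n * (2 ^ n * (fact n / R) * (fact n / R))) ^ DIM('a)) (\<bar>\<eta>\<bar> / R)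
      (\<lambda>j. (1 / (c + of_real (\<eta> * real j)) * (1 / (cnj c + of_real (\<eta> * real j)))) ^ DIM('a))"
    using R by (intro diff_bound_power) auto
  then have 1: "norm ((sdiff ^^ i) (\<lambda>j. (1 / (c + of_real (\<eta> * real j)) * (1 / (cnj c + of_real (\<eta> * real j)))) ^ DIM('a)) j)
     \<le> (2 ^ n * (2 ^ n * (fact n / R) * (fact n / R))) ^ DIM('a) * (\<bar>\<eta>\<bar> / R) ^ i" if "i + j \<le> n" for i j
    using that by (auto simp: diff_bound_def)
  have eq: "cutoff L (P + (\<eta> * real j) *\<^sub>R e) = of_real ((L\<^sup>2) ^ DIM('a)) *
      (1 / (c + of_real (\<eta> * real j)) * (1 / (cnj c + of_real (\<eta> * real j)))) ^ DIM('a)" for j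
  proof -
    have "(c + of_real (\<eta> * real j)) * (cnj c + of_real (\<eta> * real j)) = of_real ((norm (c + of_real (\<eta> * real j)))\<^sup>2)"
      using complex_norm_square[of "c + of_real (\<eta> * real j)"] by simp
    then have "1 / (c + of_real (\<eta> * real j)) * (1 / (cnj c + of_real (\<eta> * real j)))
        = 1 / of_real (L\<^sup>2 + (norm (P + (\<eta> * real j) *\<^sub>R e))\<^sup>2)"
      unfolding sq by simp
    then show ?thesis
      by (simp add: cutoff_def power_divide)
  qed
  have cm: "(sdiff ^^ i) (\<lambda>j. a * g j) = (\<lambda>j. a * (sdiff ^^ i) g j)" for a g i
    by (induction i) (auto simp: sdiff_def algebra_simps)
  show "diff_bound n ((2 ^ n * (2 ^ n * fact n * fact n)) ^ DIM('a) * (L / R) ^ (2 * DIM('a))) (\<bar>\<eta>\<bar> / R)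
    (\<lambda>j. cutoff L (P + (\<eta> * real j) *\<^sub>R e))"
    unfolding diff_bound_def eq cm
  proof (intro allI impI)
    fix i j assume ij: "i + j \<le> n"
    have "norm (of_real ((L\<^sup>2) ^ DIM('a)) * (sdiff ^^ i) (\<lambda>j. (1 / (c + of_real (\<eta> * real j)) * (1 / (cnj c + of_real (\<eta> * real j)))) ^ DIM('a)) j)
      \<le> (L\<^sup>2) ^ DIM('a) * ((2 ^ n * (2 ^ n * (fact n / R) * (fact n / R))) ^ DIM('a) * (\<bar>\<eta>\<bar> / R) ^ i)"
      unfolding norm_mult norm_of_real using 1[OF ij] by (intro mult_mono) auto
    also have "\<dots> = (L\<^sup>2 * (2 ^ n * (2 ^ n * (fact n / R) * (fact n / R)))) ^ DIM('a) * (\<bar>\<eta>\<bar> / R) ^ i"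
      by (simp only: power_mult_distrib mult.assoc)
    also have "L\<^sup>2 * (2 ^ n * (2 ^ n * (fact n / R) * (fact n / R))) = (2 ^ n * (2 ^ n * fact n * fact n)) * (L / R)\<^sup>2"
      using R by (simp add: power2_eq_square)
    also have "((2 ^ n * (2 ^ n * fact n * fact n)) * (L / R)\<^sup>2) ^ DIM('a) = (2 ^ n * (2 ^ n * fact n * fact n)) ^ DIM('a) * (L / R) ^ (2 * DIM('a))"
      by (simp only: power_mult_distrib power_mult)
    finally show "norm (of_real ((L\<^sup>2) ^ DIM('a)) * (sdiff ^^ i) (\<lambda>j. (1 / (c + of_real (\<eta> * real j)) * (1 / (cnj c + of_real (\<eta> * real j)))) ^ DIM('a)) j)
      \<le> (2 ^ n * (2 ^ n * fact n * fact n)) ^ DIM('a) * (L / R) ^ (2 * DIM('a)) * (\<bar>\<eta>\<bar> / R) ^ i" .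
  qed
qed simp


section \<open>Oscillatory integrals and finite differences\<close>

definition fdiff :: "'a \<Rightarrow> ('a::euclidean_space \<Rightarrow> complex) \<Rightarrow> 'a \<Rightarrow> complex" where
  "fdiff h f z = f (z + h) - f z"

lemma fdiff_sdiff: "(fdiff h ^^ i) f (P + real j *\<^sub>R h) = (sdiff ^^ i) (\<lambda>j. f (P + real j *\<^sub>R h)) j"
proof (induction i arbitrary: j)
  case (Suc i)
  have "P + real j *\<^sub>R h + h = P + real (Suc j) *\<^sub>R h" by (simp add: algebra_simps)
  then show ?case
    by (simp only: funpow.simps o_apply fdiff_def[of h "(fdiff h ^^ i) f"] sdiff_def[of "(sdiff ^^ i) g" for g] Suc.IH)
qed simp

lemma diff_bound_fdiff:
  assumes "diff_bound n B \<epsilon> (\<lambda>j. f (P + real j *\<^sub>R h))"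
  shows "norm ((fdiff h ^^ n) f P) \<le> B * \<epsilon> ^ n"
  using diff_boundD[OF assms, of n 0] fdiff_sdiff[of n h f P 0] by simp

lemma lborel_distr_shift: "distr lborel borel (\<lambda>z. z + h) = (lborel :: 'a::euclidean_space measure)"
proof -
  have "(\<lambda>z. z + h) = (+) h" by (auto simp: add.commute)
  then show ?thesis using lborel_distr_plus[of h] by simp
qed

lemma lborel_integral_shift:
  fixes f :: "'a::euclidean_space \<Rightarrow> complex"
  assumes [measurable]: "f \<in> borel_measurable borel"
  shows "(LINT z|lborel. f (z + h)) = (LINT z|lborel. f z)"
    and "integrable lborel f \<Longrightarrow> integrable lborel (\<lambda>z. f (z + h))"
proof -
  show "(LINT z|lborel. f (z + h)) = (LINT z|lborel. f z)"
    using integral_distr[of "\<lambda>z. z + h" lborel borel f] by (simp add: lborel_distr_shift)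
  show "integrable lborel (\<lambda>z. f (z + h))" if "integrable lborel f"
    using integrable_distr_eq[of "\<lambda>z. z + h" lborel borel f] that by (simp add: lborel_distr_shift)
qed

lemma measurable_fdiff [measurable]:
  "f \<in> borel_measurable borel \<Longrightarrow> (fdiff h ^^ i) f \<in> borel_measurable (borel :: 'a::euclidean_space measure)"
proof (induction i)
  case (Suc i)
  then have [measurable]: "(fdiff h ^^ i) f \<in> borel_measurable borel" by simp
  have "(fdiff h ^^ Suc i) f = (\<lambda>z. (fdiff h ^^ i) f (z + h) - (fdiff h ^^ i) f z)"
    by (auto simp: fdiff_def)
  then show ?case by simp
qed simp

definition ecis :: "'a::euclidean_space \<Rightarrow> 'a \<Rightarrow> complex" where
  "ecis u z = exp (\<i> * of_real (u \<bullet> z))"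

lemma measurable_ecis [measurable]:
  assumes [measurable]: "f \<in> borel_measurable M" "g \<in> borel_measurable M"
  shows "(\<lambda>x. ecis (f x) (g x)) \<in> borel_measurable M"
  unfolding ecis_def by measurable

lemma norm_ecis [simp]: "norm (ecis u z) = 1"
  by (simp add: ecis_def)

lemma ecis_shift: "u \<bullet> h = pi \<Longrightarrow> ecis u (z + h) = - ecis u z"
  by (simp add: ecis_def inner_add_right distrib_left exp_add)

lemma integrable_ecis_mult:
  fixes f :: "'a::euclidean_space \<Rightarrow> complex"
  assumes f: "integrable lborel f"
  shows "integrable lborel (\<lambda>z. ecis u z * f z)"
proof -
  have [measurable]: "f \<in> borel_measurable borel"
    using borel_measurable_integrable[OF f] by simp
  show ?thesis
    by (rule Bochner_Integration.integrable_bound[OF f]) (auto simp: norm_mult)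
qed

text \<open>Shifting by a half-period changes the sign of the exponential, so it turns into a difference of the amplitude.\<close>

lemma oscillatory_integral:
  fixes a :: "'a::euclidean_space \<Rightarrow> complex"
  assumes a: "integrable lborel a" and [measurable]: "a \<in> borel_measurable borel" and h: "u \<bullet> h = pi"
  shows "integrable lborel ((fdiff h ^^ n) a)"
    and "(LINT z|lborel. ecis u z * (fdiff h ^^ n) a z) = (- 2) ^ n * (LINT z|lborel. ecis u z * a z)"
proof (induction n)
  case 0
  case 1 show ?case using a by simp
  case 2 show ?case by simp
next
  case (Suc n)
  let ?d = "(fdiff h ^^ n) a"
  have [measurable]: "?d \<in> borel_measurable borel" by measurable
  have eq: "(fdiff h ^^ Suc n) a = (\<lambda>z. ?d (z + h) - ?d z)"
    by (auto simp: fdiff_def)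
  have i: "integrable lborel (\<lambda>z. ?d (z + h))" "integrable lborel ?d"
    using lborel_integral_shift(2)[of ?d h] Suc by auto
  {
    case 1
    show ?case unfolding eq using i by simp
  next
    case 2
    have "(LINT z|lborel. ecis u z * (fdiff h ^^ Suc n) a z)
       = (LINT z|lborel. ecis u z * ?d (z + h)) - (LINT z|lborel. ecis u z * ?d z)"
      unfolding eq right_diff_distrib using i by (intro Bochner_Integration.integral_diff integrable_ecis_mult)
    also have "(LINT z|lborel. ecis u z * ?d (z + h)) = (LINT z|lborel. - (ecis u (z + h) * ?d (z + h)))"
      by (simp add: ecis_shift[OF h])
    also have "\<dots> = - (LINT z|lborel. ecis u (z + h) * ?d (z + h))"
      by simp
    also have "(LINT z|lborel. ecis u (z + h) * ?d (z + h)) = (LINT z|lborel. ecis u z * ?d z)"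
      by (rule lborel_integral_shift(1)) measurable
    finally show ?case using Suc by simp
  }
qed

text \<open>The \<open>n\<close> differences multiply the integral by (-2)^n; the resulting gain
  2^(-n) is given away. What counts is that the amplitude is replaced by its differences.\<close>

lemma norm_oscillatory_le:
  fixes a :: "'a::euclidean_space \<Rightarrow> complex"
  assumes a: "integrable lborel a" and [measurable]: "a \<in> borel_measurable borel" and h: "u \<bullet> h = pi"
  shows "ennreal (norm (LINT z|lborel. ecis u z * a z)) \<le> (\<integral>\<^sup>+z. ennreal (norm ((fdiff h ^^ n) a z)) \<partial>lborel)"
proof -
  let ?d = "(fdiff h ^^ n) a"
  have i: "integrable lborel ?d" by (rule oscillatory_integral[OF assms])
  have "norm (LINT z|lborel. ecis u z * a z) \<le> 2 ^ n * norm (LINT z|lborel. ecis u z * a z)"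
    by (simp add: mult_le_cancel_right1)
  also have "\<dots> = norm (LINT z|lborel. ecis u z * ?d z)"
    unfolding oscillatory_integral(2)[OF assms] by (simp add: norm_mult norm_power)
  finally have "ennreal (norm (LINT z|lborel. ecis u z * a z)) \<le> ennreal (norm (LINT z|lborel. ecis u z * ?d z))"
    by (rule ennreal_leI)
  also have "\<dots> \<le> (\<integral>\<^sup>+z. ennreal (norm (ecis u z * ?d z)) \<partial>lborel)"
    by (intro integral_norm_bound_ennreal integrable_ecis_mult i)
  finally show ?thesis by (simp add: norm_mult)
qed

text \<open>The coordinate axis is one on which the component of \<open>u\<close> is at least |u|
  divided by the dimension. Stepping along an axis matches the estimates, which concern partial
  derivatives.\<close>

lemma half_period:
  fixes u :: "'a::euclidean_space"
  assumes u: "u \<noteq> 0"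
  obtains e \<eta> where "e \<in> Basis" "u \<bullet> (\<eta> *\<^sub>R e) = pi" "0 < \<bar>\<eta>\<bar>" "\<bar>\<eta>\<bar> \<le> pi * real DIM('a) / norm u"
proof -
  have "\<exists>e\<in>Basis. norm u \<le> real DIM('a) * \<bar>u \<bullet> e\<bar>"
  proof (rule ccontr)
    assume "\<not> ?thesis"
    then have lt: "\<bar>u \<bullet> e\<bar> < norm u / real DIM('a)" if "e \<in> Basis" for e
      using that by (auto simp: not_le field_simps)
    have "norm u \<le> (\<Sum>e\<in>Basis. \<bar>u \<bullet> e\<bar>)" by (rule norm_le_l1)
    also have "\<dots> < (\<Sum>e\<in>(Basis::'a set). norm u / real DIM('a))"
      by (intro sum_strict_mono lt) auto
    finally show False by simp
  qed
  then obtain e where e: "e \<in> Basis" "norm u \<le> real DIM('a) * \<bar>u \<bullet> e\<bar>" by blast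
  then have nz: "0 < \<bar>u \<bullet> e\<bar>" using u by (cases "u \<bullet> e = 0") auto
  show ?thesis
  proof (rule that[OF e(1), of "pi / (u \<bullet> e)"])
    show "u \<bullet> ((pi / (u \<bullet> e)) *\<^sub>R e) = pi" "0 < \<bar>pi / (u \<bullet> e)\<bar>" using nz by auto
    show "\<bar>pi / (u \<bullet> e)\<bar> \<le> pi * real DIM('a) / norm u"
      using e(2) nz u pi_gt_zero by (simp add: abs_divide field_simps)
  qed
qed

section \<open>Integrals of powers inside and outside a ball\<close>

text \<open>A dyadic sum instead of polar coordinates: \<open>Hedberg_sum\<close> with W k = 2^k,
  where \<Phi> is the volume of the dyadic ball cut with the ball of radius \<open>r\<close>,
  bounded by either volume.\<close>

lemma nn_integral_powr_ball:
  assumes s: "0 < s" "s < real DIM('a::euclidean_space)"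
  obtains C where "0 < C" "\<And>r. 0 < r \<Longrightarrow>
    (\<integral>\<^sup>+z. ennreal (norm (z::'a) powr (- s)) * indicator (ball 0 r) z \<partial>lborel) \<le> ennreal (C * r powr (real DIM('a) - s))"
proof -
  let ?m = "real DIM('a)"
  let ?U = "unit_ball_vol ?m"
  have U: "0 < ?U" and two: "(1::real) < 2" by simp_all
  obtain C0 where C0: "0 < C0" "\<And>(W :: int \<Rightarrow> real) \<Phi> \<Lambda> M.
    (\<And>k. 0 < W k) \<Longrightarrow> (\<And>k. 2 * W k \<le> W (k + 1)) \<Longrightarrow> (\<And>k. 0 \<le> \<Phi> k) \<Longrightarrow> (\<And>k. \<Phi> k \<le> \<Lambda>) \<Longrightarrow>
    (\<And>k. \<Phi> k \<le> M * W k powr ?m) \<Longrightarrow>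
    (\<integral>\<^sup>+k. ennreal (W k powr (- s) * \<Phi> k) \<partial>count_space UNIV) \<le> ennreal (C0 * \<Lambda> powr (1 - s / ?m) * M powr (s / ?m))"
    by (rule Hedberg_sum[OF two s]) (blast intro: that)
  show ?thesis
  proof (rule that[of "2 powr s * (C0 * ?U)"])
    show "0 < 2 powr s * (C0 * ?U)" using C0 U by simp
    fix r :: real assume r: "0 < r"
    let ?B = "\<lambda>k. ball (0::'a) (dyad k) \<inter> ball 0 r"
    let ?\<Phi> = "\<lambda>k. measure lborel (?B k)"
    have fin: "emeasure lborel (?B k) = ennreal (?\<Phi> k)" for k
    proof -
      have "emeasure lborel (?B k) \<le> emeasure lborel (ball (0::'a) r)"
        by (intro emeasure_mono) auto
      then have "emeasure lborel (?B k) \<noteq> top"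
        using emeasure_lborel_ball_finite[of "0::'a" r] by (auto simp: top_unique)
      then show ?thesis by (simp add: emeasure_eq_ennreal_measure)
    qed
    have le: "?\<Phi> k \<le> measure lborel (ball (0::'a) r)" "?\<Phi> k \<le> measure lborel (ball (0::'a) (dyad k))" for k
      using measure_wm_mono[OF adm_weight_1, of "?B k" "ball 0 r" 0 r]
        measure_wm_mono[OF adm_weight_1, of "?B k" "ball 0 (dyad k)" 0 "dyad k"] by (auto simp: wm_1)
    have "(\<integral>\<^sup>+z. ennreal (norm (z::'a) powr (- s)) * indicator (ball 0 r) z \<partial>lborel)
      \<le> (\<integral>\<^sup>+z. \<integral>\<^sup>+k. ennreal (2 powr s) * (ennreal (dyad k powr (- s)) * indicator (?B k) z) \<partial>count_space UNIV \<partial>lborel)"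
    proof (intro nn_integral_mono)
      fix z :: 'a
      show "ennreal (norm z powr (- s)) * indicator (ball 0 r) z
        \<le> (\<integral>\<^sup>+k. ennreal (2 powr s) * (ennreal (dyad k powr (- s)) * indicator (?B k) z) \<partial>count_space UNIV)"
      proof (cases "z \<noteq> 0 \<and> z \<in> ball 0 r")
        case True
        have "ennreal (norm z powr (- s)) \<le> ennreal (2 powr (- (- s))) *
          (\<integral>\<^sup>+k. ennreal (dyad k powr (- s)) * indicator {k. norm z < dyad k} k \<partial>count_space UNIV)"
          using True s by (intro powr_le_dyadic_sum) auto
        also have "\<dots> = (\<integral>\<^sup>+k. ennreal (2 powr s) * (ennreal (dyad k powr (- s)) * indicator {k. norm z < dyad k} k) \<partial>count_space UNIV)"
          by (simp add: nn_integral_cmult)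
        also have "\<dots> = (\<integral>\<^sup>+k. ennreal (2 powr s) * (ennreal (dyad k powr (- s)) * indicator (?B k) z) \<partial>count_space UNIV)"
          using True by (intro nn_integral_cong) (auto split: split_indicator)
        finally show ?thesis using True by simp
      qed auto
    qed
    also have "\<dots> = (\<integral>\<^sup>+k. \<integral>\<^sup>+z. ennreal (2 powr s) * (ennreal (dyad k powr (- s)) * indicator (?B k) z) \<partial>lborel \<partial>count_space UNIV)"
      by (intro nn_integral_count_int) measurable
    also have "\<dots> = ennreal (2 powr s) * (\<integral>\<^sup>+k. ennreal (dyad k powr (- s) * ?\<Phi> k) \<partial>count_space UNIV)"
      by (simp add: nn_integral_cmult fin ennreal_mult)
    also have "\<dots> \<le> ennreal (2 powr s) * ennreal (C0 * (?U * r powr ?m) powr (1 - s / ?m) * ?U powr (s / ?m))"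
    proof (intro mult_left_mono C0(2))
      fix k
      show "?\<Phi> k \<le> ?U * r powr ?m" using le(1)[of k] r by (simp add: content_ball powr_realpow)
      show "?\<Phi> k \<le> ?U * dyad k powr ?m" using le(2)[of k] by (simp add: content_ball powr_realpow)
    qed (auto simp: dyad_Suc)
    also have "C0 * (?U * r powr ?m) powr (1 - s / ?m) * ?U powr (s / ?m) = C0 * ?U * r powr (?m - s)"
    proof -
      have "?m * (1 - s / ?m) = ?m - s" by (simp add: field_simps)
      then have "(?U * r powr ?m) powr (1 - s / ?m) = ?U powr (1 - s / ?m) * r powr (?m - s)"
        by (simp add: powr_mult powr_powr)
      moreover have "?U powr (1 - s / ?m) * ?U powr (s / ?m) = ?U"
        using U by (simp flip: powr_add)
      ultimately show ?thesis by (simp add: mult_ac)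
    qed
    finally show "(\<integral>\<^sup>+z. ennreal (norm (z::'a) powr (- s)) * indicator (ball 0 r) z \<partial>lborel)
      \<le> ennreal (2 powr s * (C0 * ?U) * r powr (?m - s))"
      using C0 U by (simp add: mult.assoc flip: ennreal_mult)
  qed
qed

text \<open>The same scheme with \<Phi> the indicator of the scales above \<open>r\<close>: it is at
  most 1 and at most (2^k / r)^(2a) with a = b - m, where m is the dimension. The exponent 2a is one
  convenient choice above a.\<close>

lemma nn_integral_powr_outside_ball:
  assumes b: "real DIM('a::euclidean_space) < b"
  obtains C where "0 < C" "\<And>r. 0 < r \<Longrightarrow>
    (\<integral>\<^sup>+z. ennreal (norm (z::'a) powr (- b)) * indicator (- ball 0 r) z \<partial>lborel) \<le> ennreal (C * r powr (real DIM('a) - b))"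
proof -
  let ?m = "real DIM('a)"
  let ?U = "unit_ball_vol ?m"
  define a where "a = b - ?m"
  have a: "0 < a" and a2: "a < 2 * a" and two: "(1::real) < 2" using b by (simp_all add: a_def)
  have U: "0 < ?U" by simp
  obtain C0 where C0: "0 < C0" "\<And>(W :: int \<Rightarrow> real) \<Phi> \<Lambda> M.
    (\<And>k. 0 < W k) \<Longrightarrow> (\<And>k. 2 * W k \<le> W (k + 1)) \<Longrightarrow> (\<And>k. 0 \<le> \<Phi> k) \<Longrightarrow> (\<And>k. \<Phi> k \<le> \<Lambda>) \<Longrightarrow>
    (\<And>k. \<Phi> k \<le> M * W k powr (2 * a)) \<Longrightarrow>
    (\<integral>\<^sup>+k. ennreal (W k powr (- a) * \<Phi> k) \<partial>count_space UNIV) \<le> ennreal (C0 * \<Lambda> powr (1 - a / (2 * a)) * M powr (a / (2 * a)))"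
    by (rule Hedberg_sum[OF two a(1) a2]) (blast intro: that)
  show ?thesis
  proof (rule that[of "2 powr b * (?U * C0)"])
    show "0 < 2 powr b * (?U * C0)" using C0 U by simp
    fix r :: real assume r: "0 < r"
    let ?I = "\<lambda>k. (if r < dyad k then 1 else 0) :: real"
    have "(\<integral>\<^sup>+z. ennreal (norm (z::'a) powr (- b)) * indicator (- ball 0 r) z \<partial>lborel)
      \<le> (\<integral>\<^sup>+z. \<integral>\<^sup>+k. ennreal (2 powr b) * (ennreal (dyad k powr (- b) * ?I k) * indicator (ball (0::'a) (dyad k)) z) \<partial>count_space UNIV \<partial>lborel)"
    proof (intro nn_integral_mono)
      fix z :: 'a
      show "ennreal (norm z powr (- b)) * indicator (- ball 0 r) z
        \<le> (\<integral>\<^sup>+k. ennreal (2 powr b) * (ennreal (dyad k powr (- b) * ?I k) * indicator (ball 0 (dyad k)) z) \<partial>count_space UNIV)"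
      proof (cases "r \<le> norm z")
        case True
        have "ennreal (norm z powr (- b)) \<le> ennreal (2 powr (- (- b))) *
          (\<integral>\<^sup>+k. ennreal (dyad k powr (- b)) * indicator {k. norm z < dyad k} k \<partial>count_space UNIV)"
          using True r b by (intro powr_le_dyadic_sum) auto
        also have "\<dots> = (\<integral>\<^sup>+k. ennreal (2 powr b) * (ennreal (dyad k powr (- b)) * indicator {k. norm z < dyad k} k) \<partial>count_space UNIV)"
          by (simp add: nn_integral_cmult)
        also have "\<dots> \<le> (\<integral>\<^sup>+k. ennreal (2 powr b) * (ennreal (dyad k powr (- b) * ?I k) * indicator (ball 0 (dyad k)) z) \<partial>count_space UNIV)"
          using True by (intro nn_integral_mono mult_left_mono) (auto split: split_indicator)
        finally show ?thesis using True by simp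
      qed (auto split: split_indicator)
    qed
    also have "\<dots> = (\<integral>\<^sup>+k. \<integral>\<^sup>+z. ennreal (2 powr b) * (ennreal (dyad k powr (- b) * ?I k) * indicator (ball (0::'a) (dyad k)) z) \<partial>lborel \<partial>count_space UNIV)"
      by (intro nn_integral_count_int) measurable
    also have "\<dots> = (\<integral>\<^sup>+k. ennreal (2 powr b * ?U) * ennreal (dyad k powr (- a) * ?I k) \<partial>count_space UNIV)"
    proof (intro nn_integral_cong)
      fix k
      have "dyad k powr (- b) * dyad k ^ DIM('a) = dyad k powr (- a)"
        by (simp add: a_def flip: powr_realpow powr_add)
      then have "dyad k powr (- b) * ?I k * (?U * dyad k ^ DIM('a)) = ?U * (dyad k powr (- a) * ?I k)"
        by simp
      moreover have "(\<integral>\<^sup>+z. ennreal (2 powr b) * (ennreal (dyad k powr (- b) * ?I k) * indicator (ball (0::'a) (dyad k)) z) \<partial>lborel)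
         = ennreal (2 powr b * (dyad k powr (- b) * ?I k * (?U * dyad k ^ DIM('a))))"
        by (simp add: nn_integral_cmult nn_integral_cmult_indicator emeasure_lborel_ball_eq content_ball ennreal_mult)
      ultimately show "(\<integral>\<^sup>+z. ennreal (2 powr b) * (ennreal (dyad k powr (- b) * ?I k) * indicator (ball (0::'a) (dyad k)) z) \<partial>lborel)
         = ennreal (2 powr b * ?U) * ennreal (dyad k powr (- a) * ?I k)"
        using U by (simp flip: ennreal_mult add: mult.assoc)
    qed
    also have "\<dots> = ennreal (2 powr b * ?U) * (\<integral>\<^sup>+k. ennreal (dyad k powr (- a) * ?I k) \<partial>count_space UNIV)"
      by (simp add: nn_integral_cmult)
    also have "\<dots> \<le> ennreal (2 powr b * ?U) * ennreal (C0 * 1 powr (1 - a / (2 * a)) * (r powr (- (2 * a))) powr (a / (2 * a)))"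
    proof (intro mult_left_mono C0(2))
      fix k
      show "?I k \<le> r powr (- (2 * a)) * dyad k powr (2 * a)"
      proof (cases "r < dyad k")
        case True
        then have "1 \<le> (dyad k / r) powr (2 * a)"
          using r a by (intro ge_one_powr_ge_zero) auto
        also have "(dyad k / r) powr (2 * a) = r powr (- (2 * a)) * dyad k powr (2 * a)"
          using r by (simp add: powr_divide powr_minus_divide)
        finally show ?thesis using True by simp
      qed simp
    qed (auto simp: dyad_Suc)
    also have "C0 * 1 powr (1 - a / (2 * a)) * (r powr (- (2 * a))) powr (a / (2 * a)) = C0 * r powr (?m - b)"
      using a by (simp add: powr_powr) (simp add: a_def)
    finally show "(\<integral>\<^sup>+z. ennreal (norm (z::'a) powr (- b)) * indicator (- ball 0 r) z \<partial>lborel)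
      \<le> ennreal (2 powr b * (?U * C0) * r powr (?m - b))"
      using C0 U by (simp add: mult.assoc flip: ennreal_mult)
  qed
qed


section \<open>Kernels of symbols of negative order\<close>

lemma powr_divide_eq: "(x / y) powr a = x powr a * y powr (- a)" for x y a :: real
  by (simp add: powr_divide powr_minus_divide)

text \<open>A multiplier of order - s with a fixed constant. The jets record pure derivatives along
  the coordinate axes, since only these occur in differences along an axis, with size estimates up
  to the dimension. The value 0 at the origin fixes a multiplier that may be singular there.\<close>

definition symbol_like :: "real \<Rightarrow> real \<Rightarrow> ('a::euclidean_space \<Rightarrow> complex) \<Rightarrow> bool" where
  "symbol_like s C a \<longleftrightarrow> a \<in> borel_measurable borel \<and> a 0 = 0 \<and> (\<forall>e\<in>Basis. \<exists>D.
     (\<forall>z. z \<noteq> 0 \<longrightarrow> D 0 z = a z) \<and>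
     (\<forall>k z. z \<noteq> 0 \<longrightarrow> ((\<lambda>t. D k (z + t *\<^sub>R e)) has_vector_derivative D (Suc k) z) (at 0)) \<and>
     (\<forall>k\<le>DIM('a). \<forall>z. z \<noteq> 0 \<longrightarrow> norm (D k z) \<le> C * norm z powr (- s - real k)))"

lemma symbol_like_measurable: "symbol_like s C a \<Longrightarrow> a \<in> borel_measurable borel"
  by (simp add: symbol_like_def)

lemma symbol_like_jet:
  fixes a :: "'a::euclidean_space \<Rightarrow> complex"
  assumes "symbol_like s C a" "e \<in> Basis"
  obtains D where "\<forall>z. z \<noteq> 0 \<longrightarrow> D 0 z = a z"
    "\<forall>k z. z \<noteq> 0 \<longrightarrow> ((\<lambda>t. D k (z + t *\<^sub>R e)) has_vector_derivative D (Suc k) z) (at 0)"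
    "\<forall>k\<le>DIM('a). \<forall>z. z \<noteq> 0 \<longrightarrow> norm (D k z) \<le> C * norm z powr (- s - real k)"
  using assms unfolding symbol_like_def by (elim conjE) (drule (1) bspec, elim exE conjE, rule that)

lemma symbol_like_bound:
  fixes a :: "'a::euclidean_space \<Rightarrow> complex"
  assumes a: "symbol_like s C a"
  shows "norm (a z) \<le> C * norm z powr (- s)"
proof (cases "z = 0")
  case True
  then show ?thesis using a by (simp add: symbol_like_def)
next
  case False
  obtain e :: 'a where "e \<in> Basis" using nonempty_Basis by blast
  from symbol_like_jet[OF a this] obtain D where D: "\<forall>z. z \<noteq> 0 \<longrightarrow> D 0 z = a z"
    "\<forall>k\<le>DIM('a). \<forall>z. z \<noteq> 0 \<longrightarrow> norm (D k z) \<le> C * norm z powr (- s - real k)" .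
  then show ?thesis
    using D(1)[rule_format, of z] D(2)[rule_format, of 0 z] False by simp
qed

text \<open>The step is small compared with the distance to the origin: after as many steps as the
  dimension, the points are still at distance at least |P| / 2 from the singularity, and the
  estimates can be frozen there.\<close>

lemma diff_bound_symbol:
  fixes a :: "'a::euclidean_space \<Rightarrow> complex"
  assumes a: "symbol_like s C a" and C: "0 \<le> C" and s: "0 < s" and e: "e \<in> Basis"
    and P: "2 * real DIM('a) * \<bar>\<eta>\<bar> \<le> norm P" "0 < norm P"
  shows "diff_bound DIM('a) (C * (norm P / 2) powr (- s)) (\<bar>\<eta>\<bar> / (norm P / 2)) (\<lambda>j. a (P + real j *\<^sub>R (\<eta> *\<^sub>R e)))"
proof -
  let ?n = "DIM('a)"
  obtain D where D0: "\<And>z. z \<noteq> 0 \<Longrightarrow> D 0 z = a z"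
    and der: "\<And>k z. z \<noteq> 0 \<Longrightarrow> ((\<lambda>t. D k (z + t *\<^sub>R e)) has_vector_derivative D (Suc k) z) (at 0)"
    and bd: "\<And>k z. k \<le> ?n \<Longrightarrow> z \<noteq> 0 \<Longrightarrow> norm (D k z) \<le> C * norm z powr (- s - real k)"
  proof -
    from symbol_like_jet[OF a e] obtain D where "\<forall>z. z \<noteq> 0 \<longrightarrow> D 0 z = a z"
      "\<forall>k z. z \<noteq> 0 \<longrightarrow> ((\<lambda>t. D k (z + t *\<^sub>R e)) has_vector_derivative D (Suc k) z) (at 0)"
      "\<forall>k\<le>?n. \<forall>z. z \<noteq> 0 \<longrightarrow> norm (D k z) \<le> C * norm z powr (- s - real k)" .
    then show ?thesis by (intro that[of D]) simp_all
  qed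
  have R: "norm P / 2 \<le> norm (P + t *\<^sub>R (\<eta> *\<^sub>R e))" if "0 \<le> t" "t \<le> real ?n" for t
  proof -
    have "norm (t *\<^sub>R (\<eta> *\<^sub>R e)) = t * \<bar>\<eta>\<bar>" using that e by (simp add: abs_mult)
    also have "\<dots> \<le> real ?n * \<bar>\<eta>\<bar>" using that by (intro mult_right_mono) auto
    also have "\<dots> \<le> norm P / 2" using P by simp
    finally show ?thesis
      using norm_triangle_ineq2[of P "- (t *\<^sub>R (\<eta> *\<^sub>R e))"] by simp
  qed
  then have nz: "P + t *\<^sub>R (\<eta> *\<^sub>R e) \<noteq> 0" if "0 \<le> t" "t \<le> real ?n" for t
    using that P(2) by fastforce
  \<comment> \<open>The jet along the line, reparametrised so that a unit step is one step of length
    \<eta>; each derivative brings a factor \<eta>.\<close>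
  define E where "E k t = of_real (\<eta> ^ k) * D k (P + t *\<^sub>R (\<eta> *\<^sub>R e))" for k t
  have "diff_bound ?n (C * (norm P / 2) powr (- s)) (\<bar>\<eta>\<bar> / (norm P / 2)) (\<lambda>j. E 0 (real j))"
  proof (rule diff_bound_jet)
    fix k and t :: real assume t: "0 \<le> t" "t \<le> real ?n"
    let ?z = "P + t *\<^sub>R (\<eta> *\<^sub>R e)"
    have "((\<lambda>t'. (t' - t) * \<eta>) has_vector_derivative \<eta>) (at t)"
      by (auto intro!: derivative_eq_intros simp: has_real_derivative_iff_has_vector_derivative[symmetric])
    from vector_diff_chain_at[OF this, of "\<lambda>r. D k (?z + r *\<^sub>R e)" "D (Suc k) ?z"] der[OF nz[OF t], of k]
    have "((\<lambda>t'. D k (?z + ((t' - t) * \<eta>) *\<^sub>R e)) has_vector_derivative \<eta> *\<^sub>R D (Suc k) ?z) (at t)"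
      by (simp add: o_def)
    then have "((\<lambda>t'. D k (P + t' *\<^sub>R (\<eta> *\<^sub>R e))) has_vector_derivative \<eta> *\<^sub>R D (Suc k) ?z) (at t)"
      by (simp add: algebra_simps)
    then have "((\<lambda>t'. of_real (\<eta> ^ k) * D k (P + t' *\<^sub>R (\<eta> *\<^sub>R e))) has_vector_derivative of_real (\<eta> ^ k) * (\<eta> *\<^sub>R D (Suc k) ?z)) (at t)"
      by (intro has_vector_derivative_mult_right)
    then show "(E k has_vector_derivative E (Suc k) t) (at t)"
      by (simp add: E_def[abs_def] scaleR_conv_of_real mult_ac)
  next
    fix k and t :: real assume k: "k \<le> ?n" and t: "0 \<le> t" "t \<le> real ?n"
    let ?z = "P + t *\<^sub>R (\<eta> *\<^sub>R e)"
    have "norm (E k t) = \<bar>\<eta>\<bar> ^ k * norm (D k ?z)"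
      by (simp only: E_def norm_mult norm_of_real power_abs)
    also have "\<dots> \<le> \<bar>\<eta>\<bar> ^ k * (C * norm ?z powr (- s - real k))"
      using k nz[OF t] by (intro mult_left_mono bd) auto
    also have "\<dots> \<le> \<bar>\<eta>\<bar> ^ k * (C * (norm P / 2) powr (- s - real k))"
      using C s P(2) R[OF t] by (intro mult_left_mono powr_mono2') auto
    also have "(norm P / 2) powr (- s - real k) = (norm P / 2) powr (- s) / (norm P / 2) ^ k"
      using P(2) by (simp add: powr_diff powr_realpow)
    finally show "norm (E k t) \<le> C * (norm P / 2) powr (- s) * (\<bar>\<eta>\<bar> / (norm P / 2)) ^ k"
      by (simp add: power_divide mult_ac)
  qed
  moreover have "E 0 (real j) = a (P + real j *\<^sub>R (\<eta> *\<^sub>R e))" if "j \<le> ?n" for j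
    using that nz[of "real j"] by (simp add: E_def D0)
  ultimately show ?thesis
  proof -
    assume d: "diff_bound ?n (C * (norm P / 2) powr (- s)) (\<bar>\<eta>\<bar> / (norm P / 2)) (\<lambda>j. E 0 (real j))"
      and eq: "\<And>j. j \<le> ?n \<Longrightarrow> E 0 (real j) = a (P + real j *\<^sub>R (\<eta> *\<^sub>R e))"
    have cong: "i + j \<le> ?n \<Longrightarrow> (sdiff ^^ i) (\<lambda>j. E 0 (real j)) j = (sdiff ^^ i) (\<lambda>j. a (P + real j *\<^sub>R (\<eta> *\<^sub>R e))) j" for i j
    proof (induction i arbitrary: j)
      case (Suc i)
      then have "i + Suc j \<le> ?n" "i + j \<le> ?n" by simp_all
      then show ?case by (simp only: funpow.simps o_apply sdiff_def[of "(sdiff ^^ i) f" for f] Suc.IH)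
    qed (simp add: eq)
    show ?thesis
      unfolding diff_bound_def
    proof (intro allI impI)
      fix i j assume ij: "i + j \<le> ?n"
      show "norm ((sdiff ^^ i) (\<lambda>j. a (P + real j *\<^sub>R (\<eta> *\<^sub>R e))) j) \<le> C * (norm P / 2) powr (- s) * (\<bar>\<eta>\<bar> / (norm P / 2)) ^ i"
        using diff_boundD[OF d ij] unfolding cong[OF ij] .
    qed
  qed
qed

text \<open>A difference consists of two translates, so each one doubles the integral at most and
  enlarges the ball by the length of the step. This is used near the singularity, where no
  cancellation is available.\<close>

lemma nn_integral_fdiff_ball:
  fixes f :: "'a::euclidean_space \<Rightarrow> complex"
  assumes [measurable]: "f \<in> borel_measurable borel"
  shows "(\<integral>\<^sup>+z. ennreal (norm ((fdiff h ^^ i) f z)) * indicator (ball 0 r) z \<partial>lborel)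
    \<le> 2 ^ i * (\<integral>\<^sup>+z. ennreal (norm (f z)) * indicator (ball 0 (r + real i * norm h)) z \<partial>lborel)"
proof (induction i arbitrary: r)
  case (Suc i)
  let ?d = "(fdiff h ^^ i) f"
  let ?I = "\<lambda>r. \<integral>\<^sup>+z. ennreal (norm (?d z)) * indicator (ball 0 r) z \<partial>lborel"
  let ?J = "\<integral>\<^sup>+z. ennreal (norm (f z)) * indicator (ball 0 (r + real (Suc i) * norm h)) z \<partial>lborel"
  have [measurable]: "?d \<in> borel_measurable borel" by measurable
  have "(\<integral>\<^sup>+z. ennreal (norm ((fdiff h ^^ Suc i) f z)) * indicator (ball 0 r) z \<partial>lborel)
     \<le> (\<integral>\<^sup>+z. ennreal (norm (?d (h + 1 *\<^sub>R z))) * indicator (ball 0 (r + norm h)) (h + 1 *\<^sub>R z)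
          + ennreal (norm (?d z)) * indicator (ball 0 (r + norm h)) z \<partial>lborel)"
  proof (intro nn_integral_mono)
    fix z
    have n: "norm ((fdiff h ^^ Suc i) f z) \<le> norm (?d (z + h)) + norm (?d z)"
      by (simp add: fdiff_def norm_triangle_ineq4)
    show "ennreal (norm ((fdiff h ^^ Suc i) f z)) * indicator (ball 0 r) z
       \<le> ennreal (norm (?d (h + 1 *\<^sub>R z))) * indicator (ball 0 (r + norm h)) (h + 1 *\<^sub>R z)
          + ennreal (norm (?d z)) * indicator (ball 0 (r + norm h)) z"
    proof (cases "norm z < r")
      case True
      then have "norm (h + z) < r + norm h" "norm z < r + norm h"
        using norm_triangle_ineq[of h z] norm_ge_zero[of h] by linarith+
      then show ?thesis using True n by (simp add: add.commute ennreal_leI flip: ennreal_plus)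
    qed simp
  qed
  also have "\<dots> = (\<integral>\<^sup>+z. ennreal (norm (?d (h + 1 *\<^sub>R z))) * indicator (ball 0 (r + norm h)) (h + 1 *\<^sub>R z) \<partial>lborel) + ?I (r + norm h)"
    by (intro nn_integral_add) measurable
  also have "(\<integral>\<^sup>+z. ennreal (norm (?d (h + 1 *\<^sub>R z))) * indicator (ball 0 (r + norm h)) (h + 1 *\<^sub>R z) \<partial>lborel) = ?I (r + norm h)"
    using nn_integral_affine[of "\<lambda>z. ennreal (norm (?d z)) * indicator (ball 0 (r + norm h)) z" 1 h] by simp
  also have "?I (r + norm h) + ?I (r + norm h) \<le> 2 ^ i * ?J + ?I (r + norm h)"
    using Suc[of "r + norm h"] by (intro add_right_mono) (simp add: algebra_simps)
  finally have "(\<integral>\<^sup>+z. ennreal (norm ((fdiff h ^^ Suc i) f z)) * indicator (ball 0 r) z \<partial>lborel) \<le> 2 ^ i * ?J + ?I (r + norm h)" .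
  also have "\<dots> \<le> 2 ^ i * ?J + 2 ^ i * ?J"
    using Suc[of "r + norm h"] by (intro add_left_mono) (simp add: algebra_simps)
  also have "\<dots> = 2 ^ Suc i * ?J" by (simp add: mult.assoc mult_2 distrib_right)
  finally show ?case .
qed simp

text \<open>Near the origin the symbol is integrable because \<open>s\<close> is below the dimension
  m; far out the cutoff adds |z|^(-2m). The bound depends on \<open>L\<close> and only justifies the
  manipulations of the kernel.\<close>

lemma integrable_symbol_cutoff:
  fixes a :: "'a::euclidean_space \<Rightarrow> complex"
  assumes a: "symbol_like s C a" and C: "0 \<le> C" and s: "0 < s" "s < real DIM('a)"
  shows "integrable lborel (\<lambda>z. a z * cutoff L z)"
proof (rule integrableI_bounded)
  let ?m = "real DIM('a)"
  note [measurable] = symbol_like_measurable[OF a]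
  show "(\<lambda>z. a z * cutoff L z) \<in> borel_measurable lborel" by measurable
  obtain C1 where C1: "0 < C1" "\<And>r. 0 < r \<Longrightarrow>
    (\<integral>\<^sup>+z. ennreal (norm (z::'a) powr (- s)) * indicator (ball 0 r) z \<partial>lborel) \<le> ennreal (C1 * r powr (?m - s))"
    by (rule nn_integral_powr_ball[OF s]) (blast intro: that)
  have b: "real DIM('a) < s + 2 * ?m" using s by simp
  obtain C2 where C2: "0 < C2" "\<And>r. 0 < r \<Longrightarrow>
    (\<integral>\<^sup>+z. ennreal (norm (z::'a) powr (- (s + 2 * ?m))) * indicator (- ball 0 r) z \<partial>lborel) \<le> ennreal (C2 * r powr (?m - (s + 2 * ?m)))"
    by (rule nn_integral_powr_outside_ball[OF b]) (blast intro: that)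
  have pt: "ennreal (norm (a z * cutoff L z)) \<le> ennreal C * (ennreal (norm z powr (- s)) * indicator (ball 0 1) z)
      + ennreal (C * (L\<^sup>2) ^ DIM('a)) * (ennreal (norm z powr (- (s + 2 * ?m))) * indicator (- ball 0 1) z)" for z
  proof (cases "norm z < 1")
    case True
    have "norm (a z * cutoff L z) \<le> C * norm z powr (- s) * 1"
      unfolding norm_mult using C by (intro mult_mono symbol_like_bound[OF a] norm_cutoff_le_1) auto
    then show ?thesis using True C by (simp add: ennreal_leI flip: ennreal_mult)
  next
    case False
    then have z: "0 < norm z" by auto
    have "norm (cutoff L z) \<le> (L\<^sup>2 / (norm z)\<^sup>2) ^ DIM('a)"
      unfolding norm_cutoff using z by (intro power_mono divide_left_mono) (auto intro!: mult_pos_pos add_nonneg_pos)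
    also have "\<dots> = (L\<^sup>2) ^ DIM('a) * norm z powr (- (2 * ?m))"
    proof -
      have "((norm z)\<^sup>2) ^ DIM('a) = norm z powr (2 * ?m)"
        using powr_realpow[OF z, of "2 * DIM('a)"] by (simp add: power_mult)
      then show ?thesis by (simp add: power_divide powr_minus_divide)
    qed
    finally have "norm (a z * cutoff L z) \<le> (C * norm z powr (- s)) * ((L\<^sup>2) ^ DIM('a) * norm z powr (- (2 * ?m)))"
      unfolding norm_mult using C by (intro mult_mono symbol_like_bound[OF a]) auto
    also have "\<dots> = C * (L\<^sup>2) ^ DIM('a) * (norm z powr (- s) * norm z powr (- (2 * ?m)))" by simp
    also have "norm z powr (- s) * norm z powr (- (2 * ?m)) = norm z powr (- (s + 2 * ?m))"
      by (simp flip: powr_add)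
    finally show ?thesis using False C by (simp add: ennreal_leI flip: ennreal_mult)
  qed
  have "(\<integral>\<^sup>+z. ennreal (norm (a z * cutoff L z)) \<partial>lborel) \<le> (\<integral>\<^sup>+z. ennreal C * (ennreal (norm (z::'a) powr (- s)) * indicator (ball 0 1) z)
      + ennreal (C * (L\<^sup>2) ^ DIM('a)) * (ennreal (norm z powr (- (s + 2 * ?m))) * indicator (- ball 0 1) z) \<partial>lborel)"
    by (intro nn_integral_mono pt)
  also have "\<dots> = ennreal C * (\<integral>\<^sup>+z. ennreal (norm (z::'a) powr (- s)) * indicator (ball 0 1) z \<partial>lborel)
      + ennreal (C * (L\<^sup>2) ^ DIM('a)) * (\<integral>\<^sup>+z. ennreal (norm (z::'a) powr (- (s + 2 * ?m))) * indicator (- ball 0 1) z \<partial>lborel)"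
    by (subst nn_integral_add, measurable) (simp add: nn_integral_cmult)
  also have "\<dots> \<le> ennreal C * ennreal (C1 * 1 powr (?m - s)) + ennreal (C * (L\<^sup>2) ^ DIM('a)) * ennreal (C2 * 1 powr (?m - (s + 2 * ?m)))"
    by (intro add_mono mult_left_mono C1 C2) auto
  also have "\<dots> < \<infinity>" by (simp add: ennreal_mult_less_top)
  finally show "(\<integral>\<^sup>+z. ennreal (norm (a z * cutoff L z)) \<partial>lborel) < \<infinity>" .
qed

text \<open>As many differences as the dimension m, with a half-period step of length |\<eta>|,
  comparable to 1/|u| from above. Within distance 2m|\<eta>| of the origin the size of the symbol
  gives |\<eta>|^(m-s); farther out the differences are at most |\<eta>|^m |z|^(-s-m), whose
  integral is of the same order since s > 0. No bound involves \<open>L\<close>.\<close>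

proposition kernel_bound:
  assumes s: "0 < s" "s < real DIM('a::euclidean_space)" and C: "0 \<le> C"
  obtains K where "0 \<le> K" "\<And>(a :: 'a \<Rightarrow> complex) L u. symbol_like s C a \<Longrightarrow> 0 < L \<Longrightarrow> u \<noteq> 0 \<Longrightarrow>
    norm (LINT z|lborel. ecis u z * (a z * cutoff L z)) \<le> K * norm u powr (s - real DIM('a))"
proof -
  let ?m = "real DIM('a)"
  let ?n = "DIM('a)"
  obtain C1 where C1: "0 < C1" "\<And>r. 0 < r \<Longrightarrow>
    (\<integral>\<^sup>+z. ennreal (norm (z::'a) powr (- s)) * indicator (ball 0 r) z \<partial>lborel) \<le> ennreal (C1 * r powr (?m - s))"
    by (rule nn_integral_powr_ball[OF s]) (blast intro: that)
  have b: "real DIM('a) < s + ?m" using s by simp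
  obtain C2 where C2: "0 < C2" "\<And>r. 0 < r \<Longrightarrow>
    (\<integral>\<^sup>+z. ennreal (norm (z::'a) powr (- (s + ?m))) * indicator (- ball 0 r) z \<partial>lborel) \<le> ennreal (C2 * r powr (?m - (s + ?m)))"
    by (rule nn_integral_powr_outside_ball[OF b]) (blast intro: that)
  obtain Cc where Cc: "0 \<le> Cc" "\<And>(P :: 'a) e \<eta> L R. e \<in> Basis \<Longrightarrow> 0 < L \<Longrightarrow> 0 < R \<Longrightarrow>
    (\<And>j. j \<le> ?n \<Longrightarrow> R\<^sup>2 \<le> L\<^sup>2 + (norm (P + (\<eta> * real j) *\<^sub>R e))\<^sup>2) \<Longrightarrow>
    diff_bound ?n (Cc * (L / R) ^ (2 * DIM('a))) (\<bar>\<eta>\<bar> / R) (\<lambda>j. cutoff L (P + (\<eta> * real j) *\<^sub>R e))"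
    by (rule diff_bound_cutoff[where n="?n" and 'a='a]) (blast intro: that)
  define B where "B = 2 ^ ?n * C * Cc * 2 powr (s + ?m)"
  have B: "0 \<le> B" using C Cc by (simp add: B_def)
  define K1 where "K1 = 2 ^ ?n * (C * (C1 * (3 * ?m) powr (?m - s))) + B * (C2 * (2 * ?m) powr (- s))"
  have K1: "0 \<le> K1" using C C1 C2 B by (simp add: K1_def)
  show ?thesis
  proof (rule that[of "K1 * (pi * ?m) powr (?m - s)"])
    show "0 \<le> K1 * (pi * ?m) powr (?m - s)" using K1 by simp
    fix a :: "'a \<Rightarrow> complex" and L :: real and u :: 'a
    assume a: "symbol_like s C a" and L: "0 < L" and u: "u \<noteq> 0"
    note [measurable] = symbol_like_measurable[OF a]
    let ?f = "\<lambda>z. a z * cutoff L z"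
    obtain e \<eta> where e: "e \<in> Basis" "u \<bullet> (\<eta> *\<^sub>R e) = pi" "0 < \<bar>\<eta>\<bar>" "\<bar>\<eta>\<bar> \<le> pi * real DIM('a) / norm u"
      by (rule half_period[OF u])
    define h where "h = \<eta> *\<^sub>R e"
    have h: "norm h = \<bar>\<eta>\<bar>" using e by (simp add: h_def)
    let ?d = "(fdiff h ^^ ?n) ?f"
    let ?r = "2 * ?m * \<bar>\<eta>\<bar>"
    have r: "0 < ?r" using e by simp
    have [measurable]: "?f \<in> borel_measurable borel" by measurable
    have [measurable]: "?d \<in> borel_measurable borel" by measurable
    have far: "norm (?d z) \<le> B * \<bar>\<eta>\<bar> ^ ?n * norm z powr (- (s + ?m))" if z: "?r \<le> norm z" for z
    proof -
      have z0: "0 < norm z" using z r by linarith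
      let ?R = "norm z / 2"
      \<comment> \<open>The scale on which the cutoff varies near \<open>z\<close> is the larger of
        \<open>L\<close> and |z| / 2. With it the amplitude is at most 1 and each difference gains
        at least as much as for the symbol, uniformly in \<open>L\<close>.\<close>
      let ?R' = "max L ?R"
      have 1: "diff_bound ?n (C * ?R powr (- s)) (\<bar>\<eta>\<bar> / ?R) (\<lambda>j. a (z + real j *\<^sub>R h))"
        unfolding h_def using z z0 by (intro diff_bound_symbol[OF a C s(1) e(1)])
      have far_pt: "?R \<le> norm (z + (\<eta> * real j) *\<^sub>R e)" if "j \<le> ?n" for j
      proof -
        have "norm ((\<eta> * real j) *\<^sub>R e) \<le> ?m * \<bar>\<eta>\<bar>"
          using e(1) that by (simp add: abs_mult mult.commute mult_left_mono)
        then show ?thesis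
          using norm_triangle_ineq2[of z "- ((\<eta> * real j) *\<^sub>R e)"] z by simp
      qed
      have "diff_bound ?n (Cc * (L / ?R') ^ (2 * DIM('a))) (\<bar>\<eta>\<bar> / ?R') (\<lambda>j. cutoff L (z + (\<eta> * real j) *\<^sub>R e))"
      proof (rule Cc(2)[OF e(1) L])
        show "0 < ?R'" using L by simp
        fix j assume "j \<le> ?n"
        then have "?R\<^sup>2 \<le> (norm (z + (\<eta> * real j) *\<^sub>R e))\<^sup>2"
          using far_pt by (intro power_mono) auto
        moreover have "?R'\<^sup>2 = L\<^sup>2 \<or> ?R'\<^sup>2 = ?R\<^sup>2"
          by (simp add: max_def)
        ultimately show "?R'\<^sup>2 \<le> L\<^sup>2 + (norm (z + (\<eta> * real j) *\<^sub>R e))\<^sup>2"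
          using zero_le_power2[of L] zero_le_power2[of "norm (z + (\<eta> * real j) *\<^sub>R e)"] by linarith
      qed
      moreover have "Cc * (L / ?R') ^ (2 * DIM('a)) \<le> Cc"
      proof -
        have "(L / ?R') ^ (2 * DIM('a)) \<le> 1" using L by (intro power_le_one) auto
        then show ?thesis using Cc(1) by (simp add: mult_left_le)
      qed
      moreover have "\<bar>\<eta>\<bar> / ?R' \<le> \<bar>\<eta>\<bar> / ?R" using z0 L by (intro divide_left_mono) auto
      ultimately have "diff_bound ?n Cc (\<bar>\<eta>\<bar> / ?R) (\<lambda>j. cutoff L (z + (\<eta> * real j) *\<^sub>R e))"
        using Cc(1) L by (elim diff_bound_mono) auto
      then have 2: "diff_bound ?n Cc (\<bar>\<eta>\<bar> / ?R) (\<lambda>j. cutoff L (z + real j *\<^sub>R h))"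
        by (simp add: h_def mult.commute)
      have "diff_bound ?n (2 ^ ?n * (C * ?R powr (- s)) * Cc) (\<bar>\<eta>\<bar> / ?R) (\<lambda>j. ?f (z + real j *\<^sub>R h))"
        using C Cc by (intro diff_bound_mult 1 2) auto
      then have "norm (?d z) \<le> 2 ^ ?n * (C * ?R powr (- s)) * Cc * (\<bar>\<eta>\<bar> / ?R) ^ ?n"
        by (rule diff_bound_fdiff)
      also have "\<dots> = 2 ^ ?n * C * Cc * \<bar>\<eta>\<bar> ^ ?n * (?R powr (- s) / ?R powr ?m)"
      proof -
        have "?R ^ ?n = ?R powr ?m" using z0 by (simp add: powr_realpow)
        then show ?thesis by (simp only: power_divide[of "\<bar>\<eta>\<bar>" ?R]) simp
      qed
      also have "?R powr (- s) / ?R powr ?m = ?R powr (- (s + ?m))"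
        by (simp flip: powr_diff)
      also have "\<dots> = 2 powr (s + ?m) * norm z powr (- (s + ?m))"
        by (simp only: powr_divide_eq minus_minus mult.commute)
      finally show ?thesis by (simp add: B_def mult_ac)
    qed
    \<comment> \<open>The m differences enlarge the ball from radius 2m|\<eta>| to
      3m|\<eta>|.\<close>
    have near: "(\<integral>\<^sup>+z. ennreal (norm (?d z)) * indicator (ball 0 ?r) z \<partial>lborel)
        \<le> ennreal (2 ^ ?n * (C * (C1 * (3 * ?m) powr (?m - s))) * \<bar>\<eta>\<bar> powr (?m - s))"
    proof -
      have eqr: "?r + ?m * norm h = 3 * ?m * \<bar>\<eta>\<bar>" by (simp add: h)
      have "(\<integral>\<^sup>+z. ennreal (norm (?d z)) * indicator (ball 0 ?r) z \<partial>lborel)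
          \<le> 2 ^ ?n * (\<integral>\<^sup>+z. ennreal (norm (?f z)) * indicator (ball 0 (?r + ?m * norm h)) z \<partial>lborel)"
        by (rule nn_integral_fdiff_ball) measurable
      also have "\<dots> \<le> 2 ^ ?n * (\<integral>\<^sup>+z. ennreal C * (ennreal (norm (z::'a) powr (- s)) * indicator (ball 0 (3 * ?m * \<bar>\<eta>\<bar>)) z) \<partial>lborel)"
      proof (intro mult_left_mono nn_integral_mono)
        fix z
        have "norm (?f z) \<le> C * norm z powr (- s) * 1"
          unfolding norm_mult using C by (intro mult_mono symbol_like_bound[OF a] norm_cutoff_le_1) auto
        then show "ennreal (norm (?f z)) * indicator (ball 0 (?r + ?m * norm h)) z
            \<le> ennreal C * (ennreal (norm z powr (- s)) * indicator (ball 0 (3 * ?m * \<bar>\<eta>\<bar>)) z)"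
          unfolding eqr using C by (auto simp: ennreal_leI simp flip: ennreal_mult split: split_indicator)
      qed simp
      also have "\<dots> = 2 ^ ?n * (ennreal C * (\<integral>\<^sup>+z. ennreal (norm (z::'a) powr (- s)) * indicator (ball 0 (3 * ?m * \<bar>\<eta>\<bar>)) z \<partial>lborel))"
        by (simp add: nn_integral_cmult)
      also have "\<dots> \<le> 2 ^ ?n * (ennreal C * ennreal (C1 * (3 * ?m * \<bar>\<eta>\<bar>) powr (?m - s)))"
        using e by (intro mult_left_mono C1) auto
      also have "\<dots> = ennreal (2 ^ ?n) * (ennreal C * ennreal (C1 * ((3 * ?m) powr (?m - s) * \<bar>\<eta>\<bar> powr (?m - s))))"
        by (simp add: powr_mult ennreal_power flip: ennreal_numeral)
      also have "\<dots> = ennreal (2 ^ ?n * (C * (C1 * ((3 * ?m) powr (?m - s) * \<bar>\<eta>\<bar> powr (?m - s)))))"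
        using C C1 by (simp only: ennreal_mult[symmetric] mult_nonneg_nonneg less_imp_le powr_ge_zero zero_le_power zero_le_numeral)
      finally show ?thesis by (simp add: mult_ac)
    qed
    have outer: "(\<integral>\<^sup>+z. ennreal (norm (?d z)) * indicator (- ball 0 ?r) z \<partial>lborel)
        \<le> ennreal (B * (C2 * (2 * ?m) powr (- s)) * \<bar>\<eta>\<bar> powr (?m - s))"
    proof -
      have "(\<integral>\<^sup>+z. ennreal (norm (?d z)) * indicator (- ball 0 ?r) z \<partial>lborel)
        \<le> (\<integral>\<^sup>+z. ennreal (B * \<bar>\<eta>\<bar> ^ ?n) * (ennreal (norm (z::'a) powr (- (s + ?m))) * indicator (- ball 0 ?r) z) \<partial>lborel)"
      proof (intro nn_integral_mono)
        fix z
        show "ennreal (norm (?d z)) * indicator (- ball 0 ?r) z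
           \<le> ennreal (B * \<bar>\<eta>\<bar> ^ ?n) * (ennreal (norm z powr (- (s + ?m))) * indicator (- ball 0 ?r) z)"
        proof (cases "?r \<le> norm z")
          case True
          then have "z \<in> - ball 0 ?r" by simp
          then show ?thesis using far[OF True] B by (simp add: ennreal_leI flip: ennreal_mult)
        next
          case False
          then have "z \<notin> - ball 0 ?r" by simp
          then show ?thesis by simp
        qed
      qed
      also have "\<dots> = ennreal (B * \<bar>\<eta>\<bar> ^ ?n) * (\<integral>\<^sup>+z. ennreal (norm (z::'a) powr (- (s + ?m))) * indicator (- ball 0 ?r) z \<partial>lborel)"
        by (simp add: nn_integral_cmult)
      also have "\<dots> \<le> ennreal (B * \<bar>\<eta>\<bar> ^ ?n) * ennreal (C2 * ?r powr (?m - (s + ?m)))"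
        using r by (intro mult_left_mono C2) auto
      also have "\<dots> = ennreal (B * (C2 * (2 * ?m) powr (- s)) * \<bar>\<eta>\<bar> powr (?m - s))"
      proof -
        have "\<bar>\<eta>\<bar> ^ ?n * \<bar>\<eta>\<bar> powr (- s) = \<bar>\<eta>\<bar> powr (?m - s)"
          using e(3) by (simp flip: powr_realpow powr_add)
        moreover have "?r powr (?m - (s + ?m)) = (2 * ?m) powr (- s) * \<bar>\<eta>\<bar> powr (- s)"
          by (simp add: powr_mult)
        moreover have "B * \<bar>\<eta>\<bar> ^ ?n * (C2 * ((2 * ?m) powr (- s) * \<bar>\<eta>\<bar> powr (- s)))
            = B * (C2 * (2 * ?m) powr (- s)) * (\<bar>\<eta>\<bar> ^ ?n * \<bar>\<eta>\<bar> powr (- s))"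
          by (simp only: mult_ac)
        ultimately have "B * \<bar>\<eta>\<bar> ^ ?n * (C2 * ?r powr (?m - (s + ?m))) = B * (C2 * (2 * ?m) powr (- s)) * \<bar>\<eta>\<bar> powr (?m - s)"
          by (simp only:)
        then show ?thesis using B C2 by (simp flip: ennreal_mult)
      qed
      finally show ?thesis .
    qed
    have "ennreal (norm (LINT z|lborel. ecis u z * ?f z)) \<le> (\<integral>\<^sup>+z. ennreal (norm (?d z)) \<partial>lborel)"
      using e(2) unfolding h_def by (intro norm_oscillatory_le integrable_symbol_cutoff[OF a C s]) measurable
    also have "\<dots> = (\<integral>\<^sup>+z. ennreal (norm (?d z)) * indicator (ball 0 ?r) z + ennreal (norm (?d z)) * indicator (- ball 0 ?r) z \<partial>lborel)"
      by (intro nn_integral_cong) (auto split: split_indicator)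
    also have "\<dots> = (\<integral>\<^sup>+z. ennreal (norm (?d z)) * indicator (ball 0 ?r) z \<partial>lborel) + (\<integral>\<^sup>+z. ennreal (norm (?d z)) * indicator (- ball 0 ?r) z \<partial>lborel)"
      by (intro nn_integral_add) measurable
    also have "\<dots> \<le> ennreal (2 ^ ?n * (C * (C1 * (3 * ?m) powr (?m - s))) * \<bar>\<eta>\<bar> powr (?m - s)) + ennreal (B * (C2 * (2 * ?m) powr (- s)) * \<bar>\<eta>\<bar> powr (?m - s))"
      by (intro add_mono near outer)
    also have "\<dots> = ennreal (K1 * \<bar>\<eta>\<bar> powr (?m - s))"
      using C C1 C2 B by (simp add: K1_def distrib_right flip: ennreal_plus)
    finally have "norm (LINT z|lborel. ecis u z * ?f z) \<le> K1 * \<bar>\<eta>\<bar> powr (?m - s)"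
      using K1 by (simp add: ennreal_le_iff)
    also have "\<dots> \<le> K1 * (pi * ?m / norm u) powr (?m - s)"
      using K1 e s by (intro mult_left_mono powr_mono2) auto
    also have "(pi * ?m / norm u) powr (?m - s) = (pi * ?m) powr (?m - s) * norm u powr (- (?m - s))"
      by (rule powr_divide_eq)
    finally show "norm (LINT z|lborel. ecis u z * ?f z) \<le> K1 * (pi * ?m) powr (?m - s) * norm u powr (s - ?m)"
      by (simp add: mult.assoc)
  qed
qed


section \<open>Fourier transform of the cutoff\<close>

definition cutoff_ft :: "real \<Rightarrow> 'a::euclidean_space \<Rightarrow> complex" where
  "cutoff_ft L v = (LINT z|lborel. ecis v z * cutoff L z)"

lemma measurable_cutoff_ft [measurable]: "cutoff_ft L \<in> borel_measurable borel"
  unfolding cutoff_ft_def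
  by (intro sigma_finite_measure.borel_measurable_lebesgue_integral[OF sigma_finite_lborel]) measurable

lemma integrable_cutoff_1: "integrable lborel (cutoff 1 :: 'a::euclidean_space \<Rightarrow> complex)"
proof (rule integrableI_bounded)
  let ?m = "real DIM('a)"
  show "(cutoff 1 :: 'a \<Rightarrow> complex) \<in> borel_measurable lborel" by measurable
  have b: "real DIM('a) < 2 * ?m" by simp
  obtain C2 where C2: "0 < C2" "\<And>r. 0 < r \<Longrightarrow>
    (\<integral>\<^sup>+z. ennreal (norm (z::'a) powr (- (2 * ?m))) * indicator (- ball 0 r) z \<partial>lborel) \<le> ennreal (C2 * r powr (?m - (2 * ?m)))"
    by (rule nn_integral_powr_outside_ball[OF b]) (blast intro: that)
  have pt: "ennreal (norm (cutoff 1 (z::'a))) \<le> indicator (ball 0 1) z + ennreal (norm z powr (- (2 * ?m))) * indicator (- ball 0 1) z" for z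
  proof (cases "norm z < 1")
    case True
    have "ennreal (norm (cutoff 1 z)) \<le> ennreal 1" by (intro ennreal_leI norm_cutoff_le_1)
    then show ?thesis using True by simp
  next
    case False
    then have z: "0 < norm z" by auto
    have "norm (cutoff 1 z) \<le> (1 / (norm z)\<^sup>2) ^ DIM('a)"
      unfolding norm_cutoff using z by (auto intro!: power_mono divide_left_mono mult_pos_pos add_nonneg_pos)
    also have "\<dots> = norm z powr (- (2 * ?m))"
      using powr_realpow[OF z, of "2 * DIM('a)"] by (simp add: power_mult power_divide powr_minus_divide)
    finally show ?thesis using False by (simp add: ennreal_leI)
  qed
  have "(\<integral>\<^sup>+z. ennreal (norm (cutoff 1 (z::'a))) \<partial>lborel)
     \<le> (\<integral>\<^sup>+z. indicator (ball 0 1) z + ennreal (norm (z::'a) powr (- (2 * ?m))) * indicator (- ball 0 1) z \<partial>lborel)"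
    by (intro nn_integral_mono pt)
  also have "\<dots> = emeasure lborel (ball (0::'a) 1) + (\<integral>\<^sup>+z. ennreal (norm (z::'a) powr (- (2 * ?m))) * indicator (- ball 0 1) z \<partial>lborel)"
    by (subst nn_integral_add) simp_all
  also have "\<dots> \<le> emeasure lborel (ball (0::'a) 1) + ennreal (C2 * 1 powr (?m - (2 * ?m)))"
    by (intro add_left_mono C2) simp
  also have "\<dots> < \<infinity>" by (simp add: emeasure_lborel_ball_eq)
  finally show "(\<integral>\<^sup>+z. ennreal (norm (cutoff 1 (z::'a))) \<partial>lborel) < \<infinity>" .
qed

text \<open>One difference more than the dimension m gives decay of order m + 1, enough for
  integrability. The differences of the cutoff are bounded by a multiple of the cutoff itself, so
  nothing is lost in the integral over \<open>z\<close>.\<close>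

lemma cutoff_ft_decay:
  obtains K V0 where "0 \<le> K" "0 < V0"
    "\<And>v::'a::euclidean_space. V0 \<le> norm v \<Longrightarrow> norm (cutoff_ft 1 v) \<le> K * norm v powr (- (real DIM('a) + 1))"
proof -
  let ?m = "real DIM('a)"
  let ?n = "Suc DIM('a)"
  obtain Cc where Cc: "0 \<le> Cc" "\<And>(P :: 'a) e \<eta> L R. e \<in> Basis \<Longrightarrow> 0 < L \<Longrightarrow> 0 < R \<Longrightarrow>
    (\<And>j. j \<le> ?n \<Longrightarrow> R\<^sup>2 \<le> L\<^sup>2 + (norm (P + (\<eta> * real j) *\<^sub>R e))\<^sup>2) \<Longrightarrow>
    diff_bound ?n (Cc * (L / R) ^ (2 * DIM('a))) (\<bar>\<eta>\<bar> / R) (\<lambda>j. cutoff L (P + (\<eta> * real j) *\<^sub>R e))"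
    by (rule diff_bound_cutoff[where n="?n" and 'a='a]) (blast intro: that)
  define c0 where "c0 = (LINT z|lborel. norm (cutoff 1 (z::'a)))"
  have c0: "(\<integral>\<^sup>+z. ennreal (norm (cutoff 1 (z::'a))) \<partial>lborel) = ennreal c0" "0 \<le> c0"
    unfolding c0_def by (subst nn_integral_eq_integral) (auto intro: integrable_norm integrable_cutoff_1)
  define K0 where "K0 = Cc * 2 ^ (2 * DIM('a)) * 2 ^ ?n * c0"
  have K0: "0 \<le> K0" using Cc c0 by (simp add: K0_def)
  show ?thesis
  proof (rule that[of "K0 * (pi * ?m) ^ ?n" "2 * real ?n * (pi * ?m)"])
    show "0 \<le> K0 * (pi * ?m) ^ ?n" using K0 by simp
    show "0 < 2 * real ?n * (pi * ?m)" by simp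
    fix v :: 'a
    assume v: "2 * real ?n * (pi * ?m) \<le> norm v"
    have v0: "0 < norm v" using v \<open>0 < 2 * real ?n * (pi * ?m)\<close> by linarith
    then have "v \<noteq> 0" by auto
    then obtain e \<eta> where e: "e \<in> Basis" "v \<bullet> (\<eta> *\<^sub>R e) = pi" "0 < \<bar>\<eta>\<bar>" "\<bar>\<eta>\<bar> \<le> pi * real DIM('a) / norm v"
      by (rule half_period)
    define h where "h = \<eta> *\<^sub>R e"
    \<comment> \<open>The threshold for |v| is chosen so that all steps together have length at most
      1/2, small on the unit scale of the cutoff.\<close>
    have small: "real ?n * \<bar>\<eta>\<bar> \<le> 1 / 2"
    proof -
      have "real ?n * \<bar>\<eta>\<bar> \<le> real ?n * (pi * ?m / norm v)" using e by (intro mult_left_mono) auto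
      also have "\<dots> \<le> 1 / 2" using v v0 by (simp add: field_simps)
      finally show ?thesis .
    qed
    have pt: "norm ((fdiff h ^^ ?n) (cutoff 1) z) \<le> Cc * 2 ^ (2 * DIM('a)) * 2 ^ ?n * \<bar>\<eta>\<bar> ^ ?n * norm (cutoff 1 z)" for z
    proof -
      \<comment> \<open>Half the distance scale at \<open>z\<close>, which all steps respect; its
        power 1/R^(2m) is 4^m times the modulus of the cutoff.\<close>
      define R where "R = sqrt (1 + (norm z)\<^sup>2) / 2"
      have "1 \<le> sqrt (1 + (norm z)\<^sup>2)" by simp
      then have R0: "0 < R" "1 \<le> 2 * R" unfolding R_def by linarith+
      have aux: "(1 + a) / 4 \<le> 1 + b" if "a \<le> 1" "0 \<le> b" for a b :: real
        using that by (simp add: field_simps)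
      have R2: "R\<^sup>2 = (1 + (norm z)\<^sup>2) / 4" by (simp add: R_def power_divide)
      have "diff_bound ?n (Cc * (1 / R) ^ (2 * DIM('a))) (\<bar>\<eta>\<bar> / R) (\<lambda>j. cutoff 1 (z + (\<eta> * real j) *\<^sub>R e))"
      proof (rule Cc(2)[OF e(1) _ R0(1)])
        fix j assume j: "j \<le> ?n"
        have "norm ((\<eta> * real j) *\<^sub>R e) = real j * \<bar>\<eta>\<bar>" using e(1) by (simp add: abs_mult)
        also have "\<dots> \<le> real ?n * \<bar>\<eta>\<bar>" using j by (intro mult_right_mono) auto
        also have "\<dots> \<le> 1 / 2" by (rule small)
        finally have "norm z - 1 / 2 \<le> norm (z + (\<eta> * real j) *\<^sub>R e)"
          using norm_triangle_ineq2[of z "- ((\<eta> * real j) *\<^sub>R e)"] by simp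
        then have "norm z / 2 \<le> norm (z + (\<eta> * real j) *\<^sub>R e) \<or> norm z \<le> 1" by linarith
        then show "R\<^sup>2 \<le> 1\<^sup>2 + (norm (z + (\<eta> * real j) *\<^sub>R e))\<^sup>2"
        proof
          assume "norm z / 2 \<le> norm (z + (\<eta> * real j) *\<^sub>R e)"
          then have "(norm z / 2)\<^sup>2 \<le> (norm (z + (\<eta> * real j) *\<^sub>R e))\<^sup>2" by (intro power_mono) auto
          then show ?thesis unfolding R2 by (simp add: power_divide)
        next
          assume "norm z \<le> 1"
          then have "(norm z)\<^sup>2 \<le> 1" by (simp add: power_le_one)
          then show ?thesis unfolding R2 using aux[OF _ zero_le_power2] by (simp only: power_one)
        qed
      qed simp
      then have "diff_bound ?n (Cc * (1 / R) ^ (2 * DIM('a))) (\<bar>\<eta>\<bar> / R) (\<lambda>j. cutoff 1 (z + real j *\<^sub>R h))"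
        by (simp add: h_def mult.commute)
      then have "norm ((fdiff h ^^ ?n) (cutoff 1) z) \<le> Cc * (1 / R) ^ (2 * DIM('a)) * (\<bar>\<eta>\<bar> / R) ^ ?n"
        by (rule diff_bound_fdiff)
      also have "\<dots> \<le> Cc * (1 / R) ^ (2 * DIM('a)) * (\<bar>\<eta>\<bar> * 2) ^ ?n"
      proof -
        have "1 / R \<le> 2" using R0 by (simp add: field_simps)
        then have "\<bar>\<eta>\<bar> / R \<le> \<bar>\<eta>\<bar> * 2"
          using mult_left_mono[of "1 / R" 2 "\<bar>\<eta>\<bar>"] by simp
        then show ?thesis using Cc(1) R0 by (intro mult_left_mono power_mono) auto
      qed
      also have "(1 / R) ^ (2 * DIM('a)) = 2 ^ (2 * DIM('a)) * norm (cutoff 1 z)"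
      proof -
        have "(1 / R)\<^sup>2 = 2\<^sup>2 * (1\<^sup>2 / (1\<^sup>2 + (norm z)\<^sup>2))" by (simp add: power_divide R2)
        then show ?thesis unfolding norm_cutoff power_mult by (simp only: power_mult_distrib)
      qed
      also have "Cc * (2 ^ (2 * DIM('a)) * norm (cutoff 1 z)) * (\<bar>\<eta>\<bar> * 2) ^ ?n = Cc * 2 ^ (2 * DIM('a)) * 2 ^ ?n * \<bar>\<eta>\<bar> ^ ?n * norm (cutoff 1 z)"
        by (simp only: power_mult_distrib mult_ac)
      finally show ?thesis .
    qed
    have "ennreal (norm (cutoff_ft 1 v)) \<le> (\<integral>\<^sup>+z. ennreal (norm ((fdiff h ^^ ?n) (cutoff 1) z)) \<partial>lborel)"
      unfolding cutoff_ft_def using e(2) by (intro norm_oscillatory_le integrable_cutoff_1) (auto simp: h_def)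
    also have "\<dots> \<le> (\<integral>\<^sup>+z. ennreal (Cc * 2 ^ (2 * DIM('a)) * 2 ^ ?n * \<bar>\<eta>\<bar> ^ ?n) * ennreal (norm (cutoff 1 (z::'a))) \<partial>lborel)"
      using pt Cc by (intro nn_integral_mono) (auto simp: ennreal_leI simp flip: ennreal_mult)
    also have "\<dots> = ennreal (Cc * 2 ^ (2 * DIM('a)) * 2 ^ ?n * \<bar>\<eta>\<bar> ^ ?n) * ennreal c0"
      by (simp add: nn_integral_cmult c0(1))
    also have "\<dots> = ennreal (K0 * \<bar>\<eta>\<bar> ^ ?n)"
      using Cc c0 by (simp only: K0_def ennreal_mult[symmetric] mult_nonneg_nonneg zero_le_power abs_ge_zero zero_le_numeral) (simp only: mult_ac)
    finally have "norm (cutoff_ft 1 v) \<le> K0 * \<bar>\<eta>\<bar> ^ ?n"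
      using K0 by (subst (asm) ennreal_le_iff) auto
    also have "\<dots> \<le> K0 * (pi * ?m / norm v) ^ ?n"
      using e K0 by (intro mult_left_mono power_mono) auto
    also have "\<dots> = K0 * (pi * ?m) ^ ?n * (1 / norm v ^ ?n)"
      by (simp only: power_divide) simp
    also have "1 / norm v ^ ?n = norm v powr (- (?m + 1))"
    proof -
      have "norm v ^ ?n = norm v powr (?m + 1)"
        using powr_realpow[OF v0, of ?n] by (simp add: add.commute)
      then show ?thesis by (simp only: powr_minus_divide)
    qed
    finally show "norm (cutoff_ft 1 v) \<le> K0 * (pi * ?m) ^ ?n * norm v powr (- (?m + 1))" .
  qed
qed

lemma cutoff_ft_integrable: "(\<integral>\<^sup>+v. ennreal (norm (cutoff_ft 1 (v::'a::euclidean_space))) \<partial>lborel) < top"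
proof -
  let ?m = "real DIM('a)"
  obtain K V0 where K: "0 \<le> K" and V0: "0 < V0"
    and dec: "\<And>v::'a. V0 \<le> norm v \<Longrightarrow> norm (cutoff_ft 1 v) \<le> K * norm v powr (- (?m + 1))"
    by (rule cutoff_ft_decay[where 'a='a]) (blast intro: that)
  have b: "real DIM('a) < ?m + 1" by simp
  obtain C2 where C2: "0 < C2" "\<And>r. 0 < r \<Longrightarrow>
    (\<integral>\<^sup>+z. ennreal (norm (z::'a) powr (- (?m + 1))) * indicator (- ball 0 r) z \<partial>lborel) \<le> ennreal (C2 * r powr (?m - (?m + 1)))"
    by (rule nn_integral_powr_outside_ball[OF b]) (blast intro: that)
  define c0 where "c0 = (LINT z|lborel. norm (cutoff 1 (z::'a)))"
  have c0: "0 \<le> c0" by (simp add: c0_def)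
  have bd: "norm (cutoff_ft 1 (v::'a)) \<le> c0" for v
    unfolding cutoff_ft_def c0_def
    by (rule order_trans[OF integral_norm_bound]) (simp add: norm_mult)
  have "(\<integral>\<^sup>+v. ennreal (norm (cutoff_ft 1 (v::'a))) \<partial>lborel)
     \<le> (\<integral>\<^sup>+v. ennreal c0 * indicator (ball 0 V0) v + ennreal K * (ennreal (norm (v::'a) powr (- (?m + 1))) * indicator (- ball 0 V0) v) \<partial>lborel)"
  proof (intro nn_integral_mono)
    fix v :: 'a
    show "ennreal (norm (cutoff_ft 1 v)) \<le> ennreal c0 * indicator (ball 0 V0) v + ennreal K * (ennreal (norm v powr (- (?m + 1))) * indicator (- ball 0 V0) v)"
    proof (cases "norm v < V0")
      case True
      then show ?thesis using bd[of v] by (simp add: ennreal_leI)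
    next
      case False
      then show ?thesis using dec[of v] K by (simp add: ennreal_leI flip: ennreal_mult)
    qed
  qed
  also have "\<dots> = ennreal c0 * emeasure lborel (ball (0::'a) V0) + ennreal K * (\<integral>\<^sup>+z. ennreal (norm (z::'a) powr (- (?m + 1))) * indicator (- ball 0 V0) z \<partial>lborel)"
    by (subst nn_integral_add, measurable) (simp add: nn_integral_cmult nn_integral_cmult_indicator)
  also have "\<dots> \<le> ennreal c0 * emeasure lborel (ball (0::'a) V0) + ennreal K * ennreal (C2 * V0 powr (?m - (?m + 1)))"
    by (intro add_left_mono mult_left_mono C2 V0) simp
  also have "\<dots> < top"
    by (simp add: emeasure_lborel_ball_eq ennreal_mult_less_top)
  finally show ?thesis .
qed

lemma cutoff_ft_scale:
  fixes v :: "'a::euclidean_space"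
  assumes L: "0 < L"
  shows "cutoff_ft L v = of_real (L ^ DIM('a)) * cutoff_ft 1 (L *\<^sub>R v)"
proof -
  have d: "(lborel :: 'a measure) = density (distr lborel borel (\<lambda>x. 0 + L *\<^sub>R x)) (\<lambda>_. ennreal (\<bar>L\<bar> ^ DIM('a)) :: ennreal)"
    using L lborel_affine[of L "0::'a"] by simp
  have "cutoff_ft L v = (LINT z|density (distr lborel borel (\<lambda>x. 0 + L *\<^sub>R x)) (\<lambda>_. ennreal (\<bar>L\<bar> ^ DIM('a))). ecis v z * cutoff L z)"
    unfolding cutoff_ft_def by (simp only: d[symmetric])
  also have "\<dots> = (LINT z|lborel. (L ^ DIM('a)) *\<^sub>R (ecis v (L *\<^sub>R z) * cutoff L (L *\<^sub>R z)))"
    using L by (subst integral_density) (auto simp: integral_distr)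
  also have "\<dots> = (LINT z|lborel. of_real (L ^ DIM('a)) * (ecis (L *\<^sub>R v) z * cutoff 1 z))"
  proof (intro Bochner_Integration.integral_cong refl)
    fix z :: 'a
    have "L\<^sup>2 / (L\<^sup>2 + (norm (L *\<^sub>R z))\<^sup>2) = 1\<^sup>2 / (1\<^sup>2 + (norm z)\<^sup>2)"
    proof -
      have "L\<^sup>2 + (norm (L *\<^sub>R z))\<^sup>2 = L\<^sup>2 * (1 + (norm z)\<^sup>2)"
        by (simp add: power_mult_distrib distrib_left)
      then show ?thesis using L by simp
    qed
    then have "cutoff L (L *\<^sub>R z) = cutoff 1 z"
      unfolding cutoff_def by (simp only:)
    moreover have "ecis v (L *\<^sub>R z) = ecis (L *\<^sub>R v) z" by (simp add: ecis_def)
    ultimately show "(L ^ DIM('a)) *\<^sub>R (ecis v (L *\<^sub>R z) * cutoff L (L *\<^sub>R z)) = of_real (L ^ DIM('a)) * (ecis (L *\<^sub>R v) z * cutoff 1 z)"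
      by (simp add: scaleR_conv_of_real)
  qed
  also have "\<dots> = of_real (L ^ DIM('a)) * cutoff_ft 1 (L *\<^sub>R v)"
    by (simp add: cutoff_ft_def)
  finally show ?thesis .
qed

lemma norm_integral_le_nn:
  fixes f :: "'a \<Rightarrow> complex"
  shows "ennreal (norm (LINT x|M. f x)) \<le> (\<integral>\<^sup>+x. ennreal (norm (f x)) \<partial>M)"
  by (cases "integrable M f") (auto intro: integral_norm_bound_ennreal simp: not_integrable_integral_eq)

lemma lborel_integrable_product:
  fixes A :: "'a::euclidean_space \<Rightarrow> complex" and G :: "'b::euclidean_space \<Rightarrow> complex"
    and h :: "'a \<times> 'b \<Rightarrow> complex"
  assumes A: "integrable lborel A" and G: "integrable lborel G"
    and [measurable]: "h \<in> borel_measurable (borel \<Otimes>\<^sub>M borel)" and h: "\<And>z y. norm (h (z, y)) \<le> norm (A z) * norm (G y)"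
  shows "integrable (lborel \<Otimes>\<^sub>M lborel) h"
proof (rule lborel_pair.Fubini_integrable)
  have [measurable]: "A \<in> borel_measurable borel" "G \<in> borel_measurable borel"
    using borel_measurable_integrable[OF A] borel_measurable_integrable[OF G] by simp_all
  have hm[measurable]: "h \<in> borel_measurable (lborel \<Otimes>\<^sub>M lborel)"
    using assms(3) by (simp cong: measurable_cong_sets)
  show "h \<in> borel_measurable (lborel \<Otimes>\<^sub>M lborel)" by fact
  have i: "integrable lborel (\<lambda>y. h (z, y))" for z
    by (rule Bochner_Integration.integrable_bound[OF integrable_mult_right[OF integrable_norm[OF G], of "norm (A z)"]])
      (auto simp: h)
  then show "AE z in lborel. integrable lborel (\<lambda>y. h (z, y))" by simp
  show "integrable lborel (\<lambda>z. LINT y|lborel. norm (h (z, y)))"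
  proof (rule Bochner_Integration.integrable_bound[OF integrable_mult_left[OF integrable_norm[OF A], of "LINT y|lborel. norm (G y)"]])
    show "(\<lambda>z. LINT y|lborel. norm (h (z, y))) \<in> borel_measurable lborel" by measurable
    have "(LINT y|lborel. norm (h (z, y))) \<le> norm (A z) * (LINT y|lborel. norm (G y))" for z
    proof -
      have "(LINT y|lborel. norm (h (z, y))) \<le> (LINT y|lborel. norm (A z) * norm (G y))"
        using i G h by (intro integral_mono) auto
      then show ?thesis by simp
    qed
    then show "AE z in lborel. norm (LINT y|lborel. norm (h (z, y))) \<le> norm (norm (A z) * (LINT y|lborel. norm (G y)))"
      by (auto simp: integral_nonneg_AE abs_mult)
  qed
qed

text \<open>Fubini's theorem exchanges the frequency integral with the integral that defines the
  Fourier transform, which exposes the kernel at \<open>X - Y\<close>.\<close>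

lemma multiplier_kernel_bound:
  fixes A G :: "'b::euclidean_space \<Rightarrow> complex"
  assumes A: "integrable lborel A" and G: "integrable lborel G"
  shows "ennreal (norm (LINT z|lborel. ecis X z * A z * (LINT Y|lborel. ecis (- z) Y * G Y)))
    \<le> (\<integral>\<^sup>+Y. ennreal (norm (G Y) * norm (LINT z|lborel. ecis (X - Y) z * A z)) \<partial>lborel)"
proof -
  have [measurable]: "A \<in> borel_measurable borel" "G \<in> borel_measurable borel"
    using borel_measurable_integrable[OF A] borel_measurable_integrable[OF G] by simp_all
  let ?h = "\<lambda>(z, Y). ecis X z * A z * (ecis (- z) Y * G Y)"
  have i: "integrable (lborel \<Otimes>\<^sub>M lborel) ?h"
    by (rule lborel_integrable_product[OF A G]) (auto simp: norm_mult)
  have "(LINT z|lborel. ecis X z * A z * (LINT Y|lborel. ecis (- z) Y * G Y))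
     = (LINT z|lborel. LINT Y|lborel. ecis X z * A z * (ecis (- z) Y * G Y))"
    by simp
  also have "\<dots> = (LINT Y|lborel. LINT z|lborel. ecis X z * A z * (ecis (- z) Y * G Y))"
    by (rule lborel_pair.Fubini_integral[symmetric]) (use i in simp)
  also have "\<dots> = (LINT Y|lborel. G Y * (LINT z|lborel. ecis (X - Y) z * A z))"
  proof (intro Bochner_Integration.integral_cong refl)
    fix Y
    have eq: "ecis X z * A z * (ecis (- z) Y * G Y) = G Y * (ecis (X - Y) z * A z)" for z
    proof -
      have "ecis X z * ecis (- z) Y = ecis (X - Y) z"
        by (simp add: ecis_def inner_diff_left inner_commute algebra_simps flip: exp_add)
      then show ?thesis by (metis (no_types, lifting) mult.assoc mult.commute)
    qed
    show "(LINT z|lborel. ecis X z * A z * (ecis (- z) Y * G Y)) = G Y * (LINT z|lborel. ecis (X - Y) z * A z)"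
      unfolding eq by simp
  qed
  finally show ?thesis
    using norm_integral_le_nn[of lborel "\<lambda>Y. G Y * (LINT z|lborel. ecis (X - Y) z * A z)"] by (simp add: norm_mult)
qed


section \<open>Pointwise bounds for the operators\<close>

lemma iter_deriv_line:
  fixes f :: "'a::euclidean_space \<Rightarrow> complex"
  assumes f: "smooth_on S f" and p: "p \<in> S" and v: "v \<in> Basis"
  shows "((\<lambda>t. iter_deriv (replicate k v) f (p + t *\<^sub>R v)) has_vector_derivative
    iter_deriv (replicate (Suc k) v) f p) (at 0)"
proof -
  let ?g = "iter_deriv (replicate k v) f"
  have "set (replicate k v) \<subseteq> Basis" using v by auto
  then have "?g differentiable at p" using f p unfolding smooth_on_def by blast
  then have d: "(?g has_derivative frechet_derivative ?g (at p)) (at p)"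
    by (simp add: frechet_derivative_works)
  have l: "((\<lambda>t. p + t *\<^sub>R v) has_derivative (\<lambda>t. t *\<^sub>R v)) (at 0)"
    by (auto intro!: derivative_eq_intros)
  have "((\<lambda>t. ?g (p + t *\<^sub>R v)) has_derivative (\<lambda>t. frechet_derivative ?g (at p) (t *\<^sub>R v))) (at 0)"
    using has_derivative_compose[OF l, of ?g "frechet_derivative ?g (at p)"] d by simp
  moreover have "frechet_derivative ?g (at p) (t *\<^sub>R v) = t *\<^sub>R frechet_derivative ?g (at p) v" for t
    using d by (simp add: has_derivative_bounded_linear linear_simps)
  moreover have "frechet_derivative ?g (at p) v = iter_deriv (replicate (Suc k) v) f p"
    by (simp add: iter_deriv_def dir_deriv_def)
  ultimately show ?thesis
    by (simp add: has_vector_derivative_def)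
qed

lemma finite_uniform_constant:
  fixes F R :: "'j \<Rightarrow> 'y \<Rightarrow> real"
  assumes "finite J" "\<And>j. j \<in> J \<Longrightarrow> \<exists>C. \<forall>y. Q y \<longrightarrow> F j y \<le> C * R j y" "\<And>j y. 0 \<le> R j y"
  shows "\<exists>C\<ge>0. \<forall>j\<in>J. \<forall>y. Q y \<longrightarrow> F j y \<le> C * R j y"
  using assms(1,2)
proof (induction J rule: finite_induct)
  case empty
  then show ?case by auto
next
  case (insert j J)
  then obtain C where C: "0 \<le> C" "\<forall>j\<in>J. \<forall>y. Q y \<longrightarrow> F j y \<le> C * R j y" by auto
  obtain C' where C': "\<forall>y. Q y \<longrightarrow> F j y \<le> C' * R j y" using insert.prems[of j] by auto
  have "C * R i y \<le> max C C' * R i y" "C' * R i y \<le> max C C' * R i y" for i y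
    using assms(3) by (intro mult_right_mono; simp)+
  then show ?case
    using C C' by (intro exI[of _ "max C C'"]) (fastforce intro: order_trans)
qed

text \<open>Only finitely many derivatives enter (axes times orders up to the dimension), so their
  constants have a common bound. It is taken before \<open>x\<close> is fixed, which makes all later
  kernel bounds uniform in \<open>x\<close>.\<close>

lemma symbol_likeI:
  fixes f :: "'x::euclidean_space \<times> 'z::euclidean_space \<Rightarrow> complex"
  assumes f: "smooth_on S f" and S: "\<And>x z. z \<noteq> 0 \<Longrightarrow> (x, z) \<in> S"
    and bd: "\<And>e k. e \<in> Basis \<Longrightarrow> \<exists>C. \<forall>x z. z \<noteq> 0 \<longrightarrow>
      norm (iter_deriv (replicate k (0, e)) f (x, z)) \<le> C * norm z powr (- s - real k)"
  shows "\<exists>C\<ge>0. \<forall>x. symbol_like s C (\<lambda>z. if z = 0 then 0 else f (x, z))"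
proof -
  have "\<exists>C\<ge>0. \<forall>j\<in>(Basis :: 'z set) \<times> {..DIM('z)}. \<forall>y. snd y \<noteq> 0 \<longrightarrow>
     norm (iter_deriv (replicate (snd j) (0, fst j)) f y) \<le> C * norm (snd y) powr (- s - real (snd j))"
    using bd by (intro finite_uniform_constant) auto
  then obtain C where C: "0 \<le> C" "\<And>e k x z. e \<in> Basis \<Longrightarrow> k \<le> DIM('z) \<Longrightarrow> z \<noteq> 0 \<Longrightarrow>
     norm (iter_deriv (replicate k (0, e)) f (x, z)) \<le> C * norm z powr (- s - real k)"
    by fastforce
  have "symbol_like s C (\<lambda>z. if z = 0 then 0 else f (x, z))" for x
    unfolding symbol_like_def
  proof (intro conjI ballI)
    show "(if (0::'z) = 0 then 0 else f (x, 0)) = 0" by simp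
    have "continuous_on (- {0}) (\<lambda>z. if z = 0 then 0 else f (x, z))"
    proof (subst continuous_on_cong[OF refl, of _ _ "\<lambda>z. f (x, z)"])
      show "continuous_on (- {0}) (\<lambda>z. f (x, z))"
      proof (intro continuous_at_imp_continuous_on ballI)
        fix z :: 'z assume "z \<in> - {0}"
        then have "iter_deriv [] f differentiable at (x, z)"
          using f S[of z x] unfolding smooth_on_def by (metis ComplD empty_set empty_subsetI singleton_iff)
        then have "isCont f (x, z)"
          by (simp add: iter_deriv_def differentiable_imp_continuous_within)
        then show "isCont (\<lambda>z. f (x, z)) z"
          by (intro isCont_o2[of _ "\<lambda>z. (x, z)" f]) (auto intro!: continuous_intros)
      qed
    qed auto
    then show "(\<lambda>z. if z = 0 then 0 else f (x, z)) \<in> borel_measurable borel"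
      by (rule borel_measurable_continuous_countable_exceptions[rotated]) simp
    fix e :: 'z assume e: "e \<in> Basis"
    show "\<exists>D. (\<forall>z. z \<noteq> 0 \<longrightarrow> D 0 z = (if z = 0 then 0 else f (x, z))) \<and>
       (\<forall>k z. z \<noteq> 0 \<longrightarrow> ((\<lambda>t. D k (z + t *\<^sub>R e)) has_vector_derivative D (Suc k) z) (at 0)) \<and>
       (\<forall>k\<le>DIM('z). \<forall>z. z \<noteq> 0 \<longrightarrow> norm (D k z) \<le> C * norm z powr (- s - real k))"
    proof (intro exI[of _ "\<lambda>k z. iter_deriv (replicate k (0, e)) f (x, z)"] conjI allI impI)
      fix k :: nat and z :: 'z assume z: "z \<noteq> 0"
      show "iter_deriv (replicate 0 (0, e)) f (x, z) = (if z = 0 then 0 else f (x, z))"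
        using z by (simp add: iter_deriv_def)
      have "(0, e) \<in> (Basis :: ('x \<times> 'z) set)" using e by (simp add: Basis_prod_def)
      from iter_deriv_line[OF f S[OF z, of x] this, of k]
      show "((\<lambda>t. iter_deriv (replicate k (0, e)) f (x, z + t *\<^sub>R e)) has_vector_derivative
          iter_deriv (replicate (Suc k) (0, e)) f (x, z)) (at 0)"
        by simp
      show "norm (iter_deriv (replicate k (0, e)) f (x, z)) \<le> C * norm z powr (- s - real k)" if "k \<le> DIM('z)"
        using C(2)[OF e that z] .
    qed
  qed
  then show ?thesis using C(1) by blast
qed

lemma Basis_vec_axis: "e \<in> (Basis :: (real ^ 'n) set) \<Longrightarrow> \<exists>i. e = axis i 1"
  by (auto simp: Basis_vec_def)

text \<open>A nonpositive power is larger at the smaller base. The absolute value covers a negative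
  \<open>C\<close>, which the class definitions do not exclude.\<close>

lemma powr_weaken:
  fixes C a b c X :: real
  assumes "X \<le> C * b powr c" "0 < a" "a \<le> b" "c \<le> 0"
  shows "X \<le> \<bar>C\<bar> * a powr c"
proof -
  have "C * b powr c \<le> \<bar>C\<bar> * b powr c" by (intro mult_right_mono) auto
  also have "\<dots> \<le> \<bar>C\<bar> * a powr c" using assms by (intro mult_left_mono powr_mono2') auto
  finally show ?thesis using assms by simp
qed

text \<open>The size function dominates the norm and the exponents are negative, so homogeneous and
  inhomogeneous classes lead to the same estimate in powers of the norm. A basis direction of the
  product space lies entirely in \<xi> or entirely in \<eta>, so a pure derivative is a multi-index
  of the class.\<close>

lemma bilinear_class_symbol_like:
  fixes \<sigma> :: "'n::finite bilinear_symbol"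
  assumes \<sigma>: "\<sigma> \<in> bilinear_class \<rho> (- s) \<delta>" and s: "0 < s" and \<rho>: "\<And>\<xi> \<eta>. norm (\<xi>, \<eta>) \<le> \<rho> \<xi> \<eta>"
  shows "\<exists>C\<ge>0. \<forall>x. symbol_like s C (\<lambda>z. if z = 0 then 0 else \<sigma> (x, z))"
proof (rule symbol_likeI)
  show "smooth_on {(x, \<xi>, \<eta>). \<rho> \<xi> \<eta> \<noteq> 0} \<sigma>" using \<sigma> by (simp add: bilinear_class_def)
  have pos: "0 < \<rho> (fst z) (snd z)" if "z \<noteq> 0" for z
    using \<rho>[of "fst z" "snd z"] zero_less_norm_iff[THEN iffD2, OF that] by (simp only: prod.collapse)
  show "(x, z) \<in> {(x, \<xi>, \<eta>). \<rho> \<xi> \<eta> \<noteq> 0}" if "z \<noteq> 0" for x z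
    using pos[OF that] by (cases z) auto
  have bd: "\<exists>C. \<forall>x \<xi> \<eta>. \<rho> \<xi> \<eta> \<noteq> 0 \<longrightarrow> norm (deriv3 [] \<beta> \<gamma> \<sigma> (x, \<xi>, \<eta>)) \<le> C * \<rho> \<xi> \<eta> powr (- s - real (length \<beta> + length \<gamma>))" for \<beta> \<gamma>
  proof -
    have "\<forall>\<alpha> \<beta> \<gamma>. \<exists>C. \<forall>x \<xi> \<eta>. \<rho> \<xi> \<eta> \<noteq> 0 \<longrightarrow> norm (deriv3 \<alpha> \<beta> \<gamma> \<sigma> (x, \<xi>, \<eta>))
        \<le> C * \<rho> \<xi> \<eta> powr (- s - real (length \<beta> + length \<gamma>) + \<delta> * real (length \<alpha>))"
      using \<sigma> by (simp add: bilinear_class_def)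
    from this[THEN spec, of "[]", THEN spec, of \<beta>, THEN spec, of \<gamma>] show ?thesis by simp
  qed
  fix e :: "(real ^ 'n) \<times> (real ^ 'n)" and k assume "e \<in> Basis"
  then have "(\<exists>i. e = (axis i 1, 0)) \<or> (\<exists>i. e = (0, axis i 1))"
    by (auto simp: Basis_prod_def dest: Basis_vec_axis)
  then obtain \<beta> \<gamma> where D: "iter_deriv (replicate k (0, e)) \<sigma> = deriv3 [] \<beta> \<gamma> \<sigma>" and l: "length \<beta> + length \<gamma> = k"
  proof (elim disjE exE)
    fix i assume "e = (axis i 1, 0)"
    then show ?thesis by (intro that[of "replicate k i" "[]"]) (auto simp: deriv3_def map_replicate_const)
  next
    fix i assume "e = (0, axis i 1)"
    then show ?thesis by (intro that[of "[]" "replicate k i"]) (auto simp: deriv3_def map_replicate_const)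
  qed
  obtain C where C: "\<And>x \<xi> \<eta>. \<rho> \<xi> \<eta> \<noteq> 0 \<Longrightarrow> norm (deriv3 [] \<beta> \<gamma> \<sigma> (x, \<xi>, \<eta>)) \<le> C * \<rho> \<xi> \<eta> powr (- s - real k)"
    using bd[of \<beta> \<gamma>] l by auto
  show "\<exists>C. \<forall>x z. z \<noteq> 0 \<longrightarrow> norm (iter_deriv (replicate k (0, e)) \<sigma> (x, z)) \<le> C * norm z powr (- s - real k)"
  proof (intro exI[of _ "\<bar>C\<bar>"] allI impI)
    fix x and z :: "(real ^ 'n) \<times> (real ^ 'n)" assume z: "z \<noteq> 0"
    have "norm (deriv3 [] \<beta> \<gamma> \<sigma> (x, fst z, snd z)) \<le> C * \<rho> (fst z) (snd z) powr (- s - real k)"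
      using pos[OF z] by (intro C) simp
    then have "norm (deriv3 [] \<beta> \<gamma> \<sigma> (x, fst z, snd z)) \<le> \<bar>C\<bar> * norm z powr (- s - real k)"
      using z s \<rho>[of "fst z" "snd z"] by (intro powr_weaken) auto
    then show "norm (iter_deriv (replicate k (0, e)) \<sigma> (x, z)) \<le> \<bar>C\<bar> * norm z powr (- s - real k)"
      by (simp add: D)
  qed
qed

lemma linear_class_symbol_like:
  fixes \<sigma> :: "'n::finite linear_symbol"
  assumes \<sigma>: "\<sigma> \<in> linear_class \<rho> (- s) \<delta>" and s: "0 < s" and \<rho>: "\<And>\<xi>. norm \<xi> \<le> \<rho> \<xi>"
  shows "\<exists>C\<ge>0. \<forall>x. symbol_like s C (\<lambda>z. if z = 0 then 0 else \<sigma> (x, z))"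
proof (rule symbol_likeI)
  show "smooth_on {(x, \<xi>). \<rho> \<xi> \<noteq> 0} \<sigma>" using \<sigma> by (simp add: linear_class_def)
  have pos: "0 < \<rho> z" if "z \<noteq> 0" for z
    using \<rho>[of z] zero_less_norm_iff[THEN iffD2, OF that] by linarith
  show "(x, z) \<in> {(x, \<xi>). \<rho> \<xi> \<noteq> 0}" if "z \<noteq> 0" for x z
    using pos[OF that] by auto
  have bd: "\<exists>C. \<forall>x \<xi>. \<rho> \<xi> \<noteq> 0 \<longrightarrow> norm (deriv2 [] \<beta> \<sigma> (x, \<xi>)) \<le> C * \<rho> \<xi> powr (- s - real (length \<beta>))" for \<beta>
  proof -
    have "\<forall>\<alpha> \<beta>. \<exists>C. \<forall>x \<xi>. \<rho> \<xi> \<noteq> 0 \<longrightarrow> norm (deriv2 \<alpha> \<beta> \<sigma> (x, \<xi>)) \<le> C * \<rho> \<xi> powr (- s - real (length \<beta>) + \<delta> * real (length \<alpha>))"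
      using \<sigma> by (simp add: linear_class_def)
    from this[THEN spec, of "[]", THEN spec, of \<beta>] show ?thesis by simp
  qed
  fix e :: "real ^ 'n" and k assume "e \<in> Basis"
  then obtain i where "e = axis i 1" using Basis_vec_axis by blast
  then have D: "iter_deriv (replicate k (0, e)) \<sigma> = deriv2 [] (replicate k i) \<sigma>"
    by (auto simp: deriv2_def map_replicate_const)
  obtain C where C: "\<And>x \<xi>. \<rho> \<xi> \<noteq> 0 \<Longrightarrow> norm (deriv2 [] (replicate k i) \<sigma> (x, \<xi>)) \<le> C * \<rho> \<xi> powr (- s - real k)"
    using bd[of "replicate k i"] by auto
  show "\<exists>C. \<forall>x z. z \<noteq> 0 \<longrightarrow> norm (iter_deriv (replicate k (0, e)) \<sigma> (x, z)) \<le> C * norm z powr (- s - real k)"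
  proof (intro exI[of _ "\<bar>C\<bar>"] allI impI)
    fix x z :: "real ^ 'n" assume z: "z \<noteq> 0"
    have "norm (deriv2 [] (replicate k i) \<sigma> (x, z)) \<le> C * \<rho> z powr (- s - real k)"
      using pos[OF z] by (intro C) simp
    then show "norm (iter_deriv (replicate k (0, e)) \<sigma> (x, z)) \<le> \<bar>C\<bar> * norm z powr (- s - real k)"
      unfolding D using z s \<rho>[of z] by (intro powr_weaken) auto
  qed
qed

section \<open>Operators as multipliers on the product space\<close>

lemma fourier_lborel:
  fixes f :: "real ^ 'n::finite \<Rightarrow> complex"
  assumes [measurable]: "f \<in> borel_measurable borel"
  shows "fourier f \<xi> = (LINT y|lborel. ecis (- \<xi>) y * f y)"
proof -
  have "fourier f \<xi> = (LINT y|lborel. exp (- \<i> * of_real (y \<bullet> \<xi>)) * f y)"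
    unfolding fourier_def by (intro integral_completion) measurable
  then show ?thesis by (simp add: ecis_def inner_commute)
qed

definition tensor :: "('a \<Rightarrow> complex) \<Rightarrow> ('b \<Rightarrow> complex) \<Rightarrow> 'a \<times> 'b \<Rightarrow> complex" where
  "tensor f g = (\<lambda>(y, z). f y * g z)"

lemma tensor_integrable:
  fixes f :: "'a::euclidean_space \<Rightarrow> complex" and g :: "'b::euclidean_space \<Rightarrow> complex"
  assumes "integrable lborel f" "integrable lborel g"
  shows "integrable lborel (tensor f g)"
proof -
  have [measurable]: "f \<in> borel_measurable borel" "g \<in> borel_measurable borel"
    using assms[THEN borel_measurable_integrable] by simp_all
  have "integrable (lborel \<Otimes>\<^sub>M lborel) (tensor f g)"
    unfolding tensor_def by (rule lborel_integrable_product[OF assms]) (auto simp: norm_mult)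
  then show ?thesis by (simp add: lborel_prod)
qed

lemma fourier_tensor:
  fixes f g :: "real ^ 'n::finite \<Rightarrow> complex"
  assumes f: "integrable lborel f" and g: "integrable lborel g"
  shows "fourier f (fst z) * fourier g (snd z) = (LINT Y|lborel. ecis (- z) Y * tensor f g Y)"
proof -
  have [measurable]: "f \<in> borel_measurable borel" "g \<in> borel_measurable borel"
    using f g borel_measurable_integrable by force+
  let ?h = "\<lambda>Y. ecis (- z) Y * tensor f g Y"
  have i: "integrable (lborel \<Otimes>\<^sub>M lborel) ?h"
    unfolding lborel_prod by (intro integrable_ecis_mult tensor_integrable f g)
  have "(LINT Y|lborel. ?h Y) = (LINT y|lborel. LINT w|lborel. ?h (y, w))"
    using lborel_pair.integral_fst'[OF i] by (simp add: lborel_prod)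
  also have "\<dots> = (LINT y|lborel. LINT w|lborel. (ecis (- fst z) y * f y) * (ecis (- snd z) w * g w))"
  proof (intro Bochner_Integration.integral_cong refl)
    fix y w
    have "ecis (- z) (y, w) = ecis (- fst z) y * ecis (- snd z) w"
      by (cases z) (simp add: ecis_def distrib_left exp_add algebra_simps flip: exp_add)
    then show "?h (y, w) = (ecis (- fst z) y * f y) * (ecis (- snd z) w * g w)"
      by (simp add: tensor_def)
  qed
  finally show ?thesis by (simp add: fourier_lborel)
qed

text \<open>The bilinear operator at \<open>x\<close> is a linear multiplier operator in doubled
  dimension, applied to the tensor product of \<open>f\<close> and \<open>g\<close> and evaluated at
  \<open>(x, x)\<close>.\<close>

lemma T_op_lborel:
  fixes f g :: "real ^ 'n::finite \<Rightarrow> complex"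
  assumes f: "integrable lborel f" and g: "integrable lborel g" and [measurable]: "a \<in> borel_measurable borel"
    and ae: "AE z in lborel. \<sigma> (x, z) = a z"
  shows "T_op \<sigma> f g x = (LINT z|lborel. ecis (x, x) z * a z * (LINT Y|lborel. ecis (- z) Y * tensor f g Y))"
proof -
  have [measurable]: "tensor f g \<in> borel_measurable borel"
    using borel_measurable_integrable[OF tensor_integrable[OF f g]] by simp
  let ?R = "\<lambda>z. ecis (x, x) z * a z * (LINT Y|lborel. ecis (- z) Y * tensor f g Y)"
  let ?T = "\<lambda>z. case z of (\<xi>, \<eta>) \<Rightarrow> exp (\<i> * of_real (x \<bullet> (\<xi> + \<eta>))) * \<sigma> (x, \<xi>, \<eta>) * fourier f \<xi> * fourier g \<eta>"
  have m: "?R \<in> borel_measurable borel"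
    by (intro borel_measurable_times sigma_finite_measure.borel_measurable_lebesgue_integral[OF sigma_finite_lborel]) measurable
  then have mR: "?R \<in> borel_measurable lebesgue"
    by (simp add: measurable_completion)
  have eq: "AE z in lebesgue. ?R z = ?T z"
  proof (rule AE_completion, rule eventually_mono[OF ae])
    fix z assume "\<sigma> (x, z) = a z"
    then have "?T z = exp (\<i> * of_real (x \<bullet> (fst z + snd z))) * a z * (fourier f (fst z) * fourier g (snd z))"
      by (cases z) (simp add: mult.assoc)
    moreover have "exp (\<i> * of_real (x \<bullet> (fst z + snd z))) = ecis (x, x) z"
      by (cases z) (simp add: ecis_def inner_add_right)
    ultimately show "?R z = ?T z"
      by (simp only: fourier_tensor[OF f g])
  qed
  \<comment> \<open>The symbol may be arbitrary on a null set; with respect to the completed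
    measure, equality almost everywhere to a Borel function already gives measurability.\<close>
  have mT: "?T \<in> borel_measurable lebesgue"
    by (rule borel_measurable_AE[OF mR eq])
  have "T_op \<sigma> f g x = (LINT z|lebesgue. ?R z)"
    unfolding T_op_def using eq by (intro integral_cong_AE mT mR) (auto elim: eventually_mono)
  also have "\<dots> = (LINT z|lborel. ?R z)"
    using m by (intro integral_completion) simp
  finally show ?thesis .
qed

lemma tendsto_cutoff: "(\<lambda>k. cutoff (real (Suc k)) z) \<longlonglongrightarrow> 1"
proof -
  have inv: "(\<lambda>k. 1 / real (Suc k)) \<longlonglongrightarrow> 0"
    using LIMSEQ_inverse_real_of_nat by (simp add: inverse_eq_divide)
  have "(\<lambda>k. (1 / (1 + (norm z)\<^sup>2 * (1 / real (Suc k))\<^sup>2)) ^ DIM('a)) \<longlonglongrightarrow> (1 / (1 + (norm z)\<^sup>2 * 0\<^sup>2)) ^ DIM('a)"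
    by (intro tendsto_intros inv) auto
  moreover have "1 / (1 + c * (1 / real (Suc k))\<^sup>2) = (real (Suc k))\<^sup>2 / ((real (Suc k))\<^sup>2 + c)" if "0 \<le> c" for c k
  proof -
    have "(real (Suc k))\<^sup>2 + c > 0" using that by (intro add_pos_nonneg) auto
    then show ?thesis by (simp add: power_divide field_simps del: of_nat_Suc)
  qed
  ultimately have "(\<lambda>k. ((real (Suc k))\<^sup>2 / ((real (Suc k))\<^sup>2 + (norm z)\<^sup>2)) ^ DIM('a)) \<longlonglongrightarrow> 1"
    by simp
  from tendsto_of_real[OF this, where 'a=complex] show ?thesis
    unfolding cutoff_def by (simp only: of_real_1)
qed

text \<open>Dominated convergence with the unregularised integrand as majorant. If that integrand is
  not integrable, its integral is 0 by convention and the bound is trivial.\<close>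

lemma regularized_limit_bound:
  fixes a F :: "'b::euclidean_space \<Rightarrow> complex" and c :: "nat \<Rightarrow> 'b \<Rightarrow> complex" and B :: "nat \<Rightarrow> ennreal"
  assumes [measurable]: "a \<in> borel_measurable borel" "F \<in> borel_measurable borel" "\<And>k. c k \<in> borel_measurable borel"
    and c: "\<And>k z. norm (c k z) \<le> 1" "\<And>z. (\<lambda>k. c k z) \<longlonglongrightarrow> 1"
    and bd: "\<And>k. ennreal (norm (LINT z|lborel. ecis X z * (a z * c k z) * F z)) \<le> B k"
    and B: "B \<longlonglongrightarrow> B0"
  shows "ennreal (norm (LINT z|lborel. ecis X z * a z * F z)) \<le> B0"
proof (cases "integrable lborel (\<lambda>z. ecis X z * a z * F z)")
  case False
  then show ?thesis by (simp add: not_integrable_integral_eq)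
next
  case True
  have "(\<lambda>k. LINT z|lborel. ecis X z * (a z * c k z) * F z) \<longlonglongrightarrow> (LINT z|lborel. ecis X z * a z * F z)"
  proof (rule integral_dominated_convergence[where w="\<lambda>z. norm (ecis X z * a z * F z)"])
    show "integrable lborel (\<lambda>z. norm (ecis X z * a z * F z))" using True by (rule integrable_norm)
    show "AE z in lborel. (\<lambda>k. ecis X z * (a z * c k z) * F z) \<longlonglongrightarrow> ecis X z * a z * F z"
    proof (intro AE_I2)
      fix z
      have "(\<lambda>k. ecis X z * (a z * c k z) * F z) \<longlonglongrightarrow> ecis X z * (a z * 1) * F z"
        by (intro tendsto_intros c)
      then show "(\<lambda>k. ecis X z * (a z * c k z) * F z) \<longlonglongrightarrow> ecis X z * a z * F z" by simp
    qed
    fix k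
    show "AE z in lborel. norm (ecis X z * (a z * c k z) * F z) \<le> norm (ecis X z * a z * F z)"
    proof (intro AE_I2)
      fix z
      have "norm (a z) * norm (c k z) * norm (F z) \<le> norm (a z) * 1 * norm (F z)"
        by (intro mult_right_mono mult_left_mono c) auto
      then show "norm (ecis X z * (a z * c k z) * F z) \<le> norm (ecis X z * a z * F z)"
        by (simp add: norm_mult)
    qed
  qed measurable
  then have "(\<lambda>k. ennreal (norm (LINT z|lborel. ecis X z * (a z * c k z) * F z))) \<longlonglongrightarrow> ennreal (norm (LINT z|lborel. ecis X z * a z * F z))"
    by (intro tendsto_ennrealI tendsto_norm)
  then show ?thesis
    by (rule LIMSEQ_le[OF _ B]) (use bd in auto)
qed

text \<open>The kernel bound in dimension 2n holds uniformly under the cutoff, so it survives the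
  limit. The summand 1 in the constant ensures that it is positive.\<close>

proposition T_op_le_riesz2:
  fixes \<sigma> :: "'n::finite bilinear_symbol"
  assumes sym: "\<And>x. symbol_like s C0 (\<lambda>z. if z = 0 then 0 else \<sigma> (x, z))" and C0: "0 \<le> C0"
    and s: "0 < s" "s < 2 * real CARD('n)"
  obtains C where "0 < C" "\<And>f g x. integrable lborel f \<Longrightarrow> integrable lborel g \<Longrightarrow>
    ennreal (norm (T_op \<sigma> f g x)) \<le> ennreal C * riesz2 s (\<lambda>y. norm (f y)) (\<lambda>y. norm (g y)) x"
proof -
  let ?e = "s - 2 * real CARD('n)"
  have dim: "real DIM((real ^ 'n) \<times> (real ^ 'n)) = 2 * real CARD('n)" by simp
  obtain K where K: "0 \<le> K" "\<And>(a :: (real ^ 'n) \<times> (real ^ 'n) \<Rightarrow> complex) L u. symbol_like s C0 a \<Longrightarrow> 0 < L \<Longrightarrow> u \<noteq> 0 \<Longrightarrow>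
    norm (LINT z|lborel. ecis u z * (a z * cutoff L z)) \<le> K * norm u powr ?e"
    by (rule kernel_bound[where 'a="(real ^ 'n) \<times> (real ^ 'n)", unfolded dim, OF s C0]) (blast intro: that)
  show ?thesis
  proof (rule that[of "K * 2 powr (- ?e) + 1"])
    show "0 < K * 2 powr (- ?e) + 1" using K by (simp add: add_nonneg_pos)
    fix f g :: "real ^ 'n \<Rightarrow> complex" and x
    assume f: "integrable lborel f" and g: "integrable lborel g"
    have [measurable]: "f \<in> borel_measurable borel" "g \<in> borel_measurable borel"
      using f g borel_measurable_integrable by force+
    define a where "a z = (if z = 0 then 0 else \<sigma> (x, z))" for z
    have a: "symbol_like s C0 a" using sym by (simp add: a_def[abs_def])
    note [measurable] = symbol_like_measurable[OF a]
    let ?G = "tensor f g"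
    have G: "integrable lborel ?G" by (rule tensor_integrable[OF f g])
    have [measurable]: "?G \<in> borel_measurable borel"
      using borel_measurable_integrable[OF G] by simp
    have H: "(\<lambda>Y. ennreal (norm (f (fst Y)) * norm (g (snd Y)) * (norm (x - fst Y) + norm (x - snd Y)) powr ?e)) \<in> borel_measurable borel"
      unfolding borel_prod[symmetric] by measurable
    let ?B = "ennreal (K * 2 powr (- ?e) + 1) * riesz2 s (\<lambda>y. norm (f y)) (\<lambda>y. norm (g y)) x"
    \<comment> \<open>The norm of the pair (u, v) is at least half the sum of the two norms, and the
      exponent is negative.\<close>
    have ker: "norm (LINT z|lborel. ecis (u, v) z * (a z * cutoff L z)) \<le> (K * 2 powr (- ?e) + 1) * (norm u + norm v) powr ?e"
      if L: "0 < L" and uv: "(u, v) \<noteq> 0" for u v L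
    proof -
      have "norm (LINT z|lborel. ecis (u, v) z * (a z * cutoff L z)) \<le> K * norm (u, v) powr ?e"
        by (rule K(2)[OF a L uv])
      also have "\<dots> \<le> K * ((norm u + norm v) / 2) powr ?e"
      proof -
        have "0 < norm u + norm v"
          using uv by (auto simp: zero_prod_def add_pos_nonneg add_nonneg_pos)
        moreover have "(norm u + norm v) / 2 \<le> norm (u, v)"
          using norm_fst_le[of u v] norm_snd_le[of v u] by simp
        ultimately show ?thesis
          using K s by (intro mult_left_mono powr_mono2') auto
      qed
      also have "\<dots> = K * 2 powr (- ?e) * (norm u + norm v) powr ?e"
        by (simp only: powr_divide_eq mult_ac)
      also have "\<dots> \<le> (K * 2 powr (- ?e) + 1) * (norm u + norm v) powr ?e"
        by (intro mult_right_mono) auto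
      finally show ?thesis .
    qed
    have reg: "ennreal (norm (LINT z|lborel. ecis (x, x) z * (a z * cutoff (real (Suc k)) z) * (LINT Y|lborel. ecis (- z) Y * ?G Y))) \<le> ?B" for k
    proof -
      let ?A = "\<lambda>z. a z * cutoff (real (Suc k)) z"
      have A: "integrable lborel ?A"
        using s by (intro integrable_symbol_cutoff[OF a C0]) auto
      have "ennreal (norm (LINT z|lborel. ecis (x, x) z * ?A z * (LINT Y|lborel. ecis (- z) Y * ?G Y)))
        \<le> (\<integral>\<^sup>+Y. ennreal (norm (?G Y) * norm (LINT z|lborel. ecis ((x, x) - Y) z * ?A z)) \<partial>lborel)"
        by (rule multiplier_kernel_bound[OF A G])
      also have "\<dots> \<le> (\<integral>\<^sup>+Y. ennreal (K * 2 powr (- ?e) + 1) *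
         ennreal (norm (f (fst Y)) * norm (g (snd Y)) * (norm (x - fst Y) + norm (x - snd Y)) powr ?e) \<partial>lborel)"
      proof (intro nn_integral_mono_AE, rule eventually_mono[OF AE_lborel_singleton[of "(x, x)"]])
        fix Y :: "(real ^ 'n) \<times> (real ^ 'n)" assume Y: "Y \<noteq> (x, x)"
        obtain y z where Yyz: "Y = (y, z)" by (cases Y)
        have "norm (?G Y) * norm (LINT z|lborel. ecis ((x, x) - Y) z * ?A z)
           \<le> (norm (f y) * norm (g z)) * ((K * 2 powr (- ?e) + 1) * (norm (x - y) + norm (x - z)) powr ?e)"
        proof -
          have "(x - y, x - z) \<noteq> 0" using Y by (auto simp: Yyz zero_prod_def)
          moreover have "(x, x) - Y = (x - y, x - z)" by (simp add: Yyz)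
          moreover have "norm (?G Y) = norm (f y) * norm (g z)" by (simp add: Yyz tensor_def norm_mult)
          ultimately show ?thesis
            using ker[of "real (Suc k)" "x - y" "x - z"] by (intro mult_mono) (simp_all del: of_nat_Suc)
        qed
        also have "\<dots> = (K * 2 powr (- ?e) + 1) * (norm (f y) * norm (g z) * (norm (x - y) + norm (x - z)) powr ?e)"
          by (simp only: mult_ac)
        finally have "ennreal (norm (?G Y) * norm (LINT z|lborel. ecis ((x, x) - Y) z * ?A z))
          \<le> ennreal ((K * 2 powr (- ?e) + 1) * (norm (f y) * norm (g z) * (norm (x - y) + norm (x - z)) powr ?e))"
          by (rule ennreal_leI)
        also have "\<dots> = ennreal (K * 2 powr (- ?e) + 1) * ennreal (norm (f y) * norm (g z) * (norm (x - y) + norm (x - z)) powr ?e)"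
          using K(1) by (intro ennreal_mult) auto
        finally show "ennreal (norm (?G Y) * norm (LINT z|lborel. ecis ((x, x) - Y) z * ?A z))
          \<le> ennreal (K * 2 powr (- ?e) + 1) *
            ennreal (norm (f (fst Y)) * norm (g (snd Y)) * (norm (x - fst Y) + norm (x - snd Y)) powr ?e)"
          by (simp only: Yyz fst_conv snd_conv)
      qed
      also have "\<dots> = ennreal (K * 2 powr (- ?e) + 1) *
          (\<integral>\<^sup>+Y. ennreal (norm (f (fst Y)) * norm (g (snd Y)) * (norm (x - fst Y) + norm (x - snd Y)) powr ?e) \<partial>lborel)"
        by (intro nn_integral_cmult) (use H in simp)
      also have "(\<integral>\<^sup>+Y. ennreal (norm (f (fst Y)) * norm (g (snd Y)) * (norm (x - fst Y) + norm (x - snd Y)) powr ?e) \<partial>lborel)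
          = riesz2 s (\<lambda>y. norm (f y)) (\<lambda>y. norm (g y)) x"
        unfolding riesz2_def lborel_prod[symmetric]
        by (subst lborel.nn_integral_fst[symmetric]) (use H in \<open>simp_all add: lborel_prod\<close>)
      finally show ?thesis .
    qed
    have "T_op \<sigma> f g x = (LINT z|lborel. ecis (x, x) z * a z * (LINT Y|lborel. ecis (- z) Y * ?G Y))"
    proof (rule T_op_lborel[OF f g])
      show "a \<in> borel_measurable borel" by measurable
      show "AE z in lborel. \<sigma> (x, z) = a z"
        by (rule eventually_mono[OF AE_lborel_singleton[of 0]]) (simp add: a_def)
    qed
    also have "ennreal (norm \<dots>) \<le> ?B"
    proof (rule regularized_limit_bound[where c="\<lambda>k. cutoff (real (Suc k))" and B="\<lambda>_. ?B"])
      show "(\<lambda>z. LINT Y|lborel. ecis (- z) Y * ?G Y) \<in> borel_measurable borel"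
        by (intro sigma_finite_measure.borel_measurable_lebesgue_integral[OF sigma_finite_lborel]) measurable
    qed (use reg tendsto_cutoff norm_cutoff_le_1 in auto)
    finally show "ennreal (norm (T_op \<sigma> f g x)) \<le> ?B" .
  qed
qed


section \<open>Symbols constant along a direction\<close>

lemma integrable_cutoff:
  assumes L: "1 \<le> L"
  shows "integrable lborel (cutoff L :: 'a::euclidean_space \<Rightarrow> complex)"
proof (rule Bochner_Integration.integrable_bound[OF integrable_mult_right[OF integrable_cutoff_1, of "of_real ((L\<^sup>2) ^ DIM('a))"]])
  have "norm (cutoff L z) \<le> (L\<^sup>2) ^ DIM('a) * norm (cutoff 1 z)" for z :: 'a
  proof -
    have L1: "1 \<le> L\<^sup>2" using L by simp
    have "L\<^sup>2 / (L\<^sup>2 + (norm z)\<^sup>2) \<le> L\<^sup>2 / (1 + (norm z)\<^sup>2)"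
    proof -
      have "0 < 1 + (norm z)\<^sup>2" "0 < L\<^sup>2 + (norm z)\<^sup>2" using L1 zero_le_power2[of "norm z"] by linarith+
      then show ?thesis using L1 by (intro divide_left_mono) auto
    qed
    then have "(L\<^sup>2 / (L\<^sup>2 + (norm z)\<^sup>2)) ^ DIM('a) \<le> (L\<^sup>2 * (1\<^sup>2 / (1\<^sup>2 + (norm z)\<^sup>2))) ^ DIM('a)"
      by (intro power_mono) auto
    then show ?thesis unfolding norm_cutoff by (simp only: power_mult_distrib)
  qed
  then show "AE z in lborel. norm (cutoff L z :: complex) \<le> norm (of_real ((L\<^sup>2) ^ DIM('a)) * cutoff 1 (z::'a) :: complex)"
    by (simp add: norm_mult norm_power)
qed measurable

text \<open>With w = \<xi> - t \<eta> the phase u.\<xi> + v.\<eta> becomes u.w + (v + t u).\<eta>,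
  so the kernel is a product. The second factor, the transform of the cutoff in \<eta>, concentrates
  on v = - t u as \<open>L\<close> grows.\<close>

lemma shear_kernel:
  fixes b :: "'a::euclidean_space \<Rightarrow> complex"
  assumes b: "integrable lborel b" and L: "1 \<le> L"
  shows "integrable lborel (\<lambda>z. b (fst z - t *\<^sub>R snd z) * cutoff L (snd z))"
    and "(LINT z|lborel. ecis (u, v) z * (b (fst z - t *\<^sub>R snd z) * cutoff L (snd z)))
      = cutoff_ft L (v + t *\<^sub>R u) * (LINT w|lborel. ecis u w * b w)"
proof -
  have [measurable]: "b \<in> borel_measurable borel" using borel_measurable_integrable[OF b] by simp
  let ?A = "\<lambda>z. b (fst z - t *\<^sub>R snd z) * cutoff L (snd z)"
  have sh: "(\<integral>\<^sup>+\<xi>. ennreal (norm (b (\<xi> - c))) \<partial>lborel) = (\<integral>\<^sup>+\<xi>. ennreal (norm (b \<xi>)) \<partial>lborel)" for c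
    using nn_integral_affine[of "\<lambda>\<xi>. ennreal (norm (b \<xi>))" 1 "- c"] by simp
  have [measurable]: "?A \<in> borel_measurable borel"
    unfolding borel_prod[symmetric] by measurable
  have "integrable (lborel \<Otimes>\<^sub>M lborel) ?A"
  proof (rule integrableI_bounded)
    show "?A \<in> borel_measurable (lborel \<Otimes>\<^sub>M lborel)" by measurable
    have "(\<integral>\<^sup>+z. ennreal (norm (?A z)) \<partial>(lborel \<Otimes>\<^sub>M lborel)) = (\<integral>\<^sup>+\<eta>. \<integral>\<^sup>+\<xi>. ennreal (norm (?A (\<xi>, \<eta>))) \<partial>lborel \<partial>lborel)"
      by (rule lborel_pair.nn_integral_snd[symmetric]) measurable
    also have "\<dots> = (\<integral>\<^sup>+\<eta>. (\<integral>\<^sup>+\<xi>. ennreal (norm (b \<xi>)) \<partial>lborel) * ennreal (norm (cutoff L (\<eta> :: 'a))) \<partial>lborel)"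
      by (intro nn_integral_cong) (simp add: norm_mult ennreal_mult nn_integral_multc sh)
    also have "\<dots> = (\<integral>\<^sup>+\<xi>. ennreal (norm (b \<xi>)) \<partial>lborel) * (\<integral>\<^sup>+\<eta>. ennreal (norm (cutoff L (\<eta> :: 'a))) \<partial>lborel)"
      by (simp add: nn_integral_cmult)
    also have "\<dots> < \<infinity>"
      using b integrable_cutoff[OF L, where 'a='a] unfolding integrable_iff_bounded by (simp add: ennreal_mult_less_top)
    finally show "(\<integral>\<^sup>+z. ennreal (norm (?A z)) \<partial>(lborel \<Otimes>\<^sub>M lborel)) < \<infinity>" .
  qed
  then show A: "integrable lborel ?A" by (simp add: lborel_prod)
  let ?h = "\<lambda>z. ecis (u, v) z * ?A z"
  have i: "integrable (lborel \<Otimes>\<^sub>M lborel) ?h"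
    unfolding lborel_prod by (rule integrable_ecis_mult[OF A])
  have "(LINT z|lborel. ?h z) = (LINT \<eta>|lborel. LINT \<xi>|lborel. ?h (\<xi>, \<eta>))"
    using lborel_pair.integral_snd[of "\<lambda>\<xi> \<eta>. ?h (\<xi>, \<eta>)"] i by (simp add: lborel_prod split_beta')
  also have "\<dots> = (LINT \<eta>|lborel. (ecis (v + t *\<^sub>R u) \<eta> * cutoff L \<eta>) * (LINT w|lborel. ecis u w * b w))"
  proof (intro Bochner_Integration.integral_cong refl)
    fix \<eta> :: 'a
    have "?h (\<xi>, \<eta>) = (ecis (v + t *\<^sub>R u) \<eta> * cutoff L \<eta>) * (ecis u (\<xi> + - t *\<^sub>R \<eta>) * b (\<xi> + - t *\<^sub>R \<eta>))" for \<xi>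
    proof -
      have "ecis (u, v) (\<xi>, \<eta>) = ecis (v + t *\<^sub>R u) \<eta> * ecis u (\<xi> + - t *\<^sub>R \<eta>)"
        by (simp add: ecis_def inner_add_left inner_add_right inner_diff_right algebra_simps flip: exp_add)
      then show ?thesis by simp
    qed
    then have "(LINT \<xi>|lborel. ?h (\<xi>, \<eta>)) = (ecis (v + t *\<^sub>R u) \<eta> * cutoff L \<eta>) * (LINT \<xi>|lborel. ecis u (\<xi> + - t *\<^sub>R \<eta>) * b (\<xi> + - t *\<^sub>R \<eta>))"
      by (simp only: integral_mult_right_zero)
    also have "(LINT \<xi>|lborel. ecis u (\<xi> + - t *\<^sub>R \<eta>) * b (\<xi> + - t *\<^sub>R \<eta>)) = (LINT w|lborel. ecis u w * b w)"
      by (rule lborel_integral_shift(1)) measurable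
    finally show "(LINT \<xi>|lborel. ?h (\<xi>, \<eta>)) = (ecis (v + t *\<^sub>R u) \<eta> * cutoff L \<eta>) * (LINT w|lborel. ecis u w * b w)" .
  qed
  finally show "(LINT z|lborel. ?h z) = cutoff_ft L (v + t *\<^sub>R u) * (LINT w|lborel. ecis u w * b w)"
    by (simp add: cutoff_ft_def)
qed

lemma AE_lborel_shear: "AE z in (lborel :: ('a::euclidean_space \<times> 'a) measure). fst z - t *\<^sub>R snd z \<noteq> 0"
proof -
  let ?N = "{z :: 'a \<times> 'a. fst z - t *\<^sub>R snd z = 0}"
  have "closed ?N" by (intro closed_Collect_eq) (auto intro!: continuous_intros)
  then have [measurable]: "?N \<in> sets borel" by simp
  have "emeasure lborel ?N = (\<integral>\<^sup>+\<eta>. \<integral>\<^sup>+\<xi>. indicator ?N (\<xi>, \<eta>) \<partial>lborel \<partial>lborel)"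
    unfolding lborel_prod[symmetric]
    by (subst lborel_pair.nn_integral_snd) (simp_all only: lborel_prod nn_integral_indicator sets_lborel space_lborel Int_UNIV_right \<open>?N \<in> sets borel\<close> borel_measurable_indicator)
  also have "\<dots> = (\<integral>\<^sup>+\<eta>. emeasure lborel {t *\<^sub>R \<eta> :: 'a} \<partial>lborel)"
  proof (intro nn_integral_cong)
    fix \<eta> :: 'a
    have "(\<integral>\<^sup>+\<xi>. indicator ?N (\<xi>, \<eta>) \<partial>lborel) = (\<integral>\<^sup>+\<xi>. indicator {t *\<^sub>R \<eta>} \<xi> \<partial>lborel)"
      by (intro nn_integral_cong) (simp add: indicator_def)
    then show "(\<integral>\<^sup>+\<xi>. indicator ?N (\<xi>, \<eta>) \<partial>lborel) = emeasure lborel {t *\<^sub>R \<eta>}"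
      by (simp only: nn_integral_indicator borel_singleton sets_lborel sets.empty_sets)
  qed
  finally have "emeasure lborel ?N = 0" by simp
  then show ?thesis by (intro AE_I[of _ _ ?N]) (use \<open>?N \<in> sets borel\<close> in auto)
qed

lemma nn_integral_reflect:
  fixes \<phi> :: "'a::euclidean_space \<Rightarrow> ennreal"
  assumes [measurable]: "\<phi> \<in> borel_measurable borel"
  shows "(\<integral>\<^sup>+y. \<phi> (x - y) \<partial>lborel) = (\<integral>\<^sup>+y. \<phi> y \<partial>lborel)"
  using nn_integral_affine[of \<phi> "- 1" x] by simp

text \<open>Within distance 1 the kernel is integrable and \<open>f\<close> bounded; beyond it the
  kernel is at most 1 and \<open>f\<close> integrable. This provides the dominating function for the
  passage to the limit.\<close>

lemma riesz1_finite:
  fixes f :: "'a::euclidean_space \<Rightarrow> real"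
  assumes s: "0 < s" "s < real DIM('a)" and [measurable]: "f \<in> borel_measurable borel"
    and B: "\<And>x. 0 \<le> f x" "\<And>x. f x \<le> B" and int: "(\<integral>\<^sup>+y. ennreal (f y) \<partial>lborel) < top"
  shows "riesz1 s f x < top"
proof -
  let ?m = "real DIM('a)"
  have B0: "0 \<le> B" using B order_trans by blast
  have e: "0 < ?m - s" "?m - s < real DIM('a)" using s by auto
  obtain C1 where C1: "0 < C1" "\<And>r. 0 < r \<Longrightarrow>
    (\<integral>\<^sup>+z. ennreal (norm (z::'a) powr (- (?m - s))) * indicator (ball 0 r) z \<partial>lborel) \<le> ennreal (C1 * r powr (?m - (?m - s)))"
    by (rule nn_integral_powr_ball[OF e]) (blast intro: that)
  have "riesz1 s f x \<le> (\<integral>\<^sup>+y. ennreal B * (ennreal (norm (x - y) powr (- (?m - s))) * indicator (ball 0 1) (x - y)) + ennreal (f y) \<partial>lborel)"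
    unfolding riesz1_def
  proof (intro nn_integral_mono)
    fix y
    show "ennreal (f y * norm (x - y) powr (s - ?m)) \<le> ennreal B * (ennreal (norm (x - y) powr (- (?m - s))) * indicator (ball 0 1) (x - y)) + ennreal (f y)"
    proof (cases "norm (x - y) < 1")
      case True
      have "f y * norm (x - y) powr (s - ?m) \<le> B * norm (x - y) powr (s - ?m)"
        using B by (intro mult_right_mono) auto
      then have "ennreal (f y * norm (x - y) powr (s - ?m)) \<le> ennreal B * ennreal (norm (x - y) powr (s - ?m))"
        using B0 by (simp add: ennreal_leI flip: ennreal_mult)
      then show ?thesis using True by (simp add: add_increasing2)
    next
      case False
      then have "norm (x - y) powr (s - ?m) \<le> 1"
        using s powr_mono[of "s - ?m" 0 "norm (x - y)"] by (auto split: if_splits)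
      then have "f y * norm (x - y) powr (s - ?m) \<le> f y"
        using B by (simp add: mult_left_le)
      then show ?thesis using False by (simp add: ennreal_leI)
    qed
  qed
  also have "\<dots> = ennreal B * (\<integral>\<^sup>+y. ennreal (norm (x - y) powr (- (?m - s))) * indicator (ball 0 1) (x - y) \<partial>lborel) + (\<integral>\<^sup>+y. ennreal (f y) \<partial>lborel)"
    by (simp add: nn_integral_add nn_integral_cmult)
  also have "(\<integral>\<^sup>+y. ennreal (norm (x - y) powr (- (?m - s))) * indicator (ball 0 1) (x - y) \<partial>lborel)
      = (\<integral>\<^sup>+z. ennreal (norm (z::'a) powr (- (?m - s))) * indicator (ball 0 1) z \<partial>lborel)"
    by (rule nn_integral_reflect) measurable
  also have "ennreal B * \<dots> + (\<integral>\<^sup>+y. ennreal (f y) \<partial>lborel) \<le> ennreal B * ennreal (C1 * 1 powr (?m - (?m - s))) + (\<integral>\<^sup>+y. ennreal (f y) \<partial>lborel)"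
    by (intro add_right_mono mult_left_mono C1) auto
  also have "\<dots> < top" using int by (simp add: ennreal_mult_less_top)
  finally show ?thesis .
qed

text \<open>The dilates of \<open>cutoff_ft\<close> concentrate at the origin with constant total
  mass \<Gamma> in absolute value, so the integral over \<open>z\<close> tends to \<Gamma> times |g|
  at (1 + t) x - t y. Continuity and boundedness of \<open>g\<close> serve the inner limit,
  finiteness of the Riesz potential of |f| the outer one.\<close>

lemma approximate_identity_limit:
  fixes f g :: "'a::euclidean_space \<Rightarrow> complex"
  assumes s: "0 < s" "s < real DIM('a)" and f: "continuous_on UNIV f" "\<And>x. norm (f x) \<le> Bf" "integrable lborel f"
    and g: "continuous_on UNIV g" "\<And>x. norm (g x) \<le> Bg"
    and \<Gamma>: "(\<integral>\<^sup>+w. ennreal (norm (cutoff_ft 1 (w::'a))) \<partial>lborel) = ennreal \<Gamma>" "0 \<le> \<Gamma>"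
  shows "(\<lambda>k. \<integral>\<^sup>+y. \<integral>\<^sup>+z. ennreal (norm (f y) * norm (x - y) powr (s - real DIM('a)) *
      (norm (g z) * norm (cutoff_ft (real (Suc k)) ((1 + t) *\<^sub>R x - t *\<^sub>R y - z)))) \<partial>lborel \<partial>lborel)
    \<longlonglongrightarrow> ennreal \<Gamma> * bil s t (\<lambda>y. norm (f y)) (\<lambda>y. norm (g y)) x"
proof -
  have [measurable]: "f \<in> borel_measurable borel" "g \<in> borel_measurable borel"
    using f(1) g(1) by (auto intro: borel_measurable_continuous_onI)
  define F where "F y = norm (f y) * norm (x - y) powr (s - real DIM('a))" for y
  define V where "V y = (1 + t) *\<^sub>R x - t *\<^sub>R y" for y
  have [measurable]: "F \<in> borel_measurable borel" "V \<in> borel_measurable borel" unfolding F_def V_def by measurable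
  have F0: "0 \<le> F y" for y by (simp add: F_def)
  have Bg: "0 \<le> Bg" using g(2) norm_ge_zero order_trans by blast
  let ?I = "\<lambda>k y. \<integral>\<^sup>+w. ennreal (F y * (norm (g (V y - (1 / real (Suc k)) *\<^sub>R w)) * norm (cutoff_ft 1 w))) \<partial>lborel"
  \<comment> \<open>The substitution puts \<open>z\<close> at distance of order 1/L from the limit
    point; the Jacobian cancels the factor L^n of the dilated transform.\<close>
  have subst: "(\<integral>\<^sup>+z. ennreal (F y * (norm (g z) * norm (cutoff_ft (real (Suc k)) (V y - z)))) \<partial>lborel) = ?I k y" for k y
  proof -
    let ?L = "real (Suc k)"
    have "(\<integral>\<^sup>+z. ennreal (F y * (norm (g z) * norm (cutoff_ft ?L (V y - z)))) \<partial>lborel)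
      = ennreal (\<bar>- (1 / ?L)\<bar> ^ DIM('a)) * (\<integral>\<^sup>+w. ennreal (F y * (norm (g (V y + - (1 / ?L) *\<^sub>R w)) * norm (cutoff_ft ?L (V y - (V y + - (1 / ?L) *\<^sub>R w))))) \<partial>lborel)"
      by (rule nn_integral_affine) auto
    also have "\<dots> = (\<integral>\<^sup>+w. ennreal (\<bar>- (1 / ?L)\<bar> ^ DIM('a)) * ennreal (F y * (norm (g (V y + - (1 / ?L) *\<^sub>R w)) * norm (cutoff_ft ?L (V y - (V y + - (1 / ?L) *\<^sub>R w))))) \<partial>lborel)"
      by (rule nn_integral_cmult[symmetric]) measurable
    also have "\<dots> = ?I k y"
    proof (intro nn_integral_cong)
      fix w :: 'a
      have "cutoff_ft ?L (V y - (V y + - (1 / ?L) *\<^sub>R w)) = of_real (?L ^ DIM('a)) * cutoff_ft 1 w"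
        by (subst cutoff_ft_scale) (simp_all del: of_nat_Suc)
      then have n: "norm (cutoff_ft ?L (V y - (V y + - (1 / ?L) *\<^sub>R w))) = ?L ^ DIM('a) * norm (cutoff_ft 1 w)"
        by (simp only: norm_mult norm_of_real abs_of_nonneg zero_le_power of_nat_0_le_iff)
      have c: "(1 / ?L) ^ DIM('a) * ?L ^ DIM('a) = 1"
        by (simp add: power_divide)
      have "(\<bar>- (1 / ?L)\<bar> ^ DIM('a)) * (F y * (norm (g (V y + - (1 / ?L) *\<^sub>R w)) * (?L ^ DIM('a) * norm (cutoff_ft 1 w))))
        = ((1 / ?L) ^ DIM('a) * ?L ^ DIM('a)) * (F y * (norm (g (V y - (1 / ?L) *\<^sub>R w)) * norm (cutoff_ft 1 w)))"
        by (simp add: mult_ac)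
      also have "\<dots> = F y * (norm (g (V y - (1 / ?L) *\<^sub>R w)) * norm (cutoff_ft 1 w))"
        unfolding c by simp
      finally show "ennreal (\<bar>- (1 / ?L)\<bar> ^ DIM('a)) * ennreal (F y * (norm (g (V y + - (1 / ?L) *\<^sub>R w)) * norm (cutoff_ft ?L (V y - (V y + - (1 / ?L) *\<^sub>R w)))))
        = ennreal (F y * (norm (g (V y - (1 / ?L) *\<^sub>R w)) * norm (cutoff_ft 1 w)))"
        unfolding n by (subst ennreal_mult[symmetric]) (auto simp: F0 simp del: of_nat_Suc)
    qed
    finally show ?thesis .
  qed
  have G1: "(\<integral>\<^sup>+w. ennreal (c * norm (cutoff_ft 1 (w::'a))) \<partial>lborel) = ennreal (c * \<Gamma>)" if "0 \<le> c" for c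
    using that \<Gamma> by (simp add: ennreal_mult nn_integral_cmult)
  have inner: "(\<lambda>k. ?I k y) \<longlonglongrightarrow> ennreal (F y * norm (g (V y)) * \<Gamma>)" for y
  proof -
    have "(\<lambda>k. ?I k y) \<longlonglongrightarrow> (\<integral>\<^sup>+w. ennreal (F y * (norm (g (V y)) * norm (cutoff_ft 1 (w::'a)))) \<partial>lborel)"
    proof (rule nn_integral_dominated_convergence[where w="\<lambda>w::'a. ennreal ((F y * Bg) * norm (cutoff_ft 1 w))"])
      show "AE w in lborel. ennreal (F y * (norm (g (V y - (1 / real (Suc j)) *\<^sub>R w)) * norm (cutoff_ft 1 w))) \<le> ennreal ((F y * Bg) * norm (cutoff_ft 1 w))" for j
        using g(2) F0 by (intro AE_I2 ennreal_leI) (simp add: mult.assoc mult_left_mono mult_right_mono)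
      show "(\<integral>\<^sup>+w. ennreal ((F y * Bg) * norm (cutoff_ft 1 (w::'a))) \<partial>lborel) < \<infinity>"
        using F0 Bg by (subst G1) auto
      show "AE w in lborel. (\<lambda>k. ennreal (F y * (norm (g (V y - (1 / real (Suc k)) *\<^sub>R w)) * norm (cutoff_ft 1 w)))) \<longlonglongrightarrow> ennreal (F y * (norm (g (V y)) * norm (cutoff_ft 1 w)))"
      proof (intro AE_I2 tendsto_ennrealI tendsto_mult tendsto_norm tendsto_const)
        fix w :: 'a
        have "(\<lambda>k. 1 / real (Suc k)) \<longlonglongrightarrow> 0"
          using LIMSEQ_inverse_real_of_nat by (simp add: inverse_eq_divide)
        then have "(\<lambda>k. V y - (1 / real (Suc k)) *\<^sub>R w) \<longlonglongrightarrow> V y - 0 *\<^sub>R w"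
          by (intro tendsto_intros)
        then show "(\<lambda>k. g (V y - (1 / real (Suc k)) *\<^sub>R w)) \<longlonglongrightarrow> g (V y)"
          using g(1) by (intro isCont_tendsto_compose[of "V y" g]) (auto simp: continuous_on_eq_continuous_at)
      qed
    qed measurable
    also have "(\<integral>\<^sup>+w. ennreal (F y * (norm (g (V y)) * norm (cutoff_ft 1 (w::'a)))) \<partial>lborel) = ennreal (F y * norm (g (V y)) * \<Gamma>)"
      using G1[of "F y * norm (g (V y))"] F0 by (simp add: mult.assoc)
    finally show ?thesis .
  qed
  have "(\<lambda>k. \<integral>\<^sup>+y. ?I k y \<partial>lborel) \<longlonglongrightarrow> (\<integral>\<^sup>+y. ennreal (F y * norm (g (V y)) * \<Gamma>) \<partial>lborel)"
  proof (rule nn_integral_dominated_convergence[where w="\<lambda>y. ennreal (Bg * \<Gamma>) * ennreal (F y)"])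
    have "?I k y \<le> ennreal (Bg * \<Gamma>) * ennreal (F y)" for k y
    proof -
      have "?I k y \<le> (\<integral>\<^sup>+w. ennreal ((F y * Bg) * norm (cutoff_ft 1 (w::'a))) \<partial>lborel)"
        using g(2) F0 by (intro nn_integral_mono ennreal_leI) (simp add: mult.assoc mult_left_mono mult_right_mono)
      also have "\<dots> = ennreal (Bg * \<Gamma>) * ennreal (F y)"
        using F0[of y] Bg \<Gamma>(2) by (subst G1) (auto simp: mult_ac simp flip: ennreal_mult)
      finally show ?thesis .
    qed
    then show "AE y in lborel. ?I j y \<le> ennreal (Bg * \<Gamma>) * ennreal (F y)" for j by simp
    have "(\<integral>\<^sup>+y. ennreal (F y) \<partial>lborel) = riesz1 s (\<lambda>y. norm (f y)) x" by (simp add: F_def riesz1_def)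
    also have "\<dots> < top"
      using f(3) by (intro riesz1_finite[OF s _ _ f(2)]) (auto simp: integrable_iff_bounded)
    finally show "(\<integral>\<^sup>+y. ennreal (Bg * \<Gamma>) * ennreal (F y) \<partial>lborel) < \<infinity>"
      by (simp add: nn_integral_cmult ennreal_mult_less_top)
    show "AE y in lborel. (\<lambda>k. ?I k y) \<longlonglongrightarrow> ennreal (F y * norm (g (V y)) * \<Gamma>)" using inner by simp
  qed measurable
  moreover have "(\<integral>\<^sup>+y. ennreal (F y * norm (g (V y)) * \<Gamma>) \<partial>lborel) = ennreal \<Gamma> * bil s t (\<lambda>y. norm (f y)) (\<lambda>y. norm (g y)) x"
  proof -
    have "(\<integral>\<^sup>+y. ennreal (F y * norm (g (V y)) * \<Gamma>) \<partial>lborel) = (\<integral>\<^sup>+y. ennreal \<Gamma> * ennreal (F y * norm (g (V y))) \<partial>lborel)"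
      using F0 \<Gamma>(2) by (intro nn_integral_cong) (simp add: mult.commute flip: ennreal_mult)
    also have "\<dots> = ennreal \<Gamma> * (\<integral>\<^sup>+y. ennreal (F y * norm (g (V y))) \<partial>lborel)"
      by (intro nn_integral_cmult) measurable
    finally show ?thesis by (simp add: bil_def F_def V_def mult_ac)
  qed
  ultimately show ?thesis
    by (simp only: subst[unfolded F_def V_def] F_def V_def)
qed

text \<open>A symbol that depends on \<xi> - t \<eta> alone has a singular kernel supported on a
  subspace. Two cutoffs are therefore taken, one in \<xi> - t \<eta> and one in \<eta>: the first
  regularises the one-variable kernel, the second smears out the measure on the subspace and is
  removed as an approximate identity.\<close>

proposition T_op_le_bil:
  fixes \<sigma> :: "'n::finite bilinear_symbol" and \<sigma>0 :: "'n linear_symbol"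
  assumes sym: "\<And>x. symbol_like s C0 (\<lambda>z. if z = 0 then 0 else \<sigma>0 (x, z))" and C0: "0 \<le> C0"
    and s: "0 < s" "s < real CARD('n)"
    and \<sigma>: "\<And>x \<xi> \<eta>. \<xi> - t *\<^sub>R \<eta> \<noteq> 0 \<Longrightarrow> \<sigma> (x, \<xi>, \<eta>) = \<sigma>0 (x, \<xi> - t *\<^sub>R \<eta>)"
  obtains C where "0 < C" "\<And>f g x. integrable lborel f \<Longrightarrow> integrable lborel g \<Longrightarrow>
    continuous_on UNIV f \<Longrightarrow> continuous_on UNIV g \<Longrightarrow> bmf (\<lambda>y. norm (f y)) \<Longrightarrow> bmf (\<lambda>y. norm (g y)) \<Longrightarrow>
    ennreal (norm (T_op \<sigma> f g x)) \<le> ennreal C * bil s t (\<lambda>y. norm (f y)) (\<lambda>y. norm (g y)) x"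
proof -
  let ?e = "s - real CARD('n)"
  have dim: "real DIM(real ^ 'n) = real CARD('n)" by simp
  obtain K where K: "0 \<le> K" "\<And>(a :: real ^ 'n \<Rightarrow> complex) L u. symbol_like s C0 a \<Longrightarrow> 0 < L \<Longrightarrow> u \<noteq> 0 \<Longrightarrow>
    norm (LINT z|lborel. ecis u z * (a z * cutoff L z)) \<le> K * norm u powr ?e"
    by (rule kernel_bound[where 'a="real ^ 'n", unfolded dim, OF s C0]) (blast intro: that)
  obtain \<Gamma> where \<Gamma>: "(\<integral>\<^sup>+w. ennreal (norm (cutoff_ft 1 (w::real ^ 'n))) \<partial>lborel) = ennreal \<Gamma>" "0 \<le> \<Gamma>"
    using cutoff_ft_integrable[where 'a="real ^ 'n"] by (metis ennreal_cases less_irrefl)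
  show ?thesis
  proof (rule that[of "K * \<Gamma> + 1"])
    show "0 < K * \<Gamma> + 1" using K \<Gamma> by (simp add: add_nonneg_pos)
    fix f g :: "real ^ 'n \<Rightarrow> complex" and x
    assume f: "integrable lborel f" and g: "integrable lborel g"
      and fc: "continuous_on UNIV f" and gc: "continuous_on UNIV g"
      and bf: "bmf (\<lambda>y. norm (f y))" and bg: "bmf (\<lambda>y. norm (g y))"
    obtain Bf Bg where Bf: "\<And>x. norm (f x) \<le> Bf" and Bg: "\<And>x. norm (g x) \<le> Bg"
      using bf bg unfolding bmf_def by blast
    have [measurable]: "f \<in> borel_measurable borel" "g \<in> borel_measurable borel"
      using fc gc by (auto intro: borel_measurable_continuous_onI)
    define a where "a z = (if z = 0 then 0 else \<sigma>0 (x, z))" for z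
    have a: "symbol_like s C0 a" using sym by (simp add: a_def[abs_def])
    note [measurable] = symbol_like_measurable[OF a]
    let ?G = "tensor f g"
    have G: "integrable lborel ?G" by (rule tensor_integrable[OF f g])
    have [measurable]: "?G \<in> borel_measurable borel"
      using borel_measurable_integrable[OF G] by simp
    define a' where "a' z = a (fst z - t *\<^sub>R snd z)" for z :: "(real ^ 'n) \<times> (real ^ 'n)"
    define c where "c k z = cutoff (real (Suc k)) (fst z - t *\<^sub>R snd z) * cutoff (real (Suc k)) (snd z)" for k and z :: "(real ^ 'n) \<times> (real ^ 'n)"
    have [measurable]: "a' \<in> borel_measurable borel" "c k \<in> borel_measurable borel" for k
      unfolding a'_def c_def borel_prod[symmetric] by measurable
    let ?J = "\<lambda>k. \<integral>\<^sup>+y. \<integral>\<^sup>+z. ennreal (norm (f y) * norm (x - y) powr ?e *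
      (norm (g z) * norm (cutoff_ft (real (Suc k)) ((1 + t) *\<^sub>R x - t *\<^sub>R y - z)))) \<partial>lborel \<partial>lborel"
    have reg: "ennreal (norm (LINT z|lborel. ecis (x, x) z * (a' z * c k z) * (LINT Y|lborel. ecis (- z) Y * ?G Y))) \<le> ennreal K * ?J k" for k
    proof -
      let ?L = "real (Suc k)"
      let ?b = "\<lambda>w. a w * cutoff ?L w"
      have L: "1 \<le> ?L" "0 < ?L" by simp_all
      have b: "integrable lborel ?b" using s by (intro integrable_symbol_cutoff[OF a C0]) auto
      have A_eq: "a' z * c k z = ?b (fst z - t *\<^sub>R snd z) * cutoff ?L (snd z)" for z
        by (simp add: a'_def c_def mult.assoc del: of_nat_Suc)
      have A: "integrable lborel (\<lambda>z. a' z * c k z)"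
        unfolding A_eq by (rule shear_kernel(1)[OF b L(1)])
      have "ennreal (norm (LINT z|lborel. ecis (x, x) z * (a' z * c k z) * (LINT Y|lborel. ecis (- z) Y * ?G Y)))
        \<le> (\<integral>\<^sup>+Y. ennreal (norm (?G Y) * norm (LINT z|lborel. ecis ((x, x) - Y) z * (a' z * c k z))) \<partial>lborel)"
        by (rule multiplier_kernel_bound[OF A G])
      also have "\<dots> = (\<integral>\<^sup>+y. \<integral>\<^sup>+z. ennreal (norm (?G (y, z)) * norm (LINT w|lborel. ecis ((x, x) - (y, z)) w * (a' w * c k w))) \<partial>lborel \<partial>lborel)"
      proof -
        have "(\<lambda>Y. LINT w|lborel. ecis ((x, x) - Y) w * (a' w * c k w)) \<in> borel_measurable borel"
          by (intro sigma_finite_measure.borel_measurable_lebesgue_integral[OF sigma_finite_lborel]) measurable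
        then show ?thesis
          unfolding lborel_prod[symmetric] by (subst lborel.nn_integral_fst[symmetric]) (auto simp: lborel_prod)
      qed
      also have "\<dots> \<le> (\<integral>\<^sup>+y. \<integral>\<^sup>+z. ennreal K * ennreal (norm (f y) * norm (x - y) powr ?e *
          (norm (g z) * norm (cutoff_ft ?L ((1 + t) *\<^sub>R x - t *\<^sub>R y - z)))) \<partial>lborel \<partial>lborel)"
      proof (intro nn_integral_mono_AE, rule eventually_mono[OF AE_lborel_singleton[of x]], intro nn_integral_mono)
        fix y z assume y: "y \<noteq> x"
        have "(LINT w|lborel. ecis ((x, x) - (y, z)) w * (a' w * c k w))
           = cutoff_ft ?L ((x - z) + t *\<^sub>R (x - y)) * (LINT w|lborel. ecis (x - y) w * ?b w)"
          unfolding A_eq using shear_kernel(2)[OF b L(1), of "x - y" "x - z" t] by simp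
        \<comment> \<open>The factor from the cutoff in \<eta> vanishes in argument exactly at the
          point where \<open>bil\<close> evaluates \<open>g\<close>.\<close>
        also have "(x - z) + t *\<^sub>R (x - y) = (1 + t) *\<^sub>R x - t *\<^sub>R y - z" by (simp add: algebra_simps)
        finally have "norm (?G (y, z)) * norm (LINT w|lborel. ecis ((x, x) - (y, z)) w * (a' w * c k w))
          = norm (f y) * norm (g z) * (norm (cutoff_ft ?L ((1 + t) *\<^sub>R x - t *\<^sub>R y - z)) * norm (LINT w|lborel. ecis (x - y) w * ?b w))"
          by (simp add: tensor_def norm_mult del: of_nat_Suc)
        also have "\<dots> \<le> norm (f y) * norm (g z) * (norm (cutoff_ft ?L ((1 + t) *\<^sub>R x - t *\<^sub>R y - z)) * (K * norm (x - y) powr ?e))"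
          using y by (intro mult_left_mono K(2)[OF a L(2)]) auto
        also have "\<dots> = K * (norm (f y) * norm (x - y) powr ?e * (norm (g z) * norm (cutoff_ft ?L ((1 + t) *\<^sub>R x - t *\<^sub>R y - z))))"
          by (simp only: mult_ac)
        finally have "ennreal (norm (?G (y, z)) * norm (LINT w|lborel. ecis ((x, x) - (y, z)) w * (a' w * c k w)))
          \<le> ennreal (K * (norm (f y) * norm (x - y) powr ?e * (norm (g z) * norm (cutoff_ft ?L ((1 + t) *\<^sub>R x - t *\<^sub>R y - z)))))"
          by (rule ennreal_leI)
        also have "\<dots> = ennreal K * ennreal (norm (f y) * norm (x - y) powr ?e * (norm (g z) * norm (cutoff_ft ?L ((1 + t) *\<^sub>R x - t *\<^sub>R y - z))))"
          using K(1) by (intro ennreal_mult) auto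
        finally show "ennreal (norm (?G (y, z)) * norm (LINT w|lborel. ecis ((x, x) - (y, z)) w * (a' w * c k w))) \<le> \<dots>" .
      qed
      also have "\<dots> = ennreal K * ?J k"
        by (simp add: nn_integral_cmult del: of_nat_Suc)
      finally show ?thesis .
    qed
    have ae: "AE z in lborel. \<sigma> (x, z) = a' z"
      by (rule eventually_mono[OF AE_lborel_shear[of t]]) (auto simp: a'_def a_def \<sigma>)
    have J: "?J \<longlonglongrightarrow> ennreal \<Gamma> * bil s t (\<lambda>y. norm (f y)) (\<lambda>y. norm (g y)) x"
      using approximate_identity_limit[of s f Bf g Bg \<Gamma> x t] s fc Bf f gc Bg \<Gamma> by simp
    have "T_op \<sigma> f g x = (LINT z|lborel. ecis (x, x) z * a' z * (LINT Y|lborel. ecis (- z) Y * ?G Y))"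
      by (rule T_op_lborel[OF f g _ ae]) measurable
    also have "ennreal (norm \<dots>) \<le> ennreal K * (ennreal \<Gamma> * bil s t (\<lambda>y. norm (f y)) (\<lambda>y. norm (g y)) x)"
    proof (rule regularized_limit_bound[where c=c and B="\<lambda>k. ennreal K * ?J k"])
      show "(\<lambda>z. LINT Y|lborel. ecis (- z) Y * ?G Y) \<in> borel_measurable borel"
        by (intro sigma_finite_measure.borel_measurable_lebesgue_integral[OF sigma_finite_lborel]) measurable
      show "norm (c k z) \<le> 1" for k z
        unfolding c_def norm_mult using norm_cutoff_le_1 by (intro mult_le_one) auto
      have "(\<lambda>k. c k z) \<longlonglongrightarrow> 1 * 1" for z
        unfolding c_def by (intro tendsto_mult tendsto_cutoff)
      then show "(\<lambda>k. c k z) \<longlonglongrightarrow> 1" for z by simp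
      show "(\<lambda>k. ennreal K * ?J k) \<longlonglongrightarrow> ennreal K * (ennreal \<Gamma> * bil s t (\<lambda>y. norm (f y)) (\<lambda>y. norm (g y)) x)"
        by (intro ennreal_tendsto_cmult J) simp
    qed (use reg in simp_all)
    also have "\<dots> = ennreal (K * \<Gamma>) * bil s t (\<lambda>y. norm (f y)) (\<lambda>y. norm (g y)) x"
      using K(1) \<Gamma>(2) by (simp add: ennreal_mult mult.assoc)
    also have "\<dots> \<le> ennreal (K * \<Gamma> + 1) * bil s t (\<lambda>y. norm (f y)) (\<lambda>y. norm (g y)) x"
      by (intro mult_right_mono ennreal_leI) auto
    finally show "ennreal (norm (T_op \<sigma> f g x)) \<le> ennreal (K * \<Gamma> + 1) * bil s t (\<lambda>y. norm (f y)) (\<lambda>y. norm (g y)) x" .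
  qed
qed


section \<open>Boundedness\<close>

lemma set_integrable_measurable:
  fixes w :: "'a::euclidean_space \<Rightarrow> real"
  assumes "\<And>k::nat. set_integrable lebesgue (cball 0 (real k)) w"
  shows "w \<in> borel_measurable lebesgue"
proof (rule borel_measurable_LIMSEQ_metric)
  show "(\<lambda>x. indicator (cball 0 (real k)) x *\<^sub>R w x) \<in> borel_measurable lebesgue" for k
    using assms[of k] unfolding set_integrable_def by (rule borel_measurable_integrable)
  show "(\<lambda>k. indicator (cball 0 (real k)) x *\<^sub>R w x) \<longlonglongrightarrow> w x" for x
  proof (rule tendsto_eventually)
    have "\<forall>\<^sub>F k in sequentially. norm x \<le> real k"
      by (rule eventually_ge_at_top[THEN filterlim_real_sequentially[unfolded filterlim_iff, rule_format]])
    then show "\<forall>\<^sub>F k in sequentially. indicator (cball 0 (real k)) x *\<^sub>R w x = w x"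
      by (rule eventually_mono) simp
  qed
qed

lemma adm_weightI:
  assumes "v \<in> borel_measurable borel" "\<And>x. 0 < v x" "\<And>c r. 0 < r \<Longrightarrow> emeasure (wm v) (ball c r) < top"
  shows "adm_weight v"
  unfolding adm_weight_def
proof (intro conjI allI)
  show "emeasure (wm v) (ball c r) < top" for c r
    using assms(3)[of r c] by (cases "0 < r") (simp_all add: not_less ball_empty)
qed (use assms in auto)

text \<open>A Borel function agrees with the weight almost everywhere; where it is not positive it
  is reset to 1, which affects only a null set because the weight is positive almost
  everywhere.\<close>

lemma weight_Borel_version:
  fixes w :: "real ^ 'n::finite \<Rightarrow> real"
  assumes w: "weight w"
  obtains v where "adm_weight v" "AE x in lborel. w x = v x"
proof -
  have int: "set_integrable lebesgue (cball c r) w" for c r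
    using w by (simp add: weight_def)
  obtain v0 where v0: "v0 \<in> borel_measurable lborel" "AE x in lborel. w x = v0 x"
    using completion_ex_borel_measurable_real[OF set_integrable_measurable[OF int]] by blast
  define v where "v x = (if 0 < v0 x then v0 x else 1)" for x
  have [measurable]: "v0 \<in> borel_measurable borel" using v0 by simp
  have m: "v \<in> borel_measurable borel" unfolding v_def by measurable
  have "AE x in lborel. 0 < w x" using w by (simp add: weight_def AE_completion_iff)
  with v0(2) have ae: "AE x in lborel. w x = v x"
    by eventually_elim (simp add: v_def)
  have "adm_weight v"
  proof (rule adm_weightI)
    fix c :: "real ^ 'n" and r :: real
    have "emeasure (wm v) (ball c r) = (\<integral>\<^sup>+x\<in>ball c r. ennreal (v x) \<partial>lborel)"
      by (rule emeasure_wm[OF m]) simp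
    also have "\<dots> = (\<integral>\<^sup>+x\<in>ball c r. ennreal (w x) \<partial>lborel)"
      by (intro nn_integral_cong_AE) (use ae in eventually_elim, simp)
    also have "\<dots> \<le> (\<integral>\<^sup>+x. ennreal (norm (indicator (cball c r) x *\<^sub>R w x)) \<partial>lebesgue)"
      unfolding nn_integral_completion
      by (intro nn_integral_mono) (auto split: split_indicator simp: ennreal_leI)
    also have "\<dots> < top"
      using int[of c r] unfolding set_integrable_def integrable_iff_bounded by simp
    finally show "emeasure (wm v) (ball c r) < top" .
  qed (use m in \<open>auto simp: v_def\<close>)
  with ae that show ?thesis by blast
qed

lemma ball_avg_Borel_version:
  assumes [measurable]: "v \<in> borel_measurable borel" and ae: "AE x in lborel. u x = v x"
  shows "ball_avg u c r = emeasure (wm v) (ball c r) / emeasure lborel (ball c r)"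
proof -
  have "(\<integral>\<^sup>+x\<in>ball c r. ennreal (u x) \<partial>lborel) = (\<integral>\<^sup>+x\<in>ball c r. ennreal (v x) \<partial>lborel)"
    by (intro nn_integral_cong_AE) (use ae in eventually_elim, simp)
  then show ?thesis
    by (simp add: ball_avg_def nn_integral_completion emeasure_wm)
qed

lemma SUP_ball_boundE:
  fixes F :: "'a \<Rightarrow> real \<Rightarrow> ennreal"
  assumes "(SUP c. SUP r\<in>{0<..}. F c r) < \<infinity>"
  obtains A where "0 \<le> A" "\<And>c r. 0 < r \<Longrightarrow> F c r \<le> ennreal A"
proof -
  obtain A where A: "0 \<le> A" "(SUP c. SUP r\<in>{0<..}. F c r) = ennreal A"
    using assms by (cases "SUP c. SUP r\<in>{0<..}. F c r") auto
  have "F c r \<le> ennreal A" if "0 < r" for c r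
    unfolding A(2)[symmetric] using that by (intro SUP_upper2[of c] SUP_upper) auto
  with A(1) that show ?thesis by blast
qed

text \<open>The averages of positive functions are nonzero, so finiteness of their product makes
  every factor finite: the dual weights are locally integrable as a consequence. The
  \<open>q\<close>-th root then puts the condition in the form symmetric in the three
  weights.\<close>

lemma Muckenhoupt_condition:
  fixes v \<sigma>1 \<sigma>2 :: "'a::euclidean_space \<Rightarrow> real"
  defines "avg \<equiv> \<lambda>u c r. emeasure (wm u) (ball c r) / emeasure lborel (ball c r)"
  assumes v: "v \<in> borel_measurable borel" "\<And>x. 0 < v x"
    and \<sigma>1: "\<sigma>1 \<in> borel_measurable borel" "\<And>x. 0 < \<sigma>1 x"
    and \<sigma>2: "\<sigma>2 \<in> borel_measurable borel" "\<And>x. 0 < \<sigma>2 x"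
    and q: "0 < q" and A0: "0 \<le> A0"
    and H: "\<And>c r. 0 < r \<Longrightarrow> avg v c r * ennpowr (avg \<sigma>1 c r) (q * a1) * ennpowr (avg \<sigma>2 c r) (q * a2) \<le> ennreal A0"
  shows "adm_weight v" "adm_weight \<sigma>1" "adm_weight \<sigma>2"
    and "\<exists>A>0. \<forall>c r. 0 < r \<longrightarrow> bvol v c r powr (1 / q) * (bvol \<sigma>1 c r powr a1 * bvol \<sigma>2 c r powr a2)
      \<le> A * measure lborel (ball c r) powr (1 / q + a1 + a2)"
proof -
  have L: "emeasure lborel (ball c r) = ennreal (measure lborel (ball c r))" for c :: 'a and r
    using emeasure_lborel_ball_finite[of c r] by (simp add: emeasure_eq_ennreal_measure)
  have avg: "avg u c r = emeasure (wm u) (ball c r) * ennreal (1 / measure lborel (ball c r))" if "0 < r" for u c r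
    using lball_pos[OF that, of c] by (simp add: avg_def L divide_ennreal_def inverse_ennreal inverse_eq_divide)
  have pos: "avg u c r \<noteq> 0" if "u \<in> borel_measurable borel" "\<And>x. 0 < u x" "0 < r" for u c r
    using lball_pos[OF that(3), of c] emeasure_wm_ball_neq_0[OF that, of c]
    by (simp add: avg that(3) ennreal_eq_0_iff not_le)
  have lt: "ennpowr y a < top \<longleftrightarrow> y < top" for y a
    by (simp add: less_top[symmetric] ennpowr_eq_top_iff)
  have fin: "avg v c r < top" "avg \<sigma>1 c r < top" "avg \<sigma>2 c r < top" if r: "0 < r" for c r
  proof -
    have "avg v c r * ennpowr (avg \<sigma>1 c r) (q * a1) * ennpowr (avg \<sigma>2 c r) (q * a2) < top"
      using H[OF r, of c] by (rule order_le_less_trans) simp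
    then show "avg v c r < top" "avg \<sigma>1 c r < top" "avg \<sigma>2 c r < top"
      using pos[OF v r, of c] pos[OF \<sigma>1 r, of c] pos[OF \<sigma>2 r, of c]
      by (auto simp: ennreal_mult_less_top ennpowr_eq_0_iff lt)
  qed
  have finD: "emeasure (wm u) (ball c r) < top" if "avg u c r < top" "0 < r" for u c r
    using that lball_pos[OF that(2), of c] by (auto simp: avg ennreal_mult_less_top ennreal_eq_0_iff)
  show adm: "adm_weight v" "adm_weight \<sigma>1" "adm_weight \<sigma>2"
    by (rule adm_weightI; use v \<sigma>1 \<sigma>2 fin finD in blast)+
  show "\<exists>A>0. \<forall>c r. 0 < r \<longrightarrow> bvol v c r powr (1 / q) * (bvol \<sigma>1 c r powr a1 * bvol \<sigma>2 c r powr a2)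
      \<le> A * measure lborel (ball c r) powr (1 / q + a1 + a2)"
  proof (intro exI[of _ "A0 powr (1 / q) + 1"] conjI allI impI)
    show "0 < A0 powr (1 / q) + 1" by (simp add: add_nonneg_pos)
    fix c :: 'a and r :: real assume r: "0 < r"
    let ?L = "measure lborel (ball c r)" and ?V = "bvol v c r" and ?S = "bvol \<sigma>1 c r" and ?T = "bvol \<sigma>2 c r"
    have p: "0 < ?L" "0 < ?V" "0 < ?S" "0 < ?T" using lball_pos[OF r] bvol_pos[OF _ r] adm by auto
    have a: "avg u c r = ennreal (bvol u c r / ?L)" if "adm_weight u" for u
      using bvol_pos[OF that r, of c] p(1) by (simp add: avg[OF r] emeasure_ball_bvol[OF that] flip: ennreal_mult)
    have "ennreal ((?V / ?L) * (?S / ?L) powr (q * a1) * (?T / ?L) powr (q * a2)) \<le> ennreal A0"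
      using H[OF r, of c] p by (simp add: a adm ennpowr_ennreal flip: ennreal_mult)
    then have "(?V / ?L) * (?S / ?L) powr (q * a1) * (?T / ?L) powr (q * a2) \<le> A0"
      using A0 by (simp add: ennreal_le_iff)
    then have "((?V / ?L) * (?S / ?L) powr (q * a1) * (?T / ?L) powr (q * a2)) powr (1 / q) \<le> A0 powr (1 / q)"
      using q p by (intro powr_mono2) auto
    also have "((?V / ?L) * (?S / ?L) powr (q * a1) * (?T / ?L) powr (q * a2)) powr (1 / q)
      = ?V powr (1 / q) * (?S powr a1 * ?T powr a2) / ?L powr (1 / q + a1 + a2)"
      using p q by (simp add: powr_mult powr_powr powr_divide powr_add)
    finally have "?V powr (1 / q) * (?S powr a1 * ?T powr a2) \<le> A0 powr (1 / q) * ?L powr (1 / q + a1 + a2)"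
      using p by (simp add: divide_le_eq)
    also have "\<dots> \<le> (A0 powr (1 / q) + 1) * ?L powr (1 / q + a1 + a2)"
      by (intro mult_right_mono) auto
    finally show "?V powr (1 / q) * (?S powr a1 * ?T powr a2) \<le> (A0 powr (1 / q) + 1) * ?L powr (1 / q + a1 + a2)" .
  qed
qed

section \<open>From test functions to norm inequalities\<close>

lemma conj_exp_simps:
  assumes "1 < p"
  shows "q / conj_exp p = q * (1 - 1 / p)" "(1 - conj_exp p) * (1 - p) = 1" "(1 - conj_exp p) * (1 - 1 / p) = - (1 / p)"
  using assms by (simp_all add: conj_exp_def field_simps)

text \<open>Continuity and boundedness are the two properties that the later estimates take from
  Schwartz functions; integrability enters through a case distinction.\<close>

lemma schwartzD:
  assumes f: "schwartz f"
  shows schwartz_continuous: "continuous_on UNIV f" and schwartz_bmf: "bmf (\<lambda>x. norm (f x))"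
proof -
  have "f differentiable at x" for x
  proof -
    have "iter_deriv [] f differentiable at x" using f unfolding schwartz_def smooth_on_def by (metis UNIV_I empty_set empty_subsetI)
    then show ?thesis by (simp add: iter_deriv_def)
  qed
  then show c: "continuous_on UNIV f"
    by (auto intro!: continuous_at_imp_continuous_on differentiable_imp_continuous_within)
  have "\<exists>C. \<forall>x. norm ((\<Prod>i\<leftarrow>[]. x $ i) *\<^sub>R iter_deriv (map (\<lambda>i. axis i 1) []) f x) \<le> C"
    using f unfolding schwartz_def by blast
  then obtain C where "\<And>x. norm (f x) \<le> C" by (auto simp: iter_deriv_def)
  then show "bmf (\<lambda>x. norm (f x))"
    using borel_measurable_continuous_onI[OF c] by (auto simp: bmf_def)
qed

text \<open>Multiplication by a unimodular exponential preserves integrability in both directions,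
  and a non-integrable function has integral 0 by convention. Hence the operator vanishes unless
  both functions are integrable.\<close>

lemma fourier_eq_0_if_not_integrable:
  fixes f :: "real ^ 'n::finite \<Rightarrow> complex"
  assumes m: "f \<in> borel_measurable borel" and f: "\<not> integrable lborel f"
  shows "fourier f \<xi> = 0"
proof -
  have "\<not> integrable lborel (\<lambda>y. ecis (- \<xi>) y * f y)"
  proof
    assume "integrable lborel (\<lambda>y. ecis (- \<xi>) y * f y)"
    then have "integrable lborel (\<lambda>y. ecis \<xi> y * (ecis (- \<xi>) y * f y))" by (rule integrable_ecis_mult)
    moreover have "ecis \<xi> y * (ecis (- \<xi>) y * f y) = f y" for y
      by (simp add: ecis_def mult.assoc[symmetric] flip: exp_add)
    ultimately show False using f by simp
  qed
  then show ?thesis by (simp add: fourier_lborel[OF m] not_integrable_integral_eq)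
qed

lemma fourier_eq_0_AE:
  fixes f :: "real ^ 'n::finite \<Rightarrow> complex"
  assumes m: "f \<in> borel_measurable borel" and f: "AE x in lborel. f x = 0"
  shows "fourier f \<xi> = 0"
  unfolding fourier_lborel[OF m] by (rule integral_eq_zero_AE) (use f in eventually_elim, simp)

lemma T_op_eq_0:
  assumes "(\<forall>\<xi>. fourier f \<xi> = 0) \<or> (\<forall>\<eta>. fourier g \<eta> = 0)"
  shows "T_op \<sigma> f g x = 0"
  using assms by (auto simp: T_op_def split_beta')

lemma Lp_norm_Borel_version:
  assumes "AE x in lborel. w x = v x"
  shows "Lp_norm p w h = ennpowr (\<integral>\<^sup>+x. ennreal (norm (h x) powr p * v x) \<partial>lborel) (1 / p)"
proof -
  have "(\<integral>\<^sup>+x. ennreal (norm (h x) powr p * w x) \<partial>lborel) = (\<integral>\<^sup>+x. ennreal (norm (h x) powr p * v x) \<partial>lborel)"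
    by (intro nn_integral_cong_AE) (use assms in eventually_elim, simp)
  then show ?thesis by (simp add: Lp_norm_def nn_integral_completion)
qed

text \<open>Covers the case in which one norm is 0 and the other infinite: the right side of the
  claim is then 0, and the operator must be shown to vanish.\<close>

lemma fourier_eq_0_if_norm_0:
  fixes f :: "real ^ 'n::finite \<Rightarrow> complex"
  assumes [measurable]: "f \<in> borel_measurable borel" "v \<in> borel_measurable borel" and v: "\<And>x. 0 < v x"
    and 0: "(\<integral>\<^sup>+x. ennreal (norm (f x) powr p * v x) \<partial>lborel) = 0"
  shows "fourier f \<xi> = 0"
proof (rule fourier_eq_0_AE)
  have "AE x in lborel. ennreal (norm (f x) powr p * v x) = 0"
    using 0 by (subst (asm) nn_integral_0_iff_AE) auto
  then show "AE x in lborel. f x = 0"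
  proof eventually_elim
    case (elim x)
    then have "norm (f x) powr p * v x \<le> 0" by (simp add: ennreal_eq_0_iff)
    then show ?case using v[of x] by (simp add: mult_le_0_iff not_le[symmetric])
  qed
qed fact

text \<open>The degenerate cases are settled here once and for all: a non-integrable function or a
  zero norm makes the operator vanish, and an infinite norm opposite a nonzero one makes the right
  side infinite. Estimates with real norms \<open>nf\<close>, \<open>ng\<close> for integrable
  functions remain.\<close>

lemma bounded_bilinear_LpI:
  fixes \<sigma> :: "'n::finite bilinear_symbol"
  assumes p: "0 < p1" "0 < p2" "0 < q" and adm: "adm_weight v1" "adm_weight v2"
    and ae: "AE x in lborel. w1 x = v1 x" "AE x in lborel. w2 x = v2 x" "AE x in lborel. w x = v x"
    and C: "0 < C"
    and bd: "\<And>f g nf ng. integrable lborel f \<Longrightarrow> integrable lborel g \<Longrightarrow> continuous_on UNIV f \<Longrightarrow> continuous_on UNIV g \<Longrightarrow>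
      bmf (\<lambda>x. norm (f x)) \<Longrightarrow> bmf (\<lambda>x. norm (g x)) \<Longrightarrow> 0 \<le> nf \<Longrightarrow> 0 \<le> ng \<Longrightarrow>
      (\<integral>\<^sup>+x. ennreal (norm (f x) powr p1 * v1 x) \<partial>lborel) \<le> ennreal (nf powr p1) \<Longrightarrow>
      (\<integral>\<^sup>+x. ennreal (norm (g x) powr p2 * v2 x) \<partial>lborel) \<le> ennreal (ng powr p2) \<Longrightarrow>
      (\<integral>\<^sup>+x. ennreal (norm (T_op \<sigma> f g x) powr q * v x) \<partial>lborel) \<le> ennreal (C * (nf * ng) powr q)"
  shows "bounded_bilinear_Lp (T_op \<sigma>) p1 w1 p2 w2 q w"
  unfolding bounded_bilinear_Lp_def
proof (intro exI[of _ "C powr (1 / q)"] allI impI)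
  fix f g :: "real ^ 'n \<Rightarrow> complex" assume f: "schwartz f" and g: "schwartz g"
  have mf: "f \<in> borel_measurable borel" and mg: "g \<in> borel_measurable borel"
    using schwartz_continuous[OF f] schwartz_continuous[OF g] by (auto intro: borel_measurable_continuous_onI)
  define N1 where "N1 = (\<integral>\<^sup>+x. ennreal (norm (f x) powr p1 * v1 x) \<partial>lborel)"
  define N2 where "N2 = (\<integral>\<^sup>+x. ennreal (norm (g x) powr p2 * v2 x) \<partial>lborel)"
  have L: "Lp_norm p1 w1 f = ennpowr N1 (1 / p1)" "Lp_norm p2 w2 g = ennpowr N2 (1 / p2)"
    unfolding N1_def N2_def using ae by (simp_all add: Lp_norm_Borel_version)
  show "Lp_norm q w (T_op \<sigma> f g) \<le> ennreal (C powr (1 / q)) * Lp_norm p1 w1 f * Lp_norm p2 w2 g"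
  proof (cases "\<not> integrable lborel f \<or> \<not> integrable lborel g \<or> N1 = 0 \<or> N2 = 0")
    case True
    then have "(\<forall>\<xi>. fourier f \<xi> = 0) \<or> (\<forall>\<eta>. fourier g \<eta> = 0)"
      using fourier_eq_0_if_not_integrable[OF mf] fourier_eq_0_if_not_integrable[OF mg]
        fourier_eq_0_if_norm_0[OF mf adm_weight_measurable adm_weight_pos, OF adm(1,1), of p1]
        fourier_eq_0_if_norm_0[OF mg adm_weight_measurable adm_weight_pos, OF adm(2,2), of p2]
      unfolding N1_def N2_def by blast
    then have "T_op \<sigma> f g x = 0" for x by (rule T_op_eq_0)
    then show ?thesis using p by (simp add: Lp_norm_def)
  next
    case False
    show ?thesis
    proof (cases "N1 = top \<or> N2 = top")
      case True
      have "0 < C powr (1 / q)" using C by simp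
      then have "ennreal (C powr (1 / q)) * Lp_norm p1 w1 f * Lp_norm p2 w2 g = top"
        using True False unfolding L by (auto simp: ennreal_mult_eq_top_iff ennpowr_eq_0_iff ennreal_eq_0_iff)
      then show ?thesis by simp
    next
      case fin: False
      obtain n1 where n1: "0 \<le> n1" "N1 = ennreal n1" using fin by (cases N1) auto
      obtain n2 where n2: "0 \<le> n2" "N2 = ennreal n2" using fin by (cases N2) auto
      let ?f = "n1 powr (1 / p1)" and ?g = "n2 powr (1 / p2)"
      have "(\<integral>\<^sup>+x. ennreal (norm (T_op \<sigma> f g x) powr q * v x) \<partial>lborel) \<le> ennreal (C * (?f * ?g) powr q)"
      proof (rule bd)
        show "(\<integral>\<^sup>+x. ennreal (norm (f x) powr p1 * v1 x) \<partial>lborel) \<le> ennreal (?f powr p1)"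
          using n1 p unfolding N1_def by (simp add: powr_powr)
        show "(\<integral>\<^sup>+x. ennreal (norm (g x) powr p2 * v2 x) \<partial>lborel) \<le> ennreal (?g powr p2)"
          using n2 p unfolding N2_def by (simp add: powr_powr)
      qed (use False f g in \<open>auto intro: schwartz_continuous schwartz_bmf\<close>)
      then have "Lp_norm q w (T_op \<sigma> f g) \<le> ennpowr (ennreal (C * (?f * ?g) powr q)) (1 / q)"
        unfolding Lp_norm_Borel_version[OF ae(3)] using p by (intro ennpowr_mono) auto
      also have "\<dots> = ennreal (C powr (1 / q) * ?f * ?g)"
        using C p by (simp add: ennpowr_ennreal powr_mult powr_powr mult.assoc)
      also have "\<dots> = ennreal (C powr (1 / q)) * Lp_norm p1 w1 f * Lp_norm p2 w2 g"
        unfolding L n1(2) n2(2) using n1 n2 by (simp add: ennpowr_ennreal ennreal_mult)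
      finally show ?thesis .
    qed
  qed
qed

lemma weighted_integral_of_pointwise_bound:
  fixes h :: "'a::euclidean_space \<Rightarrow> complex"
  assumes K: "0 < K" and q: "0 < q" and h: "\<And>x. ennreal (norm (h x)) \<le> ennreal K * R x"
  shows "(\<integral>\<^sup>+x. ennreal (norm (h x) powr q * v x) \<partial>lborel)
    \<le> ennreal (K powr q) * (\<integral>\<^sup>+x. ennpowr (R x) q * ennreal (v x) \<partial>lborel)"
proof -
  have "(\<integral>\<^sup>+x. ennreal (norm (h x) powr q * v x) \<partial>lborel)
    \<le> (\<integral>\<^sup>+x. ennreal (K powr q) * (ennpowr (R x) q * ennreal (v x)) \<partial>lborel)"
  proof (intro nn_integral_mono)
    fix x
    have "ennreal (norm (h x) powr q * v x) = ennpowr (ennreal (norm (h x))) q * ennreal (v x)"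
      by (simp add: ennpowr_ennreal ennreal_mult')
    also have "\<dots> \<le> ennpowr (ennreal K * R x) q * ennreal (v x)"
      using q by (intro mult_right_mono ennpowr_mono h) auto
    also have "\<dots> = ennreal (K powr q) * (ennpowr (R x) q * ennreal (v x))"
      using ennpowr_ennreal[of K q] K by (simp only: ennpowr_mult mult.assoc less_imp_le)
    finally show "ennreal (norm (h x) powr q * v x) \<le> ennreal (K powr q) * (ennpowr (R x) q * ennreal (v x))" .
  qed
  also have "\<dots> = ennreal (K powr q) * (\<integral>\<^sup>+x. ennpowr (R x) q * ennreal (v x) \<partial>lborel)"
    by (rule nn_integral_cmult_real) (use K in simp)
  finally show ?thesis .
qed

lemma measurable_riesz2 [measurable]:
  assumes [measurable]: "f \<in> borel_measurable borel" "g \<in> borel_measurable borel"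
  shows "riesz2 s f g \<in> borel_measurable borel"
  unfolding riesz2_def by measurable

section \<open>Bounds for the symbol classes\<close>

theorem bilinear_class_bounded:
  fixes \<sigma> :: "'n::finite bilinear_symbol"
  assumes P: "1 < p1" "1 < p2" and q: "0 < q" and s: "0 < s" "s < 2 * real CARD('n)"
    and pq: "1 / q = 1 / p1 + 1 / p2 - s / real CARD('n)"
    and \<sigma>: "\<sigma> \<in> bilinear_class \<rho> (- s) \<delta>" "\<And>\<xi> \<eta>. norm (\<xi>, \<eta>) \<le> \<rho> \<xi> \<eta>"
    and w: "weight w1" "weight w2" and A: "A_bilinear p1 p2 q w1 w2"
  shows "bounded_bilinear_Lp (T_op \<sigma>) p1 w1 p2 w2 q (prod_weight p1 p2 q w1 w2)"
proof -
  obtain v1 where v1: "adm_weight v1" "AE x in lborel. w1 x = v1 x" by (rule weight_Borel_version[OF w(1)])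
  obtain v2 where v2: "adm_weight v2" "AE x in lborel. w2 x = v2 x" by (rule weight_Borel_version[OF w(2)])
  note [measurable] = adm_weight_measurable[OF v1(1)] adm_weight_measurable[OF v2(1)]
  note pos = adm_weight_pos[OF v1(1)] adm_weight_pos[OF v2(1)]
  \<comment> \<open>The target weight and the two dual weights. Since (1 - p')(1 - p) = 1 and (1 -
    p')(1 - 1/p) = - 1/p, the original weights reappear in the norms and the threefold product is
    1.\<close>
  define W where "W x = v1 x powr (q / p1) * v2 x powr (q / p2)" for x
  define S1 where "S1 x = v1 x powr (1 - conj_exp p1)" for x
  define S2 where "S2 x = v2 x powr (1 - conj_exp p2)" for x
  have m [measurable]: "W \<in> borel_measurable borel" "S1 \<in> borel_measurable borel" "S2 \<in> borel_measurable borel"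
    unfolding W_def S1_def S2_def by measurable
  have spos: "0 < W x" "0 < S1 x" "0 < S2 x" for x
    using pos[of x] by (simp_all add: W_def S1_def S2_def)
  have aeW: "AE x in lborel. prod_weight p1 p2 q w1 w2 x = W x"
    using v1(2) v2(2) by eventually_elim (simp add: prod_weight_def W_def)
  have aeS: "AE x in lborel. w1 x powr (1 - conj_exp p1) = S1 x" "AE x in lborel. w2 x powr (1 - conj_exp p2) = S2 x"
    subgoal using v1(2) by eventually_elim (simp add: S1_def)
    subgoal using v2(2) by eventually_elim (simp add: S2_def)
    done
  note avg = ball_avg_Borel_version[OF m(1) aeW] ball_avg_Borel_version[OF m(2) aeS(1)] ball_avg_Borel_version[OF m(3) aeS(2)]
  obtain A0 where A0: "0 \<le> A0" "\<And>c r. 0 < r \<Longrightarrow>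
      ball_avg (prod_weight p1 p2 q w1 w2) c r
        * ennpowr (ball_avg (\<lambda>x. w1 x powr (1 - conj_exp p1)) c r) (q / conj_exp p1)
        * ennpowr (ball_avg (\<lambda>x. w2 x powr (1 - conj_exp p2)) c r) (q / conj_exp p2) \<le> ennreal A0"
    by (rule SUP_ball_boundE[OF A[unfolded A_bilinear_def]]) (blast intro: that)
  have H: "emeasure (wm W) (ball c r) / emeasure lborel (ball c r)
      * ennpowr (emeasure (wm S1) (ball c r) / emeasure lborel (ball c r)) (q * (1 - 1 / p1))
      * ennpowr (emeasure (wm S2) (ball c r) / emeasure lborel (ball c r)) (q * (1 - 1 / p2)) \<le> ennreal A0" if "0 < r" for c r
    using A0(2)[OF that, of c] by (simp only: avg conj_exp_simps(1)[OF P(1)] conj_exp_simps(1)[OF P(2)])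
  note M = Muckenhoupt_condition[OF m(1) spos(1) m(2) spos(2) m(3) spos(3) q A0(1) H]
  have e: "1 / q + (1 - 1 / p1) + (1 - 1 / p2) = 2 - s / real DIM(real ^ 'n)" using pq by simp
  obtain B where B: "0 < B" "\<forall>c r. 0 < r \<longrightarrow> bvol W c r powr (1 / q) * (bvol S1 c r powr (1 - 1 / p1) * bvol S2 c r powr (1 - 1 / p2))
      \<le> B * measure lborel (ball c r) powr (2 - s / real DIM(real ^ 'n))"
    using M(4) unfolding e by blast
  have one: "W x powr (1 / q) * (S1 x powr (1 - 1 / p1) * S2 x powr (1 - 1 / p2)) = 1" for x
  proof -
    have "W x powr (1 / q) = v1 x powr (1 / p1) * v2 x powr (1 / p2)"
      using pos[of x] q by (simp add: W_def powr_mult powr_powr)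
    moreover have "S1 x powr (1 - 1 / p1) = v1 x powr - (1 / p1)" "S2 x powr (1 - 1 / p2) = v2 x powr - (1 / p2)"
      unfolding S1_def S2_def powr_powr by (simp_all only: conj_exp_simps(3)[OF P(1)] conj_exp_simps(3)[OF P(2)])
    ultimately show ?thesis using pos[of x] by (simp add: powr_minus field_simps)
  qed
  have wS: "wpow p1 S1 f = (\<integral>\<^sup>+x. ennreal (f x powr p1 * v1 x) \<partial>lborel)" "wpow p2 S2 f = (\<integral>\<^sup>+x. ennreal (f x powr p2 * v2 x) \<partial>lborel)" for f
    unfolding wpow_def S1_def S2_def powr_powr conj_exp_simps(2)[OF P(1)] conj_exp_simps(2)[OF P(2)]
    using pos by (simp_all add: less_imp_le)
  obtain C where C: "0 < C" "\<And>f g nf ng. loc_int f \<Longrightarrow> loc_int g \<Longrightarrow> 0 \<le> nf \<Longrightarrow> 0 \<le> ng \<Longrightarrow>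
    wpow p1 S1 f \<le> ennreal (nf powr p1) \<Longrightarrow> wpow p2 S2 g \<le> ennreal (ng powr p2) \<Longrightarrow>
    (\<integral>\<^sup>+x. ennpowr (riesz2 s f g x) q \<partial>wm W) \<le> ennreal (C * (nf * ng) powr q)"
    using riesz2_weighted[OF M(1,2,3) P q s(1) _ one B(1) B(2)[rule_format]] pq by auto
  obtain C0 where C0: "0 \<le> C0" "\<And>x. symbol_like s C0 (\<lambda>z. if z = 0 then 0 else \<sigma> (x, z))"
    using bilinear_class_symbol_like[OF \<sigma>(1) s(1) \<sigma>(2)] by blast
  obtain K where K: "0 < K" "\<And>f g x. integrable lborel f \<Longrightarrow> integrable lborel g \<Longrightarrow>
    ennreal (norm (T_op \<sigma> f g x)) \<le> ennreal K * riesz2 s (\<lambda>y. norm (f y)) (\<lambda>y. norm (g y)) x"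
    by (rule T_op_le_riesz2[OF C0(2,1) s]) (blast intro: that)
  show ?thesis
  proof (rule bounded_bilinear_LpI[where C="K powr q * C", OF _ _ q v1(1) v2(1) v1(2) v2(2) aeW])
    fix f g :: "real ^ 'n \<Rightarrow> complex" and nf ng :: real
    assume f: "integrable lborel f" "bmf (\<lambda>x. norm (f x))" "0 \<le> nf" "(\<integral>\<^sup>+x. ennreal (norm (f x) powr p1 * v1 x) \<partial>lborel) \<le> ennreal (nf powr p1)"
      and g: "integrable lborel g" "bmf (\<lambda>x. norm (g x))" "0 \<le> ng" "(\<integral>\<^sup>+x. ennreal (norm (g x) powr p2 * v2 x) \<partial>lborel) \<le> ennreal (ng powr p2)"
    note [measurable] = bmfD(1)[OF f(2)] bmfD(1)[OF g(2)]
    let ?R = "riesz2 s (\<lambda>y. norm (f y)) (\<lambda>y. norm (g y))"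
    have "(\<integral>\<^sup>+x. ennreal (norm (T_op \<sigma> f g x) powr q * W x) \<partial>lborel)
      \<le> ennreal (K powr q) * (\<integral>\<^sup>+x. ennpowr (?R x) q * ennreal (W x) \<partial>lborel)"
      by (rule weighted_integral_of_pointwise_bound[OF K(1) q K(2)[OF f(1) g(1)]])
    also have "(\<integral>\<^sup>+x. ennpowr (?R x) q * ennreal (W x) \<partial>lborel) = (\<integral>\<^sup>+x. ennpowr (?R x) q \<partial>wm W)"
      by (subst nn_integral_wm) (simp_all add: mult.commute)
    also have "ennreal (K powr q) * \<dots> \<le> ennreal (K powr q) * ennreal (C * (nf * ng) powr q)"
      using f g by (intro mult_left_mono C(2)) (simp_all add: bmf_loc_int wS)
    also have "\<dots> = ennreal (K powr q * C * (nf * ng) powr q)"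
      using C(1) by (simp add: mult.assoc flip: ennreal_mult)
    finally show "(\<integral>\<^sup>+x. ennreal (norm (T_op \<sigma> f g x) powr q * W x) \<partial>lborel) \<le> ennreal (K powr q * C * (nf * ng) powr q)" .
  qed (use P K C in simp_all)
qed

text \<open>Common end of the weighted and the unweighted case: any bound for the positive sheared
  operator passes to \<open>T_op\<close> through the pointwise domination.\<close>

lemma T_op_bounded_of_bil:
  fixes \<sigma> :: "'n::finite bilinear_symbol" and \<sigma>0 :: "'n linear_symbol"
  assumes P: "0 < p1" "0 < p2" and q: "0 < q" and s: "0 < s" "s < real CARD('n)"
    and \<sigma>0: "\<sigma>0 \<in> linear_class \<rho> (- s) \<delta>" "\<And>\<xi>. norm \<xi> \<le> \<rho> \<xi>"
    and \<sigma>: "\<forall>x \<xi> \<eta>. \<xi> - t *\<^sub>R \<eta> \<noteq> 0 \<longrightarrow> \<sigma> (x, \<xi>, \<eta>) = \<sigma>0 (x, \<xi> - t *\<^sub>R \<eta>)"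
    and adm: "adm_weight v1" "adm_weight v2"
    and ae: "AE x in lborel. w1 x = v1 x" "AE x in lborel. w2 x = v2 x" "AE x in lborel. w x = W x"
    and bil: "\<exists>C>0. \<forall>f g nf ng. bmf f \<longrightarrow> bmf g \<longrightarrow> 0 \<le> nf \<longrightarrow> 0 \<le> ng \<longrightarrow>
      (\<integral>\<^sup>+x. ennreal (f x powr p1 * v1 x) \<partial>lborel) \<le> ennreal (nf powr p1) \<longrightarrow>
      (\<integral>\<^sup>+x. ennreal (g x powr p2 * v2 x) \<partial>lborel) \<le> ennreal (ng powr p2) \<longrightarrow>
      (\<integral>\<^sup>+x. ennpowr (bil s t f g x) q * ennreal (W x) \<partial>lborel) \<le> ennreal (C * (nf * ng) powr q)"
  shows "bounded_bilinear_Lp (T_op \<sigma>) p1 w1 p2 w2 q w"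
proof -
  obtain C where C: "0 < C" "\<And>f g nf ng. bmf f \<Longrightarrow> bmf g \<Longrightarrow> 0 \<le> nf \<Longrightarrow> 0 \<le> ng \<Longrightarrow>
      (\<integral>\<^sup>+x. ennreal (f x powr p1 * v1 x) \<partial>lborel) \<le> ennreal (nf powr p1) \<Longrightarrow>
      (\<integral>\<^sup>+x. ennreal (g x powr p2 * v2 x) \<partial>lborel) \<le> ennreal (ng powr p2) \<Longrightarrow>
      (\<integral>\<^sup>+x. ennpowr (bil s t f g x) q * ennreal (W x) \<partial>lborel) \<le> ennreal (C * (nf * ng) powr q)"
    using bil by auto
  obtain C0 where C0: "0 \<le> C0" "\<And>x. symbol_like s C0 (\<lambda>z. if z = 0 then 0 else \<sigma>0 (x, z))"
    using linear_class_symbol_like[OF \<sigma>0(1) s(1) \<sigma>0(2)] by blast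
  obtain K where K: "0 < K" "\<And>f g x. integrable lborel f \<Longrightarrow> integrable lborel g \<Longrightarrow>
    continuous_on UNIV f \<Longrightarrow> continuous_on UNIV g \<Longrightarrow> bmf (\<lambda>y. norm (f y)) \<Longrightarrow> bmf (\<lambda>y. norm (g y)) \<Longrightarrow>
    ennreal (norm (T_op \<sigma> f g x)) \<le> ennreal K * bil s t (\<lambda>y. norm (f y)) (\<lambda>y. norm (g y)) x"
    by (rule T_op_le_bil[OF C0(2,1) s \<sigma>[rule_format]]) (assumption, rule that)
  show ?thesis
  proof (rule bounded_bilinear_LpI[where C="K powr q * C", OF P q adm ae])
    fix f g :: "real ^ 'n \<Rightarrow> complex" and nf ng :: real
    assume f: "integrable lborel f" "continuous_on UNIV f" "bmf (\<lambda>x. norm (f x))" "0 \<le> nf" "(\<integral>\<^sup>+x. ennreal (norm (f x) powr p1 * v1 x) \<partial>lborel) \<le> ennreal (nf powr p1)"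
      and g: "integrable lborel g" "continuous_on UNIV g" "bmf (\<lambda>x. norm (g x))" "0 \<le> ng" "(\<integral>\<^sup>+x. ennreal (norm (g x) powr p2 * v2 x) \<partial>lborel) \<le> ennreal (ng powr p2)"
    have "(\<integral>\<^sup>+x. ennreal (norm (T_op \<sigma> f g x) powr q * W x) \<partial>lborel)
      \<le> ennreal (K powr q) * (\<integral>\<^sup>+x. ennpowr (bil s t (\<lambda>y. norm (f y)) (\<lambda>y. norm (g y)) x) q * ennreal (W x) \<partial>lborel)"
      by (rule weighted_integral_of_pointwise_bound[OF K(1) q K(2)[OF f(1) g(1) f(2) g(2) f(3) g(3)]])
    also have "\<dots> \<le> ennreal (K powr q) * ennreal (C * (nf * ng) powr q)"
      using f g by (intro mult_left_mono C(2)) simp_all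
    also have "\<dots> = ennreal (K powr q * C * (nf * ng) powr q)"
      using C(1) by (simp add: mult.assoc flip: ennreal_mult)
    finally show "(\<integral>\<^sup>+x. ennreal (norm (T_op \<sigma> f g x) powr q * W x) \<partial>lborel) \<le> ennreal (K powr q * C * (nf * ng) powr q)" .
  qed (use K C in simp_all)
qed

text \<open>The condition on a single weight is, for the pair v^(q/p) and v^(1 - p'), the two-weight
  hypothesis of the Riesz potential bound.\<close>

lemma A_linear_riesz1:
  fixes w :: "real ^ 'n::finite \<Rightarrow> real"
  assumes p: "1 < p" and q: "0 < q" and s: "0 < s" and pq: "1 / q = 1 / p - s / real CARD('n)"
    and w: "weight w" and A: "A_linear p q w"
  obtains v where "adm_weight v" "AE x in lborel. w x = v x" "adm_weight (\<lambda>x. v x powr (q / p))"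
    "\<exists>C>0. \<forall>f nf. loc_int f \<longrightarrow> 0 \<le> nf \<longrightarrow> wpow p (\<lambda>x. v x powr (1 - conj_exp p)) f \<le> ennreal (nf powr p) \<longrightarrow>
      (\<integral>\<^sup>+x. ennpowr (riesz1 s f x) q \<partial>wm (\<lambda>x. v x powr (q / p))) \<le> ennreal (C * nf powr q)"
proof -
  obtain v where v: "adm_weight v" "AE x in lborel. w x = v x" by (rule weight_Borel_version[OF w])
  note [measurable] = adm_weight_measurable[OF v(1)]
  note pos = adm_weight_pos[OF v(1)]
  define W where "W x = v x powr (q / p)" for x
  define S where "S x = v x powr (1 - conj_exp p)" for x
  have m [measurable]: "W \<in> borel_measurable borel" "S \<in> borel_measurable borel"
    unfolding W_def S_def by measurable
  have spos: "0 < W x" "0 < S x" for x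
    using pos[of x] by (simp_all add: W_def S_def)
  have aeW: "AE x in lborel. w x powr (q / p) = W x" "AE x in lborel. w x powr (1 - conj_exp p) = S x"
    subgoal using v(2) by eventually_elim (simp add: W_def)
    subgoal using v(2) by eventually_elim (simp add: S_def)
    done
  note avg = ball_avg_Borel_version[OF m(1) aeW(1)] ball_avg_Borel_version[OF m(2) aeW(2)]
  obtain A0 where A0: "0 \<le> A0" "\<And>c r. 0 < r \<Longrightarrow>
      ball_avg (\<lambda>x. w x powr (q / p)) c r
        * ennpowr (ball_avg (\<lambda>x. w x powr (1 - conj_exp p)) c r) (q / conj_exp p) \<le> ennreal A0"
    by (rule SUP_ball_boundE[OF A[unfolded A_linear_def]]) (blast intro: that)
  \<comment> \<open>The three-weight lemma is applied with the dual weight entered twice, each time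
    with half the exponent.\<close>
  let ?a = "(1 - 1 / p) / 2"
  have qa: "q * ?a + q * ?a = q * (1 - 1 / p)" by (simp add: field_simps)
  have H: "emeasure (wm W) (ball c r) / emeasure lborel (ball c r)
      * ennpowr (emeasure (wm S) (ball c r) / emeasure lborel (ball c r)) (q * ?a)
      * ennpowr (emeasure (wm S) (ball c r) / emeasure lborel (ball c r)) (q * ?a) \<le> ennreal A0" if "0 < r" for c r
    unfolding mult.assoc[of "emeasure _ _ / _"] ennpowr_add qa
    using A0(2)[OF that, of c] by (simp only: avg conj_exp_simps(1)[OF p])
  note M = Muckenhoupt_condition[OF m(1) spos(1) m(2) spos(2) m(2) spos(2) q A0(1) H]
  have e: "1 / q + ?a + ?a = 1 - s / real DIM(real ^ 'n)" "?a + ?a = 1 - 1 / p" using pq by simp_all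
  obtain B where B: "0 < B" "\<forall>c r. 0 < r \<longrightarrow> bvol W c r powr (1 / q) * bvol S c r powr (1 - 1 / p)
      \<le> B * measure lborel (ball c r) powr (1 - s / real DIM(real ^ 'n))"
    using M(4) unfolding e powr_add[symmetric] by blast
  have one: "W x powr (1 / q) * S x powr (1 - 1 / p) = 1" for x
    using pos[of x] q by (simp add: W_def S_def powr_powr conj_exp_simps p powr_minus)
  have "\<exists>C>0. \<forall>f nf. loc_int f \<longrightarrow> 0 \<le> nf \<longrightarrow> wpow p S f \<le> ennreal (nf powr p) \<longrightarrow>
      (\<integral>\<^sup>+x. ennpowr (riesz1 s f x) q \<partial>wm W) \<le> ennreal (C * nf powr q)"
    by (rule riesz1_weighted[OF M(1,2) p q s _ one B(1) B(2)[rule_format]]) (use pq in simp_all)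
  from that[OF v M(1)[unfolded W_def] this[unfolded W_def S_def]] show ?thesis .
qed

text \<open>The sine is positive on the open interval, so \<open>tan\<close> can be 0 only where the
  cosine is 0, by the convention for division; and tan \<theta> = - 1 means sin(\<theta> + pi/4) =
  0, which leaves \<theta> = 3 pi / 4.\<close>

lemma tan_neq:
  assumes \<theta>: "0 < \<theta>" "\<theta> < pi"
  shows "\<theta> \<noteq> pi / 2 \<Longrightarrow> tan \<theta> \<noteq> 0" "\<theta> \<noteq> 3 * pi / 4 \<Longrightarrow> tan \<theta> \<noteq> - 1"
proof -
  have s: "0 < sin \<theta>" using \<theta> by (rule sin_gt_zero)
  show "tan \<theta> \<noteq> 0" if "\<theta> \<noteq> pi / 2"
  proof -
    have "cos \<theta> \<noteq> 0" using cos_inj_pi[of \<theta> "pi / 2"] \<theta> that by auto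
    then show ?thesis using s by (simp add: tan_def)
  qed
  show "tan \<theta> \<noteq> - 1" if "\<theta> \<noteq> 3 * pi / 4"
  proof
    assume t: "tan \<theta> = - 1"
    then have "cos \<theta> \<noteq> 0" by (auto simp: tan_def)
    then have "sin \<theta> = - cos \<theta>" using t by (simp add: tan_def field_simps)
    then have "sin (\<theta> + pi / 4) = 0" by (simp add: sin_add sin_45 cos_45)
    then have "sin (\<theta> + pi / 4 - pi) = 0" unfolding sin_diff[of "\<theta> + pi / 4" pi] by simp
    then have "\<theta> + pi / 4 - pi = 0" using \<theta> by (subst (asm) sin_zero_pi_iff) auto
    with that show False by simp
  qed
qed

theorem linear_class_bounded:
  fixes \<sigma> :: "'n::finite bilinear_symbol" and \<sigma>0 :: "'n linear_symbol"
  assumes P: "1 < p1" "1 < p2" and q: "0 < q" and s: "0 < s" "s < real CARD('n)"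
    and pq: "1 / q = 1 / p1 + 1 / p2 - s / real CARD('n)"
    and t: "t \<noteq> 0" "t \<noteq> - 1"
    and \<sigma>0: "\<sigma>0 \<in> linear_class \<rho> (- s) \<delta>" "\<And>\<xi>. norm \<xi> \<le> \<rho> \<xi>"
    and \<sigma>: "\<forall>x \<xi> \<eta>. \<xi> - t *\<^sub>R \<eta> \<noteq> 0 \<longrightarrow> \<sigma> (x, \<xi>, \<eta>) = \<sigma>0 (x, \<xi> - t *\<^sub>R \<eta>)"
  shows "bounded_bilinear_Lp (T_op \<sigma>) p1 (\<lambda>_. 1) p2 (\<lambda>_. 1) q (\<lambda>_. 1)"
    and "\<lbrakk>1 / p = 1 / p1 + 1 / p2; 1 / p < 1; weight w1; weight w2; A_linear p q w1; A_linear p q w2\<rbrakk>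
      \<Longrightarrow> bounded_bilinear_Lp (T_op \<sigma>) p1 w1 p2 w2 q (prod_weight p1 p2 q w1 w2)"
proof -
  have P0: "0 < p1" "0 < p2" using P by simp_all
  have "bil_bounded TYPE(real ^ 'n) s t p1 p2 q"
    using bil_bounded[where 'a="real ^ 'n", OF t P q s(1)] s(2) pq by simp
  then show "bounded_bilinear_Lp (T_op \<sigma>) p1 (\<lambda>_. 1) p2 (\<lambda>_. 1) q (\<lambda>_. 1)"
    unfolding bil_bounded_def
    by (intro T_op_bounded_of_bil[OF P0 q s \<sigma>0 \<sigma>, where ?v1.0="\<lambda>_. 1" and ?v2.0="\<lambda>_. 1" and W="\<lambda>_. 1"] adm_weight_1)
      simp_all
  assume p: "1 / p = 1 / p1 + 1 / p2" "1 / p < 1" and w: "weight w1" "weight w2"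
    and A: "A_linear p q w1" "A_linear p q w2"
  have "0 < 1 / p" using P unfolding p(1) by (simp add: add_pos_pos)
  then have p1: "1 < p" using p(2) by (simp add: divide_less_eq)
  have pq': "1 / q = 1 / p - s / real CARD('n)" using pq p(1) by simp
  obtain v1 where v1: "adm_weight v1" "AE x in lborel. w1 x = v1 x" "adm_weight (\<lambda>x. v1 x powr (q / p))"
    "\<exists>C>0. \<forall>f nf. loc_int f \<longrightarrow> 0 \<le> nf \<longrightarrow> wpow p (\<lambda>x. v1 x powr (1 - conj_exp p)) f \<le> ennreal (nf powr p) \<longrightarrow>
      (\<integral>\<^sup>+x. ennpowr (riesz1 s f x) q \<partial>wm (\<lambda>x. v1 x powr (q / p))) \<le> ennreal (C * nf powr q)"
    by (rule A_linear_riesz1[OF p1 q s(1) pq' w(1) A(1)]) (blast intro: that)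
  obtain v2 where v2: "adm_weight v2" "AE x in lborel. w2 x = v2 x" "adm_weight (\<lambda>x. v2 x powr (q / p))"
    "\<exists>C>0. \<forall>f nf. loc_int f \<longrightarrow> 0 \<le> nf \<longrightarrow> wpow p (\<lambda>x. v2 x powr (1 - conj_exp p)) f \<le> ennreal (nf powr p) \<longrightarrow>
      (\<integral>\<^sup>+x. ennpowr (riesz1 s f x) q \<partial>wm (\<lambda>x. v2 x powr (q / p))) \<le> ennreal (C * nf powr q)"
    by (rule A_linear_riesz1[OF p1 q s(1) pq' w(2) A(2)]) (blast intro: that)
  \<comment> \<open>These exponents cancel, so that the norms and the output weight produced by
    \<open>bil_weighted\<close> are those of the original weights.\<close>
  have v: "(v1 x powr (1 - conj_exp p)) powr (1 - p) = v1 x" "(v2 x powr (1 - conj_exp p)) powr (1 - p) = v2 x" for x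
    using adm_weight_nonneg[OF v1(1)] adm_weight_nonneg[OF v2(1)] by (simp_all add: powr_powr conj_exp_simps p1)
  have W: "(v1 x powr (q / p)) powr (p / p1) = v1 x powr (q / p1)" "(v2 x powr (q / p)) powr (p / p2) = v2 x powr (q / p2)" for x
    using p1 by (simp_all add: powr_powr)
  show "bounded_bilinear_Lp (T_op \<sigma>) p1 w1 p2 w2 q (prod_weight p1 p2 q w1 w2)"
  proof (rule T_op_bounded_of_bil[OF P0 q s \<sigma>0 \<sigma> v1(1) v2(1) v1(2) v2(2)])
    show "AE x in lborel. prod_weight p1 p2 q w1 w2 x = v1 x powr (q / p1) * v2 x powr (q / p2)"
      using v1(2) v2(2) by eventually_elim (simp add: prod_weight_def)
  qed (rule bil_weighted[OF v1(3) v2(3) t(1) P q p(1) v1(4) v2(4), unfolded v W])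
qed

theorem theorem12:
  fixes p1 p2 q s :: real
  assumes "1 < p1" and "1 < p2" and "0 < q" and "0 < s"
    and "1 / q = 1 / p1 + 1 / p2 - s / real CARD('n::finite)"
  shows
    "(\<forall>\<delta> (\<sigma> :: 'n bilinear_symbol).
        s < 2 * real CARD('n) \<longrightarrow> 0 \<le> \<delta> \<longrightarrow> \<delta> \<le> 1 \<longrightarrow>
        \<sigma> \<in> BS_class (- s) \<delta> \<union> BS_class_hom (- s) \<delta> \<longrightarrow>
        (\<forall>w1 w2. weight w1 \<longrightarrow> weight w2 \<longrightarrow> A_bilinear p1 p2 q w1 w2 \<longrightarrow>
           bounded_bilinear_Lp (T_op \<sigma>) p1 w1 p2 w2 q (prod_weight p1 p2 q w1 w2)))
     \<and>
     (\<forall>\<theta> \<delta> (\<sigma> :: 'n bilinear_symbol) (\<sigma>\<^sub>0 :: 'n linear_symbol).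
        s < real CARD('n) \<longrightarrow>
        0 < \<theta> \<longrightarrow> \<theta> < pi \<longrightarrow> \<theta> \<noteq> pi / 2 \<longrightarrow> \<theta> \<noteq> 3 * pi / 4 \<longrightarrow>
        0 \<le> \<delta> \<longrightarrow> \<delta> \<le> 1 \<longrightarrow>
        (\<sigma> \<in> BS_theta_class \<theta> (- s) \<delta> \<and> \<sigma>\<^sub>0 \<in> S_class (- s) \<delta> \<and>
           (\<forall>x \<xi> \<eta>. \<sigma> (x, \<xi>, \<eta>) = \<sigma>\<^sub>0 (x, \<xi> - tan \<theta> *\<^sub>R \<eta>))
         \<or>
         \<sigma> \<in> BS_theta_class_hom \<theta> (- s) \<delta> \<and> \<sigma>\<^sub>0 \<in> S_class_hom (- s) \<delta> \<and>
           (\<forall>x \<xi> \<eta>. \<xi> - tan \<theta> *\<^sub>R \<eta> \<noteq> 0 \<longrightarrow> \<sigma> (x, \<xi>, \<eta>) = \<sigma>\<^sub>0 (x, \<xi> - tan \<theta> *\<^sub>R \<eta>))) \<longrightarrow>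
        bounded_bilinear_Lp (T_op \<sigma>) p1 (\<lambda>_. 1) p2 (\<lambda>_. 1) q (\<lambda>_. 1) \<and>
        (\<forall>p. 1 / p = 1 / p1 + 1 / p2 \<longrightarrow> 1 / p < 1 \<longrightarrow>
           (\<forall>w1 w2. weight w1 \<longrightarrow> weight w2 \<longrightarrow> A_linear p q w1 \<longrightarrow> A_linear p q w2 \<longrightarrow>
              bounded_bilinear_Lp (T_op \<sigma>) p1 w1 p2 w2 q (prod_weight p1 p2 q w1 w2))))"
  proof (intro conjI allI impI)
  fix \<delta> :: real and \<sigma> :: "'n bilinear_symbol" and w1 w2 :: "real ^ 'n \<Rightarrow> real"
  assume s: "s < 2 * real CARD('n)" and \<sigma>: "\<sigma> \<in> BS_class (- s) \<delta> \<union> BS_class_hom (- s) \<delta>"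
    and w: "weight w1" "weight w2" and A: "A_bilinear p1 p2 q w1 w2"
  \<comment> \<open>The two size functions of the bilinear classes dominate the norm of the pair,
    which is all that the common theorem asks of \<rho>.\<close>
  have n: "norm (\<xi>, \<eta>) \<le> norm \<xi> + norm \<eta>" "norm (\<xi>, \<eta>) \<le> 1 + norm \<xi> + norm \<eta>" for \<xi> \<eta> :: "real ^ 'n"
    using norm_Pair_le[of \<xi> \<eta>] by simp_all
  show "bounded_bilinear_Lp (T_op \<sigma>) p1 w1 p2 w2 q (prod_weight p1 p2 q w1 w2)"
    using \<sigma> unfolding BS_class_def BS_class_hom_def Un_iff
    by (elim disjE) (rule bilinear_class_bounded[OF assms(1-4) s assms(5) _ n(2) w A], assumption,
      rule bilinear_class_bounded[OF assms(1-4) s assms(5) _ n(1) w A], assumption)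
next
  fix \<theta> \<delta> :: real and \<sigma> :: "'n bilinear_symbol" and \<sigma>\<^sub>0 :: "'n linear_symbol"
  assume s: "s < real CARD('n)" and \<theta>: "0 < \<theta>" "\<theta> < pi" "\<theta> \<noteq> pi / 2" "\<theta> \<noteq> 3 * pi / 4"
    and h: "\<sigma> \<in> BS_theta_class \<theta> (- s) \<delta> \<and> \<sigma>\<^sub>0 \<in> S_class (- s) \<delta> \<and>
           (\<forall>x \<xi> \<eta>. \<sigma> (x, \<xi>, \<eta>) = \<sigma>\<^sub>0 (x, \<xi> - tan \<theta> *\<^sub>R \<eta>))
         \<or>
         \<sigma> \<in> BS_theta_class_hom \<theta> (- s) \<delta> \<and> \<sigma>\<^sub>0 \<in> S_class_hom (- s) \<delta> \<and>
           (\<forall>x \<xi> \<eta>. \<xi> - tan \<theta> *\<^sub>R \<eta> \<noteq> 0 \<longrightarrow> \<sigma> (x, \<xi>, \<eta>) = \<sigma>\<^sub>0 (x, \<xi> - tan \<theta> *\<^sub>R \<eta>))"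
  obtain \<rho> where \<rho>: "\<sigma>\<^sub>0 \<in> linear_class \<rho> (- s) \<delta>" "\<And>\<xi>. norm \<xi> \<le> \<rho> \<xi>"
    using h by (elim disjE conjE) (auto simp: S_class_def S_class_hom_def intro: that)
  have \<sigma>: "\<forall>x \<xi> \<eta>. \<xi> - tan \<theta> *\<^sub>R \<eta> \<noteq> 0 \<longrightarrow> \<sigma> (x, \<xi>, \<eta>) = \<sigma>\<^sub>0 (x, \<xi> - tan \<theta> *\<^sub>R \<eta>)"
    using h by blast
  note bounded = linear_class_bounded[OF assms(1-4) s assms(5) tan_neq(1)[OF \<theta>(1-3)] tan_neq(2)[OF \<theta>(1,2,4)] \<rho> \<sigma>]
  show "bounded_bilinear_Lp (T_op \<sigma>) p1 (\<lambda>_. 1) p2 (\<lambda>_. 1) q (\<lambda>_. 1)"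
    by (rule bounded(1))
  show "bounded_bilinear_Lp (T_op \<sigma>) p1 w1 p2 w2 q (prod_weight p1 p2 q w1 w2)"
    if "1 / p = 1 / p1 + 1 / p2" "1 / p < 1" "weight w1" "weight w2" "A_linear p q w1" "A_linear p q w2" for p w1 w2
    using that by (rule bounded(2))
qed

end
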